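(* The stable conjectures $\mathrm{JC}_\infty$ and $\mathrm{DC}_\infty$ are equivalent: $\mathrm{JC}_n$ holds for all integers $n\ge 1$ if and only if $\mathrm{DC}_n$ holds for all integers $n\ge 1$.
   Context: For an integer $n\ge 1$, the Jacobian Conjecture $\mathrm{JC}_n$ is the assertion: for any field $\mathbf{k}$ of characteristic zero, any polynomial endomorphism $\phi$ of the affine space $\mathbb{A}^n_{\mathbf{k}}=\mathrm{Spec}\,\mathbf{k}[x_1,\dots,x_n]$ over $\mathbf{k}$ with Jacobian $1$, i.e. $\det\left(\partial\phi^*(x_i)/\partial x_j\right)_{1\le i,j\le n}=1$, is an automorphism. For an integer $n\ge 1$ and a field $\mathbf{k}$, the $n$-th Weyl algebra $A_{n,\mathbf{k}}$ is the associative unital $\mathbf{k}$-algebra with $2n$ generators $y_1,\dots,y_{2n}$ and relations $[y_i,y_j]=\omega_{ij}$, where $\omega_{ij}=\delta_{i,j+n}-\delta_{i+n,j}$ for $1\le i,j\le 2n$. The Dixmier Conjecture $\mathrm{DC}_n$ is the assertion: for any field $\mathbf{k}$ of characteristic zero, any endomorphism of the $\mathbf{k}$-algebra $A_{n,\mathbf{k}}$ is an automorphism. $\mathrm{JC}_\infty$ (the stable Jacobian conjecture) is the conjunction of the conjectures $\mathrm{JC}_n$ for all finite $n\ge1$; $\mathrm{DC}_\infty$ (the stable Dixmier conjecture) is the conjunction of the conjectures $\mathrm{DC}_n$ for all finite $n\ge1$. *)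

theory Defs
  imports "HOL-Algebra.QuotRing" "HOL-Library.Multiset" "HOL-Combinatorics.Permutations"
begin

section \<open>Monoid rings\<close>

text \<open>
  The monoid ring \<open>R[M]\<close>, whose elements are the finitely supported functions from \<open>M\<close> to
  \<open>R\<close>, extended by zero outside the carrier of \<open>M\<close>. The monomials of a polynomial ring form the
  free commutative monoid (finite multisets of variables) and those of a free associative algebra
  form the free monoid (words), so both algebras below are instances.
\<close>

definition monoid_ring_supp :: "('a, 'r) ring_scheme \<Rightarrow> ('m \<Rightarrow> 'a) \<Rightarrow> 'm set"
  where "monoid_ring_supp R f = {m. f m \<noteq> \<zero>\<^bsub>R\<^esub>}"

definition monoid_ring :: "('m, 'x) monoid_scheme \<Rightarrow> ('a, 'r) ring_scheme \<Rightarrow> ('m \<Rightarrow> 'a) ring"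
  where "monoid_ring M R =
    \<lparr>carrier = {f. range f \<subseteq> carrier R \<and> finite (monoid_ring_supp R f)
                   \<and> monoid_ring_supp R f \<subseteq> carrier M},
     monoid.mult = (\<lambda>f g m. \<Oplus>\<^bsub>R\<^esub>p \<in> {(a, b). a \<in> monoid_ring_supp R f \<and> b \<in> monoid_ring_supp R g
                                        \<and> a \<otimes>\<^bsub>M\<^esub> b = m}. f (fst p) \<otimes>\<^bsub>R\<^esub> g (snd p)),
     one = (\<lambda>m. if m = \<one>\<^bsub>M\<^esub> then \<one>\<^bsub>R\<^esub> else \<zero>\<^bsub>R\<^esub>),
     zero = (\<lambda>m. \<zero>\<^bsub>R\<^esub>),
     add = (\<lambda>f g m. f m \<oplus>\<^bsub>R\<^esub> g m)\<rparr>"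

definition monoid_ring_const ::
    "('m, 'x) monoid_scheme \<Rightarrow> ('a, 'r) ring_scheme \<Rightarrow> 'a \<Rightarrow> 'm \<Rightarrow> 'a"
  where "monoid_ring_const M R c = (\<lambda>m. if m = \<one>\<^bsub>M\<^esub> then c else \<zero>\<^bsub>R\<^esub>)"

definition monoid_ring_basis :: "('a, 'r) ring_scheme \<Rightarrow> 'm \<Rightarrow> 'm \<Rightarrow> 'a"
  where "monoid_ring_basis R m = (\<lambda>m'. if m' = m then \<one>\<^bsub>R\<^esub> else \<zero>\<^bsub>R\<^esub>)"


section \<open>Algebras over a field\<close>

definition char_zero_field :: "('a, 'r) ring_scheme \<Rightarrow> bool"
  where "char_zero_field K \<longleftrightarrow> field K \<and> (\<forall>m::nat. 0 < m \<longrightarrow> [m] \<cdot>\<^bsub>K\<^esub> \<one>\<^bsub>K\<^esub> \<noteq> \<zero>\<^bsub>K\<^esub>)"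

text \<open>
  A unital associative \<open>K\<close>-algebra is given by a ring \<open>A\<close> (not necessarily commutative) with its
  structure map \<open>\<iota>\<close> from \<open>K\<close> to the centre of \<open>A\<close>; the \<open>K\<close>-linear ring homomorphisms are those
  fixing the image of \<open>\<iota>\<close>.
\<close>

definition alg_end ::
    "('a, 'r) ring_scheme \<Rightarrow> ('a \<Rightarrow> 'b) \<Rightarrow> ('b, 's) ring_scheme \<Rightarrow> ('b \<Rightarrow> 'b) set"
  where "alg_end K \<iota> A = {h \<in> ring_hom A A. \<forall>c \<in> carrier K. h (\<iota> c) = \<iota> c}"

definition alg_aut ::
    "('a, 'r) ring_scheme \<Rightarrow> ('a \<Rightarrow> 'b) \<Rightarrow> ('b, 's) ring_scheme \<Rightarrow> ('b \<Rightarrow> 'b) set"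
  where "alg_aut K \<iota> A = alg_end K \<iota> A \<inter> ring_iso A A"


section \<open>Polynomial rings and the Jacobian conjecture\<close>

definition monomials :: "nat \<Rightarrow> nat multiset monoid"
  where "monomials n = \<lparr>carrier = {m. set_mset m \<subseteq> {1..n}}, monoid.mult = (+), one = {#}\<rparr>"

definition mpoly_ring :: "('a, 'r) ring_scheme \<Rightarrow> nat \<Rightarrow> (nat multiset \<Rightarrow> 'a) ring"
  where "mpoly_ring K n = monoid_ring (monomials n) K"

definition mpoly_const :: "('a, 'r) ring_scheme \<Rightarrow> nat \<Rightarrow> 'a \<Rightarrow> nat multiset \<Rightarrow> 'a"
  where "mpoly_const K n = monoid_ring_const (monomials n) K"

definition mpoly_var :: "('a, 'r) ring_scheme \<Rightarrow> nat \<Rightarrow> nat multiset \<Rightarrow> 'a"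
  where "mpoly_var K i = monoid_ring_basis K {#i#}"

definition mpoly_deriv ::
    "('a, 'r) ring_scheme \<Rightarrow> nat \<Rightarrow> (nat multiset \<Rightarrow> 'a) \<Rightarrow> nat multiset \<Rightarrow> 'a"
  where "mpoly_deriv K j f = (\<lambda>m. [Suc (count m j)] \<cdot>\<^bsub>K\<^esub> f (add_mset j m))"

definition ring_det :: "('b, 's) ring_scheme \<Rightarrow> nat \<Rightarrow> (nat \<Rightarrow> nat \<Rightarrow> 'b) \<Rightarrow> 'b"
  where "ring_det A n M =
    (\<Oplus>\<^bsub>A\<^esub>p \<in> {p. p permutes {1..n}}. [sign p] \<cdot>\<^bsub>A\<^esub> (\<Otimes>\<^bsub>A\<^esub>i \<in> {1..n}. M i (p i)))"

text \<open>
  An endomorphism of the affine space \<open>Spec K[x\<^sub>1,\<dots>,x\<^sub>n]\<close> over \<open>K\<close> is represented by its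
  comorphism, a \<open>K\<close>-algebra endomorphism of \<open>K[x\<^sub>1,\<dots>,x\<^sub>n]\<close>; it is an automorphism iff its
  comorphism is one.
\<close>

definition jacobian :: "('a, 'r) ring_scheme \<Rightarrow> nat
    \<Rightarrow> ((nat multiset \<Rightarrow> 'a) \<Rightarrow> (nat multiset \<Rightarrow> 'a)) \<Rightarrow> nat multiset \<Rightarrow> 'a"
  where "jacobian K n \<phi> =
    ring_det (mpoly_ring K n) n (\<lambda>i j. mpoly_deriv K j (\<phi> (mpoly_var K i)))"

text \<open>
  HOL formulas cannot quantify over types, so ``any field'' ranges over all field structures
  carried by subsets of a type \<open>'a\<close>, which is arbitrary and plays the role of a universe.
\<close>

definition Jacobian_Conjecture :: "'a itself \<Rightarrow> nat \<Rightarrow> bool"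
  where "Jacobian_Conjecture _ n \<longleftrightarrow>
    (\<forall>K :: 'a ring. char_zero_field K \<longrightarrow>
      (\<forall>\<phi> \<in> alg_end K (mpoly_const K n) (mpoly_ring K n).
        jacobian K n \<phi> = \<one>\<^bsub>mpoly_ring K n\<^esub> \<longrightarrow>
        \<phi> \<in> alg_aut K (mpoly_const K n) (mpoly_ring K n)))"


section \<open>Weyl algebras and the Dixmier conjecture\<close>

definition words :: "nat \<Rightarrow> nat list monoid"
  where "words N = \<lparr>carrier = lists {1..N}, monoid.mult = (@), one = []\<rparr>"

definition free_alg :: "('a, 'r) ring_scheme \<Rightarrow> nat \<Rightarrow> (nat list \<Rightarrow> 'a) ring"
  where "free_alg K N = monoid_ring (words N) K"

definition free_var :: "('a, 'r) ring_scheme \<Rightarrow> nat \<Rightarrow> nat list \<Rightarrow> 'a"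
  where "free_var K i = monoid_ring_basis K [i]"

definition weyl_omega :: "nat \<Rightarrow> nat \<Rightarrow> nat \<Rightarrow> int"
  where "weyl_omega n i j = of_bool (i = j + n) - of_bool (i + n = j)"

definition weyl_rel :: "('a, 'r) ring_scheme \<Rightarrow> nat \<Rightarrow> nat \<Rightarrow> nat \<Rightarrow> nat list \<Rightarrow> 'a"
  where "weyl_rel K n i j = (let F = free_alg K (2 * n); y = free_var K in
    (y i \<otimes>\<^bsub>F\<^esub> y j \<ominus>\<^bsub>F\<^esub> y j \<otimes>\<^bsub>F\<^esub> y i) \<ominus>\<^bsub>F\<^esub> [weyl_omega n i j] \<cdot>\<^bsub>F\<^esub> \<one>\<^bsub>F\<^esub>)"

definition weyl_ideal :: "('a, 'r) ring_scheme \<Rightarrow> nat \<Rightarrow> (nat list \<Rightarrow> 'a) set"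
  where "weyl_ideal K n =
    Idl\<^bsub>free_alg K (2 * n)\<^esub> {weyl_rel K n i j |i j. i \<in> {1..2 * n} \<and> j \<in> {1..2 * n}}"

definition weyl_alg :: "('a, 'r) ring_scheme \<Rightarrow> nat \<Rightarrow> (nat list \<Rightarrow> 'a) set ring"
  where "weyl_alg K n = free_alg K (2 * n) Quot weyl_ideal K n"

definition weyl_const :: "('a, 'r) ring_scheme \<Rightarrow> nat \<Rightarrow> 'a \<Rightarrow> (nat list \<Rightarrow> 'a) set"
  where "weyl_const K n c =
    weyl_ideal K n +>\<^bsub>free_alg K (2 * n)\<^esub> monoid_ring_const (words (2 * n)) K c"

definition Dixmier_Conjecture :: "'a itself \<Rightarrow> nat \<Rightarrow> bool"
  where "Dixmier_Conjecture _ n \<longleftrightarrow>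
    (\<forall>K :: 'a ring. char_zero_field K \<longrightarrow>
      (\<forall>h \<in> alg_end K (weyl_const K n) (weyl_alg K n).
        h \<in> alg_aut K (weyl_const K n) (weyl_alg K n)))"

end

theory Submission
  imports Defs "HOL-Library.Poly_Mapping" "HOL-Library.Multiset_Order" "HOL-Library.Countable"
    "HOL-Library.Diagonal_Subsequence" "HOL-Algebra.Algebraic_Closure_Type"
    "HOL-Computational_Algebra.Computational_Algebra" "HOL-Number_Theory.Number_Theory"
    "Jordan_Normal_Form.Determinant"
begin

text \<open>
  Dixmier to Jacobian: a polynomial map of Jacobian determinant one extends to the Weyl algebra by the
  vector fields dual to the differentials of its components. If \<open>x\<^sub>i\<close> is an ordered polynomial in the
  images of the generators, it commutes with the images of \<open>x\<^sub>1, \<dots>, x\<^sub>n\<close>, so only these occur in it.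

  Jacobian to Dixmier (Belov-Kanel and Kontsevich): suppose that an endomorphism of the \<open>n\<close>-th Weyl
  algebra misses a generator. Its coefficients generate a ring that maps to the integers modulo
  \<open>p\<^sup>2\<close> for arbitrarily large primes \<open>p\<close>. Modulo \<open>p\<close> the centre is the polynomial ring in the \<open>p\<close>-th
  powers of the generators, and the endomorphism induces a map of the centre, of degree bounded
  independently of \<open>p\<close>. Commutators divided by \<open>p\<close> give a Poisson bracket on the centre, so the
  Jacobian determinant of this map in \<open>2n\<close> variables is a nonzero constant. By the Jacobian conjecture over a
  limit of the prime fields, which has characteristic zero, infinitely many of these maps have
  inverses of a common degree \<open>D\<close>. Then the generators are ordered polynomials of degree at most \<open>D\<close> in
  their images modulo \<open>p\<close>, whereas a linear functional certifying that a generator is no such polynomial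
  survives reduction modulo large primes.
\<close>


section \<open>Rings of additive endomorphisms\<close>

text \<open>The Jacobian conjecture is available only in characteristic zero, so it says nothing
  about the map of the centre at a single prime. It is applied once, to the limit of the maps for
  infinitely many primes, which exists because their degrees have a common bound. No bound for the
  degree of the inverse is known beforehand: the \<open>k\<close>-th prime is therefore chosen so as
  to exclude ordered polynomials of degree up to \<open>k\<close>, and the degree \<open>D\<close>
  over the limit is compared with a later \<open>k\<close>. The limit field has to live on the same
  type \<open>'a\<close> as the given field, of which only infinitude is known; hence it is built
  from countably many terms. Reductions modulo p and modulo p^2 concern the same elements, since
  commutators that vanish modulo p are divided by p. So no quotient rings are formed there: elements
  are operators on polynomials over a ring such as \<open>int\<close>, and equality is replaced by
  congruence modulo an ideal. The given field is treated alike, as a quotient of a polynomial ring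
  over the integers; specialization then is evaluation of integer polynomials.\<close>

typedef (overloaded) 'm endo = "{f :: 'm::ring_1 \<Rightarrow> 'm. \<forall>x y. f (x + y) = f x + f y}"
  morphisms app Endo
  by (rule exI[of _ "\<lambda>x. x"]) simp

setup_lifting type_definition_endo

lemma app_add [simp]: "app T (x + y) = app T x + app T y"
  using app[of T] by simp

lemma app_zero [simp]: "app T 0 = 0"
  using app_add[of T 0 0] by simp

lemma app_minus [simp]: "app T (- x) = - app T x"
  using app_add[of T x "- x"] by (simp add: eq_neg_iff_add_eq_0 add.commute)

lemma app_diff [simp]: "app T (x - y) = app T x - app T y"
  using app_add[of T x "- y"] by simp

lemma app_sum: "app T (sum f A) = (\<Sum>a\<in>A. app T (f a))"
  by (induction A rule: infinite_finite_induct) auto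

lemma endo_eqI: "(\<And>x. app T x = app S x) \<Longrightarrow> T = S"
  by (metis app_inject ext)

instantiation endo :: (ring_1) ring_1
begin

lift_definition zero_endo :: "'a endo" is "\<lambda>_. 0" by simp
lift_definition one_endo :: "'a endo" is "\<lambda>x. x" by simp
lift_definition plus_endo :: "'a endo \<Rightarrow> 'a endo \<Rightarrow> 'a endo" is "\<lambda>f g x. f x + g x"
  by (simp add: algebra_simps)
lift_definition minus_endo :: "'a endo \<Rightarrow> 'a endo \<Rightarrow> 'a endo" is "\<lambda>f g x. f x - g x"
  by (simp add: algebra_simps)
lift_definition uminus_endo :: "'a endo \<Rightarrow> 'a endo" is "\<lambda>f x. - f x"
  by (simp add: algebra_simps)
lift_definition times_endo :: "'a endo \<Rightarrow> 'a endo \<Rightarrow> 'a endo" is "\<lambda>f g x. f (g x)"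
  by simp

instance
proof
  fix a b c :: "'a endo"
  show "0 \<noteq> (1::'a endo)" by transfer (metis zero_neq_one)
  show "a * b * c = a * (b * c)" by transfer simp
  show "(a + b) * c = a * c + b * c" by transfer simp
  show "a * (b + c) = a * b + a * c" by transfer simp
  show "a + b + c = a + (b + c)" by transfer (simp add: algebra_simps)
  show "a + b = b + a" by transfer (simp add: algebra_simps)
  show "0 + a = a" "1 * a = a" "a * 1 = a" by (transfer, simp)+
  show "- a + a = 0" "a - b = a + - b" by (transfer, simp)+
qed

end

lemma app_simps [simp]:
  "app 0 x = 0" "app 1 x = x" "app (S + T) x = app S x + app T x"
  "app (S - T) x = app S x - app T x" "app (- T) x = - app T x" "app (S * T) x = app S (app T x)"
  by (transfer, simp)+

lemma app_of_nat [simp]: "app (of_nat m) x = of_nat m * x"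
  by (induction m) (auto simp: algebra_simps)

lemma app_of_int [simp]: "app (of_int m) x = of_int m * x"
  by (cases m rule: int_diff_cases) (simp add: left_diff_distrib)

lemma app_sum_left: "app (sum T A) x = (\<Sum>a\<in>A. app (T a) x)"
  by (induction A rule: infinite_finite_induct) auto

section \<open>Congruences and inner derivations in noncommutative rings\<close>

definition comm :: "'b::ring_1 \<Rightarrow> 'b \<Rightarrow> 'b"
  where "comm x y = x * y - y * x"

lemma comm_add [simp]: "comm x (y + z) = comm x y + comm x z"
  and comm_diff [simp]: "comm x (y - z) = comm x y - comm x z"
  and comm_uminus [simp]: "comm x (- y) = - comm x y"
  and comm_zero [simp]: "comm x 0 = 0"
  and comm_one [simp]: "comm x 1 = 0"
  and comm_self [simp]: "comm x x = 0"
  and comm_add_left [simp]: "comm (x + y) z = comm x z + comm y z"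
  and comm_diff_left [simp]: "comm (x - y) z = comm x z - comm y z"
  and comm_uminus_left [simp]: "comm (- x) y = - comm x y"
  and comm_zero_left [simp]: "comm 0 y = 0"
  and comm_one_left [simp]: "comm 1 y = 0"
  by (auto simp: comm_def algebra_simps)

lemma comm_swap: "comm y x = - comm x y"
  by (simp add: comm_def)

lemma comm_mult: "comm x (y * z) = comm x y * z + y * comm x z"
  by (simp add: comm_def algebra_simps)

lemma comm_sum: "comm x (sum f A) = (\<Sum>a\<in>A. comm x (f a))"
  by (induction A rule: infinite_finite_induct) auto

lemma comm_of_nat_mult [simp]: "comm x (of_nat m * y) = of_nat m * comm x y"
  using mult_of_nat_commute[of m x] by (simp add: comm_def algebra_simps) (simp add: mult.assoc[symmetric])

lemma comm_of_nat [simp]: "comm x (of_nat m) = 0"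
  using mult_of_nat_commute[of m x] by (simp add: comm_def)

lemma of_nat_left_commute: "x * (of_nat m * y) = of_nat m * (x * (y :: 'b::ring_1))"
  by (metis mult.assoc mult_of_nat_commute)

lemma jacobi: "comm x (comm y z) = comm (comm x y) z + comm y (comm x z)"
  by (simp add: comm_def algebra_simps)

text \<open>Pascal's rule, isolated because left multiplication by an element acts in this way on
  two different arrays: on \<open>adp q i x * q ^ j\<close> and, for commuting \<open>a\<close> and
  \<open>b\<close>, on \<open>a ^ i * b ^ j\<close>.\<close>

lemma pascal_sum:
  fixes T :: "'b::ring_1 \<Rightarrow> 'b" and g :: "nat \<Rightarrow> nat \<Rightarrow> 'b"
  assumes add: "\<And>x y. T (x + y) = T x + T y"
    and step: "\<And>i j. T (g i j) = g (Suc i) j + g i (Suc j)"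
  shows "(T ^^ m) (g 0 0) = (\<Sum>k\<le>m. of_nat (m choose k) * g k (m - k))"
proof (induction m)
  case (Suc m)
  have zero: "T 0 = 0" using add[of 0 0] by simp
  have Tsum: "T (sum f A) = (\<Sum>a\<in>A. T (f a))" if "finite A" for f and A :: "nat set"
    using that by (induction A rule: finite_induct) (auto simp: add zero)
  have Tnat: "T (of_nat c * x) = of_nat c * T x" for c x
    by (induction c) (auto simp: add zero algebra_simps)
  have "(T ^^ Suc m) (g 0 0) = (\<Sum>k\<le>m. of_nat (m choose k) * (g (Suc k) (m - k) + g k (Suc (m - k))))"
    using Suc by (simp add: Tsum Tnat step)
  also have "\<dots> = (\<Sum>k\<le>m. of_nat (m choose k) * g (Suc k) (m - k))
                + (\<Sum>k\<le>m. of_nat (m choose k) * g k (Suc m - k))"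
    by (simp add: sum.distrib algebra_simps Suc_diff_le)
  also have "(\<Sum>k\<le>m. of_nat (m choose k) * g k (Suc m - k))
      = (\<Sum>k\<le>Suc m. of_nat (m choose k) * g k (Suc m - k))"
    by (simp add: binomial_eq_0)
  also have "\<dots> = g 0 (Suc m) + (\<Sum>k\<le>m. of_nat (m choose Suc k) * g (Suc k) (m - k))"
    by (subst sum.atMost_Suc_shift) simp
  also have "(\<Sum>k\<le>m. of_nat (m choose k) * g (Suc k) (m - k)) + \<dots>
      = g 0 (Suc m) + (\<Sum>k\<le>m. of_nat (Suc m choose Suc k) * g (Suc k) (m - k))"
    by (simp add: sum.distrib[symmetric] algebra_simps)
  also have "\<dots> = (\<Sum>k\<le>Suc m. of_nat (Suc m choose k) * g k (Suc m - k))"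
    by (simp only: sum.atMost_Suc_shift) simp
  finally show ?case .
qed simp

definition adp :: "'b::ring_1 \<Rightarrow> nat \<Rightarrow> 'b \<Rightarrow> 'b"
  where "adp q k = comm q ^^ k"

lemma adp_0 [simp]: "adp q 0 x = x"
  and adp_Suc [simp]: "adp q (Suc k) x = comm q (adp q k x)"
  by (auto simp: adp_def)

lemma adp_Suc': "adp q (Suc k) x = adp q k (comm q x)"
  by (simp add: adp_def funpow_swap1)

lemma adp_diff: "adp q k (x - y) = adp q k x - adp q k y"
  by (induction k) auto

lemma adp_of_nat_mult: "adp q k (of_nat m * x) = of_nat m * adp q k x"
  by (induction k) auto

lemma funpow_mult_left: "((*) q ^^ m) x = q ^ m * (x :: 'b::ring_1)"
  by (induction m) (auto simp: mult.assoc)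

text \<open>Left multiplication by \<open>q\<close> is the sum of \<open>comm q\<close> and right
  multiplication by \<open>q\<close>, and these two commute.\<close>

lemma power_mult_adp:
  "q ^ m * x = (\<Sum>k\<le>m. of_nat (m choose k) * (adp q k x * q ^ (m - k)))"
  using pascal_sum[of "(*) q" "\<lambda>i j. adp q i x * q ^ j" m]
  by (simp add: funpow_mult_left comm_def algebra_simps)

lemma power_add_commuting:
  fixes a b :: "'b::ring_1"
  assumes "a * b = b * a"
  shows "(a + b) ^ m = (\<Sum>k\<le>m. of_nat (m choose k) * (a ^ k * b ^ (m - k)))"
proof -
  have "b * a ^ i = a ^ i * b" for i
    using power_commuting_commutes[OF assms] by metis
  then have "(a + b) * (a ^ i * b ^ j) = a ^ Suc i * b ^ j + a ^ i * b ^ Suc j" for i j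
    by (simp add: algebra_simps) (simp add: mult.assoc[symmetric])
  from pascal_sum[of "(*) (a + b)" "\<lambda>i j. a ^ i * b ^ j" m, OF _ this] show ?thesis
    by (simp add: funpow_mult_left algebra_simps)
qed

text \<open>The factors are multiplied in increasing order of their indices, and elements of
  \<open>a\<close> outside \<open>{1..N}\<close> are ignored. For the Weyl algebra these are the
  Poincare-Birkhoff-Witt monomials.\<close>

definition omon :: "(nat \<Rightarrow> 'b::monoid_mult) \<Rightarrow> nat \<Rightarrow> nat multiset \<Rightarrow> 'b"
  where "omon P N a = prod_list (map (\<lambda>i. P i ^ count a i) [1..<Suc N])"

lemma omon_0 [simp]: "omon P 0 a = 1"
  and omon_Suc [simp]: "omon P (Suc N) a = omon P N a * P (Suc N) ^ count a (Suc N)"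
  by (simp_all add: omon_def)

lemma omon_empty [simp]: "omon P N {#} = 1"
  by (induction N) auto

lemma omon_cong_count: "(\<And>i. i \<in> {1..N} \<Longrightarrow> count a i = count b i) \<Longrightarrow> omon P N a = omon P N b"
  by (induction N) auto

text \<open>A subring \<open>A\<close> with a two-sided ideal \<open>J\<close>, both inside one type
  class ring. The quotient is never formed, so that one element can be considered modulo several
  ideals.\<close>

locale ring_mod =
  fixes A J :: "'b::ring_1 set"
  assumes one_A [simp, intro]: "1 \<in> A"
    and add_A [simp, intro]: "\<And>x y. x \<in> A \<Longrightarrow> y \<in> A \<Longrightarrow> x + y \<in> A"
    and uminus_A [simp, intro]: "\<And>x. x \<in> A \<Longrightarrow> - x \<in> A"
    and mult_A [simp, intro]: "\<And>x y. x \<in> A \<Longrightarrow> y \<in> A \<Longrightarrow> x * y \<in> A"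
    and J_sub: "J \<subseteq> A"
    and zero_J [simp, intro]: "0 \<in> J"
    and add_J [simp, intro]: "\<And>x y. x \<in> J \<Longrightarrow> y \<in> J \<Longrightarrow> x + y \<in> J"
    and mult_J [simp, intro]: "\<And>x y. x \<in> J \<Longrightarrow> y \<in> A \<Longrightarrow> x * y \<in> J"
    and mult_J' [simp, intro]: "\<And>x y. x \<in> A \<Longrightarrow> y \<in> J \<Longrightarrow> x * y \<in> J"
begin

lemma in_A_of_J [intro]: "x \<in> J \<Longrightarrow> x \<in> A"
  using J_sub by blast

lemma zero_A [simp, intro]: "0 \<in> A" by blast

lemma diff_A [simp, intro]: "x \<in> A \<Longrightarrow> y \<in> A \<Longrightarrow> x - y \<in> A"
  using add_A[of x "- y"] by simp

lemma uminus_J [simp, intro]: "x \<in> J \<Longrightarrow> - x \<in> J"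
  using mult_J'[of "- 1" x] by simp

lemma diff_J [simp, intro]: "x \<in> J \<Longrightarrow> y \<in> J \<Longrightarrow> x - y \<in> J"
  using add_J[of x "- y"] by simp

lemma of_nat_A [simp, intro]: "of_nat m \<in> A"
  by (induction m) auto

lemma power_A [simp, intro]: "x \<in> A \<Longrightarrow> x ^ m \<in> A"
  by (induction m) auto

lemma sum_A [intro]: "(\<And>i. i \<in> I \<Longrightarrow> f i \<in> A) \<Longrightarrow> sum f I \<in> A"
  by (induction I rule: infinite_finite_induct) auto

lemma sum_J [intro]: "(\<And>i. i \<in> I \<Longrightarrow> f i \<in> J) \<Longrightarrow> sum f I \<in> J"
  by (induction I rule: infinite_finite_induct) auto

lemma comm_A [simp, intro]: "x \<in> A \<Longrightarrow> y \<in> A \<Longrightarrow> comm x y \<in> A"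
  by (simp add: comm_def)

lemma comm_J [simp, intro]: "x \<in> J \<Longrightarrow> y \<in> A \<Longrightarrow> comm x y \<in> J"
  by (simp add: comm_def)

lemma comm_J' [simp, intro]: "x \<in> A \<Longrightarrow> y \<in> J \<Longrightarrow> comm x y \<in> J"
  by (simp add: comm_def)

lemma adp_A [simp, intro]: "q \<in> A \<Longrightarrow> x \<in> A \<Longrightarrow> adp q k x \<in> A"
  by (induction k) auto

lemma adp_J [simp, intro]: "q \<in> A \<Longrightarrow> x \<in> J \<Longrightarrow> adp q k x \<in> J"
  by (induction k) auto

lemma cong_J: "x - y \<in> J \<Longrightarrow> x \<in> J \<longleftrightarrow> y \<in> J"
  using add_J diff_J by (metis add.commute add_diff_cancel diff_add_cancel diff_diff_eq2)

lemma cong_trans: "x - y \<in> J \<Longrightarrow> y - z \<in> J \<Longrightarrow> x - z \<in> J"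
  using add_J[of "x - y" "y - z"] by simp

lemma cong_sym: "x - y \<in> J \<Longrightarrow> y - x \<in> J"
  using uminus_J[of "x - y"] by simp

lemma cong_mult:
  assumes "x - x' \<in> J" "y - y' \<in> J" "x' \<in> A" "y \<in> A"
  shows "x * y - x' * y' \<in> J"
proof -
  have "x * y - x' * y' = (x - x') * y + x' * (y - y')" by (simp add: algebra_simps)
  then show ?thesis using assms by auto
qed

lemma omon_A [intro]: "(\<And>i. i \<in> {1..N} \<Longrightarrow> P i \<in> A) \<Longrightarrow> omon P N a \<in> A"
  by (induction N) auto

lemma comm_power_J:
  assumes "comm q x \<in> J" "x \<in> A"
  shows "comm q (x ^ m) \<in> J"
  using assms by (induction m) (auto simp: comm_mult)

lemma comm_omon_J:
  assumes "\<And>i. i \<in> {1..N} \<Longrightarrow> comm q (P i) \<in> J" "\<And>i. i \<in> {1..N} \<Longrightarrow> P i \<in> A"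
  shows "comm q (omon P N a) \<in> J"
  using assms
proof (induction N)
  case (Suc N)
  then have "omon P N a \<in> A" by (intro omon_A) auto
  moreover have "comm q (omon P N a) \<in> J" using Suc by simp
  moreover have "comm q (P (Suc N) ^ count a (Suc N)) \<in> J" "P (Suc N) \<in> A"
    using Suc.prems by (auto intro: comm_power_J)
  ultimately show ?case by (auto simp: comm_mult)
qed auto

lemma comm_power_one:
  assumes "comm q x - 1 \<in> J" "x \<in> A" "q \<in> A"
  shows "comm q (x ^ m) - of_nat m * x ^ (m - 1) \<in> J"
proof (induction m)
  case (Suc m)
  have "comm q (x ^ Suc m) - of_nat (Suc m) * x ^ (Suc m - 1)
      = (comm q x - 1) * x ^ m + x * (comm q (x ^ m) - of_nat m * x ^ (m - 1))
         + (x * (of_nat m * x ^ (m - 1)) - of_nat m * x ^ m)"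
    by (simp add: comm_mult algebra_simps)
  also have "x * (of_nat m * x ^ (m - 1)) - of_nat m * x ^ m = 0"
    by (cases m) (auto simp: of_nat_left_commute simp del: of_nat_Suc)
  finally show ?case using assms Suc by auto
qed auto

text \<open>Since \<open>comm q\<close> is a derivation that is constant on each \<open>P i\<close>
  modulo \<open>J\<close>, the order of the factors does not disturb the rule for partial
  derivatives.\<close>

lemma comm_omon:
  assumes "\<And>i. i \<in> {1..N} \<Longrightarrow> comm q (P i) - of_bool (i = j) \<in> J"
    and "\<And>i. i \<in> {1..N} \<Longrightarrow> P i \<in> A" and "j \<in> {1..N}" and "q \<in> A"
  shows "comm q (omon P N a) - of_nat (count a j) * omon P N (a - {#j#}) \<in> J"
  using assms
proof (induction N)
  case (Suc N)
  have A: "omon P N a \<in> A" "P (Suc N) \<in> A" using Suc.prems by (auto intro!: omon_A)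
  show ?case
  proof (cases "j = Suc N")
    case True
    then have 0: "comm q (P i) \<in> J" if "i \<in> {1..N}" for i
      using Suc.prems(1)[of i] that by simp
    have 1: "comm q (omon P N a) \<in> J"
      using Suc.prems by (intro comm_omon_J 0) auto
    have 2: "comm q (P (Suc N) ^ count a j) - of_nat (count a j) * P (Suc N) ^ (count a j - 1) \<in> J"
      using Suc.prems(1)[of "Suc N"] Suc.prems True by (intro comm_power_one) auto
    have 3: "omon P N (a - {#j#}) = omon P N a"
      using True by (intro omon_cong_count) auto
    have "comm q (omon P (Suc N) a) - of_nat (count a j) * omon P (Suc N) (a - {#j#})
      = comm q (omon P N a) * P (Suc N) ^ count a j + omon P N a *
        (comm q (P (Suc N) ^ count a j) - of_nat (count a j) * P (Suc N) ^ (count a j - 1))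
        + (omon P N a * (of_nat (count a j) * P (Suc N) ^ (count a j - 1))
            - of_nat (count a j) * (omon P N a * P (Suc N) ^ (count a j - 1)))"
      using True 3 by (simp add: comm_mult algebra_simps)
    also have "omon P N a * (of_nat (count a j) * P (Suc N) ^ (count a j - 1))
            - of_nat (count a j) * (omon P N a * P (Suc N) ^ (count a j - 1)) = 0"
      by (simp add: of_nat_left_commute 3[unfolded True])
    finally show ?thesis using 1 2 A by auto
  next
    case False
    with Suc.prems have j: "j \<in> {1..N}" by auto
    have IH: "comm q (omon P N a) - of_nat (count a j) * omon P N (a - {#j#}) \<in> J"
      using Suc.prems j by (intro Suc.IH) auto
    have "comm q (P (Suc N)) \<in> J" using Suc.prems(1)[of "Suc N"] False by simp
    then have 1: "comm q (P (Suc N) ^ count a (Suc N)) \<in> J"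
      using A by (intro comm_power_J) auto
    have "comm q (omon P (Suc N) a) - of_nat (count a j) * omon P (Suc N) (a - {#j#})
      = (comm q (omon P N a) - of_nat (count a j) * omon P N (a - {#j#})) * P (Suc N) ^ count a (Suc N)
        + omon P N a * comm q (P (Suc N) ^ count a (Suc N))"
      using False by (simp add: comm_mult algebra_simps)
    then show ?thesis using IH 1 A by auto
  qed
qed auto

text \<open>Applying \<open>comm (q j)\<close>, which acts like \<open>\<partial>/\<partial>P\<^sub>j\<close>, lowers the degree of a relation.\<close>

lemma omon_independent:
  assumes "finite F" and "\<And>a. a \<in> F \<Longrightarrow> set_mset a \<subseteq> {1..N}"
    and "\<And>a. a \<in> F \<Longrightarrow> c a \<in> A"
    and "\<And>a j. a \<in> F \<Longrightarrow> j \<in> {1..N} \<Longrightarrow> comm (q j) (c a) \<in> J"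
    and "\<And>a j m x. a \<in> F \<Longrightarrow> 0 < m \<Longrightarrow> m \<le> count a j \<Longrightarrow> x \<in> A \<Longrightarrow> of_nat m * x \<in> J \<Longrightarrow> x \<in> J"
    and q: "\<And>i j. i \<in> {1..N} \<Longrightarrow> j \<in> {1..N} \<Longrightarrow> comm (q j) (P i) - of_bool (i = j) \<in> J"
    and P: "\<And>i. i \<in> {1..N} \<Longrightarrow> P i \<in> A" and qA: "\<And>i. i \<in> {1..N} \<Longrightarrow> q i \<in> A"
    and "(\<Sum>a\<in>F. c a * omon P N a) \<in> J"
  shows "\<forall>a\<in>F. c a \<in> J"
proof -
  obtain k where "\<forall>a\<in>F. size a \<le> k"
    using \<open>finite F\<close> by (meson finite_nat_set_iff_bounded_le finite_imageI imageI)
  from assms(1-5,9) this show ?thesis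
  proof (induction k arbitrary: F c)
    case 0
    then have "F \<subseteq> {{#}}" by auto
    with 0 show ?case by (auto simp: subset_singleton_iff)
  next
    case (Suc k)
    \<comment> \<open>The differentiated relation has coefficient \<open>count a j\<close> times
      \<open>c a\<close> at \<open>a - {#j#}\<close>, and the torsion hypothesis removes the
      integer. The empty monomial escapes this argument and is treated last.\<close>
    have pos: "c a \<in> J" if a: "a \<in> F" "j \<in># a" for a j
    proof -
      have j: "j \<in> {1..N}" using Suc.prems(2)[OF a(1)] a(2) by blast
      define F' where "F' = (\<lambda>a. a - {#j#}) ` {a \<in> F. j \<in># a}"
      define c' where "c' b = of_nat (Suc (count b j)) * c (add_mset j b)" for b
      have 1: "(\<Sum>b\<in>F'. c' b * omon P N b) = (\<Sum>a\<in>{a \<in> F. j \<in># a}. c a * (of_nat (count a j) * omon P N (a - {#j#})))"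
        unfolding F'_def
      proof (subst sum.reindex)
        show "inj_on (\<lambda>a. a - {#j#}) {a \<in> F. j \<in># a}"
          by (rule inj_onI) (metis (mono_tags, lifting) insert_DiffM mem_Collect_eq)
        show "sum ((\<lambda>b. c' b * omon P N b) \<circ> (\<lambda>a. a - {#j#})) {a \<in> F. j \<in># a}
           = (\<Sum>a\<in>{a \<in> F. j \<in># a}. c a * (of_nat (count a j) * omon P N (a - {#j#})))"
        proof (rule sum.cong[OF refl])
          fix a assume "a \<in> {a \<in> F. j \<in># a}"
          then have "j \<in># a" by simp
          then have "Suc (count (a - {#j#}) j) = count a j" "add_mset j (a - {#j#}) = a" by auto
          then show "((\<lambda>b. c' b * omon P N b) \<circ> (\<lambda>a. a - {#j#})) a
              = c a * (of_nat (count a j) * omon P N (a - {#j#}))"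
            unfolding c'_def comp_def
            by (metis mult.assoc mult_of_nat_commute)
        qed
      qed
      also have "\<dots> = (\<Sum>a\<in>F. c a * (of_nat (count a j) * omon P N (a - {#j#})))"
        using Suc.prems(1) by (intro sum.mono_neutral_left) (auto simp: not_in_iff)
      finally have eq: "(\<Sum>b\<in>F'. c' b * omon P N b) = \<dots>" .
      have "comm (q j) (\<Sum>a\<in>F. c a * omon P N a) - (\<Sum>b\<in>F'. c' b * omon P N b)
         = (\<Sum>a\<in>F. comm (q j) (c a) * omon P N a + c a * (comm (q j) (omon P N a)
               - of_nat (count a j) * omon P N (a - {#j#})))"
        unfolding eq comm_sum sum_subtractf[symmetric] by (simp add: comm_mult algebra_simps)
      also have "\<dots> \<in> J"
        using Suc.prems(2,3,4) P q j qA
        by (intro sum_J add_J mult_J mult_J' comm_omon omon_A) auto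
      finally have "comm (q j) (\<Sum>a\<in>F. c a * omon P N a) \<in> J \<longleftrightarrow> (\<Sum>b\<in>F'. c' b * omon P N b) \<in> J"
        by (rule cong_J)
      then have s: "(\<Sum>b\<in>F'. c' b * omon P N b) \<in> J"
        using Suc.prems(6) qA j by auto
      have F'D: "add_mset j b \<in> F" if "b \<in> F'" for b
        using that by (auto simp: F'_def)
      have "\<forall>b\<in>F'. c' b \<in> J"
      proof (rule Suc.IH[of F' c'])
        show "finite F'" using Suc.prems(1) by (simp add: F'_def)
        show "set_mset b \<subseteq> {1..N}" if "b \<in> F'" for b
          using Suc.prems(2)[OF F'D[OF that]] by simp
        show "c' b \<in> A" if "b \<in> F'" for b
          using Suc.prems(3)[OF F'D[OF that]] unfolding c'_def by blast
        show "comm (q i) (c' b) \<in> J" if "b \<in> F'" "i \<in> {1..N}" for b i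
          using Suc.prems(4)[OF F'D[OF that(1)] that(2)] unfolding c'_def by (simp del: of_nat_Suc)
        show "x \<in> J" if "b \<in> F'" "0 < m" "m \<le> count b i" "x \<in> A" "of_nat m * x \<in> J" for b i m x
        proof (rule Suc.prems(5)[OF F'D[OF that(1)] that(2) _ that(4,5)])
          show "m \<le> count (add_mset j b) i" using that(3) by simp
        qed
        show "(\<Sum>b\<in>F'. c' b * omon P N b) \<in> J" by (rule s)
        show "\<forall>a\<in>F'. size a \<le> k" using Suc.prems(7) F'D by fastforce
      qed
      moreover have "a - {#j#} \<in> F'" using a by (auto simp: F'_def)
      ultimately have "c' (a - {#j#}) \<in> J" by blast
      moreover have "Suc (count (a - {#j#}) j) = count a j" "add_mset j (a - {#j#}) = a"
        using a by auto
      ultimately have "of_nat (count a j) * c a \<in> J"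
        unfolding c'_def by (simp only:)
      moreover have "0 < count a j" using a by simp
      ultimately show "c a \<in> J" using Suc.prems(5)[of a "count a j" j "c a"] Suc.prems(3) a by blast
    qed
    show ?case
    proof
    fix a assume aF: "a \<in> F"
    show "c a \<in> J"
    proof (cases "a = {#}")
      case True
      have "(\<Sum>b\<in>F. c b * omon P N b) = c a + (\<Sum>b\<in>F - {a}. c b * omon P N b)"
        using Suc.prems(1) aF True by (subst sum.remove[of _ a]) auto
      moreover have "(\<Sum>b\<in>F - {a}. c b * omon P N b) \<in> J"
      proof (intro sum_J mult_J omon_A P)
        fix b assume "b \<in> F - {a}"
        then show "c b \<in> J" using True pos[of b] by (metis Diff_iff insertI1 multiset_nonemptyE)
      qed
      ultimately show ?thesis using Suc.prems(6) by (metis add_diff_cancel_right' diff_J)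
    next
      case False
      then show ?thesis using pos[of a] aF by (metis multiset_nonemptyE)
    qed
    qed
  qed
qed

lemma adp_mult_power:
  assumes "comm q c \<in> J" "comm q x - 1 \<in> J" "c \<in> A" "x \<in> A" "q \<in> A"
  shows "adp q m (c * x ^ m) - of_nat (fact m) * c \<in> J"
proof (induction m)
  case (Suc m)
  have "comm q (c * x ^ Suc m) - of_nat (Suc m) * (c * x ^ m)
      = comm q c * x ^ Suc m + c * (comm q (x ^ Suc m) - of_nat (Suc m) * x ^ (Suc m - 1))
        + (c * (of_nat (Suc m) * x ^ m) - of_nat (Suc m) * (c * x ^ m))"
    by (simp add: comm_mult algebra_simps)
  also have "c * (of_nat (Suc m) * x ^ m) - of_nat (Suc m) * (c * x ^ m) = 0"
    by (metis diff_self mult.assoc mult_of_nat_commute)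
  finally have "comm q (c * x ^ Suc m) - of_nat (Suc m) * (c * x ^ m) \<in> J"
    using assms comm_power_one[of q x "Suc m"] by auto
  then have "adp q m (comm q (c * x ^ Suc m) - of_nat (Suc m) * (c * x ^ m)) \<in> J"
    using assms by blast
  then have 1: "adp q (Suc m) (c * x ^ Suc m) - of_nat (Suc m) * adp q m (c * x ^ m) \<in> J"
    by (simp only: adp_diff adp_of_nat_mult adp_Suc')
  have 2: "of_nat (Suc m) * adp q m (c * x ^ m) - of_nat (fact (Suc m)) * c \<in> J"
  proof -
    have "of_nat (Suc m) * (adp q m (c * x ^ m) - of_nat (fact m) * c) \<in> J"
      using Suc by (intro mult_J') auto
    then show ?thesis by (simp only: fact_Suc of_nat_mult right_diff_distrib mult.assoc of_nat_id)
  qed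
  from cong_trans[OF 1 2] show ?case .
qed auto

text \<open>Taylor expansion: \<open>x\<close> is a combination of the monomials in the \<open>P i\<close> with coefficients in
  their centralizer, because the inner derivations \<open>comm (q j)\<close> are nilpotent.\<close>

lemma taylor_closed:
  fixes N p :: nat
  assumes HA: "\<And>x y. x \<in> H \<Longrightarrow> y \<in> H \<Longrightarrow> x + y \<in> H"
    and HP: "\<And>x j. x \<in> H \<Longrightarrow> j \<in> {1..N} \<Longrightarrow> x * P j \<in> H"
    and Hdiv: "\<And>m x. \<not> p dvd m \<Longrightarrow> x \<in> A \<Longrightarrow> of_nat m * x \<in> H \<Longrightarrow> x \<in> H"
    and HC: "\<And>c. c \<in> A \<Longrightarrow> (\<And>j. j \<in> {1..N} \<Longrightarrow> comm (q j) c \<in> J) \<Longrightarrow> c \<in> H"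
    and q: "\<And>i j. i \<in> {1..N} \<Longrightarrow> j \<in> {1..N} \<Longrightarrow> comm (q j) (P i) - of_bool (i = j) \<in> J"
    and P: "\<And>i. i \<in> {1..N} \<Longrightarrow> P i \<in> A" and qA: "\<And>i. i \<in> {1..N} \<Longrightarrow> q i \<in> A"
    and qq: "\<And>i j x. i \<in> {1..N} \<Longrightarrow> j \<in> {1..N} \<Longrightarrow> x \<in> A \<Longrightarrow> comm (comm (q i) (q j)) x \<in> J"
    and nil: "\<And>j x. j \<in> {1..N} \<Longrightarrow> x \<in> A \<Longrightarrow> adp (q j) p x \<in> J"
    and p: "prime p" and x: "x \<in> A"
  shows "x \<in> H"
proof -
  have JH: "x \<in> H" if "x \<in> J" for x
    using that qA by (intro HC) auto
  have ad_killed: "comm (q i) (adp (q j) m x) \<in> J"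
    if "i \<in> {1..N}" "j \<in> {1..N}" "x \<in> A" "comm (q i) x \<in> J" for i j m x
  proof (induction m)
    case (Suc m)
    have "comm (q i) (adp (q j) (Suc m) x)
       = comm (comm (q i) (q j)) (adp (q j) m x) + comm (q j) (comm (q i) (adp (q j) m x))"
      unfolding adp_Suc by (rule jacobi)
    also have "\<dots> \<in> J" using that qq Suc qA by auto
    finally show ?case .
  qed (use that in simp)
  \<comment> \<open>Downward induction on the number \<open>k\<close> of derivations known to kill
    \<open>x\<close>. For \<open>k = N\<close> the element lies in the centralizer and
    \<open>HC\<close> applies; \<open>k = 0\<close> is the claim.\<close>
  have "\<forall>x\<in>A. (\<forall>j\<in>{1..k}. comm (q j) x \<in> J) \<longrightarrow> x \<in> H" if "k \<le> N" for k
    using that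
  proof (induction "N - k" arbitrary: k)
    case 0
    then have "k = N" by simp
    then show ?case using HC by blast
  next
    case (Suc d)
    have d: "d = N - Suc k" "Suc k \<le> N" using Suc.hyps(2) Suc.prems by linarith+
    have IH: "x \<in> H" if "x \<in> A" "\<And>j. j \<in> {1..Suc k} \<Longrightarrow> comm (q j) x \<in> J" for x
      using Suc.hyps(1)[OF d] that by blast
    have Sk: "Suc k \<in> {1..N}" and sub: "j \<in> {1..k} \<Longrightarrow> j \<in> {1..N}" for j using d by auto
    \<comment> \<open>Inner induction on the order of nilpotency of \<open>comm (q (Suc k))\<close>
      on \<open>x\<close>. It is at most \<open>p\<close>, so that the factorials below are not
      divisible by \<open>p\<close>.\<close>
    have main: "\<forall>x\<in>A. (\<forall>j\<in>{1..k}. comm (q j) x \<in> J) \<longrightarrow> adp (q (Suc k)) m x \<in> J \<longrightarrow> x \<in> H" if "m \<le> p" for m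
      using that
    proof (induction m)
      case (Suc m)
      show ?case
      proof (intro ballI impI)
        fix x assume x: "x \<in> A" "\<forall>j\<in>{1..k}. comm (q j) x \<in> J" "adp (q (Suc k)) (Suc m) x \<in> J"
        define c where "c = adp (q (Suc k)) m x"
        \<comment> \<open>Up to the factor \<open>fact m\<close> this is \<open>x\<close> without
          its top Taylor term. Here \<open>c\<close> is the last derivative of \<open>x\<close> that
          may be nonzero, and it is killed by one derivation more than \<open>x\<close>.\<close>
        define x' where "x' = of_nat (fact m) * x - c * P (Suc k) ^ m"
        have cA: "c \<in> A" using x qA Sk by (auto simp: c_def)
        have ck: "comm (q j) c \<in> J" if "j \<in> {1..k}" for j
          unfolding c_def using ad_killed[OF sub[OF that] Sk x(1)] x(2) that by blast
        have cS: "comm (q (Suc k)) c \<in> J" using x(3) by (simp add: c_def)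
        have cH: "c \<in> H"
        proof (rule IH[OF cA])
          fix j assume "j \<in> {1..Suc k}"
          then show "comm (q j) c \<in> J" using ck cS by (cases "j = Suc k") auto
        qed
        have cPH: "c * P (Suc k) ^ i \<in> H" for i
        proof (induction i)
          case (Suc i)
          have "c * P (Suc k) ^ Suc i = c * P (Suc k) ^ i * P (Suc k)"
            by (simp add: power_Suc2 mult.assoc del: power_Suc)
          with Suc show ?case using HP[OF _ Sk] by simp
        qed (use cH in simp)
        have x'A: "x' \<in> A" using x cA P Sk by (auto simp: x'_def)
        have PJ: "comm (q j) (P (Suc k)) \<in> J" if "j \<in> {1..k}" for j
          using q[of "Suc k" j] sub[OF that] Sk that by auto
        have "comm (q j) x' \<in> J" if "j \<in> {1..k}" for j
        proof -
          have "comm (q j) (P (Suc k) ^ m) \<in> J"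
            using PJ[OF that] P Sk by (intro comm_power_J) auto
          then show ?thesis
            using x(2) ck[OF that] that cA P Sk unfolding x'_def
            by (simp add: comm_mult)
        qed
        moreover have "adp (q (Suc k)) m x' \<in> J"
        proof -
          have "adp (q (Suc k)) m (c * P (Suc k) ^ m) - of_nat (fact m) * c \<in> J"
            using q[of "Suc k" "Suc k"] Sk P qA cA cS by (intro adp_mult_power) auto
          then have "of_nat (fact m) * c - adp (q (Suc k)) m (c * P (Suc k) ^ m) \<in> J"
            by (rule cong_sym)
          then show ?thesis unfolding x'_def adp_diff adp_of_nat_mult c_def .
        qed
        ultimately have "x' \<in> H" using Suc x'A by auto
        then have "of_nat (fact m) * x \<in> H"
          using HA[OF \<open>x' \<in> H\<close> cPH[of m]] by (simp add: x'_def)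
        moreover have "\<not> p dvd fact m"
          using Suc.prems p prime_dvd_fact_iff[of p m] by simp
        ultimately show "x \<in> H" using Hdiv x(1) by blast
      qed
    qed (use JH in simp)
    show ?case using main[of p] nil[OF Sk] by blast
  qed
  from this[of 0] x show ?thesis by simp
qed

end


section \<open>Ideals and multivariate polynomials\<close>

definition is_hom :: "('r::comm_ring_1 \<Rightarrow> 'c::ring_1) \<Rightarrow> bool"
  where "is_hom s \<longleftrightarrow> s 1 = 1 \<and> (\<forall>x y. s (x + y) = s x + s y) \<and> (\<forall>x y. s (x * y) = s x * s y)"

lemma is_homD:
  assumes "is_hom s"
  shows "s 1 = 1" "s (x + y) = s x + s y" "s (x * y) = s x * s y"
  using assms by (auto simp: is_hom_def)

lemma is_hom_0: "is_hom s \<Longrightarrow> s 0 = 0"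
  using is_homD(2)[of s 0 0] by simp

lemma is_hom_minus: "is_hom s \<Longrightarrow> s (- x) = - s x"
  using is_homD(2)[of s x "- x"] by (simp add: is_hom_0 eq_neg_iff_add_eq_0 add.commute)

lemma is_hom_diff: "is_hom s \<Longrightarrow> s (x - y) = s x - s y"
  using is_homD(2)[of s x "- y"] by (simp add: is_hom_minus)

lemma is_hom_of_nat: "is_hom s \<Longrightarrow> s (of_nat n) = of_nat n"
  by (induction n) (auto simp: is_homD is_hom_0)

lemma is_hom_of_int: "is_hom s \<Longrightarrow> s (of_int n) = of_int n"
  by (cases n rule: int_diff_cases) (simp add: is_hom_diff is_hom_of_nat)

lemma is_hom_sum: "is_hom s \<Longrightarrow> s (sum f A) = (\<Sum>a\<in>A. s (f a))"
  by (induction A rule: infinite_finite_induct) (auto simp: is_homD is_hom_0)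

lemma is_hom_of_int' [simp]: "is_hom (of_int :: int \<Rightarrow> 'c::ring_1)"
  by (auto simp: is_hom_def)

locale cring_ideal =
  fixes I :: "'r::comm_ring_1 set"
  assumes zero_I [simp, intro]: "0 \<in> I"
    and add_I [simp, intro]: "\<And>x y. x \<in> I \<Longrightarrow> y \<in> I \<Longrightarrow> x + y \<in> I"
    and mult_I [simp, intro]: "\<And>x y. y \<in> I \<Longrightarrow> x * y \<in> I"
begin

lemma mult_I' [simp, intro]: "x \<in> I \<Longrightarrow> x * y \<in> I"
  using mult_I[of x y] by (simp add: mult.commute)

lemma uminus_I [simp, intro]: "x \<in> I \<Longrightarrow> - x \<in> I"
  using mult_I[of x "- 1"] by simp

lemma diff_I [simp, intro]: "x \<in> I \<Longrightarrow> y \<in> I \<Longrightarrow> x - y \<in> I"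
  using add_I[of x "- y"] by simp

lemma sum_I [intro]: "(\<And>i. i \<in> A \<Longrightarrow> f i \<in> I) \<Longrightarrow> sum f A \<in> I"
  by (induction A rule: infinite_finite_induct) auto

lemma cong_I: "x - y \<in> I \<Longrightarrow> x \<in> I \<longleftrightarrow> y \<in> I"
  using add_I diff_I by (metis add.commute add_diff_cancel diff_add_cancel diff_diff_eq2)

lemma cong_trans: "x - y \<in> I \<Longrightarrow> y - z \<in> I \<Longrightarrow> x - z \<in> I"
  using add_I[of "x - y" "y - z"] by simp

lemma cong_sym: "x - y \<in> I \<Longrightarrow> y - x \<in> I"
  using uminus_I[of "x - y"] by simp

lemma cong_mult: "x - x' \<in> I \<Longrightarrow> y - y' \<in> I \<Longrightarrow> x * y - x' * y' \<in> I"
proof -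
  assume "x - x' \<in> I" "y - y' \<in> I"
  moreover have "x * y - x' * y' = (x - x') * y + x' * (y - y')" by (simp add: algebra_simps)
  ultimately show ?thesis by auto
qed

lemma cong_add: "x - x' \<in> I \<Longrightarrow> y - y' \<in> I \<Longrightarrow> (x + y) - (x' + y') \<in> I"
  using add_I[of "x - x'" "y - y'"] by (simp add: algebra_simps)

lemma cong_sum: "(\<And>i. i \<in> A \<Longrightarrow> f i - g i \<in> I) \<Longrightarrow> sum f A - sum g A \<in> I"
  by (simp add: sum_subtractf[symmetric] sum_I)

lemma cong_prod: "(\<And>i. i \<in> A \<Longrightarrow> f i - g i \<in> I) \<Longrightarrow> prod f A - prod g A \<in> I"
  by (induction A rule: infinite_finite_induct) (auto intro!: cong_mult)

end

locale cring_prime = cring_ideal +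
  assumes one_notin [simp]: "1 \<notin> I"
    and prime_I: "\<And>x y. x * y \<in> I \<Longrightarrow> x \<in> I \<or> y \<in> I"
begin

lemma power_notin: "x \<notin> I \<Longrightarrow> x ^ n \<notin> I"
  by (induction n) (auto dest: prime_I)

end

lemma cring_ideal_dvd: "cring_ideal {x. (c :: 'r::comm_ring_1) dvd x}"
  by unfold_locales auto

lemma cring_ideal_0: "cring_ideal {0 :: 'r::comm_ring_1}"
  by unfold_locales auto

lemma cring_prime_int: "prime (p::nat) \<Longrightarrow> cring_prime {x. int p dvd x}"
  using prime_dvd_mult_iff[of "int p"] by unfold_locales (auto simp: prime_int_nat_transfer)

section \<open>Multivariate polynomials as finitely supported functions on multisets\<close>

abbreviation "lookup \<equiv> Poly_Mapping.lookup"
abbreviation "keys \<equiv> Poly_Mapping.keys"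
abbreviation "single \<equiv> Poly_Mapping.single"

lemma pm_sum_single: "f = (\<Sum>m\<in>keys f. single m (lookup f m))"
proof (rule poly_mapping_eqI)
  fix k
  have "lookup (\<Sum>m\<in>keys f. single m (lookup f m)) k = (\<Sum>m\<in>keys f. if m = k then lookup f m else 0)"
    by (simp add: lookup_sum lookup_single when_def)
  also have "\<dots> = lookup f k"
    by (simp add: in_keys_iff)
  finally show "lookup f k = lookup (\<Sum>m\<in>keys f. single m (lookup f m)) k" ..
qed

lemma pm_induct_keys [consumes 1, case_names zero single add]:
  fixes f :: "'m \<Rightarrow>\<^sub>0 'r::comm_monoid_add"
  assumes "keys f \<subseteq> S" and z: "P 0" and s: "\<And>m c. m \<in> S \<Longrightarrow> P (single m c)"
    and a: "\<And>f g. P f \<Longrightarrow> P g \<Longrightarrow> P (f + g)"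
  shows "P f"
proof -
  have "finite (keys f)" by simp
  then have "P (\<Sum>m\<in>keys f. single m (lookup f m))" using assms(1)
  proof (induction "keys f" rule: infinite_finite_induct)
    case infinite
    then show ?case by simp
  next
    case empty
    then show ?case using z by (metis sum.empty)
  next
    case (insert x F)
    have "P (\<Sum>m\<in>A. single m (lookup f m))" if "finite A" "A \<subseteq> S" for A
      using that by (induction A rule: finite_induct) (auto intro: z s a)
    then show ?case using insert by simp
  qed
  then show ?thesis by (simp only: pm_sum_single[symmetric])
qed

lemmas pm_induct = pm_induct_keys[OF subset_UNIV, case_names zero single add]

text \<open>The common scheme of additive extensions from single terms: evaluation, partial
  derivatives, ordered substitution and pairings are instances.\<close>

definition lext :: "('m \<Rightarrow> 'r \<Rightarrow> 'c) \<Rightarrow> ('m \<Rightarrow>\<^sub>0 'r::zero) \<Rightarrow> 'c::comm_monoid_add"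
  where "lext g f = (\<Sum>m\<in>keys f. g m (lookup f m))"

lemma lext_superset:
  assumes "finite S" "keys f \<subseteq> S" "\<And>m. g m 0 = 0"
  shows "lext g f = (\<Sum>m\<in>S. g m (lookup f m))"
  unfolding lext_def using assms by (intro sum.mono_neutral_left) (auto simp: in_keys_iff)

lemma lext_zero [simp]: "lext g 0 = 0"
  by (simp add: lext_def)

lemma lext_single: "(\<And>m. g m 0 = 0) \<Longrightarrow> lext g (single m c) = g m c"
  by (subst lext_superset[of "{m}"]) auto

lemma lext_add:
  assumes "\<And>m. g m 0 = 0" "\<And>m x y. g m (x + y) = g m x + g m y"
  shows "lext g (f + h) = lext g f + lext g h"
proof -
  let ?S = "keys f \<union> keys h"
  have "keys (f + h) \<subseteq> ?S" by (rule keys_add)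
  then show ?thesis
    by (subst (1 2 3) lext_superset[of ?S]) (auto simp: assms lookup_add sum.distrib)
qed

definition pfilt :: "('m \<Rightarrow> bool) \<Rightarrow> ('m \<Rightarrow>\<^sub>0 'r) \<Rightarrow> 'm \<Rightarrow>\<^sub>0 'r::comm_monoid_add"
  where "pfilt P f = (\<Sum>m\<in>{m \<in> keys f. P m}. single m (lookup f m))"

lemma lookup_pfilt: "lookup (pfilt P f) m = (if P m then lookup f m else 0)"
proof -
  have "lookup (pfilt P f) m = (\<Sum>k\<in>{k \<in> keys f. P k}. if k = m then lookup f k else 0)"
    by (simp add: pfilt_def lookup_sum lookup_single when_def)
  also have "\<dots> = (if P m then lookup f m else 0)"
    by (subst sum.delta) (auto simp: in_keys_iff)
  finally show ?thesis .
qed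

lemma keys_pfilt: "keys (pfilt P f) = {m \<in> keys f. P m}"
  by (auto simp: in_keys_iff lookup_pfilt split: if_splits)

lemma pfilt_add: "pfilt P (f + g) = pfilt P f + pfilt P g"
  by (rule poly_mapping_eqI) (auto simp: lookup_pfilt lookup_add)

lemma pfilt_zero [simp]: "pfilt P 0 = 0"
  by (rule poly_mapping_eqI) (auto simp: lookup_pfilt)

lemma lookup_single_mult:
  fixes f :: "'v multiset \<Rightarrow>\<^sub>0 'r::comm_ring_1"
  shows "lookup (single a c * f) m = (if a \<subseteq># m then c * lookup f (m - a) else 0)"
proof (induction f rule: pm_induct)
  case (single k d)
  show ?case
    by (auto simp: mult_single lookup_single when_def) (metis mset_subset_eq_add_left)
next
  case (add f g)
  then show ?case by (simp add: distrib_left lookup_add)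
qed auto

type_synonym ('v, 'r) mp = "'v multiset \<Rightarrow>\<^sub>0 'r"

definition Cst :: "'r \<Rightarrow> ('v, 'r::comm_ring_1) mp" where "Cst c = single {#} c"
definition Var :: "'v \<Rightarrow> ('v, 'r::comm_ring_1) mp" where "Var i = single {#i#} 1"

lemma is_hom_Cst [simp]: "is_hom Cst"
  by (auto simp: is_hom_def Cst_def single_add mult_single)

lemma Cst_0 [simp]: "Cst 0 = 0" and Cst_1 [simp]: "Cst 1 = 1"
  and Cst_add: "Cst (a + b) = Cst a + Cst b" and Cst_mult: "Cst (a * b) = Cst a * Cst b"
  and Cst_diff: "Cst (a - b) = Cst a - Cst b" and Cst_minus: "Cst (- a) = - Cst a"
  and Cst_of_nat [simp]: "Cst (of_nat n) = of_nat n" and Cst_of_int [simp]: "Cst (of_int i) = of_int i"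
  using is_hom_Cst is_homD is_hom_0 is_hom_diff is_hom_minus is_hom_of_nat is_hom_of_int by blast+

lemma lookup_Cst: "lookup (Cst c) m = (if m = {#} then c else 0)"
  by (auto simp: Cst_def lookup_single when_def)

lemma lookup_Cst_mult [simp]: "lookup (Cst c * f) m = c * lookup f m"
  by (simp add: Cst_def lookup_single_mult)

lemma lookup_of_nat_mult [simp]:
  fixes f :: "('v, 'r::comm_ring_1) mp"
  shows "lookup (of_nat c * f) m = of_nat c * lookup f m"
  using lookup_Cst_mult[of "of_nat c" f m] by simp

lemma single_Var: "single (add_mset i m) c = Var i * single m (c :: 'r::comm_ring_1)"
  by (simp add: Var_def mult_single)

lemma single_eq: "single m c = Cst c * prod_mset (image_mset Var m)"
proof (induction m)
  case (add i m)
  then show ?case by (simp add: single_Var mult.left_commute)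
qed (simp add: Cst_def)

definition mvars :: "'v set \<Rightarrow> ('v, 'r::comm_ring_1) mp set"
  where "mvars V = {f. \<forall>m\<in>keys f. set_mset m \<subseteq> V}"

lemma mvars_0 [simp, intro]: "0 \<in> mvars V"
  and mvars_add [simp, intro]: "f \<in> mvars V \<Longrightarrow> g \<in> mvars V \<Longrightarrow> f + g \<in> mvars V"
  and mvars_single [intro]: "set_mset m \<subseteq> V \<Longrightarrow> single m c \<in> mvars V"
  and mvars_Cst [simp, intro]: "Cst c \<in> mvars V"
  and mvars_Var [intro]: "i \<in> V \<Longrightarrow> Var i \<in> mvars V"
  using keys_add[of f g] by (auto simp: mvars_def Cst_def Var_def split: if_splits)

lemma mvars_UNIV [simp]: "f \<in> mvars UNIV"
  by (simp add: mvars_def)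

lemma mvars_mono: "f \<in> mvars V \<Longrightarrow> V \<subseteq> W \<Longrightarrow> f \<in> mvars W"
  by (auto simp: mvars_def)

lemma mvars_mult [simp, intro]: "f \<in> mvars V \<Longrightarrow> g \<in> mvars V \<Longrightarrow> f * g \<in> mvars V"
  using keys_mult[of f g] by (fastforce simp: mvars_def)

lemma mvars_uminus [simp, intro]: "f \<in> mvars V \<Longrightarrow> - f \<in> mvars V"
  by (auto simp: mvars_def in_keys_iff)

lemma mvars_diff [simp, intro]: "f \<in> mvars V \<Longrightarrow> g \<in> mvars V \<Longrightarrow> f - g \<in> mvars V"
  using mvars_add[of f V "- g"] by simp

lemma mvars_1 [simp, intro]: "1 \<in> mvars V"
  using mvars_Cst[of 1 V] by simp

lemma mvars_power [simp, intro]: "f \<in> mvars V \<Longrightarrow> f ^ n \<in> mvars V"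
  by (induction n) auto

lemma mvars_sum [intro]: "(\<And>i. i \<in> A \<Longrightarrow> f i \<in> mvars V) \<Longrightarrow> sum f A \<in> mvars V"
  by (induction A rule: infinite_finite_induct) auto

lemma mvars_prod [intro]: "(\<And>i. i \<in> A \<Longrightarrow> f i \<in> mvars V) \<Longrightarrow> prod f A \<in> mvars V"
  by (induction A rule: infinite_finite_induct) auto

lemma mvars_of_nat [simp, intro]: "of_nat n \<in> mvars V"
  using mvars_Cst[of "of_nat n" V] by simp

lemma mvars_of_int [simp, intro]: "of_int n \<in> mvars V"
  using mvars_Cst[of "of_int n" V] by simp

lemma mvars_pfilt [intro]: "f \<in> mvars V \<Longrightarrow> pfilt P f \<in> mvars V"
  by (auto simp: mvars_def keys_pfilt)

lemma mp_induct [consumes 1, case_names Cst Var add]: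
  assumes "f \<in> mvars V" and c: "\<And>c. P (Cst c)"
    and v: "\<And>i f. i \<in> V \<Longrightarrow> f \<in> mvars V \<Longrightarrow> P f \<Longrightarrow> P (Var i * f)"
    and a: "\<And>f g. f \<in> mvars V \<Longrightarrow> g \<in> mvars V \<Longrightarrow> P f \<Longrightarrow> P g \<Longrightarrow> P (f + g)"
  shows "P f"
proof -
  have s: "P (single m c)" if "set_mset m \<subseteq> V" for m c
    using that
  proof (induction m)
    case empty
    then show ?case using c[of c] by (simp add: Cst_def)
  next
    case (add i m)
    then show ?case using v[of i "single m c"] by (simp add: single_Var mvars_single)
  qed
  have "keys f \<subseteq> {m. set_mset m \<subseteq> V}" using assms(1) by (auto simp: mvars_def)
  then have "f \<in> mvars V \<and> P f"
  proof (induction rule: pm_induct_keys)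
    case zero
    then show ?case using c[of 0] by simp
  next
    case (single m c)
    then show ?case using s by (simp add: mvars_single)
  qed (use a in auto)
  then show ?thesis ..
qed

definition meval :: "('r \<Rightarrow> 'c) \<Rightarrow> ('v \<Rightarrow> 'c) \<Rightarrow> ('v, 'r::comm_ring_1) mp \<Rightarrow> 'c::comm_ring_1"
  where "meval s a f = lext (\<lambda>m c. s c * prod_mset (image_mset a m)) f"

context
  fixes s :: "'r::comm_ring_1 \<Rightarrow> 'c::comm_ring_1"
  assumes s: "is_hom s"
begin

lemma meval_single: "meval s a (single m c) = s c * prod_mset (image_mset a m)"
  unfolding meval_def by (rule lext_single) (simp add: is_hom_0[OF s])

lemma meval_add: "meval s a (f + g) = meval s a f + meval s a g"
  unfolding meval_def by (rule lext_add) (simp_all add: is_hom_0[OF s] is_homD[OF s] algebra_simps)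

lemma meval_Cst: "meval s a (Cst c) = s c"
  by (simp add: Cst_def meval_single)

lemma meval_Var: "meval s a (Var i) = a i"
  by (simp add: Var_def meval_single is_homD[OF s])

lemma meval_mult: "meval s a (f * g) = meval s a f * meval s a g"
proof (induction f rule: pm_induct)
  case (single m c)
  show ?case
  proof (induction g rule: pm_induct)
    case (single m' c')
    then show ?case by (simp add: mult_single meval_single is_homD[OF s])
  next
    case (add f g)
    then show ?case by (simp add: distrib_left meval_add)
  qed (auto simp: meval_def)
next
  case (add f g)
  then show ?case by (simp add: distrib_right meval_add)
qed (auto simp: meval_def)

lemma is_hom_meval: "is_hom (meval s a)"
  using meval_Cst[of a 1] by (simp add: is_hom_def meval_add meval_mult is_homD[OF s])

lemma meval_cong:
  assumes "f \<in> mvars V" "\<And>i. i \<in> V \<Longrightarrow> a i = b i"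
  shows "meval s a f = meval s b f"
  using assms(1) by (induction rule: mp_induct) (auto simp: meval_Cst meval_Var meval_mult meval_add assms(2))

end

lemma meval_id: "meval Cst Var f = f"
  by (induction f rule: mp_induct[OF mvars_UNIV]) (auto simp: meval_Cst meval_Var meval_mult meval_add)

lemma is_hom_comp: "is_hom s \<Longrightarrow> is_hom t \<Longrightarrow> is_hom (\<lambda>x. t (s x))"
  by (auto simp: is_hom_def)

lemma meval_hom:
  assumes "is_hom s" "is_hom t"
  shows "t (meval s a f) = meval (\<lambda>x. t (s x)) (\<lambda>i. t (a i)) f"
  by (induction f rule: mp_induct[OF mvars_UNIV])
    (auto simp: meval_Cst meval_Var meval_mult meval_add is_hom_comp assms is_homD[OF assms(2)])

lemma meval_mvars [intro]:
  assumes "f \<in> mvars V" "\<And>i. i \<in> V \<Longrightarrow> a i \<in> mvars W"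
  shows "meval Cst a f \<in> mvars W"
  using assms(1) by (induction rule: mp_induct) (auto simp: meval_Cst meval_Var meval_mult meval_add assms(2))

abbreviation mmap :: "('r::comm_ring_1 \<Rightarrow> 'c::comm_ring_1) \<Rightarrow> ('v, 'r) mp \<Rightarrow> ('v, 'c) mp"
  where "mmap s \<equiv> meval (\<lambda>x. Cst (s x)) Var"

lemma lookup_mmap:
  assumes s: "is_hom s"
  shows "lookup (mmap s f) m = s (lookup f m)"
proof (induction f rule: pm_induct)
  case (single k c)
  have "mmap s (single k c) = single k (s c)"
    by (subst meval_single) (auto simp: is_hom_comp s single_eq)
  then show ?case by (simp add: lookup_single when_def is_hom_0[OF s])
next
  case (add f g)
  then show ?case by (simp add: meval_add is_hom_comp s lookup_add is_homD[OF s])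
qed (auto simp: meval_def is_hom_0[OF s])

lemma mmap_mvars: "is_hom s \<Longrightarrow> f \<in> mvars V \<Longrightarrow> mmap s f \<in> mvars V"
  by (auto simp: mvars_def in_keys_iff lookup_mmap is_hom_0)

definition coefs_in :: "'r set \<Rightarrow> ('v, 'r::comm_ring_1) mp set"
  where "coefs_in I = {f. \<forall>m. lookup f m \<in> I}"

lemma cring_ideal_coefs_in:
  assumes "cring_ideal I"
  shows "cring_ideal (coefs_in I :: ('v, 'r::comm_ring_1) mp set)"
proof -
  interpret cring_ideal I by fact
  have *: "f * g \<in> coefs_in I" if g: "g \<in> coefs_in I" for f g :: "('v, 'r) mp"
  proof (induction f rule: pm_induct)
    case (single m c)
    then show ?case using g by (auto simp: coefs_in_def lookup_single_mult)
  next
    case (add f h)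
    then show ?case by (auto simp: coefs_in_def distrib_right lookup_add)
  qed (auto simp: coefs_in_def)
  show ?thesis
    by unfold_locales (use * in \<open>auto simp: coefs_in_def lookup_add\<close>)
qed

lemma coefs_in_Cst [simp]: "0 \<in> I \<Longrightarrow> Cst c \<in> coefs_in I \<longleftrightarrow> c \<in> I"
  by (auto simp: coefs_in_def lookup_Cst)

lemma coefs_in_Cst_mult: "cring_ideal I \<Longrightarrow> c \<in> I \<Longrightarrow> Cst c * f \<in> coefs_in I"
  by (simp add: coefs_in_def cring_ideal.mult_I')

lemma coefs_in_0 [simp]: "f \<in> coefs_in {0} \<longleftrightarrow> f = 0"
  by (auto simp: coefs_in_def intro: poly_mapping_eqI)

lemma coefs_in_dvd: "f \<in> coefs_in {x. c dvd x} \<longleftrightarrow> Cst c dvd f" for c :: "'r::idom"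
proof
  assume f: "f \<in> coefs_in {x. c dvd x}"
  define g where "g = (\<Sum>m\<in>keys f. single m (SOME d. lookup f m = c * d))"
  have "f = Cst c * g"
    unfolding g_def sum_distrib_left
    apply (subst pm_sum_single[of f])
    apply (rule sum.cong[OF refl])
    apply (simp add: Cst_def mult_single)
    by (metis (mono_tags, lifting) coefs_in_def dvd_def f mem_Collect_eq someI_ex)
  then show "Cst c dvd f" by simp
qed (auto simp: coefs_in_def)

lemma coefs_in_mono: "I \<subseteq> I' \<Longrightarrow> f \<in> coefs_in I \<Longrightarrow> f \<in> coefs_in I'"
  by (auto simp: coefs_in_def)

text \<open>The product of the leading coefficients outside \<open>I\<close> is a coefficient of the product modulo \<open>I\<close>.\<close>

lemma cring_prime_coefs_in:
  assumes "cring_prime I"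
  shows "cring_prime (coefs_in I :: ('v::linorder, 'r::comm_ring_1) mp set)"
proof -
  interpret cring_prime I by fact
  interpret C: cring_ideal "coefs_in I :: ('v, 'r) mp set"
    by (rule cring_ideal_coefs_in) unfold_locales
  have "f * g \<notin> coefs_in I" if fI: "f \<notin> coefs_in I" and gI: "g \<notin> coefs_in I" for f g :: "('v, 'r) mp"
  proof
    assume fg: "f * g \<in> coefs_in I"
    \<comment> \<open>The terms with coefficients in \<open>I\<close> are dropped first. The
      greatest remaining monomial in the multiset order then has a coefficient outside
      \<open>I\<close>.\<close>
    have ex: "\<exists>a h. (h - f) \<in> coefs_in I \<and> lookup f a \<notin> I \<and> (\<forall>b\<in>keys (h - single a (lookup f a)). b < a)"
      if fI: "f \<notin> coefs_in I" for f :: "('v, 'r) mp"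
    proof -
      define h where "h = pfilt (\<lambda>m. lookup f m \<notin> I) f"
      have "keys h \<noteq> {}"
      proof -
        obtain m where "lookup f m \<notin> I" using fI by (auto simp: coefs_in_def)
        then have "m \<in> keys h" by (auto simp: h_def keys_pfilt in_keys_iff)
        then show ?thesis by blast
      qed
      then have a: "Max (keys h) \<in> keys h" by (intro Max_in) auto
      define a where "a = Max (keys h)"
      have fa: "lookup f a \<notin> I" "lookup h a = lookup f a"
        using a by (auto simp: a_def h_def keys_pfilt lookup_pfilt)
      have "h - f \<in> coefs_in I"
        by (auto simp: coefs_in_def h_def lookup_minus lookup_pfilt)
      moreover have "b < a" if "b \<in> keys (h - single a (lookup f a))" for b
      proof -
        have "b \<noteq> a" using that fa by (auto simp: in_keys_iff lookup_minus)
        moreover from this that have "b \<in> keys h"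
          by (auto simp: in_keys_iff lookup_minus lookup_single when_def)
        ultimately show "b < a" unfolding a_def by (simp add: order_less_le)
      qed
      ultimately show ?thesis using fa by blast
    qed
    obtain a f' where f': "f' - f \<in> coefs_in I" "lookup f a \<notin> I" "\<forall>b\<in>keys (f' - single a (lookup f a)). b < a"
      using ex[OF fI] by blast
    obtain b g' where g': "g' - g \<in> coefs_in I" "lookup g b \<notin> I" "\<forall>c\<in>keys (g' - single b (lookup g b)). c < b"
      using ex[OF gI] by blast
    define f3 where "f3 = f' - single a (lookup f a)"
    define g3 where "g3 = g' - single b (lookup g b)"
    \<comment> \<open>The multiset order is compatible with addition, so \<open>a + b\<close> arises
      only as the sum of the two greatest monomials.\<close>
    have k: "a + b \<notin> keys (f3 * g3)" "a + b \<notin> keys (f3 * single b (lookup g b))"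
       "a + b \<notin> keys (single a (lookup f a) * g3)"
    proof -
      show "a + b \<notin> keys (f3 * g3)"
      proof
        assume "a + b \<in> keys (f3 * g3)"
        then obtain x y where "x \<in> keys f3" "y \<in> keys g3" "a + b = x + y" using keys_mult[of f3 g3] by blast
        then show False using f'(3) g'(3) add_strict_mono[of x a y b] by (auto simp: f3_def g3_def)
      qed
      show "a + b \<notin> keys (f3 * single b (lookup g b))"
      proof
        assume "a + b \<in> keys (f3 * single b (lookup g b))"
        then obtain x y where "x \<in> keys f3" "y \<in> keys (single b (lookup g b))" "a + b = x + y"
          using keys_mult[of f3] by blast
        then show False using f'(3) by (auto simp: f3_def split: if_splits)
      qed
      show "a + b \<notin> keys (single a (lookup f a) * g3)"
      proof
        assume "a + b \<in> keys (single a (lookup f a) * g3)"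
        then obtain x y where "x \<in> keys (single a (lookup f a))" "y \<in> keys g3" "a + b = x + y"
          using keys_mult[of _ g3] by blast
        then show False using g'(3) by (auto simp: g3_def split: if_splits)
      qed
    qed
    have "f' * g' = f3 * g3 + f3 * single b (lookup g b) + single a (lookup f a) * g3
        + single (a + b) (lookup f a * lookup g b)"
      by (simp add: f3_def g3_def algebra_simps mult_single)
    then have "lookup (f' * g') (a + b) = lookup f a * lookup g b"
      using k by (simp add: lookup_add in_keys_iff)
    moreover have "f' * g' - f * g \<in> coefs_in I" by (intro C.cong_mult f' g')
    then have "f' * g' \<in> coefs_in I" using fg C.cong_I by blast
    ultimately have "lookup f a * lookup g b \<in> I"
      unfolding coefs_in_def mem_Collect_eq by metis
    then show False using f' g' prime_I by blast
  qed
  moreover have "1 \<notin> (coefs_in I :: ('v, 'r) mp set)"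
    using coefs_in_Cst[of I 1] by (metis Cst_1 one_notin zero_I)
  ultimately show ?thesis by unfold_locales blast+
qed

section \<open>Partial derivatives\<close>

definition pder :: "'v \<Rightarrow> ('v, 'r::comm_ring_1) mp \<Rightarrow> ('v, 'r) mp"
  where "pder i f = lext (\<lambda>m c. single (m - {#i#}) (of_nat (count m i) * c)) f"

lemma pder_single: "pder i (single m c) = single (m - {#i#}) (of_nat (count m i) * c)"
  unfolding pder_def by (rule lext_single) simp

lemma pder_add [simp]: "pder i (f + g) = pder i f + pder i g"
  unfolding pder_def by (rule lext_add) (simp_all add: single_add distrib_left)

lemma pder_0 [simp]: "pder i 0 = 0"
  by (simp add: pder_def)

lemma pder_uminus [simp]: "pder i (- f) = - pder i f"
  using pder_add[of i f "- f"] by (simp add: eq_neg_iff_add_eq_0 add.commute)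

lemma pder_diff [simp]: "pder i (f - g) = pder i f - pder i g"
  using pder_add[of i f "- g"] by simp

lemma pder_Cst [simp]: "pder i (Cst c) = 0"
  by (simp add: Cst_def pder_single)

lemma pder_1 [simp]: "pder i 1 = 0"
  using pder_Cst[of i 1] by simp

lemma lookup_pder: "lookup (pder i f) m = of_nat (Suc (count m i)) * lookup f (add_mset i m)"
proof (induction f rule: pm_induct)
  case (single k c)
  show ?case
  proof (cases "i \<in># k")
    case True
    then have "k - {#i#} = m \<longleftrightarrow> k = add_mset i m" by (metis add_mset_remove_trivial insert_DiffM)
    then show ?thesis
      by (auto simp: pder_single lookup_single when_def)
  next
    case False
    then show ?thesis by (auto simp: pder_single lookup_single when_def not_in_iff)
  qed
next
  case (add f g)
  then show ?case by (simp add: lookup_add distrib_left del: of_nat_Suc)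
qed auto

lemma pder_commute: "pder i (pder j f) = pder j (pder i f)"
  by (rule poly_mapping_eqI) (auto simp: lookup_pder add_mset_commute algebra_simps)

lemma pder_Var: "pder i (Var j) = of_bool (i = j)"
  by (auto simp: Var_def pder_single)

lemma pder_mult: "pder i (f * g) = pder i f * g + f * pder i g"
proof (induction f rule: pm_induct)
  case (single m c)
  show ?case
  proof (induction g rule: pm_induct)
    case (single n d)
    have 1: "single (m + n - {#i#}) (of_nat (count m i) * c * d) = single (m - {#i#} + n) (of_nat (count m i) * c * d)"
      by (cases "i \<in># m") (auto simp: not_in_iff)
    have 2: "single (m + n - {#i#}) (of_nat (count n i) * c * d) = single (m + (n - {#i#})) (of_nat (count n i) * c * d)"
      by (cases "i \<in># n") (auto simp: not_in_iff)
    have "pder i (single m c * single n d) = single (m + n - {#i#}) (of_nat (count m i) * c * d)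
        + single (m + n - {#i#}) (of_nat (count n i) * c * d)"
      by (simp add: mult_single pder_single single_add[symmetric] algebra_simps)
    then show ?case unfolding 1 2 by (simp add: mult_single pder_single algebra_simps)
  next
    case (add f g)
    then show ?case by (simp add: algebra_simps)
  qed auto
next
  case (add f g)
  then show ?case by (simp add: algebra_simps)
qed auto

lemma pder_Var_mult: "pder i (Var j * f) = Var j * pder i f + (if i = j then f else 0)"
  by (auto simp: pder_mult pder_Var)

lemma pder_Cst_mult [simp]: "pder i (Cst c * f) = Cst c * pder i f"
  by (simp add: pder_mult)

lemma keys_pder: "m \<in> keys (pder i f) \<Longrightarrow> add_mset i m \<in> keys f"
  by (auto simp: in_keys_iff lookup_pder)

lemma pder_mvars [simp, intro]: "f \<in> mvars V \<Longrightarrow> pder i f \<in> mvars V"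
  unfolding mvars_def by (fastforce dest: keys_pder)

lemma pder_notin:
  assumes "f \<in> mvars V" "i \<notin> V"
  shows "pder i f = 0"
proof (rule poly_mapping_eqI)
  fix m
  have "add_mset i m \<notin> keys f" using assms by (force simp: mvars_def)
  then show "lookup (pder i f) m = lookup 0 m" by (simp add: lookup_pder in_keys_iff)
qed

lemma pder_coefs_in: "cring_ideal I \<Longrightarrow> f \<in> coefs_in I \<Longrightarrow> pder i f \<in> coefs_in I"
  by (auto simp: coefs_in_def lookup_pder cring_ideal.mult_I simp del: of_nat_Suc)

lemma mmap_pder: "is_hom s \<Longrightarrow> mmap s (pder i f) = pder i (mmap s f)"
  by (rule poly_mapping_eqI) (auto simp: lookup_mmap lookup_pder is_homD is_hom_of_nat simp del: of_nat_Suc)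

lemma meval_coefs_in:
  fixes f :: "('v, 'r::comm_ring_1) mp" and a :: "'v \<Rightarrow> ('w, 'r) mp"
  assumes "cring_ideal I" "f \<in> coefs_in I"
  shows "meval Cst a f \<in> coefs_in I"
proof -
  interpret C: cring_ideal "coefs_in I :: ('w, 'r) mp set" by (intro cring_ideal_coefs_in assms)
  have "Cst (lookup f m) \<in> (coefs_in I :: ('w, 'r) mp set)" for m
    using assms by (simp add: coefs_in_def lookup_Cst cring_ideal.zero_I)
  then show ?thesis unfolding meval_def lext_def by auto
qed

lemma meval_cong_coefs:
  fixes f :: "('v, 'r::comm_ring_1) mp" and a :: "'v \<Rightarrow> ('w, 'r) mp"
  assumes "cring_ideal I" "f \<in> mvars V" "\<And>i. i \<in> V \<Longrightarrow> a i - b i \<in> coefs_in I"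
  shows "meval Cst a f - meval Cst b f \<in> coefs_in I"
proof -
  interpret C: cring_ideal "coefs_in I :: ('w, 'r) mp set" by (intro cring_ideal_coefs_in assms)
  from assms(2) show ?thesis
  proof (induction rule: mp_induct)
    case (Var i f)
    then show ?case by (simp add: meval_mult meval_Var C.cong_mult assms(3))
  next
    case (add f g)
    then show ?case using C.cong_add by (simp add: meval_add)
  qed (simp add: meval_Cst)
qed

section \<open>Degree bounds\<close>

definition degle :: "nat \<Rightarrow> ('v, 'r::comm_ring_1) mp \<Rightarrow> bool"
  where "degle d f \<longleftrightarrow> (\<forall>m\<in>keys f. size m \<le> d)"

lemma degle_0 [simp]: "degle d 0"
  and degle_add: "degle d f \<Longrightarrow> degle d g \<Longrightarrow> degle d (f + g)"
  and degle_Cst [simp]: "degle d (Cst c)"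
  and degle_single: "size m \<le> d \<Longrightarrow> degle d (single m c)"
  and degle_mono: "degle d f \<Longrightarrow> d \<le> e \<Longrightarrow> degle e f"
  using keys_add[of f g] by (auto simp: degle_def Cst_def split: if_splits)

lemma degle_mult: "degle d f \<Longrightarrow> degle e g \<Longrightarrow> degle (d + e) (f * g)"
  using keys_mult[of f g] by (fastforce simp: degle_def intro: add_mono)

lemma degle_exists: "\<exists>d. degle d f"
  unfolding degle_def by (meson finite_imageI finite_keys finite_nat_set_iff_bounded_le imageI)

lemma degle_1 [simp]: "degle d 1"
  using degle_Cst[of d 1] by simp

lemma degle_sum: "(\<And>i. i \<in> A \<Longrightarrow> degle d (f i)) \<Longrightarrow> degle d (sum f A)"
  by (induction A rule: infinite_finite_induct) (auto intro: degle_add)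

lemma degle_Var: "1 \<le> d \<Longrightarrow> degle d (Var i)"
  by (auto simp: Var_def intro: degle_single)


section \<open>The Weyl algebra as an algebra of operators\<close>

lift_definition mul :: "'m::ring_1 \<Rightarrow> 'm endo" is "\<lambda>f x. f * x"
  by (simp add: algebra_simps)

lift_definition der :: "'v \<Rightarrow> ('v, 'r::comm_ring_1) mp endo" is pder
  by simp

declare mul.rep_eq [simp] der.rep_eq [simp]

lemma mul_add: "mul (f + g) = mul f + mul g"
  and mul_mult: "mul (f * g) = mul f * mul g"
  and mul_1 [simp]: "mul 1 = 1"
  and mul_0 [simp]: "mul 0 = 0"
  and mul_minus: "mul (- f) = - mul f"
  and mul_diff: "mul (f - g) = mul f - mul g"
  and mul_of_nat [simp]: "mul (of_nat k) = of_nat k"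
  and mul_of_int [simp]: "mul (of_int c) = of_int c"
  by (rule endo_eqI; simp add: algebra_simps)+

lemma mul_sum: "mul (sum f A) = (\<Sum>a\<in>A. mul (f a))"
  by (induction A rule: infinite_finite_induct) (auto simp: mul_add)

text \<open>The regular representation, with \<open>Yop n i\<close> the left and \<open>Rop n i\<close> the right multiplication by
  \<open>y\<^sub>i\<close> on normally ordered polynomials.\<close>

definition Yop :: "nat \<Rightarrow> nat \<Rightarrow> (nat, 'r::comm_ring_1) mp endo"
  where "Yop n i = mul (Var i) + (if n < i then der (i - n) else 0)"

definition Rop :: "nat \<Rightarrow> nat \<Rightarrow> (nat, 'r::comm_ring_1) mp endo"
  where "Rop n i = mul (Var i) + (if i \<le> n then der (i + n) else 0)"

abbreviation wvars :: "nat \<Rightarrow> (nat, 'r::comm_ring_1) mp set"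
  where "wvars n \<equiv> mvars {1..2*n}"

definition lin :: "(nat, 'r::comm_ring_1) mp endo \<Rightarrow> bool"
  where "lin T \<longleftrightarrow> (\<forall>c f. app T (Cst c * f) = Cst c * app T f)"

text \<open>Linear operators that commute modulo \<open>I\<close> with all right multiplications are
  left multiplications modulo \<open>I\<close>. Hence \<open>WA n I\<close> modulo
  \<open>WJ n I\<close> is the Weyl algebra over the quotient by \<open>I\<close>.\<close>

definition WA :: "nat \<Rightarrow> 'r::comm_ring_1 set \<Rightarrow> (nat, 'r) mp endo set"
  where "WA n I = {T. lin T \<and> (\<forall>f\<in>wvars n. app T f \<in> wvars n) \<and>
     (\<forall>i\<in>{1..2*n}. \<forall>f\<in>wvars n. app T (app (Rop n i) f) - app (Rop n i) (app T f) \<in> coefs_in I)}"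

definition WJ :: "nat \<Rightarrow> 'r::comm_ring_1 set \<Rightarrow> (nat, 'r) mp endo set"
  where "WJ n I = {T \<in> WA n I. \<forall>f\<in>wvars n. app T f \<in> coefs_in I}"

lemma WA_mono: "I \<subseteq> I' \<Longrightarrow> T \<in> WA n I \<Longrightarrow> T \<in> WA n I'"
  unfolding WA_def using coefs_in_mono by blast

lemma WA_0: "cring_ideal I \<Longrightarrow> T \<in> WA n {0} \<Longrightarrow> T \<in> WA n I"
  using WA_mono[of "{0}" I] cring_ideal.zero_I by blast

lemma linD: "lin T \<Longrightarrow> app T (Cst c * f) = Cst c * app T f"
  by (simp add: lin_def)

lemma lin_simps [simp]: "lin 0" "lin 1" "lin (der i)" "lin (mul f)"
  and lin_add [simp]: "lin T \<Longrightarrow> lin S \<Longrightarrow> lin (T + S)"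
  and lin_uminus [simp]: "lin T \<Longrightarrow> lin (- T)"
  and lin_mult [simp]: "lin T \<Longrightarrow> lin S \<Longrightarrow> lin (T * S)"
  by (auto simp: lin_def distrib_left mult.left_commute)

lemma lin_Rop [simp]: "lin (Rop n i)" and lin_Yop [simp]: "lin (Yop n i)"
  by (auto simp: Rop_def Yop_def)

lemma lin_coefs_in:
  assumes "lin T" "cring_ideal I" "f \<in> coefs_in I"
  shows "app T f \<in> coefs_in I"
proof -
  interpret C: cring_ideal "coefs_in I :: (nat, 'a) mp set"
    by (rule cring_ideal_coefs_in) fact
  have "app T f = (\<Sum>m\<in>keys f. Cst (lookup f m) * app T (single m 1))"
    by (subst pm_sum_single[of f]) (simp add: app_sum single_eq[of _ 1] linD[OF assms(1), symmetric] single_eq[symmetric])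
  also have "\<dots> \<in> coefs_in I"
    using assms(2,3) by (intro C.sum_I coefs_in_Cst_mult) (auto simp: coefs_in_def)
  finally show ?thesis .
qed

lemma Rop_wvars: "i \<in> {1..2*n} \<Longrightarrow> f \<in> wvars n \<Longrightarrow> app (Rop n i) f \<in> wvars n"
  using mvars_Var[of i "{1..2*n}"] by (auto simp: Rop_def)

lemma Yop_wvars: "i \<in> {1..2*n} \<Longrightarrow> f \<in> wvars n \<Longrightarrow> app (Yop n i) f \<in> wvars n"
  using mvars_Var[of i "{1..2*n}"] by (auto simp: Yop_def)

lemma Yop_Rop: "i \<in> {1..2*n} \<Longrightarrow> j \<in> {1..2*n} \<Longrightarrow> app (Yop n i) (app (Rop n j) f) = app (Rop n j) (app (Yop n i) f)"
  by (auto simp: Yop_def Rop_def pder_Var_mult pder_commute distrib_left mult.left_commute add_ac)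

lemma ring_mod_weyl:
  assumes I: "cring_ideal I"
  shows "ring_mod (WA n I) (WJ n I)"
proof -
  interpret C: cring_ideal "coefs_in I :: (nat, 'a) mp set"
    by (rule cring_ideal_coefs_in) fact
  have mult: "T * S \<in> WA n I" if T: "T \<in> WA n I" and S: "S \<in> WA n I" for T S
  proof -
    have "app (T * S) (app (Rop n i) f) - app (Rop n i) (app (T * S) f) \<in> coefs_in I"
      if i: "i \<in> {1..2*n}" and f: "f \<in> wvars n" for i f
    proof -
      have "app T (app S (app (Rop n i) f) - app (Rop n i) (app S f)) \<in> coefs_in I"
        using T S i f I by (intro lin_coefs_in) (auto simp: WA_def)
      moreover have "app T (app (Rop n i) (app S f)) - app (Rop n i) (app T (app S f)) \<in> coefs_in I"
        using T S i f by (auto simp: WA_def)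
      ultimately show ?thesis by (auto intro: C.cong_trans)
    qed
    then show ?thesis using T S by (simp add: WA_def)
  qed
  have add: "T + S \<in> WA n I" if T: "T \<in> WA n I" and S: "S \<in> WA n I" for T S
  proof -
    have "app (T + S) (app (Rop n i) f) - app (Rop n i) (app (T + S) f) \<in> coefs_in I"
      if i: "i \<in> {1..2*n}" and f: "f \<in> wvars n" for i f
      using C.cong_add[of "app T (app (Rop n i) f)" "app (Rop n i) (app T f)"
          "app S (app (Rop n i) f)" "app (Rop n i) (app S f)"] T S i f by (auto simp: WA_def)
    then show ?thesis using T S by (auto simp: WA_def)
  qed
  have um: "- T \<in> WA n I" if T: "T \<in> WA n I" for T
  proof -
    have "app (- T) (app (Rop n i) f) - app (Rop n i) (app (- T) f) \<in> coefs_in I"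
      if i: "i \<in> {1..2*n}" and f: "f \<in> wvars n" for i f
      using C.uminus_I[of "app T (app (Rop n i) f) - app (Rop n i) (app T f)"] T i f by (auto simp: WA_def)
    then show ?thesis using T by (auto simp: WA_def)
  qed
  show ?thesis
  proof
    show "1 \<in> WA n I" "WJ n I \<subseteq> WA n I" by (auto simp: WA_def WJ_def)
    show "0 \<in> WJ n I" by (auto simp: WA_def WJ_def)
    show "x * y \<in> WJ n I" if "x \<in> WJ n I" "y \<in> WA n I" for x y
      using that mult by (auto simp: WJ_def) (auto simp: WA_def)
    show "x * y \<in> WJ n I" if "x \<in> WA n I" "y \<in> WJ n I" for x y
      using that mult lin_coefs_in[OF _ I] by (auto simp: WJ_def) (auto simp: WA_def)
    show "x + y \<in> WJ n I" if "x \<in> WJ n I" "y \<in> WJ n I" for x y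
      using that add by (auto simp: WJ_def)
  qed (use mult add um in auto)
qed

lemma Yop_WA [intro]: "i \<in> {1..2*n} \<Longrightarrow> Yop n i \<in> WA n {0}"
  unfolding WA_def by (simp add: Yop_Rop Yop_wvars del: One_nat_def)

lemma scal_WA [intro]: "mul (Cst c) \<in> WA n {0}"
  by (auto simp: WA_def linD[OF lin_Rop])

text \<open>Right multiplications generate all polynomials from \<open>1\<close>, and
  \<open>T\<close> commutes with them modulo \<open>I\<close>; so the value at \<open>1\<close>
  decides.\<close>

lemma WJ_iff:
  assumes I: "cring_ideal I" and T: "T \<in> WA n I"
  shows "T \<in> WJ n I \<longleftrightarrow> app T 1 \<in> coefs_in I"
proof
  assume *: "app T 1 \<in> coefs_in I"
  interpret C: cring_ideal "coefs_in I :: (nat, 'a) mp set"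
    by (rule cring_ideal_coefs_in) fact
  have lin: "lin T" using T by (simp add: WA_def)
  have R: "app T (app (Rop n i) f) \<in> coefs_in I"
    if "i \<in> {1..2*n}" "f \<in> wvars n" "app T f \<in> coefs_in I" for i f
  proof -
    have "app (Rop n i) (app T f) \<in> coefs_in I" using lin_coefs_in[OF lin_Rop I that(3)] .
    moreover have "app T (app (Rop n i) f) - app (Rop n i) (app T f) \<in> coefs_in I"
      using T that by (auto simp: WA_def)
    ultimately show ?thesis using C.cong_I by blast
  qed
  \<comment> \<open>On polynomials in the first \<open>n\<close> variables the derivative in
    \<open>Rop n i\<close> vanishes, and for indices above \<open>n\<close> there is none. A
    monomial is therefore built by right multiplications that put in the first \<open>n\<close>
    variables before the others.\<close>
  have x: "app T f \<in> coefs_in I" if "f \<in> mvars {1..n}" for f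
    using that
  proof (induction rule: mp_induct)
    case (Cst c)
    have "app T (Cst c) = Cst c * app T 1" using linD[OF lin, of c 1] by simp
    then show ?case using * by auto
  next
    case (Var i f)
    have "app (Rop n i) f = Var i * f"
      using Var by (auto simp: Rop_def pder_notin[where V = "{1..n}"])
    then show ?case using R[of i f] Var mvars_mono[OF Var(2), of "{1..2*n}"] by auto
  qed auto
  have s: "app T (single m c) \<in> coefs_in I" if "set_mset m \<subseteq> {1..2*n}" for m c
    using that
  proof (induction "size m" arbitrary: m rule: less_induct)
    case less
    show ?case
    proof (cases "\<exists>j\<in>#m. n < j")
      case True
      then obtain j where j: "j \<in># m" "n < j" by blast
      then obtain m' where m: "m = add_mset j m'" by (meson multi_member_split)
      have "app T (single m' c) \<in> coefs_in I" using less m by simp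
      then have "app T (app (Rop n j) (single m' c)) \<in> coefs_in I"
        using less.prems m by (intro R) (auto intro: mvars_single)
      moreover have "app (Rop n j) (single m' c) = single m c"
        using j by (simp add: Rop_def m single_Var)
      ultimately show ?thesis by simp
    next
      case False
      then show ?thesis using less by (intro x mvars_single) (auto simp: subset_iff not_less)
    qed
  qed
  have "app T f \<in> coefs_in I" if "f \<in> wvars n" for f
  proof -
    have "keys f \<subseteq> {m. set_mset m \<subseteq> {1..2*n}}" using that by (auto simp: mvars_def)
    then show ?thesis by (induction rule: pm_induct_keys) (auto simp: s)
  qed
  then show "T \<in> WJ n I" using T by (simp add: WJ_def)
qed (auto simp: WJ_def)

lemma WA_1: "T \<in> WA n I \<Longrightarrow> app T 1 \<in> wvars n"
  by (simp add: WA_def)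

lemma WA_lin: "T \<in> WA n I \<Longrightarrow> lin T"
  by (simp add: WA_def)

lemma comm_scal: "lin T \<Longrightarrow> comm T (mul (Cst c)) = 0"
  by (rule endo_eqI) (simp add: comm_def linD)


section \<open>Ordered substitution\<close>

text \<open>For noncommuting \<open>Q\<close> this is not multiplicative for the product of
  polynomials. If \<open>Q\<close> satisfies the Weyl relations, it respects the Weyl product of
  normally ordered polynomials, see \<open>osub_wop\<close>.\<close>

definition osub :: "('r::comm_ring_1 \<Rightarrow> 'b::ring_1) \<Rightarrow> (nat \<Rightarrow> 'b) \<Rightarrow> nat \<Rightarrow> (nat, 'r) mp \<Rightarrow> 'b"
  where "osub s Q N f = lext (\<lambda>m c. s c * omon Q N m) f"

lemma osub_single: "is_hom s \<Longrightarrow> osub s Q N (single m c) = s c * omon Q N m"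
  unfolding osub_def by (rule lext_single) (simp add: is_hom_0)

lemma osub_add: "is_hom s \<Longrightarrow> osub s Q N (f + g) = osub s Q N f + osub s Q N g"
  unfolding osub_def by (rule lext_add) (simp_all add: is_hom_0 is_homD algebra_simps)

lemma osub_0 [simp]: "osub s Q N 0 = 0"
  by (simp add: osub_def)

lemma osub_minus: "is_hom s \<Longrightarrow> osub s Q N (- f) = - osub s Q N f"
  using osub_add[of s Q N f "- f"] by (simp add: eq_neg_iff_add_eq_0 add.commute)

lemma osub_diff: "is_hom s \<Longrightarrow> osub s Q N (f - g) = osub s Q N f - osub s Q N g"
  using osub_add[of s Q N f "- g"] by (simp add: osub_minus)

lemma osub_Cst: "is_hom s \<Longrightarrow> osub s Q N (Cst c) = s c"
  by (simp add: Cst_def osub_single)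

lemma osub_Cst_mult: "is_hom s \<Longrightarrow> osub s Q N (Cst c * f) = s c * osub s Q N f"
proof (induction f rule: pm_induct)
  case (single m d)
  then show ?case by (simp add: Cst_def mult_single osub_single is_homD mult.assoc)
next
  case (add f g)
  then show ?case by (simp add: distrib_left osub_add)
qed auto

lemma omon_prod: "omon a N m = (\<Prod>i\<in>{1..N}. a i ^ count m i)" for a :: "nat \<Rightarrow> 'c::comm_ring_1"
  by (induction N) (auto simp: mult.commute)

lemma omon_prod_mset:
  fixes a :: "nat \<Rightarrow> 'c::comm_ring_1"
  assumes "set_mset m \<subseteq> {1..N}"
  shows "omon a N m = prod_mset (image_mset a m)"
proof -
  have "prod_mset (image_mset a m) = (\<Prod>i\<in>set_mset m. a i ^ count m i)"
    by (rule image_prod_mset_multiplicity)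
  also have "\<dots> = (\<Prod>i\<in>{1..N}. a i ^ count m i)"
    using assms by (intro prod.mono_neutral_left) (auto simp: not_in_iff)
  finally show ?thesis by (simp add: omon_prod)
qed

lemma omon_Var: "set_mset m \<subseteq> {1..N} \<Longrightarrow> omon Var N m = single m 1"
  by (simp add: omon_prod_mset single_eq)

abbreviation scal :: "'r::comm_ring_1 \<Rightarrow> (nat, 'r) mp endo"
  where "scal c \<equiv> mul (Cst c)"

lemma is_hom_scal [simp]: "is_hom scal"
  by (auto simp: is_hom_def Cst_add Cst_mult mul_add mul_mult)

lemma is_hom_mul [simp]: "is_hom mul"
  by (auto simp: is_hom_def mul_add mul_mult)

text \<open>The left multiplication by \<open>f\<close>, read as a normally ordered element of the
  Weyl algebra. It inverts \<open>\<lambda>T. app T 1\<close> up to congruence, by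
  \<open>wop_1\<close> and \<open>WJ_wop\<close>.\<close>

definition wop :: "nat \<Rightarrow> (nat, 'r::comm_ring_1) mp \<Rightarrow> (nat, 'r) mp endo"
  where "wop n f = osub scal (Yop n) (2 * n) f"

context ring_mod
begin

lemma osub_A:
  assumes "is_hom s" "\<And>c. s c \<in> A" "\<And>i. i \<in> {1..N} \<Longrightarrow> Q i \<in> A"
  shows "osub s Q N f \<in> A"
  unfolding osub_def lext_def using assms by (intro sum_A mult_A omon_A) auto

lemma omon_cong_J:
  assumes "\<And>i. i \<in> {1..N} \<Longrightarrow> Q i - Q' i \<in> J" "\<And>i. i \<in> {1..N} \<Longrightarrow> Q i \<in> A" "\<And>i. i \<in> {1..N} \<Longrightarrow> Q' i \<in> A"
  shows "omon Q N m - omon Q' N m \<in> J"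
  using assms
proof (induction N)
  case (Suc N)
  have "Q (Suc N) ^ k - Q' (Suc N) ^ k \<in> J" for k
    using Suc.prems by (induction k) (auto intro!: cong_mult)
  then show ?case using Suc by (simp, intro cong_mult Suc.IH omon_A power_A) auto
qed auto

lemma osub_cong_J:
  assumes "is_hom s" "\<And>c. s c \<in> A"
    and "\<And>i. i \<in> {1..N} \<Longrightarrow> Q i - Q' i \<in> J" "\<And>i. i \<in> {1..N} \<Longrightarrow> Q i \<in> A" "\<And>i. i \<in> {1..N} \<Longrightarrow> Q' i \<in> A"
  shows "osub s Q N f - osub s Q' N f \<in> J"
  unfolding osub_def lext_def sum_subtractf[symmetric] right_diff_distrib[symmetric]
  using assms by (intro sum_J mult_J' omon_cong_J) auto

lemma comm_osub:
  assumes s: "is_hom s" "\<And>c. s c \<in> A" "\<And>c. comm q (s c) = 0"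
    and Q: "\<And>i. i \<in> {1..N} \<Longrightarrow> comm q (Q i) - of_bool (i = j) \<in> J" "\<And>i. i \<in> {1..N} \<Longrightarrow> Q i \<in> A"
    and "j \<in> {1..N}" "q \<in> A"
  shows "comm q (osub s Q N f) - osub s Q N (pder j f) \<in> J"
proof (induction f rule: pm_induct)
  case (single m c)
  have "comm q (omon Q N m) - of_nat (count m j) * omon Q N (m - {#j#}) \<in> J"
    by (rule comm_omon[where P = Q]) (use assms in auto)
  then have "s c * (comm q (omon Q N m) - of_nat (count m j) * omon Q N (m - {#j#})) \<in> J"
    using s by auto
  then show ?case
    by (simp add: osub_single s comm_mult pder_single is_homD is_hom_of_nat right_diff_distrib)
       (metis mult.assoc mult_of_nat_commute)
next
  case (add f g)
  have "comm q (osub s Q N (f + g)) - osub s Q N (pder j (f + g))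
    = (comm q (osub s Q N f) - osub s Q N (pder j f)) + (comm q (osub s Q N g) - osub s Q N (pder j g))"
    by (simp add: osub_add s)
  then show ?case using add by (metis add_J)
qed auto

lemma osub_coefs_in:
  assumes "is_hom s" "\<And>c. c \<in> I \<Longrightarrow> s c \<in> J" "f \<in> coefs_in I" "\<And>i. i \<in> {1..N} \<Longrightarrow> Q i \<in> A"
  shows "osub s Q N f \<in> J"
  unfolding osub_def lext_def using assms by (intro sum_J mult_J omon_A) (auto simp: coefs_in_def)

lemma omon_add_right:
  assumes "i \<in> {1..N}" "\<And>k. k \<in> {i<..N} \<Longrightarrow> comm (P i) (P k) \<in> J" "\<And>k. k \<in> {1..N} \<Longrightarrow> P k \<in> A"
  shows "omon P N (add_mset i m) - omon P N m * P i \<in> J"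
  using assms
proof (induction N)
  case (Suc N)
  have A: "omon P N m \<in> A" "P (Suc N) \<in> A" "P i \<in> A" using Suc.prems by (auto intro!: omon_A)
  show ?case
  proof (cases "i = Suc N")
    case True
    have "omon P N (add_mset i m) = omon P N m" using True by (intro omon_cong_count) auto
    then show ?thesis using True by (simp add: mult.assoc power_commutes)
  next
    case False
    then have i: "i \<in> {1..N}" using Suc.prems by auto
    define Z where "Z = P (Suc N) ^ count m (Suc N)"
    have Z: "Z \<in> A" "comm (P i) Z \<in> J"
      using A Suc.prems(2)[of "Suc N"] i by (auto simp: Z_def intro!: comm_power_J)
    have "omon P N (add_mset i m) - omon P N m * P i \<in> J"
      using Suc.prems i by (intro Suc.IH) auto
    moreover have "omon P (Suc N) (add_mset i m) - omon P (Suc N) m * P i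
      = (omon P N (add_mset i m) - omon P N m * P i) * Z + omon P N m * comm (P i) Z"
      using False by (simp add: Z_def[symmetric] comm_def algebra_simps)
    ultimately show ?thesis using Z A by auto
  qed
qed auto

lemma omon_add_left:
  assumes "i \<in> {1..N}" "\<And>k. k \<in> {1..<i} \<Longrightarrow> comm (P i) (P k) \<in> J" "\<And>k. k \<in> {1..N} \<Longrightarrow> P k \<in> A"
  shows "omon P N (add_mset i m) - P i * omon P N m \<in> J"
  using assms
proof (induction N)
  case (Suc N)
  have A: "omon P N m \<in> A" "P (Suc N) \<in> A" "P i \<in> A" using Suc.prems by (auto intro!: omon_A)
  show ?case
  proof (cases "i = Suc N")
    case True
    have 1: "omon P N (add_mset i m) = omon P N m" using True by (intro omon_cong_count) auto
    have 2: "comm (P i) (omon P N m) \<in> J"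
      using Suc.prems True by (intro comm_omon_J) auto
    have "omon P (Suc N) (add_mset i m) - P i * omon P (Suc N) m
       = - comm (P i) (omon P N m) * P (Suc N) ^ count m (Suc N)"
      using True by (simp add: 1[unfolded True] comm_def algebra_simps)
    then show ?thesis using 2 A by auto
  next
    case False
    then have i: "i \<in> {1..N}" using Suc.prems by auto
    have "omon P N (add_mset i m) - P i * omon P N m \<in> J"
      using Suc.prems i by (intro Suc.IH) auto
    moreover have "omon P (Suc N) (add_mset i m) - P i * omon P (Suc N) m
      = (omon P N (add_mset i m) - P i * omon P N m) * P (Suc N) ^ count m (Suc N)"
      using False by (simp add: algebra_simps)
    ultimately show ?thesis using A by auto
  qed
qed auto

end

text \<open>The operators with indices above \<open>n\<close> act first, and their derivatives
  concern variables with indices up to \<open>n\<close>, which do not occur yet. The remaining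
  operators contain no derivatives.\<close>

lemma app_omon_Yop:
  assumes "N \<le> 2 * n" "n < N \<Longrightarrow> g \<in> mvars {n<..2*n}"
  shows "app (omon (Yop n) N m) g = omon Var N m * g"
  using assms
proof (induction N arbitrary: g)
  case (Suc N)
  have p: "app (Yop n (Suc N) ^ k) g = Var (Suc N) ^ k * g" for k
  proof (induction k)
    case (Suc k)
    show ?case
    proof (cases "n < Suc N")
      case True
      then have g: "g \<in> mvars {n<..2*n}" "Suc N \<in> {n<..2*n}" using Suc.prems \<open>Suc N \<le> 2 * n\<close> \<open>n < Suc N \<Longrightarrow> g \<in> mvars {n<..2*n}\<close> by auto
      then have "Var (Suc N) ^ k * g \<in> mvars {n<..2*n}" by (intro mvars_mult mvars_power mvars_Var)
      then have "pder (Suc N - n) (Var (Suc N) ^ k * g) = 0"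
        using g by (intro pder_notin) auto
      then have "app (Yop n (Suc N)) (Var (Suc N) ^ k * g) = Var (Suc N) * (Var (Suc N) ^ k * g)"
        using True by (simp add: Yop_def)
      then show ?thesis by (simp add: Suc mult.assoc)
    next
      case False
      then have "app (Yop n (Suc N)) (Var (Suc N) ^ k * g) = Var (Suc N) * (Var (Suc N) ^ k * g)"
        by (simp add: Yop_def)
      then show ?thesis by (simp add: Suc mult.assoc)
    qed
  qed simp
  have "app (omon (Yop n) (Suc N) m) g = app (omon (Yop n) N m) (Var (Suc N) ^ count m (Suc N) * g)"
    by (simp add: p)
  also have "\<dots> = omon Var N m * (Var (Suc N) ^ count m (Suc N) * g)"
    using Suc.prems by (intro Suc.IH) (auto intro!: mvars_mult mvars_power mvars_Var)
  finally show ?case by (simp add: mult.assoc)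
qed auto

lemma wop_1: "f \<in> wvars n \<Longrightarrow> app (wop n f) 1 = f"
proof -
  assume "f \<in> wvars n"
  then have "keys f \<subseteq> {m. set_mset m \<subseteq> {1..2*n}}" by (auto simp: mvars_def)
  then show ?thesis
  proof (induction rule: pm_induct_keys)
    case (single m c)
    then show ?case
      by (simp add: wop_def osub_single app_omon_Yop omon_Var) (simp add: Cst_def mult_single)
  qed (auto simp: wop_def osub_add)
qed

interpretation W0: ring_mod "WA n ({0} :: 'r::comm_ring_1 set)" "WJ n {0}" for n
  by (rule ring_mod_weyl) (rule cring_ideal_0)

lemma wop_WA0: "wop n f \<in> WA n {0}"
  unfolding wop_def by (rule W0.osub_A) auto

lemma wop_WA [intro]: "cring_ideal I \<Longrightarrow> wop n f \<in> WA n I"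
  by (rule WA_0[OF _ wop_WA0])

lemma Yop_WA' [intro]: "cring_ideal I \<Longrightarrow> i \<in> {1..2*n} \<Longrightarrow> Yop n i \<in> WA n I"
  using WA_0 Yop_WA by blast

lemma scal_WA' [intro]: "cring_ideal I \<Longrightarrow> scal c \<in> WA n I"
  using WA_0 scal_WA by blast

lemma scal_WJ [intro]: "cring_ideal I \<Longrightarrow> c \<in> I \<Longrightarrow> scal c \<in> WJ n I"
  by (subst WJ_iff) (auto simp: cring_ideal.zero_I)

lemma WJ_wop:
  assumes I: "cring_ideal I" and "T \<in> WA n I"
  shows "T - wop n (app T 1) \<in> WJ n I"
proof -
  interpret ring_mod "WA n I" "WJ n I" by (rule ring_mod_weyl) fact
  have "T - wop n (app T 1) \<in> WA n I" using assms by (auto simp: wop_WA)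
  then show ?thesis
    using I by (subst WJ_iff) (auto simp: wop_1[OF WA_1[OF assms(2)]] coefs_in_def cring_ideal.zero_I)
qed

lemma WJ_wop_iff: "cring_ideal I \<Longrightarrow> f \<in> wvars n \<Longrightarrow> wop n f \<in> WJ n I \<longleftrightarrow> f \<in> coefs_in I"
  by (simp add: WJ_iff wop_WA wop_1)

section \<open>Substitution of elements that satisfy the Weyl relations\<close>

definition weyl_rels :: "nat \<Rightarrow> 'b::ring_1 set \<Rightarrow> (nat \<Rightarrow> 'b) \<Rightarrow> bool"
  where "weyl_rels n J P \<longleftrightarrow>
    (\<forall>i\<in>{1..2*n}. \<forall>j\<in>{1..2*n}. comm (P i) (P j) - of_int (weyl_omega n i j) \<in> J)"

text \<open>The partner of \<open>P j\<close> under the symplectic form, with the sign for which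
  \<open>comm (qgen n P j)\<close> acts as the partial derivative in \<open>P j\<close>.\<close>

definition qgen :: "nat \<Rightarrow> (nat \<Rightarrow> 'b::ring_1) \<Rightarrow> nat \<Rightarrow> 'b"
  where "qgen n P j = (if j \<le> n then P (j + n) else - P (j - n))"

lemma comm_Yop: "i \<in> {1..2*n} \<Longrightarrow> j \<in> {1..2*n} \<Longrightarrow> comm (Yop n i) (Yop n j) = of_int (weyl_omega n i j)"
  by (rule endo_eqI)
    (auto simp: comm_def Yop_def weyl_omega_def pder_Var_mult pder_commute distrib_left mult.left_commute add_ac)

lemma weyl_rels_Yop: "cring_ideal I \<Longrightarrow> weyl_rels n (WJ n I) (Yop n)"
  unfolding weyl_rels_def
  using ring_mod.zero_J[OF ring_mod_weyl] by (auto simp: comm_Yop)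

lemma qgen_A: "(\<And>i. i \<in> {1..2*n} \<Longrightarrow> P i \<in> A) \<Longrightarrow> ring_mod A J \<Longrightarrow> j \<in> {1..2*n} \<Longrightarrow> qgen n P j \<in> A"
proof -
  assume P: "\<And>i. i \<in> {1..2*n} \<Longrightarrow> P i \<in> A" and "ring_mod A J" and j: "j \<in> {1..2*n}"
  interpret ring_mod A J by fact
  show ?thesis
  proof (cases "j \<le> n")
    case True
    then show ?thesis using P[of "j + n"] j by (auto simp: qgen_def)
  next
    case False
    then have "j - n \<in> {1..2*n}" using j by auto
    then show ?thesis using False P[of "j - n"] by (simp add: qgen_def)
  qed
qed

context ring_mod
begin

lemma comm_qgen:
  assumes P: "weyl_rels n J P" and i: "i \<in> {1..2*n}" and j: "j \<in> {1..2*n}"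
  shows "comm (qgen n P j) (P i) - of_bool (i = j) \<in> J"
proof (cases "j \<le> n")
  case True
  then have "comm (P (j + n)) (P i) - of_int (weyl_omega n (j + n) i) \<in> J"
    using P i j by (auto simp: weyl_rels_def)
  moreover have "weyl_omega n (j + n) i = of_bool (i = j)" using i j by (auto simp: weyl_omega_def)
  ultimately show ?thesis using True by (simp add: qgen_def)
next
  case False
  then have "comm (P (j - n)) (P i) - of_int (weyl_omega n (j - n) i) \<in> J"
    using P i j unfolding weyl_rels_def by (metis atLeastAtMost_iff diff_le_self le_trans linorder_not_le Suc_leI One_nat_def zero_less_diff)
  then have "- (comm (P (j - n)) (P i) - of_int (weyl_omega n (j - n) i)) \<in> J" by (rule uminus_J)
  moreover have "weyl_omega n (j - n) i = - of_bool (i = j)" using False i j by (auto simp: weyl_omega_def)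
  ultimately show ?thesis using False by (simp add: qgen_def)
qed

lemma comm_comm_qgen:
  assumes P: "weyl_rels n J P" and i: "i \<in> {1..2*n}" and j: "j \<in> {1..2*n}" and x: "x \<in> A"
    and PA: "\<And>i. i \<in> {1..2*n} \<Longrightarrow> P i \<in> A"
  shows "comm (comm (qgen n P i) (qgen n P j)) x \<in> J"
proof -
  have *: "comm (comm (P k) (P l)) x \<in> J" if "k \<in> {1..2*n}" "l \<in> {1..2*n}" for k l
  proof -
    have "comm (comm (P k) (P l) - of_int (weyl_omega n k l)) x \<in> J"
      using P that x unfolding weyl_rels_def by blast
    moreover have "comm (of_int c) x = 0" for c :: int
      by (simp add: comm_def mult_of_int_commute)
    ultimately show ?thesis by simp
  qed
  have ex: "\<exists>k\<in>{1..2*n}. qgen n P i = P k \<or> qgen n P i = - P k" if "i \<in> {1..2*n}" for i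
  proof (cases "i \<le> n")
    case True
    then show ?thesis using that by (intro bexI[of _ "i + n"]) (auto simp: qgen_def)
  next
    case False
    then show ?thesis using that by (intro bexI[of _ "i - n"]) (auto simp: qgen_def)
  qed
  obtain k where k: "k \<in> {1..2*n}" "qgen n P i = P k \<or> qgen n P i = - P k" using ex[OF i] by blast
  obtain l where l: "l \<in> {1..2*n}" "qgen n P j = P l \<or> qgen n P j = - P l" using ex[OF j] by blast
  show ?thesis using *[OF k(1) l(1)] k(2) l(2) by auto
qed

text \<open>For \<open>i\<close> up to \<open>n\<close>, the factor \<open>P i\<close> moves into
  its place from the left, across factors that commute with it. For larger \<open>i\<close> it is
  inserted from the right; bringing it to the left costs the commutator with the whole monomial,
  which is the derivative in \<open>Yop n i\<close>.\<close>

lemma osub_Yop: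
  assumes s: "is_hom s" "\<And>c. s c \<in> A" "\<And>c x. x \<in> A \<Longrightarrow> comm x (s c) = 0"
    and P: "weyl_rels n J P" and PA: "\<And>i. i \<in> {1..2*n} \<Longrightarrow> P i \<in> A"
    and i: "i \<in> {1..2*n}" and f: "f \<in> wvars n"
  shows "osub s P (2*n) (app (Yop n i) f) - P i * osub s P (2*n) f \<in> J"
proof -
  have "keys f \<subseteq> {m. set_mset m \<subseteq> {1..2*n}}" using f by (auto simp: mvars_def)
  then show ?thesis
  proof (induction rule: pm_induct_keys)
    case (single m c)
    have sP: "P i * (s c * x) = s c * (P i * x)" for x
      using s(3)[OF PA[OF i]] by (simp add: comm_def mult.assoc[symmetric])
    have Pc: "comm (P i) (P k) \<in> J" if "k \<in> {1..2*n}" "k \<le> n \<and> i \<le> n \<or> n < k \<and> n < i" for k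
    proof -
      have "comm (P i) (P k) - of_int (weyl_omega n i k) \<in> J" using P i that by (auto simp: weyl_rels_def)
      moreover have "weyl_omega n i k = 0" using that i by (auto simp: weyl_omega_def)
      ultimately show ?thesis by simp
    qed
    show ?case
    proof (cases "n < i")
      case False
      have "omon P (2*n) (add_mset i m) - P i * omon P (2*n) m \<in> J"
        using False by (intro omon_add_left i Pc PA) auto
      then have "s c * (omon P (2*n) (add_mset i m) - P i * omon P (2*n) m) \<in> J"
        using s by auto
      then show ?thesis using False
        by (simp add: Yop_def single_Var[symmetric] osub_single s sP right_diff_distrib)
    next
      case True
      then have ij: "i - n \<in> {1..2*n}" "i - n \<le> n" using i by auto
      have q: "qgen n P (i - n) = P i" using True ij by (simp add: qgen_def)
      have 1: "omon P (2*n) (add_mset i m) - omon P (2*n) m * P i \<in> J"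
        using True by (intro omon_add_right i Pc PA) auto
      have "comm (P i) (omon P (2*n) m) - of_nat (count m (i - n)) * omon P (2*n) (m - {#i - n#}) \<in> J"
        using comm_qgen[OF P _ ij(1)] PA ij i unfolding q by (intro comm_omon) auto
      with 1 have "s c * ((omon P (2*n) (add_mset i m) - omon P (2*n) m * P i)
         - (comm (P i) (omon P (2*n) m) - of_nat (count m (i - n)) * omon P (2*n) (m - {#i - n#}))) \<in> J"
        using s by auto
      moreover have "s c * (of_nat (count m (i - n)) * x) = of_nat (count m (i - n)) * (s c * x)" for x
        by (rule of_nat_left_commute)
      ultimately show ?thesis using True
        by (simp add: Yop_def single_Var[symmetric] osub_single osub_add s sP pder_single is_homD is_hom_of_nat
             comm_def algebra_simps)
    qed
  next
    case (add f g)
    have "osub s P (2*n) (app (Yop n i) (f + g)) - P i * osub s P (2*n) (f + g)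
      = (osub s P (2*n) (app (Yop n i) f) - P i * osub s P (2*n) f) +
        (osub s P (2*n) (app (Yop n i) g) - P i * osub s P (2*n) g)"
      by (simp add: osub_add s algebra_simps)
    then show ?case using add by (metis add_J)
  qed auto
qed

text \<open>Substitution is a homomorphism, since \<open>app (wop n g) f\<close> is the normally
  ordered form of the product of \<open>g\<close> and \<open>f\<close>. The relation
  \<open>rel\<close> between operators and their images is verified for generators and scalars and
  passed through products and sums.\<close>

lemma osub_wop:
  assumes s: "is_hom s" "\<And>c. s c \<in> A" "\<And>c x. x \<in> A \<Longrightarrow> comm x (s c) = 0"
    and P: "weyl_rels n J P" and PA: "\<And>i. i \<in> {1..2*n} \<Longrightarrow> P i \<in> A" and f: "f \<in> wvars n"
  shows "osub s P (2*n) (app (wop n g) f) - osub s P (2*n) g * osub s P (2*n) f \<in> J"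
proof -
  define rel where "rel T E \<longleftrightarrow> E \<in> A \<and> T \<in> WA n {0} \<and>
      (\<forall>f\<in>wvars n. osub s P (2*n) (app T f) - E * osub s P (2*n) f \<in> J)" for T E
  have osA: "osub s P (2*n) f \<in> A" for f by (intro osub_A s PA)
  have mult: "rel (T * S) (E * F)" if "rel T E" "rel S F" for T S E F
  proof -
    have "osub s P (2*n) (app (T * S) f) - E * F * osub s P (2*n) f \<in> J" if f: "f \<in> wvars n" for f
    proof -
      have "app S f \<in> wvars n" using \<open>rel S F\<close> f by (auto simp: rel_def WA_def)
      then have "osub s P (2*n) (app (T * S) f) - E * osub s P (2*n) (app S f) \<in> J"
        using \<open>rel T E\<close> by (simp add: rel_def)
      moreover have "E * (osub s P (2*n) (app S f) - F * osub s P (2*n) f) \<in> J"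
        using that \<open>rel T E\<close> \<open>rel S F\<close> by (auto simp: rel_def)
      ultimately show ?thesis
        using cong_trans by (fastforce simp: algebra_simps)
    qed
    then show ?thesis using that by (auto simp: rel_def)
  qed
  have one: "rel 1 1" by (auto simp: rel_def)
  have Y: "rel (Yop n i) (P i)" if "i \<in> {1..2*n}" for i
    using that osub_Yop[OF s P PA that] PA[OF that] by (auto simp: rel_def)
  have pow: "rel (Yop n i ^ k) (P i ^ k)" if "i \<in> {1..2*n}" for i k
    using mult[OF Y[OF that]] by (induction k) (auto intro: one)
  have om: "rel (omon (Yop n) N m) (omon P N m)" if "N \<le> 2 * n" for N m
    using that
  proof (induction N)
    case (Suc N)
    then show ?case using mult[OF Suc.IH pow[of "Suc N"]] by simp
  qed (simp add: one)
  have sc: "rel (scal c) (s c)" for c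
    by (auto simp: rel_def s osub_Cst_mult)
  have "rel (wop n g) (osub s P (2*n) g)"
  proof (induction g rule: pm_induct)
    case zero
    show ?case by (auto simp: rel_def wop_def)
  next
    case (single m c)
    show ?case unfolding wop_def by (simp add: osub_single s mult sc om)
  next
    case (add f g)
    have "osub s P (2*n) (app (wop n (f + g)) h) - osub s P (2*n) (f + g) * osub s P (2*n) h \<in> J"
      if "h \<in> wvars n" for h
    proof -
      have "osub s P (2*n) (app (wop n (f + g)) h) - osub s P (2*n) (f + g) * osub s P (2*n) h
         = (osub s P (2*n) (app (wop n f) h) - osub s P (2*n) f * osub s P (2*n) h)
          + (osub s P (2*n) (app (wop n g) h) - osub s P (2*n) g * osub s P (2*n) h)"
        by (simp add: wop_def osub_add s algebra_simps)
      then show ?thesis using add that unfolding rel_def by (metis add_J)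
    qed
    then show ?case by (auto simp: rel_def osA wop_WA0)
  qed
  then show ?thesis using f by (simp add: rel_def)
qed

end

text \<open>If \<open>T\<close> commutes with a generator, the left and the right multiplication by
  it agree on \<open>app T 1\<close> modulo \<open>I\<close>. They differ by the derivative in the
  partner variable.\<close>

lemma centralizer_pder:
  assumes I: "cring_ideal I" and T: "T \<in> WA n I"
    and c: "\<And>i. i \<in> {1..2*n} \<Longrightarrow> comm T (Yop n i) \<in> WJ n I" and i: "i \<in> {1..2*n}"
  shows "pder i (app T 1) \<in> coefs_in I"
proof -
  interpret C: cring_ideal "coefs_in I :: (nat, 'a) mp set"
    by (rule cring_ideal_coefs_in) fact
  have *: "app (Rop n j) (app T 1) - app (Yop n j) (app T 1) \<in> coefs_in I" if "j \<in> {1..2*n}" for j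
  proof -
    have YR: "app (Yop n j) 1 = app (Rop n j) 1"
      by (simp add: Yop_def Rop_def)
    have "app (comm T (Yop n j)) 1 \<in> coefs_in I" using c[OF that] unfolding WJ_def by blast
    then have a: "app T (app (Rop n j) 1) - app (Yop n j) (app T 1) \<in> coefs_in I"
      by (simp only: comm_def app_simps YR)
    have b: "app T (app (Rop n j) 1) - app (Rop n j) (app T 1) \<in> coefs_in I"
      using T that unfolding WA_def by blast
    from C.diff_I[OF a b] show ?thesis by simp
  qed
  show ?thesis
  proof (cases "i \<le> n")
    case True
    then show ?thesis using *[of "i + n"] i C.uminus_I by (fastforce simp: Rop_def Yop_def)
  next
    case False
    then have "i - n \<in> {1..2*n}" "i - n \<le> n" "\<not> n < i - n" "i - n + n = i" using i by auto
    then show ?thesis using *[of "i - n"] by (simp add: Rop_def Yop_def)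
  qed
qed

lemma degle_Yop: "degle d f \<Longrightarrow> degle (Suc d) (app (Yop n i) f)"
proof -
  assume f: "degle d f"
  have "degle (Suc d) (Var i * f)" using degle_mult[OF degle_Var[of 1 i] f] by simp
  moreover have "degle (Suc d) (pder j f)" for j
    using f by (fastforce simp: degle_def dest: keys_pder)
  ultimately show ?thesis by (auto simp: Yop_def intro: degle_add)
qed

lemma degle_omon_Yop: "set_mset m \<subseteq> {1..N} \<Longrightarrow> degle d f \<Longrightarrow> degle (size m + d) (app (omon (Yop n) N m) f)"
proof -
  have "degle ((\<Sum>i\<in>{1..N}. count m i) + d) (app (omon (Yop n) N m) f)" if "degle d f" for d f
    using that
  proof (induction N arbitrary: d f)
    case (Suc N)
    have "degle (k + d) (app (Yop n (Suc N) ^ k) f)" for k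
      using Suc.prems by (induction k) (auto intro: degle_Yop)
    from Suc.IH[OF this, of "count m (Suc N)"] show ?case by (simp add: add.assoc add.commute add.left_commute)
  qed auto
  moreover assume m: "set_mset m \<subseteq> {1..N}" and "degle d f"
  moreover have "size m = (\<Sum>i\<in>{1..N}. count m i)"
    unfolding size_multiset_overloaded_eq using m
    by (intro sum.mono_neutral_left) (auto simp: not_in_iff)
  ultimately show ?thesis by metis
qed

lemma degle_wop:
  assumes "f \<in> wvars n" "degle d f" "degle e g"
  shows "degle (d + e) (app (wop n f) g)"
proof -
  have "app (wop n f) g = (\<Sum>m\<in>keys f. Cst (lookup f m) * app (omon (Yop n) (2*n) m) g)"
    by (simp add: wop_def osub_def lext_def app_sum_left)
  also have "degle (d + e) \<dots>"
  proof (rule degle_sum)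
    fix m assume m: "m \<in> keys f"
    have "degle (size m + e) (app (omon (Yop n) (2*n) m) g)"
      using assms m by (intro degle_omon_Yop) (auto simp: mvars_def)
    then have "degle (0 + (size m + e)) (Cst (lookup f m) * app (omon (Yop n) (2*n) m) g)"
      by (intro degle_mult) auto
    then show "degle (d + e) (Cst (lookup f m) * app (omon (Yop n) (2*n) m) g)"
      by (rule degle_mono) (use assms m in \<open>auto simp: degle_def\<close>)
  qed
  finally show ?thesis .
qed


section \<open>Weyl algebras modulo a prime\<close>

text \<open>Fraction-free elimination over the domain of residues modulo \<open>I\<close>: more
  vectors than coordinates are dependent. The subring \<open>B\<close> keeps track of where the
  coefficients lie.\<close>

lemma cring_dependent:
  fixes I B :: "'r::comm_ring_1 set" and v :: "'i \<Rightarrow> 'j \<Rightarrow> 'r"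
  assumes I: "cring_prime I"
    and B: "0 \<in> B" "1 \<in> B" "\<And>x y. x \<in> B \<Longrightarrow> y \<in> B \<Longrightarrow> x - y \<in> B" "\<And>x y. x \<in> B \<Longrightarrow> y \<in> B \<Longrightarrow> x * y \<in> B"
    and "finite T" "finite S" "card T < card S" "\<And>i j. i \<in> S \<Longrightarrow> j \<in> T \<Longrightarrow> v i j \<in> B"
  shows "\<exists>l. (\<forall>i\<in>S. l i \<in> B) \<and> (\<exists>i\<in>S. l i \<notin> I) \<and> (\<forall>j\<in>T. (\<Sum>i\<in>S. l i * v i j) \<in> I)"
  using assms(6-9)
proof (induction T arbitrary: S v rule: finite_induct)
  case empty
  interpret cring_prime I by fact
  obtain i where "i \<in> S" using empty by fastforce
  then show ?case using B by (intro exI[of _ "\<lambda>_. 1"]) auto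
next
  case (insert t T)
  interpret cring_prime I by fact
  show ?case
  proof (cases "\<forall>i\<in>S. v i t \<in> I")
    case True
    have "\<exists>l. (\<forall>i\<in>S. l i \<in> B) \<and> (\<exists>i\<in>S. l i \<notin> I) \<and> (\<forall>j\<in>T. (\<Sum>i\<in>S. l i * v i j) \<in> I)"
      by (rule insert.IH) (use insert.hyps insert.prems in auto)
    then obtain l where "\<forall>i\<in>S. l i \<in> B" "\<exists>i\<in>S. l i \<notin> I" "\<forall>j\<in>T. (\<Sum>i\<in>S. l i * v i j) \<in> I"
      by blast
    moreover from True have "(\<Sum>i\<in>S. l i * v i t) \<in> I" by auto
    ultimately show ?thesis by auto
  next
    case False
    then obtain i0 where i0: "i0 \<in> S" "v i0 t \<notin> I" by blast
    define S' where "S' = S - {i0}"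
    \<comment> \<open>The pivot \<open>v i0 t\<close> clears the coordinate \<open>t\<close> of the
      other vectors without division.\<close>
    define w where "w i j = v i0 t * v i j - v i t * v i0 j" for i j
    have S': "finite S'" "card T < card S'" "S = insert i0 S'" "i0 \<notin> S'"
      using insert.prems insert.hyps i0 by (auto simp: S'_def)
    have "w i j \<in> B" if "i \<in> S'" "j \<in> T" for i j
      using that insert.prems(3) i0 B(3,4) S'(3) by (auto simp: w_def)
    then obtain l where l: "\<forall>i\<in>S'. l i \<in> B" "\<exists>i\<in>S'. l i \<notin> I" "\<forall>j\<in>T. (\<Sum>i\<in>S'. l i * w i j) \<in> I"
      using insert.IH[of S' w] S' by blast
    define k where "k i = (if i = i0 then - (\<Sum>i\<in>S'. l i * v i t) else v i0 t * l i)" for i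
    have sum: "(\<Sum>i\<in>S. k i * v i j) = (\<Sum>i\<in>S'. l i * w i j)" for j
    proof -
      have "(\<Sum>i\<in>S. k i * v i j) = k i0 * v i0 j + (\<Sum>i\<in>S'. k i * v i j)"
        using S' by simp
      also have "(\<Sum>i\<in>S'. k i * v i j) = (\<Sum>i\<in>S'. v i0 t * l i * v i j)"
        using S' by (intro sum.cong) (auto simp: k_def)
      also have "k i0 * v i0 j + \<dots> = (\<Sum>i\<in>S'. v i0 t * l i * v i j - l i * v i t * v i0 j)"
        by (simp add: k_def sum_subtractf sum_distrib_right)
      also have "\<dots> = (\<Sum>i\<in>S'. l i * w i j)"
        by (simp add: w_def algebra_simps)
      finally show ?thesis .
    qed
    have "(\<Sum>i\<in>S. k i * v i j) \<in> I" if "j \<in> insert t T" for j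
    proof (cases "j = t")
      case True
      then show ?thesis unfolding sum by (simp add: w_def mult.commute)
    qed (use that l sum in auto)
    moreover have "\<exists>i\<in>S. k i \<notin> I"
    proof -
      obtain i where "i \<in> S'" "l i \<notin> I" using l by blast
      then have "i \<in> S" "k i \<notin> I" using prime_I i0(2) S' by (auto simp: k_def)
      then show ?thesis by blast
    qed
    moreover have "k i \<in> B" if "i \<in> S" for i
    proof -
      have "(\<Sum>i\<in>U. l i * v i t) \<in> B" if "finite U" "U \<subseteq> S'" for U
        using that
      proof (induction U)
        case (insert x U)
        then have "l x * v x t \<in> B" "(\<Sum>i\<in>U. l i * v i t) \<in> B"
          using l(1) insert.prems S'(3) B(4) \<open>\<And>i j. i \<in> S \<Longrightarrow> j \<in> insert t T \<Longrightarrow> v i j \<in> B\<close> by auto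
        then have "l x * v x t - (0 - (\<Sum>i\<in>U. l i * v i t)) \<in> B" using B by metis
        then show ?case using insert by simp
      qed (use B in auto)
      then have "(\<Sum>i\<in>S'. l i * v i t) \<in> B" using S' by blast
      then have "0 - (\<Sum>i\<in>S'. l i * v i t) \<in> B" using B by metis
      then show ?thesis using that l(1) S'(3) i0(1) B(4) insert.prems(3) by (auto simp: k_def)
    qed
    ultimately show ?thesis by blast
  qed
qed

text \<open>Polynomials form a free module over those in the \<open>p\<close>-th powers of the
  variables, with the monomials in \<open>box\<close> as a basis. This is the coordinate of
  \<open>f\<close> at \<open>b\<close>, with each \<open>p\<close>-th power renamed to its variable.
  The value zero for \<open>p = 0\<close> keeps the support finite.\<close>

definition pcomp :: "nat \<Rightarrow> nat multiset \<Rightarrow> (nat, 'r::comm_ring_1) mp \<Rightarrow> (nat, 'r) mp"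
  where "pcomp p b f = Abs_poly_mapping (\<lambda>a. if p = 0 then 0 else lookup f (repeat_mset p a + b))"

text \<open>Only the variables are raised to the power \<open>p\<close>; coefficients stay fixed.
  Multiplications by its values form the centre of the Weyl algebra modulo \<open>p\<close>, see
  \<open>comm_Frob_J1\<close> and \<open>central_Frob\<close>.\<close>

definition Frob :: "nat \<Rightarrow> (nat, 'r::comm_ring_1) mp \<Rightarrow> (nat, 'r) mp"
  where "Frob p = meval Cst (\<lambda>i. Var i ^ p)"

definition box :: "nat \<Rightarrow> nat \<Rightarrow> nat multiset set"
  where "box N p = {b. set_mset b \<subseteq> {1..N} \<and> (\<forall>i. count b i < p)}"

lemma inj_repeat_mset: "p > 0 \<Longrightarrow> inj (\<lambda>a. repeat_mset p a + b)"
  by (rule injI) (auto simp: multiset_eq_iff)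

lemma lookup_pcomp: "p > 0 \<Longrightarrow> lookup (pcomp p b f) a = lookup f (repeat_mset p a + b)"
proof -
  assume p: "p > 0"
  have "finite ((\<lambda>a. repeat_mset p a + b) -` keys f)"
    by (intro finite_vimageI inj_repeat_mset p) simp
  then have "finite {a. lookup f (repeat_mset p a + b) \<noteq> 0}"
    by (rule finite_subset[rotated]) (auto simp: in_keys_iff)
  then show ?thesis using p by (simp add: pcomp_def)
qed

lemma finite_box: "finite (box N p)"
proof (rule finite_imageD)
  have "(\<lambda>b. restrict (count b) {1..N}) ` box N p \<subseteq> {1..N} \<rightarrow>\<^sub>E {..<p}"
    by (auto simp: box_def)
  then show "finite ((\<lambda>b. restrict (count b) {1..N}) ` box N p)"
    by (rule finite_subset) (auto intro: finite_PiE)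
  show "inj_on (\<lambda>b. restrict (count b) {1..N}) (box N p)"
  proof (rule inj_onI, rule multiset_eqI)
    fix a b i assume *: "a \<in> box N p" "b \<in> box N p" "restrict (count a) {1..N} = restrict (count b) {1..N}"
    show "count a i = count b i"
    proof (cases "i \<in> {1..N}")
      case True
      then show ?thesis using fun_cong[OF *(3), of i] by simp
    next
      case False
      then have "i \<notin># a" "i \<notin># b" using * by (auto simp: box_def)
      then show ?thesis by (simp add: not_in_iff)
    qed
  qed
qed

lemma box_decomp:
  assumes "p > 0"
  shows "\<exists>a b. m = repeat_mset p a + b \<and> (\<forall>i. count b i < p)"
proof (induction "size m" arbitrary: m rule: less_induct)
  case less
  show ?case
  proof (cases "\<exists>i. p \<le> count m i")
    case True
    then obtain i where i: "p \<le> count m i" by blast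
    define m' where "m' = m - replicate_mset p i"
    have m: "m = m' + replicate_mset p i"
      using i by (simp add: m'_def count_le_replicate_mset_subset_eq)
    have "size m' < size m" using assms by (simp add: m)
    then obtain a b where "m' = repeat_mset p a + b" "\<forall>i. count b i < p" using less by blast
    moreover from this have "m = repeat_mset p (add_mset i a) + b"
      by (auto simp: m multiset_eq_iff)
    ultimately show ?thesis by blast
  next
    case False
    then show ?thesis by (intro exI[of _ "{#}"] exI[of _ m]) (auto simp: not_le)
  qed
qed

lemma pcomp_add: "p > 0 \<Longrightarrow> pcomp p b (f + g) = pcomp p b f + pcomp p b g"
  by (rule poly_mapping_eqI) (simp add: lookup_pcomp lookup_add)

lemma pcomp_0 [simp]: "pcomp p b 0 = 0"
  by (cases "p = 0") (simp_all add: pcomp_def)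

lemma pcomp_diff: "p > 0 \<Longrightarrow> pcomp p b (f - g) = pcomp p b f - pcomp p b g"
  by (rule poly_mapping_eqI) (simp add: lookup_pcomp lookup_minus)

lemma pcomp_sum: "p > 0 \<Longrightarrow> pcomp p b (sum f A) = (\<Sum>a\<in>A. pcomp p b (f a))"
  by (induction A rule: infinite_finite_induct) (auto simp: pcomp_add)

lemma pcomp_mvars:
  assumes "p > 0" "f \<in> mvars V"
  shows "pcomp p b f \<in> mvars V"
  unfolding mvars_def
proof (safe)
  fix m x assume "m \<in> keys (pcomp p b f)" "x \<in># m"
  then have "repeat_mset p m + b \<in> keys f" "x \<in># repeat_mset p m + b"
    using assms(1) by (auto simp: in_keys_iff lookup_pcomp)
      (simp add: count_greater_zero_iff[symmetric] del: count_greater_zero_iff)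
  then show "x \<in> V" using assms(2) unfolding mvars_def by blast
qed

lemma pcomp_coefs_in: "p > 0 \<Longrightarrow> f \<in> coefs_in I \<Longrightarrow> pcomp p b f \<in> coefs_in I"
  by (auto simp: coefs_in_def lookup_pcomp)

lemma coefs_in_pcomp:
  assumes p: "p > 0" and f: "f \<in> mvars {1..N}" and "0 \<in> I"
    and "\<And>b. b \<in> box N p \<Longrightarrow> pcomp p b f \<in> coefs_in I"
  shows "f \<in> coefs_in I"
proof -
  have "lookup f m \<in> I" for m
  proof (cases "m \<in> keys f")
    case True
    then have m: "set_mset m \<subseteq> {1..N}" using f by (auto simp: mvars_def)
    obtain a b where ab: "m = repeat_mset p a + b" "\<forall>i. count b i < p" using box_decomp[OF p] by blast
    then have "b \<in> box N p" using m by (auto simp: box_def)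
    then have "lookup (pcomp p b f) a \<in> I" using assms(4) by (simp add: coefs_in_def)
    then show ?thesis by (simp add: lookup_pcomp p ab)
  qed (use \<open>0 \<in> I\<close> in \<open>simp add: in_keys_iff\<close>)
  then show ?thesis by (simp add: coefs_in_def)
qed

lemma Frob_add: "Frob p (f + g) = Frob p f + Frob p g"
  and Frob_mult: "Frob p (f * g) = Frob p f * Frob p g"
  and Frob_Cst [simp]: "Frob p (Cst c) = Cst c"
  and Frob_Var: "Frob p (Var i) = Var i ^ p"
  by (simp_all add: Frob_def meval_add meval_mult meval_Cst meval_Var)

lemma Frob_hom: "is_hom (Frob p)"
  unfolding Frob_def by (rule is_hom_meval) simp

lemma Frob_0 [simp]: "Frob p 0 = 0" and Frob_1 [simp]: "Frob p 1 = 1"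
  using is_hom_0[OF Frob_hom] is_homD(1)[OF Frob_hom] by auto

lemma Frob_mvars [intro]: "f \<in> mvars V \<Longrightarrow> Frob p f \<in> mvars V"
  unfolding Frob_def by (auto intro: mvars_Var)

lemma Frob_coefs_in: "cring_ideal I \<Longrightarrow> f \<in> coefs_in I \<Longrightarrow> Frob p f \<in> coefs_in I"
  unfolding Frob_def by (rule meval_coefs_in)

lemma single_empty_1 [simp]: "single {#} 1 = (1 :: ('v, 'r::comm_ring_1) mp)"
  by (rule Cst_1[unfolded Cst_def])

lemma Var_power: "Var i ^ k = single (replicate_mset k i) 1"
  by (induction k) (simp_all add: single_Var)

lemma pcomp_Var_power_mult:
  assumes "\<forall>i. count b i < p"
  shows "pcomp p b (Var i ^ p * h) = Var i * pcomp p b h"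
proof (rule poly_mapping_eqI)
  fix a
  have p: "p > 0" using assms by (metis gr0I not_less_zero)
  have "replicate_mset p i \<subseteq># repeat_mset p a + b \<longleftrightarrow> p \<le> p * count a i + count b i"
    by (simp add: count_le_replicate_mset_subset_eq[symmetric])
  also have "\<dots> \<longleftrightarrow> i \<in># a"
    using assms[rule_format, of i] by (cases "count a i") (auto simp: count_greater_zero_iff[symmetric] simp del: count_greater_zero_iff)
  finally have 1: "replicate_mset p i \<subseteq># repeat_mset p a + b \<longleftrightarrow> i \<in># a" .
  have 2: "repeat_mset p a + b - replicate_mset p i = repeat_mset p (a - {#i#}) + b" if ia: "i \<in># a"
  proof -
    obtain a' where "a = add_mset i a'" using ia by (meson multi_member_split)
    then show ?thesis by (auto simp: multiset_eq_iff)
  qed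
  show "lookup (pcomp p b (Var i ^ p * h)) a = lookup (Var i * pcomp p b h) a"
    using 1 2 unfolding Var_power by (simp add: lookup_pcomp p lookup_single_mult Var_def)
qed

lemma pcomp_Frob_mult:
  assumes b: "\<forall>i. count b i < p"
  shows "pcomp p b (Frob p l * f) = l * pcomp p b f"
proof -
  have p: "p > 0" using b by (metis gr0I not_less_zero)
  show ?thesis
  proof (induction l arbitrary: f rule: mp_induct[OF mvars_UNIV])
    case (1 c)
    show ?case by (rule poly_mapping_eqI) (simp add: lookup_pcomp p)
  next
    case (2 i l)
    then show ?case by (simp add: Frob_mult Frob_Var mult.assoc pcomp_Var_power_mult[OF b])
  next
    case (3 g h)
    then show ?case by (simp add: Frob_add distrib_right pcomp_add p)
  qed
qed

lemma pcomp_single: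
  assumes b: "\<forall>i. count b i < p" and c: "\<forall>i. count c i < p"
  shows "pcomp p b (single c x) = (if b = c then Cst x else 0)"
proof (rule poly_mapping_eqI)
  fix a
  have p: "p > 0" using b by (metis gr0I not_less_zero)
  have "repeat_mset p a + b = c \<longleftrightarrow> a = {#} \<and> b = c"
  proof
    assume *: "repeat_mset p a + b = c"
    have "count a i = 0" for i
    proof (rule ccontr)
      assume "count a i \<noteq> 0"
      then have "p * 1 \<le> p * count a i" by (intro mult_le_mono2) simp
      moreover have "count c i = p * count a i + count b i" unfolding *[symmetric] by simp
      ultimately have "p \<le> count c i" by linarith
      then show False using c by (simp add: not_le[symmetric])
    qed
    then have "a = {#}" by (simp add: multiset_eq_iff)
    then show "a = {#} \<and> b = c" using * by simp
  qed auto
  then show "lookup (pcomp p b (single c x)) a = lookup (if b = c then Cst x else 0) a"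
    by (auto simp: lookup_pcomp p lookup_single when_def lookup_Cst)
qed

lemma pcomp_Frob: "\<forall>i. count b i < p \<Longrightarrow> pcomp p b (Frob p l) = (if b = {#} then l else 0)"
  using pcomp_Frob_mult[of b p l 1] pcomp_single[of b p "{#}" 1]
  by (metis Cst_1 count_empty gr0I mult.right_neutral mult_zero_right not_less_zero single_empty_1)

lemma Frob_decomp:
  assumes p: "p > 0" and f: "f \<in> mvars {1..N}"
  shows "f = (\<Sum>b\<in>box N p. Frob p (pcomp p b f) * single b 1)"
proof -
  let ?s = "\<Sum>b\<in>box N p. Frob p (pcomp p b f) * single b 1"
  have s: "?s \<in> mvars {1..N}"
    using f p by (intro mvars_sum mvars_mult Frob_mvars pcomp_mvars mvars_single) (auto simp: box_def)
  have "f - ?s \<in> coefs_in {0}"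
  proof (rule coefs_in_pcomp[OF p, of _ N])
    fix b assume b: "b \<in> box N p"
    have "pcomp p b ?s = (\<Sum>c\<in>box N p. pcomp p c f * (if b = c then 1 else 0))"
      using b unfolding pcomp_sum[OF p] by (intro sum.cong) (auto simp: pcomp_Frob_mult pcomp_single box_def)
    also have "\<dots> = pcomp p b f"
      using b by (simp add: finite_box if_distrib[of "\<lambda>x. _ * x"] cong: if_cong)
    finally show "pcomp p b (f - ?s) \<in> coefs_in {0}" by (simp add: pcomp_diff[OF p])
  qed (use s f in auto)
  then show ?thesis by simp
qed

lemma pder_power: "pder i (f ^ k) = of_nat k * f ^ (k - 1) * pder i f"
proof (induction k)
  case (Suc k)
  then show ?case by (cases k) (auto simp: pder_mult algebra_simps)
qed auto

lemma lookup_pder_power: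
  "lookup (app (der i ^ k) f) m = of_nat (\<Prod>j\<in>{1..k}. count m i + j) * lookup f (m + replicate_mset k i)"
proof (induction k arbitrary: m)
  case (Suc k)
  have *: "(\<Prod>j\<in>{1..Suc k}. count m i + j) = Suc (count m i) * (\<Prod>j\<in>{1..k}. Suc (count m i) + j)"
  proof -
    have "(\<Prod>j\<in>{1..Suc k}. count m i + j) = (\<Prod>j\<in>{0..k}. count m i + Suc j)"
      using prod.shift_bounds_cl_Suc_ivl[of "\<lambda>j. count m i + j" 0 k] by simp
    also have "\<dots> = (count m i + Suc 0) * (\<Prod>j\<in>{Suc 0..k}. count m i + Suc j)"
      by (subst prod.atLeast_Suc_atMost) auto
    finally show ?thesis by simp
  qed
  show ?case
    by (simp only: power_Suc app_simps der.rep_eq lookup_pder Suc * of_nat_mult) simp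
qed simp

section \<open>The Weyl algebra modulo p and its centre\<close>

locale weyl_p =
  fixes n p :: nat
  assumes p: "prime p"
begin

lemma p0: "p > 0" and p1: "p > 1"
  using prime_gt_1_nat[OF p] by auto

text \<open>Coefficients remain integers at both levels: \<open>A1\<close> modulo \<open>J1\<close>
  and \<open>A2\<close> modulo \<open>J2\<close> are the Weyl algebras over the integers modulo p
  and modulo p^2, and an element of \<open>A2\<close> can be read at either level.\<close>

definition Ip :: "int set" where "Ip = {x. int p dvd x}"
definition Iq :: "int set" where "Iq = {x. int (p\<^sup>2) dvd x}"

abbreviation "A1 \<equiv> WA n Ip"
abbreviation "J1 \<equiv> WJ n Ip"
abbreviation "A2 \<equiv> WA n Iq"
abbreviation "J2 \<equiv> WJ n Iq"
abbreviation "Cp \<equiv> coefs_in Ip :: (nat, int) mp set"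
abbreviation "Cq \<equiv> coefs_in Iq :: (nat, int) mp set"

sublocale Ip: cring_prime Ip
  unfolding Ip_def by (rule cring_prime_int[OF p])

lemma Ip_ideal: "cring_ideal Ip" by unfold_locales

lemma Iq_ideal: "cring_ideal Iq"
  unfolding Iq_def by (rule cring_ideal_dvd)

sublocale M1: ring_mod A1 J1
  by (rule ring_mod_weyl[OF Ip_ideal])

sublocale M2: ring_mod A2 J2
  by (rule ring_mod_weyl[OF Iq_ideal])

lemma Cp_prime: "cring_prime Cp"
  by (rule cring_prime_coefs_in) unfold_locales

sublocale Cp: cring_prime Cp
  by (rule Cp_prime)

sublocale Cq: cring_ideal Cq
  by (rule cring_ideal_coefs_in[OF Iq_ideal])

lemma Cp_iff: "f \<in> Cp \<longleftrightarrow> (\<exists>g. f = of_nat p * g)"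
  unfolding Ip_def coefs_in_dvd by (auto simp: dvd_def)

lemma Cq_iff: "f \<in> Cq \<longleftrightarrow> (\<exists>g. f = of_nat p * (of_nat p * g))"
  unfolding Iq_def coefs_in_dvd by (auto simp: dvd_def power2_eq_square Cst_mult mult.assoc)

lemma Cq_Cp: "f \<in> Cq \<Longrightarrow> f \<in> Cp"
  unfolding Cq_iff Cp_iff by blast

lemma mult_p_Cq: "of_nat p * f \<in> Cq \<longleftrightarrow> f \<in> Cp"
  using p0 by (auto simp: coefs_in_def Ip_def Iq_def power2_eq_square)

lemma A2_A1: "T \<in> A2 \<Longrightarrow> T \<in> A1"
  by (rule WA_mono) (auto simp: Ip_def Iq_def power2_eq_square)

lemma J2_J1: "T \<in> J2 \<Longrightarrow> T \<in> J1"
  using A2_A1 Cq_Cp unfolding WJ_def by blast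

lemma J1_iff: "T \<in> A1 \<Longrightarrow> T \<in> J1 \<longleftrightarrow> app T 1 \<in> Cp"
  by (rule WJ_iff[OF Ip_ideal])

lemma p_not_dvd: "0 < m \<Longrightarrow> m < p \<Longrightarrow> \<not> p dvd m"
  by (simp add: nat_dvd_not_less)

lemma tors_Cp: "\<not> p dvd m \<Longrightarrow> of_nat m * f \<in> Cp \<Longrightarrow> f \<in> Cp"
  using p by (auto simp: coefs_in_def Ip_def prime_dvd_mult_iff prime_int_nat_transfer)

lemma tors_J1: "\<not> p dvd m \<Longrightarrow> x \<in> A1 \<Longrightarrow> of_nat m * x \<in> J1 \<Longrightarrow> x \<in> J1"
  using J1_iff[of x] J1_iff[of "of_nat m * x"] tors_Cp[of m "app x 1"] by auto

lemma p_Cp: "p dvd m \<Longrightarrow> of_nat m * f \<in> Cp"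
  by (auto simp: coefs_in_def Ip_def)

lemma p_J1: "p dvd m \<Longrightarrow> x \<in> A1 \<Longrightarrow> of_nat m * x \<in> J1"
  by (subst J1_iff) (auto simp: p_Cp)

text \<open>Differentiating \<open>p\<close> times multiplies each coefficient by \<open>p\<close>
  consecutive integers.\<close>

lemma der_power_Cp: "app (der i ^ p) f \<in> Cp"
proof -
  have "p dvd (\<Prod>j\<in>{1..p}. c + j)" for c
  proof -
    have "p - c mod p \<in> {1..p}" using p0 by (simp add: Suc_leI)
    moreover have "p dvd c + (p - c mod p)"
    proof -
      have "c + (p - c mod p) = p * (c div p) + p"
        using p0 by (metis (no_types, lifting) add.assoc add_diff_inverse_nat less_imp_le_nat mod_less_divisor mult_div_mod_eq not_less)
      then show ?thesis by simp
    qed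
    ultimately show ?thesis by (meson dvd_prodI dvd_trans finite_atLeastAtMost)
  qed
  then show ?thesis unfolding coefs_in_def Ip_def
    by (auto simp: lookup_pder_power simp del: of_nat_prod)
qed

text \<open>The multiplication and the derivative in \<open>Rop n i\<close> commute, so modulo
  \<open>p\<close> the power of their sum is the sum of their \<open>p\<close>-th powers, and the
  \<open>p\<close>-th power of a derivative vanishes.\<close>

lemma Rop_power: "i \<in> {1..2*n} \<Longrightarrow> app (Rop n i ^ p) h - Var i ^ p * h \<in> Cp"
proof (cases "i \<le> n")
  case False
  have "app (mul (Var i) ^ k) h = Var i ^ k * h" for k
    by (induction k) (auto simp: mult.assoc)
  then show ?thesis using False by (simp add: Rop_def)
next
  case True
  assume i: "i \<in> {1..2*n}"
  define a b where "a = (mul (Var i) :: (nat, int) mp endo)" and "b = (der (i + n) :: (nat, int) mp endo)"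
  have ak: "app (a ^ k) h = Var i ^ k * h" for k h
    by (induction k) (auto simp: mult.assoc a_def)
  have ab: "a * b = b * a"
    by (rule endo_eqI) (use i True in \<open>auto simp: a_def b_def pder_Var_mult\<close>)
  have "app (Rop n i ^ p) h = (\<Sum>k\<le>p. of_nat (p choose k) * app (a ^ k * b ^ (p - k)) h)"
    using True by (simp add: Rop_def a_def[symmetric] b_def[symmetric] power_add_commuting[OF ab] app_sum_left)
  also have "\<dots> = app (a ^ p) h + (\<Sum>k<p. of_nat (p choose k) * app (a ^ k * b ^ (p - k)) h)"
    by (simp add: lessThan_Suc_atMost[symmetric])
  finally have "app (Rop n i ^ p) h - Var i ^ p * h = (\<Sum>k<p. of_nat (p choose k) * app (a ^ k * b ^ (p - k)) h)"
    by (simp add: ak)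
  also have "\<dots> \<in> Cp"
  proof (rule Cp.sum_I)
    fix k assume k: "k \<in> {..<p}"
    show "of_nat (p choose k) * app (a ^ k * b ^ (p - k)) h \<in> Cp"
    proof (cases "k = 0")
      case True
      then show ?thesis using der_power_Cp by (simp add: b_def)
    next
      case False
      then show ?thesis using k by (intro p_Cp dvd_choose_prime p) auto
    qed
  qed
  finally show ?thesis .
qed

lemma A1_Rop_power:
  assumes T: "T \<in> A1" and i: "i \<in> {1..2*n}" and h: "h \<in> wvars n"
  shows "app T (app (Rop n i ^ k) h) - app (Rop n i ^ k) (app T h) \<in> Cp"
proof (induction k)
  case (Suc k)
  have hk: "app (Rop n i ^ k) h \<in> wvars n"
    using h Rop_wvars[OF i] by (induction k) auto
  have "app T (app (Rop n i) (app (Rop n i ^ k) h)) - app (Rop n i) (app T (app (Rop n i ^ k) h)) \<in> Cp"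
    using T i hk unfolding WA_def by blast
  moreover have "app (Rop n i) (app T (app (Rop n i ^ k) h) - app (Rop n i ^ k) (app T h)) \<in> Cp"
    by (rule lin_coefs_in[OF lin_Rop Ip_ideal Suc])
  ultimately show ?case unfolding power_Suc app_simps app_diff by (rule Cp.cong_trans)
qed simp

lemma A1_Cp: "T \<in> A1 \<Longrightarrow> f \<in> Cp \<Longrightarrow> app T f \<in> Cp"
  by (rule lin_coefs_in[OF WA_lin Ip_ideal])

lemma A1_Var_power:
  assumes T: "T \<in> A1" and i: "i \<in> {1..2*n}" and h: "h \<in> wvars n"
  shows "app T (Var i ^ p * h) - Var i ^ p * app T h \<in> Cp"
proof -
  have "app T (app (Rop n i ^ p) h - Var i ^ p * h) \<in> Cp"
    by (intro A1_Cp T Rop_power i)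
  then have "app T (Var i ^ p * h) - app T (app (Rop n i ^ p) h) \<in> Cp"
    using Cp.cong_sym by simp
  moreover have "app T (app (Rop n i ^ p) h) - app (Rop n i ^ p) (app T h) \<in> Cp"
    by (rule A1_Rop_power[OF assms])
  moreover have "app (Rop n i ^ p) (app T h) - Var i ^ p * app T h \<in> Cp"
    by (rule Rop_power[OF i])
  ultimately show ?thesis by (meson Cp.cong_trans)
qed

text \<open>Modulo \<open>p\<close> the \<open>p\<close>-th powers of right multiplications are
  multiplications by \<open>p\<close>-th powers of variables, and \<open>T\<close> commutes with
  right multiplications.\<close>

lemma A1_Frob:
  assumes T: "T \<in> A1" and h: "h \<in> wvars n" and g: "g \<in> wvars n"
  shows "app T (Frob p g * h) - Frob p g * app T h \<in> Cp"
  using g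
proof (induction rule: mp_induct)
  case (Cst c)
  then show ?case using linD[OF WA_lin[OF T]] by simp
next
  case (Var i g)
  have "app T (Var i ^ p * (Frob p g * h)) - Var i ^ p * app T (Frob p g * h) \<in> Cp"
    using Var by (intro A1_Var_power T mvars_mult Frob_mvars h) auto
  moreover have "Var i ^ p * (app T (Frob p g * h) - Frob p g * app T h) \<in> Cp"
    using Var by (intro Cp.mult_I)
  then have "Var i ^ p * app T (Frob p g * h) - Var i ^ p * (Frob p g * app T h) \<in> Cp"
    by (simp only: right_diff_distrib)
  ultimately show ?case unfolding Frob_mult Frob_Var mult.assoc by (rule Cp.cong_trans)
next
  case (add f g)
  have "app T (Frob p (f + g) * h) - Frob p (f + g) * app T h =
    (app T (Frob p f * h) - Frob p f * app T h) + (app T (Frob p g * h) - Frob p g * app T h)"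
    by (simp add: Frob_add algebra_simps)
  then show ?case using add by (metis Cp.add_I)
qed

lemma pder_Frob_Cp: "pder i (Frob p g) \<in> Cp"
proof (induction g rule: mp_induct[OF mvars_UNIV])
  case (2 j g)
  have "pder i (Var j ^ p) \<in> Cp"
    unfolding pder_power mult.assoc by (rule p_Cp) simp
  then show ?case using 2 by (auto simp: Frob_mult Frob_Var pder_mult)
qed (auto simp: Frob_add)

lemma mul_Frob_A1:
  assumes g: "g \<in> wvars n"
  shows "mul (Frob p g) \<in> A1"
proof -
  have "Frob p g * app (Rop n i) f - app (Rop n i) (Frob p g * f) \<in> Cp" for i f
  proof -
    have "Frob p g * app (Rop n i) f - app (Rop n i) (Frob p g * f) =
       (if i \<le> n then - (pder (i + n) (Frob p g) * f) else 0)"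
      by (simp add: Rop_def pder_mult algebra_simps)
    then show ?thesis using pder_Frob_Cp by auto
  qed
  then show ?thesis using g by (auto simp: WA_def)
qed

lemma comm_Frob_J1:
  assumes T: "T \<in> A1" and g: "g \<in> wvars n"
  shows "comm T (mul (Frob p g)) \<in> J1"
proof -
  have "comm T (mul (Frob p g)) \<in> A1" using assms mul_Frob_A1 by auto
  then show ?thesis using A1_Frob[OF T _ g, of 1] by (subst J1_iff) (auto simp: comm_def)
qed

lemma Frob_Cp_iff: "Frob p l \<in> Cp \<longleftrightarrow> l \<in> Cp"
  using pcomp_coefs_in[OF p0, of "Frob p l" Ip "{#}"] pcomp_Frob[of "{#}" p l] p0 Frob_coefs_in[OF Ip_ideal]
  by auto

lemma mul_Frob_J1_iff: "g \<in> wvars n \<Longrightarrow> mul (Frob p g) \<in> J1 \<longleftrightarrow> g \<in> Cp"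
  by (simp add: J1_iff mul_Frob_A1 Frob_Cp_iff)

lemma mul_Frob_cancel:
  assumes "mul (Frob p g) * S \<in> J1" "g \<in> wvars n" "g \<notin> Cp" "S \<in> A1"
  shows "S \<in> J1"
proof -
  have "Frob p g * app S 1 \<in> Cp" using assms(1) unfolding WJ_def by auto
  then show ?thesis using assms Cp.prime_I Frob_Cp_iff J1_iff by blast
qed

text \<open>Commuting with the generators makes all partial derivatives of \<open>app T 1\<close>
  vanish modulo \<open>p\<close>, and then only exponents divisible by \<open>p\<close>
  survive.\<close>

lemma central_Frob:
  assumes T: "T \<in> A1" and c: "\<And>i. i \<in> {1..2*n} \<Longrightarrow> comm T (Yop n i) \<in> J1"
  defines "G \<equiv> pcomp p {#} (app T 1)"
  shows "G \<in> wvars n" "T - mul (Frob p G) \<in> J1"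
proof -
  define f where "f = app T 1"
  have f: "f \<in> wvars n" using WA_1[OF T] by (simp add: f_def)
  show G: "G \<in> wvars n" unfolding G_def by (intro pcomp_mvars p0 WA_1[OF T])
  have "f - Frob p G \<in> Cp"
  proof (rule coefs_in_pcomp[OF p0, of _ "2*n"])
    show "f - Frob p G \<in> wvars n" using f G by auto
    fix b assume b: "b \<in> box (2*n) p"
    then have bp: "\<forall>i. count b i < p" by (simp add: box_def)
    show "pcomp p b (f - Frob p G) \<in> Cp"
    proof (cases "b = {#}")
      case True
      then show ?thesis using bp by (simp add: pcomp_diff p0 pcomp_Frob) (simp add: G_def f_def)
    next
      case False
      then obtain i where i: "i \<in># b" by blast
      then have i2: "i \<in> {1..2*n}" using b by (auto simp: box_def)
      have "pder i f \<in> Cp" unfolding f_def by (rule centralizer_pder[OF Ip_ideal T c i2])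
      have "lookup f (repeat_mset p a + b) \<in> Ip" for a
      proof -
        obtain b' where b': "b = add_mset i b'" using i by (meson multi_member_split)
        define m where "m = repeat_mset p a + b'"
        have "of_nat (Suc (count m i)) * lookup f (add_mset i m) \<in> Ip"
          using \<open>pder i f \<in> Cp\<close> unfolding lookup_pder[symmetric] by (simp add: coefs_in_def)
        moreover have "\<not> p dvd Suc (count m i)"
        proof
          assume "p dvd Suc (count m i)"
          also have "Suc (count m i) = p * count a i + count b i" by (simp add: m_def b')
          finally have "p dvd count b i" by (simp add: dvd_add_right_iff)
          moreover have "0 < count b i" "count b i < p" using i bp by auto
          ultimately show False by (simp add: nat_dvd_not_less)
        qed
        then have "int (Suc (count m i)) \<notin> Ip" unfolding Ip_def mem_Collect_eq int_dvd_int_iff .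
        ultimately have "lookup f (add_mset i m) \<in> Ip" using Ip.prime_I by (metis of_nat_eq_iff)
        then show ?thesis by (simp add: m_def b')
      qed
      then show ?thesis using bp False
        by (simp add: pcomp_diff p0 pcomp_Frob) (simp add: coefs_in_def lookup_pcomp p0)
    qed
  qed simp
  then show "T - mul (Frob p G) \<in> J1"
    using T mul_Frob_A1[OF G] by (subst J1_iff) (auto simp: f_def)
qed

text \<open>Over the field of fractions of the centre, the ordered monomials in the \<open>P i\<close> with exponents
  below \<open>p\<close> are as many as the dimension of the Weyl algebra, and they are linearly independent over
  the centralizer of the \<open>P i\<close>. Hence this centralizer is the centre.\<close>

lemma centralizer_central:
  assumes P: "weyl_rels n J1 P" and PA: "\<And>i. i \<in> {1..2*n} \<Longrightarrow> P i \<in> A1"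
    and w: "w \<in> A1" and wP: "\<And>i. i \<in> {1..2*n} \<Longrightarrow> comm (P i) w \<in> J1"
    and T: "T \<in> A1"
  shows "comm w T \<in> J1"
proof (rule ccontr)
  assume nc: "comm w T \<notin> J1"
  let ?N = "2 * n" and ?E = "box (2*n) p"
  define v where "v ka b = pcomp p b (app (w ^ fst ka * omon P ?N (snd ka)) 1)" for ka b
  \<comment> \<open>Ordered monomials and their products with \<open>w\<close>: twice as many
    elements as the rank of the Weyl algebra over the centre. So there is a relation with central
    coefficients \<open>l\<close>; those belonging to one monomial \<open>a\<close> are collected in
    \<open>c a\<close>.\<close>
  define S where "S = {0,1::nat} \<times> ?E"
  have E: "finite ?E" "{#} \<in> ?E" using p0 finite_box by (auto simp: box_def)
  have omA: "omon P ?N a \<in> A1" for a by (intro M1.omon_A PA)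
  have vB: "v ka b \<in> wvars n" for ka b
    unfolding v_def using w by (intro pcomp_mvars p0 WA_1[of _ n Ip] M1.mult_A M1.power_A omA)
  have "card ?E < card S" "finite S"
    using E by (auto simp: S_def card_cartesian_product card_gt_0_iff)
  then obtain l where l: "\<forall>ka\<in>S. l ka \<in> wvars n" "\<exists>ka\<in>S. l ka \<notin> Cp"
      "\<forall>b\<in>?E. (\<Sum>ka\<in>S. l ka * v ka b) \<in> Cp"
    using cring_dependent[OF Cp_prime, of "wvars n" ?E S v] E vB by blast
  define c where "c a = mul (Frob p (l (0, a))) + mul (Frob p (l (1, a))) * w" for a
  have lA: "mul (Frob p (l (k, a))) \<in> A1" "l (k, a) \<in> wvars n" if "k \<in> {0,1}" "a \<in> ?E" for k a
    using l(1) that by (auto simp: S_def intro!: mul_Frob_A1)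
  have cA: "c a \<in> A1" if "a \<in> ?E" for a using lA that w by (auto simp: c_def)
  define Z where "Z = (\<Sum>a\<in>?E. c a * omon P ?N a)"
  have ZA: "Z \<in> A1" unfolding Z_def by (intro M1.sum_A M1.mult_A cA omA)
  have Z1: "app Z 1 = (\<Sum>ka\<in>S. Frob p (l ka) * app (w ^ fst ka * omon P ?N (snd ka)) 1)"
  proof -
    define F where "F ka = Frob p (l ka) * app (w ^ fst ka * omon P ?N (snd ka)) 1" for ka
    have "(\<Sum>ka\<in>S. F ka) = (\<Sum>k\<in>{0,1}. \<Sum>a\<in>?E. F (k, a))"
      by (simp only: S_def sum.cartesian_product case_prod_eta)
    also have "\<dots> = app Z 1"
      by (simp add: F_def Z_def app_sum_left c_def sum.distrib distrib_right)
    finally show ?thesis by (simp add: F_def)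
  qed
  have "app Z 1 \<in> Cp"
  proof (rule coefs_in_pcomp[OF p0, of _ ?N])
    fix b assume b: "b \<in> ?E"
    then have "pcomp p b (app Z 1) = (\<Sum>ka\<in>S. l ka * v ka b)"
      unfolding Z1 pcomp_sum[OF p0] by (intro sum.cong) (auto simp: pcomp_Frob_mult box_def v_def)
    then show "pcomp p b (app Z 1) \<in> Cp" using l(3) b by simp
  qed (use WA_1[OF ZA] in auto)
  then have ZJ: "Z \<in> J1" by (simp add: J1_iff ZA)
  have qA: "qgen n P j \<in> A1" if "j \<in> {1..2*n}" for j
    by (rule qgen_A[OF PA _ that]) unfold_locales
  \<comment> \<open>Each \<open>c a\<close> commutes with the partners of the \<open>P i\<close>,
    since its central parts and \<open>w\<close> do; so independence over the centralizer
    applies.\<close>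
  have cJ: "\<forall>a\<in>?E. c a \<in> J1"
  proof (rule M1.omon_independent[where q = "qgen n P" and P = P and N = ?N])
    show "comm (qgen n P j) (c a) \<in> J1" if "a \<in> ?E" "j \<in> {1..?N}" for a j
    proof -
      have cw: "comm (qgen n P j) w \<in> J1"
      proof (cases "j \<le> n")
        case True
        then show ?thesis using wP[of "j + n"] that by (auto simp: qgen_def)
      next
        case False
        then have "j - n \<in> {1..2*n}" using that by auto
        then show ?thesis using False wP[of "j - n"] by (simp add: qgen_def)
      qed
      have "comm (qgen n P j) (mul (Frob p (l (k, a)))) \<in> J1" if "k \<in> {0,1}" for k
        using lA[OF that \<open>a \<in> ?E\<close>] qA[OF \<open>j \<in> {1..?N}\<close>] by (intro comm_Frob_J1)
      then show ?thesis using cw w lA[OF _ that(1)] unfolding c_def by (auto simp: comm_mult)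
    qed
    show "x \<in> J1" if "a \<in> ?E" "0 < m" "m \<le> count a j" "x \<in> A1" "of_nat m * x \<in> J1" for a j m x
    proof -
      have "m < p" using that by (auto simp: box_def intro: le_less_trans)
      then show ?thesis using that p_not_dvd tors_J1 by blast
    qed
  qed (use E cA PA qA M1.comm_qgen[OF P] ZJ in \<open>auto simp: box_def Z_def\<close>)
  obtain k a where ka: "k \<in> {0,1}" "a \<in> ?E" "l (k, a) \<notin> Cp" using l(2) by (auto simp: S_def)
  \<comment> \<open>The commutator of \<open>T\<close> with \<open>c a\<close> isolates the
    coefficient of \<open>w\<close>, which must vanish since \<open>comm T w\<close> does not. Then
    the other coefficient vanishes as well, against the choice of \<open>a\<close>.\<close>
  have "comm T (c a) \<in> J1" using cJ ka T by auto
  moreover have "comm T (mul (Frob p (l (k, a)))) \<in> J1" if "k \<in> {0,1}" for k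
    using lA[OF that ka(2)] T by (intro comm_Frob_J1)
  then have "comm T (c a) - mul (Frob p (l (1, a))) * comm T w \<in> J1"
    using lA[OF _ ka(2)] w by (auto simp: c_def comm_mult)
  ultimately have "mul (Frob p (l (1, a))) * comm T w \<in> J1" using M1.cong_J by blast
  moreover have "comm T w \<notin> J1" using nc M1.uminus_J[of "comm T w"] by (auto simp: comm_swap[of T w])
  ultimately have l1: "l (1, a) \<in> Cp" using mul_Frob_cancel lA[OF _ ka(2)] w T by blast
  then have "mul (Frob p (l (1, a))) * w \<in> J1" using mul_Frob_J1_iff lA[OF _ ka(2)] w by blast
  moreover have "c a \<in> J1" using cJ ka by blast
  ultimately have "mul (Frob p (l (0, a))) \<in> J1" unfolding c_def by (metis M1.diff_J add_diff_cancel_right')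
  then have "l (0, a) \<in> Cp" using mul_Frob_J1_iff lA[OF _ ka(2)] by blast
  then show False using l1 ka by auto
qed

end


lemma app_of_nat_mult: "app T (of_nat k * f) = of_nat k * app T f"
  by (induction k) (auto simp: distrib_right)

lemma weyl_rels_mono: "weyl_rels n J P \<Longrightarrow> J \<subseteq> J' \<Longrightarrow> weyl_rels n J' P"
  unfolding weyl_rels_def by blast

lemma omon_replicate: "i \<in> {1..N} \<Longrightarrow> omon P N (replicate_mset k i) = (P i ^ k :: 'b::ring_1)"
proof (induction N)
  case (Suc N)
  show ?case
  proof (cases "i = Suc N")
    case True
    have "omon P N (replicate_mset k i) = omon P N {#}" using True by (intro omon_cong_count) auto
    then show ?thesis using True by simp
  qed (use Suc in auto)
qed simp

lemma osub_sum: "is_hom s \<Longrightarrow> osub s Q N (sum f A) = (\<Sum>a\<in>A. osub s Q N (f a))"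
  by (induction A rule: infinite_finite_induct) (auto simp: osub_add)

context ring_mod
begin

lemma comm_power_scalar:
  assumes "comm q x - of_int c \<in> J" "x \<in> A"
  shows "comm q (x ^ m) - of_int c * (of_nat m * x ^ (m - 1)) \<in> J"
proof (induction m)
  case (Suc m)
  have *: "x * (of_int c * (of_nat m * x ^ (m - 1))) = of_int c * (of_nat m * x ^ m)"
  proof -
    have "x * (of_int c * (of_nat m * x ^ (m - 1))) = of_int c * (of_nat m * (x * x ^ (m - 1)))"
      by (metis mult.assoc mult_of_int_commute of_nat_left_commute)
    then show ?thesis by (cases m) auto
  qed
  have "comm q (x ^ Suc m) - of_int c * (of_nat (Suc m) * x ^ (Suc m - 1))
      = (comm q x - of_int c) * x ^ m + x * (comm q (x ^ m) - of_int c * (of_nat m * x ^ (m - 1)))"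
    unfolding right_diff_distrib * by (simp add: comm_mult algebra_simps)
  then show ?case using assms Suc by auto
qed simp

lemma adp_power_one:
  assumes q: "comm q x - 1 \<in> J" "x \<in> A" "q \<in> A" and "k \<le> m"
  shows "adp q k (x ^ m) - of_nat (\<Prod>j<k. m - j) * x ^ (m - k) \<in> J"
  using \<open>k \<le> m\<close>
proof (induction k)
  case (Suc k)
  let ?f = "\<Prod>j<k. m - j"
  have "adp q k (x ^ m) - of_nat ?f * x ^ (m - k) \<in> J" using Suc by simp
  then have "comm q (adp q k (x ^ m) - of_nat ?f * x ^ (m - k)) \<in> J" using q(3) by (rule comm_J'[rotated])
  then have 1: "comm q (adp q k (x ^ m)) - of_nat ?f * comm q (x ^ (m - k)) \<in> J" by simp
  have "of_nat ?f * (comm q (x ^ (m - k)) - of_nat (m - k) * x ^ (m - k - 1)) \<in> J"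
    using comm_power_one[OF q] by blast
  then have 2: "of_nat ?f * comm q (x ^ (m - k)) - of_nat (\<Prod>j<Suc k. m - j) * x ^ (m - Suc k) \<in> J"
    by (simp only: right_diff_distrib prod.lessThan_Suc of_nat_mult mult.assoc diff_diff_left) simp
  from cong_trans[OF 1 2] show ?case by simp
qed simp

end

section \<open>Leading homogeneous components\<close>

definition hc :: "nat \<Rightarrow> ('v, 'r::comm_ring_1) mp \<Rightarrow> ('v, 'r) mp"
  where "hc d f = pfilt (\<lambda>m. size m = d) f"

lemma hc_add: "hc d (f + g) = hc d f + hc d g"
  by (simp add: hc_def pfilt_add)

lemma hc_0 [simp]: "hc d 0 = 0"
  by (simp add: hc_def)

lemma hc_sum: "hc d (sum f A) = (\<Sum>a\<in>A. hc d (f a))"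
  by (induction A rule: infinite_finite_induct) (auto simp: hc_add)

lemma hc_eq_0: "degle e f \<Longrightarrow> e < d \<Longrightarrow> hc d f = 0"
  by (rule poly_mapping_eqI) (auto simp: hc_def lookup_pfilt degle_def, metis in_keys_iff not_less)

lemma hc_Cst_mult: "hc d (Cst c * f) = Cst c * hc d f"
  by (rule poly_mapping_eqI) (auto simp: hc_def lookup_pfilt)

lemma hc_single_mult: "hc (size a + d) (single a c * f) = single a c * hc d f"
proof (rule poly_mapping_eqI)
  fix m
  show "lookup (hc (size a + d) (single a c * f)) m = lookup (single a c * hc d f) m"
    by (auto simp: hc_def lookup_pfilt lookup_single_mult size_Diff_submset) (metis add_diff_inverse_nat linorder_not_le not_le_imp_less size_mset_mono)+
qed

lemma hc_coefs_in: "0 \<in> I \<Longrightarrow> f \<in> coefs_in I \<Longrightarrow> hc d f \<in> coefs_in I"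
  by (auto simp: coefs_in_def hc_def lookup_pfilt)

lemma hc_diff: "hc d (f - g) = hc d f - hc d g"
  by (rule poly_mapping_eqI) (auto simp: hc_def lookup_pfilt lookup_minus)

lemma hc_Yop:
  assumes "degle d f"
  shows "hc (Suc d) (app (Yop n i) f) = Var i * hc d f"
proof -
  have "degle d (pder j f)" for j
    using assms by (fastforce simp: degle_def dest: keys_pder)
  then have "hc (Suc d) (pder j f) = 0" for j
    by (rule hc_eq_0) simp
  moreover have "hc (Suc d) (Var i * f) = Var i * hc d f"
    using hc_single_mult[of "{#i#}" d 1 f] by (simp add: Var_def)
  ultimately show ?thesis by (simp add: Yop_def hc_add)
qed

lemma hc_omon_Yop:
  assumes "set_mset m \<subseteq> {1..N}" "degle d f"
  shows "hc (size m + d) (app (omon (Yop n) N m) f) = omon Var N m * hc d f"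
proof -
  have "hc ((\<Sum>i\<in>{1..N}. count m i) + d) (app (omon (Yop n) N m) f) = omon Var N m * hc d f"
    if "degle d f" for d f
    using that
  proof (induction N arbitrary: d f)
    case (Suc N)
    have *: "degle (k + d) (app (Yop n (Suc N) ^ k) f) \<and>
        hc (k + d) (app (Yop n (Suc N) ^ k) f) = Var (Suc N) ^ k * hc d f" for k
      using Suc.prems by (induction k) (auto simp: hc_Yop intro: degle_Yop)
    from Suc.IH[OF conjunct1[OF *[of "count m (Suc N)"]]] conjunct2[OF *[of "count m (Suc N)"]]
    show ?case by (simp add: add_ac mult_ac)
  qed auto
  moreover have "size m = (\<Sum>i\<in>{1..N}. count m i)"
    unfolding size_multiset_overloaded_eq using assms
    by (intro sum.mono_neutral_left) (auto simp: not_in_iff)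
  ultimately show ?thesis using assms by metis
qed

text \<open>The derivatives in the operators \<open>Yop n i\<close> lower the degree, so the top
  component of a Weyl product is the commutative product of the top components.\<close>

lemma hc_wop:
  assumes f: "f \<in> wvars n" "degle d f" "degle e g"
  shows "hc (d + e) (app (wop n f) g) = hc d f * hc e g"
proof -
  have m: "set_mset m \<subseteq> {1..2*n}" "size m \<le> d" if "m \<in> keys f" for m
    using f that by (auto simp: mvars_def degle_def)
  have "hc (d + e) (app (wop n f) g) = (\<Sum>m\<in>keys f. Cst (lookup f m) * hc (d + e) (app (omon (Yop n) (2*n) m) g))"
    by (simp add: wop_def osub_def lext_def app_sum_left hc_sum hc_Cst_mult)
  also have "\<dots> = (\<Sum>m\<in>keys f. if size m = d then single m (lookup f m) * hc e g else 0)"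
  proof (rule sum.cong[OF refl])
    fix m assume mf: "m \<in> keys f"
    show "Cst (lookup f m) * hc (d + e) (app (omon (Yop n) (2*n) m) g)
        = (if size m = d then single m (lookup f m) * hc e g else 0)"
    proof (cases "size m = d")
      case True
      then show ?thesis
        using hc_omon_Yop[OF m(1)[OF mf] f(3), of n] m(1)[OF mf]
        by (simp add: omon_Var mult.assoc[symmetric]) (simp add: Cst_def mult_single)
    next
      case False
      then have "size m + e < d + e" using m(2)[OF mf] by simp
      then have "hc (d + e) (app (omon (Yop n) (2*n) m) g) = 0"
        using degle_omon_Yop[OF m(1)[OF mf] f(3)] by (rule hc_eq_0[rotated])
      then show ?thesis using False by simp
    qed
  qed
  also have "\<dots> = hc d f * hc e g"
    by (simp add: hc_def[of d f] pfilt_def sum.inter_filter[symmetric] sum_distrib_right)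
  finally show ?thesis .
qed

lemma hc_wop_power:
  assumes f: "f \<in> wvars n" "degle d f"
  shows "degle (k * d) (app (wop n f ^ k) 1)" "hc (k * d) (app (wop n f ^ k) 1) = hc d f ^ k"
proof (induction k)
  case 0
  show "hc (0 * d) (app (wop n f ^ 0) 1) = hc d f ^ 0"
    by (rule poly_mapping_eqI) (auto simp: hc_def lookup_pfilt lookup_one when_def)
next
  case (Suc k)
  show "degle (Suc k * d) (app (wop n f ^ Suc k) 1)"
    using degle_wop[OF f Suc(1)] by simp
  show "hc (Suc k * d) (app (wop n f ^ Suc k) 1) = hc d f ^ Suc k"
    using hc_wop[OF f Suc(1)] Suc(2) by simp
qed simp

section \<open>The Poisson bracket on the centre modulo p\<close>

context weyl_p
begin

lemma Yop_power_1: "i \<in> {1..2*n} \<Longrightarrow> app (Yop n i ^ k) 1 = Var i ^ k"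
  by (induction k) (auto simp: Yop_def pder_power pder_Var)

lemma power_centralizes:
  assumes P: "weyl_rels n J1 P" and PA: "\<And>i. i \<in> {1..2*n} \<Longrightarrow> P i \<in> A1"
    and i: "i \<in> {1..2*n}" and j: "j \<in> {1..2*n}"
  shows "comm (P j) (P i ^ p) \<in> J1"
proof -
  let ?c = "weyl_omega n j i"
  have "comm (P j) (P i ^ p) - of_int ?c * (of_nat p * P i ^ (p - 1)) \<in> J1"
    using P i j by (intro M1.comm_power_scalar PA) (auto simp: weyl_rels_def)
  moreover have "of_int ?c * (of_nat p * P i ^ (p - 1)) = of_nat p * (of_int ?c * P i ^ (p - 1))"
    by (rule of_nat_left_commute)
  moreover have "of_nat p * (of_int ?c * P i ^ (p - 1)) \<in> J1"
  proof (rule p_J1)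
    have "(of_int ?c :: (nat, int) mp endo) \<in> A1"
      using scal_WA'[OF Ip_ideal, of "?c" n] by (metis Cst_of_int mul_of_int of_int_eq_id id_apply)
    then show "of_int ?c * P i ^ (p - 1) \<in> A1" using PA[OF i] by auto
  qed simp
  ultimately show ?thesis using M1.cong_J by metis
qed

text \<open>Commuting with the \<open>P j\<close> follows from the Weyl relations, where a factor
  \<open>p\<close> appears; centrality in the whole algebra needs
  \<open>centralizer_central\<close>.\<close>

lemma power_central:
  assumes P: "weyl_rels n J1 P" and PA: "\<And>i. i \<in> {1..2*n} \<Longrightarrow> P i \<in> A1"
    and i: "i \<in> {1..2*n}" and T: "T \<in> A1"
  shows "comm (P i ^ p) T \<in> J1"
proof -
  have "P i ^ p \<in> A1" using PA[OF i] by blast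
  then show ?thesis using centralizer_central[OF P PA _ power_centralizes[OF P PA i] T] by blast
qed

text \<open>In the expansion of \<open>q ^ p * x\<close> the inner binomial coefficients vanish
  modulo \<open>p\<close>, so the \<open>p\<close>-th power of the inner derivation by
  \<open>q\<close> is the inner derivation by \<open>q ^ p\<close>.\<close>

lemma adp_p:
  assumes "q \<in> A1" "x \<in> A1" "comm (q ^ p) x \<in> J1"
  shows "adp q p x \<in> J1"
proof -
  define F where "F k = of_nat (p choose k) * (adp q k x * q ^ (p - k))" for k
  have "q ^ p * x = (\<Sum>k\<le>p. F k)" by (simp add: power_mult_adp F_def)
  also have "{..p} = insert 0 (insert p {0<..<p})" using p0 by auto
  also have "sum F \<dots> = x * q ^ p + adp q p x + (\<Sum>k\<in>{0<..<p}. F k)"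
    using p0 by (simp add: F_def add.assoc)
  finally have "adp q p x = comm (q ^ p) x - (\<Sum>k\<in>{0<..<p}. F k)"
    by (simp add: comm_def algebra_simps)
  moreover have "(\<Sum>k\<in>{0<..<p}. F k) \<in> J1"
    unfolding F_def using assms by (intro M1.sum_J p_J1 dvd_choose_prime p) auto
  ultimately show ?thesis using assms(3) by auto
qed

lemma adp_qgen:
  assumes P: "weyl_rels n J1 P" and PA: "\<And>i. i \<in> {1..2*n} \<Longrightarrow> P i \<in> A1"
    and j: "j \<in> {1..2*n}" and x: "x \<in> A1"
  shows "adp (qgen n P j) p x \<in> J1"
proof (rule adp_p[OF _ x])
  show "qgen n P j \<in> A1" by (rule qgen_A[OF PA _ j]) unfold_locales
  show "comm (qgen n P j ^ p) x \<in> J1"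
  proof (cases "j \<le> n")
    case True
    then show ?thesis using power_central[OF P PA _ x, of "j + n"] j by (simp add: qgen_def)
  next
    case False
    then have "j - n \<in> {1..2*n}" using j by auto
    then have "comm (P (j - n) ^ p) x \<in> J1" using power_central[OF P PA _ x, of "j - n"] by blast
    then show ?thesis using False M1.uminus_J
      by (cases "even p") (auto simp: qgen_def)
  qed
qed

lemma p_A2:
  assumes x: "x \<in> A1"
  shows "of_nat p * x \<in> A2"
proof -
  have lin: "lin (of_nat p * x)"
    using WA_lin[OF x] by (simp add: lin_def mult.left_commute)
  have "app (of_nat p * x) (app (Rop n i) f) - app (Rop n i) (app (of_nat p * x) f) \<in> Cq"
    if "i \<in> {1..2*n}" "f \<in> wvars n" for i f
  proof -
    have "app x (app (Rop n i) f) - app (Rop n i) (app x f) \<in> Cp"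
      using x that unfolding WA_def by blast
    then have "of_nat p * (app x (app (Rop n i) f) - app (Rop n i) (app x f)) \<in> Cq"
      by (simp only: mult_p_Cq)
    then show ?thesis by (simp add: app_of_nat_mult right_diff_distrib)
  qed
  then show ?thesis using x lin unfolding WA_def by auto
qed

text \<open>Together with \<open>J1_decomp\<close> this is the division by \<open>p\<close>:
  elements of \<open>A2\<close> that vanish modulo \<open>p\<close> are \<open>p\<close> times
  elements that are determined modulo \<open>p\<close>.\<close>

lemma p_J2: "x \<in> A1 \<Longrightarrow> of_nat p * x \<in> J2 \<longleftrightarrow> x \<in> J1"
  using WJ_iff[OF Iq_ideal p_A2] J1_iff by (auto simp: mult_p_Cq)

lemma J1_decomp:
  assumes "x \<in> A2" "x \<in> J1"
  obtains y where "y \<in> WA n {0}" "x - of_nat p * y \<in> J2"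
proof -
  have x1: "app x 1 \<in> wvars n" by (rule WA_1[OF assms(1)])
  obtain g where g: "app x 1 = of_nat p * g" using assms A2_A1 J1_iff Cp_iff by metis
  have gv: "g \<in> wvars n" using x1 p0 unfolding g by (auto simp: mvars_def in_keys_iff)
  have "wop n g \<in> A1" using wop_WA[OF Ip_ideal] .
  then have "x - of_nat p * wop n g \<in> A2" using assms p_A2 by auto
  then have "x - of_nat p * wop n g \<in> J2"
    by (simp add: WJ_iff[OF Iq_ideal] wop_1[OF gv] g)
  then show ?thesis using that wop_WA0 by blast
qed

text \<open>One factor \<open>p\<close> comes from \<open>x\<close>, the other one from the
  commutator with \<open>w\<close>.\<close>

lemma comm_central_J2:
  assumes w: "w \<in> A2" "\<And>T. T \<in> A1 \<Longrightarrow> comm w T \<in> J1" and x: "x \<in> A2" "x \<in> J1"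
  shows "comm w x \<in> J2"
proof -
  obtain y where y: "y \<in> WA n {0}" "x - of_nat p * y \<in> J2" using J1_decomp[OF x] .
  have yA: "y \<in> A1" using WA_0[OF Ip_ideal y(1)] .
  have "of_nat p * comm w y \<in> J2" using w(2)[OF yA] w(1) A2_A1 yA by (subst p_J2) auto
  moreover have "comm w (x - of_nat p * y) \<in> J2" using w(1) y(2) by (rule M2.comm_J')
  ultimately have "comm w (x - of_nat p * y) + of_nat p * comm w y \<in> J2" by blast
  then show ?thesis by simp
qed

text \<open>\<open>a \<mapsto> comm w a / p\<close> induces a derivation of the centre modulo \<open>p\<close>, that is of the polynomial
  ring in the \<open>p\<close>-th powers of the generators.\<close>

lemma center_derivation:
  assumes w: "w \<in> A2" "\<And>T. T \<in> A1 \<Longrightarrow> comm w T \<in> J1"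
  shows "\<exists>B. (\<forall>k\<in>{1..2*n}. B k \<in> wvars n) \<and>
    (\<forall>G\<in>wvars n. \<forall>a\<in>A2. a - mul (Frob p G) \<in> J1 \<longrightarrow>
      comm w a - of_nat p * mul (Frob p (\<Sum>k\<in>{1..2*n}. B k * pder k G)) \<in> J2)"
proof -
  have YA2: "Yop n k ^ p \<in> A2" if "k \<in> {1..2*n}" for k
    using Yop_WA'[OF Iq_ideal that] by auto
  have Yc: "comm (Yop n k ^ p) T \<in> J1" if "k \<in> {1..2*n}" "T \<in> A1" for k T
    using that by (intro power_central[OF weyl_rels_Yop[OF Ip_ideal]] Yop_WA'[OF Ip_ideal])
  have YF: "Yop n k ^ p - mul (Frob p (Var k)) \<in> J1" if k: "k \<in> {1..2*n}" for k
  proof -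
    have "Var k \<in> wvars n" using k by (rule mvars_Var)
    then show ?thesis
      using A2_A1[OF YA2[OF k]] mul_Frob_A1[of "Var k"] by (subst J1_iff) (auto simp: Yop_power_1[OF k] Frob_Var)
  qed
  have "\<exists>B\<in>wvars n. comm w (Yop n k ^ p) - of_nat p * mul (Frob p B) \<in> J2" if k: "k \<in> {1..2*n}" for k
  proof -
    let ?Z = "Yop n k ^ p"
    have x: "comm w ?Z \<in> A2" "comm w ?Z \<in> J1" using w YA2[OF k] A2_A1 by auto
    obtain V where V: "V \<in> WA n {0}" "comm w ?Z - of_nat p * V \<in> J2" using J1_decomp[OF x] .
    have VA: "V \<in> A1" using WA_0[OF Ip_ideal V(1)] .
    \<comment> \<open>The quotient \<open>V\<close> of \<open>comm w ?Z\<close> by \<open>p\<close>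
      is central again: in the Jacobi identity both inner commutators with \<open>Yop n i\<close>
      vanish modulo \<open>p\<close>, and the outer ones supply another factor
      \<open>p\<close>.\<close>
    have "comm V (Yop n i) \<in> J1" if i: "i \<in> {1..2*n}" for i
    proof -
      have Yi: "Yop n i \<in> A2" "Yop n i \<in> A1"
        using Yop_WA'[OF Iq_ideal i] Yop_WA'[OF Ip_ideal i] by auto
      have 1: "comm w (comm ?Z (Yop n i)) \<in> J2"
        using Yi YA2[OF k] Yc[OF k] by (intro comm_central_J2[OF w]) auto
      have 2: "comm ?Z (comm w (Yop n i)) \<in> J2"
        using Yi YA2[OF k] Yc[OF k] w by (intro comm_central_J2) auto
      have "comm (comm w ?Z) (Yop n i) \<in> J2"
        using M2.diff_J[OF 1 2] by (simp add: jacobi[of w])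
      moreover have "comm (comm w ?Z - of_nat p * V) (Yop n i) \<in> J2" using V(2) Yi(1) by (rule M2.comm_J)
      ultimately have "comm (comm w ?Z) (Yop n i) - comm (comm w ?Z - of_nat p * V) (Yop n i) \<in> J2" by (rule M2.diff_J)
      then have "comm (of_nat p * V) (Yop n i) \<in> J2" by simp
      moreover have "comm (of_nat p * V) (Yop n i) = of_nat p * comm V (Yop n i)"
        using comm_of_nat_mult[of "Yop n i" p V] by (simp add: comm_swap[of _ "Yop n i"])
      ultimately show ?thesis using p_J2 VA Yi by auto
    qed
    from central_Frob[OF VA this] obtain B where B: "B \<in> wvars n" "V - mul (Frob p B) \<in> J1" by blast
    have "of_nat p * (V - mul (Frob p B)) \<in> J2" using B VA mul_Frob_A1 by (subst p_J2) auto
    then have "(comm w ?Z - of_nat p * V) + of_nat p * (V - mul (Frob p B)) \<in> J2" using V(2) by blast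
    then show ?thesis using B(1) by (auto simp: right_diff_distrib)
  qed
  then obtain B where B: "\<And>k. k \<in> {1..2*n} \<Longrightarrow> B k \<in> wvars n"
    "\<And>k. k \<in> {1..2*n} \<Longrightarrow> comm w (Yop n k ^ p) - of_nat p * mul (Frob p (B k)) \<in> J2"
    by metis
  define D where "D G = (\<Sum>k\<in>{1..2*n}. B k * pder k G)" for G
  have D: "D G \<in> wvars n" if "G \<in> wvars n" for G
    unfolding D_def using that B(1) by (intro mvars_sum mvars_mult pder_mvars)
  \<comment> \<open>One lift \<open>a\<close> of each \<open>G\<close> is enough, because two lifts
    differ by an element of \<open>J1\<close>, whose commutator with \<open>w\<close> vanishes
    modulo p^2. The lifts are built from the powers \<open>Yop n k ^ p\<close> with the Leibniz
    rule.\<close>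
  have ex: "\<exists>a\<in>A2. a - mul (Frob p G) \<in> J1 \<and> comm w a - of_nat p * mul (Frob p (D G)) \<in> J2"
    if "G \<in> wvars n" for G
    using that
  proof (induction rule: mp_induct)
    case (Cst c)
    show ?case
      using WA_lin[OF w(1)] scal_WA'[OF Iq_ideal]
      by (intro bexI[of _ "scal c"]) (auto simp: comm_scal D_def)
  next
    case (Var k G)
    then obtain a where a: "a \<in> A2" "a - mul (Frob p G) \<in> J1" "comm w a - of_nat p * mul (Frob p (D G)) \<in> J2"
      by blast
    have k: "k \<in> {1..2*n}" by fact
    let ?Z = "Yop n k ^ p"
    have Z: "?Z \<in> A2" "?Z \<in> A1" using YA2[OF k] A2_A1 by auto
    have aA: "a \<in> A1" using a A2_A1 by blast
    have FG: "mul (Frob p G) \<in> A1" "mul (Frob p (D G)) \<in> A1" "mul (Frob p (B k)) \<in> A1" "mul (Frob p (Var k)) \<in> A1"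
      using Var D B(1) k mvars_Var[of k] by (auto intro!: mul_Frob_A1)
    have "?Z * a - mul (Frob p (Var k * G)) \<in> J1"
      unfolding Frob_mult mul_mult using YF[OF k] a(2) FG aA by (intro M1.cong_mult)
    moreover have "comm w (?Z * a) - of_nat p * mul (Frob p (D (Var k * G))) \<in> J2"
    proof -
      have DV: "D (Var k * G) = B k * G + Var k * D G"
      proof -
        have "D (Var k * G) = (\<Sum>i\<in>{1..2*n}. Var k * (B i * pder i G) + (if i = k then B i * G else 0))"
          unfolding D_def by (intro sum.cong) (auto simp: pder_Var_mult distrib_left mult.left_commute)
        then show ?thesis using k by (simp add: sum.distrib D_def sum_distrib_left)
      qed
      have 1: "(comm w ?Z - of_nat p * mul (Frob p (B k))) * a \<in> J2" using B(2)[OF k] a(1) by (rule M2.mult_J)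
      have 2: "?Z * (comm w a - of_nat p * mul (Frob p (D G))) \<in> J2" using Z(1) a(3) by (rule M2.mult_J')
      have 3: "of_nat p * (mul (Frob p (B k)) * (a - mul (Frob p G))) \<in> J2"
        using FG a(2) aA by (subst p_J2) auto
      have 4: "of_nat p * ((?Z - mul (Frob p (Var k))) * mul (Frob p (D G))) \<in> J2"
        using FG YF[OF k] Z(2) by (subst p_J2) auto
      have "comm w (?Z * a) - of_nat p * mul (Frob p (D (Var k * G)))
        = (comm w ?Z - of_nat p * mul (Frob p (B k))) * a
         + ?Z * (comm w a - of_nat p * mul (Frob p (D G)))
         + of_nat p * (mul (Frob p (B k)) * (a - mul (Frob p G)))
         + of_nat p * ((?Z - mul (Frob p (Var k))) * mul (Frob p (D G)))"
        unfolding DV Frob_add Frob_mult mul_add mul_mult comm_mult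
        by (simp add: distrib_left distrib_right left_diff_distrib right_diff_distrib of_nat_left_commute mult.assoc)
      then show ?thesis using 1 2 3 4 by (metis M2.add_J)
    qed
    ultimately show ?case using M2.mult_A[OF Z(1) a(1)] by blast
  next
    case (add G H)
    then obtain a b where a: "a \<in> A2" "a - mul (Frob p G) \<in> J1" "comm w a - of_nat p * mul (Frob p (D G)) \<in> J2"
      and b: "b \<in> A2" "b - mul (Frob p H) \<in> J1" "comm w b - of_nat p * mul (Frob p (D H)) \<in> J2"
      by blast
    have DD: "D (G + H) = D G + D H" by (simp add: D_def sum.distrib algebra_simps)
    have "(a + b) - mul (Frob p (G + H)) = (a - mul (Frob p G)) + (b - mul (Frob p H))"
      by (simp add: Frob_add mul_add)
    moreover have "comm w (a + b) - of_nat p * mul (Frob p (D (G + H)))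
       = (comm w a - of_nat p * mul (Frob p (D G))) + (comm w b - of_nat p * mul (Frob p (D H)))"
      by (simp add: DD Frob_add mul_add algebra_simps)
    ultimately show ?case using a b by (metis M1.add_J M2.add_J M2.add_A)
  qed
  have "comm w a - of_nat p * mul (Frob p (D G)) \<in> J2"
    if G: "G \<in> wvars n" and a: "a \<in> A2" "a - mul (Frob p G) \<in> J1" for G a
  proof -
    obtain b where b: "b \<in> A2" "b - mul (Frob p G) \<in> J1" "comm w b - of_nat p * mul (Frob p (D G)) \<in> J2"
      using ex[OF G] by blast
    have "a - b \<in> J1" using M1.diff_J[OF a(2) b(2)] by simp
    then have "comm w (a - b) \<in> J2" using a b by (intro comm_central_J2[OF w]) auto
    then have "comm w (a - b) + (comm w b - of_nat p * mul (Frob p (D G))) \<in> J2" using b(3) by (rule M2.add_J)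
    then show ?thesis by simp
  qed
  then show ?thesis using B(1) unfolding D_def by blast
qed

text \<open>In the expansion of \<open>q ^ p * x ^ p\<close> the last term contributes
  \<open>fact p\<close>. In the inner terms the binomial coefficient and the falling factorial from
  differentiating \<open>x ^ p\<close> are both divisible by \<open>p\<close>.\<close>

lemma comm_powers_one:
  assumes q: "comm q x - 1 \<in> J2" "x \<in> A2" "q \<in> A2"
  shows "comm (q ^ p) (x ^ p) - of_nat (fact p) \<in> J2"
proof -
  define F where "F k = of_nat (p choose k) * (adp q k (x ^ p) * q ^ (p - k))" for k
  have "q ^ p * x ^ p = (\<Sum>k\<le>p. F k)" by (simp add: power_mult_adp F_def)
  also have "{..p} = insert 0 (insert p {0<..<p})" using p0 by auto
  also have "sum F \<dots> = x ^ p * q ^ p + adp q p (x ^ p) + (\<Sum>k\<in>{0<..<p}. F k)"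
    using p0 by (simp add: F_def add.assoc)
  finally have eq: "comm (q ^ p) (x ^ p) - of_nat (fact p)
      = (adp q p (x ^ p) - of_nat (fact p)) + (\<Sum>k\<in>{0<..<p}. F k)"
    by (simp add: comm_def algebra_simps)
  have "(\<Prod>j<p. p - j) = fact p"
    by (simp add: fact_prod_rev atLeast0LessThan)
  then have 1: "adp q p (x ^ p) - of_nat (fact p) \<in> J2"
    using M2.adp_power_one[OF q, of p p] by simp
  have 2: "F k \<in> J2" if k: "k \<in> {0<..<p}" for k
  proof -
    let ?f = "\<Prod>j<k. p - j"
    have "p dvd ?f"
      using k dvd_prodI[of "{..<k}" 0 "\<lambda>j. p - j"] by simp
    then obtain c where c: "?f = p * c" by (auto simp: dvd_def)
    have "p dvd (p choose k)" using k by (intro dvd_choose_prime p) auto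
    then obtain d where d: "p choose k = p * d" by (auto simp: dvd_def)
    have "adp q k (x ^ p) - of_nat ?f * x ^ (p - k) \<in> J2"
      using k by (intro M2.adp_power_one q) auto
    then have a: "of_nat (p choose k) * ((adp q k (x ^ p) - of_nat ?f * x ^ (p - k)) * q ^ (p - k)) \<in> J2"
      using q by auto
    have "of_nat p * (of_nat d * (of_nat p * (of_nat c * x ^ (p - k)) * q ^ (p - k))) \<in> J2"
      using q A2_A1 p_J1[of p]
      by (subst p_J2) (auto intro!: M1.mult_J' M1.mult_J M1.mult_A M1.power_A p_J1)
    then have b: "of_nat (p choose k) * ((of_nat ?f * x ^ (p - k)) * q ^ (p - k)) \<in> J2"
      by (simp add: c d mult.assoc)
    from M2.add_J[OF a b] show ?thesis by (simp add: F_def algebra_simps)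
  qed
  show ?thesis unfolding eq using M2.add_J[OF 1 M2.sum_J[of "{0<..<p}" F]] 2 by blast
qed

lemma comm_powers:
  assumes P: "weyl_rels n J2 P" and PA: "\<And>i. i \<in> {1..2*n} \<Longrightarrow> P i \<in> A2"
    and i: "i \<in> {1..2*n}" and j: "j \<in> {1..2*n}"
  shows "comm (P i ^ p) (P j ^ p) - of_int (weyl_omega n i j) * of_nat (fact p) \<in> J2"
proof -
  have w: "comm (P i) (P j) - of_int (weyl_omega n i j) \<in> J2" using P i j by (auto simp: weyl_rels_def)
  have w': "comm (P j) (P i) - of_int (weyl_omega n j i) \<in> J2" using P i j by (auto simp: weyl_rels_def)
  consider "weyl_omega n i j = 1" | "weyl_omega n j i = 1" "weyl_omega n i j = -1" | "weyl_omega n i j = 0"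
  proof -
    have "weyl_omega n j i = - weyl_omega n i j" "weyl_omega n i j \<in> {-1, 0, 1}"
      by (auto simp: weyl_omega_def)
    then show ?thesis using that by auto
  qed
  then show ?thesis
  proof cases
    case 1
    then show ?thesis using comm_powers_one[of "P i" "P j"] w PA i j by simp
  next
    case 2
    then have "comm (P j ^ p) (P i ^ p) - of_nat (fact p) \<in> J2"
      using comm_powers_one[of "P j" "P i"] w' PA i j by simp
    then have "- (comm (P j ^ p) (P i ^ p) - of_nat (fact p)) \<in> J2" by (rule M2.uminus_J)
    then show ?thesis using 2 by (simp add: comm_swap[of "P j ^ p"] add.commute)
  next
    case 3
    then have "comm (P i) (P j) \<in> J2" using w by simp
    then have "comm (P i) (P j ^ p) \<in> J2" using PA j by (intro M2.comm_power_J)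
    then have "comm (P j ^ p) (P i) \<in> J2" using M2.uminus_J by (simp add: comm_swap[of "P j ^ p"])
    then have "comm (P j ^ p) (P i ^ p) \<in> J2" using PA i by (intro M2.comm_power_J)
    then have "comm (P i ^ p) (P j ^ p) \<in> J2" using M2.uminus_J by (simp add: comm_swap[of "P i ^ p"])
    then show ?thesis using 3 by simp
  qed
qed

text \<open>The bracket with \<open>P i ^ p\<close> is a derivation of the centre with coefficients
  \<open>B i k\<close>, and on \<open>P j ^ p\<close> it takes the value
  \<open>weyl_omega n i j\<close> times \<open>fact p\<close> divided by \<open>p\<close>. So the
  transposed Jacobian matrix is a factor of the symplectic matrix, up to the unit
  \<open>fact (p - 1)\<close>.\<close>

lemma jacobian_invertible:
  assumes P: "weyl_rels n J2 P" and PA: "\<And>i. i \<in> {1..2*n} \<Longrightarrow> P i \<in> A2"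
    and Phi: "\<And>i. i \<in> {1..2*n} \<Longrightarrow> Phi i \<in> wvars n"
      "\<And>i. i \<in> {1..2*n} \<Longrightarrow> P i ^ p - mul (Frob p (Phi i)) \<in> J1"
  obtains B where "\<And>i j. i \<in> {1..2*n} \<Longrightarrow> j \<in> {1..2*n} \<Longrightarrow>
      (\<Sum>k\<in>{1..2*n}. B i k * pder k (Phi j)) - of_int (weyl_omega n i j) * of_nat (fact (p - 1)) \<in> Cp"
proof -
  have P1: "weyl_rels n J1 P" using P J2_J1 by (auto intro: weyl_rels_mono)
  have PA1: "\<And>i. i \<in> {1..2*n} \<Longrightarrow> P i \<in> A1" using PA A2_A1 by blast
  have "\<exists>B. \<forall>j\<in>{1..2*n}. (\<Sum>k\<in>{1..2*n}. B k * pder k (Phi j)) - of_int (weyl_omega n i j) * of_nat (fact (p - 1)) \<in> Cp"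
    if i: "i \<in> {1..2*n}" for i
  proof -
    have w: "P i ^ p \<in> A2" using PA[OF i] by blast
    obtain B where B: "\<And>k. k \<in> {1..2*n} \<Longrightarrow> B k \<in> wvars n"
      and B2: "\<And>G a. G \<in> wvars n \<Longrightarrow> a \<in> A2 \<Longrightarrow> a - mul (Frob p G) \<in> J1 \<Longrightarrow>
      comm (P i ^ p) a - of_nat p * mul (Frob p (\<Sum>k\<in>{1..2*n}. B k * pder k G)) \<in> J2"
      using center_derivation[OF w power_central[OF P1 PA1 i]] by blast
    have "(\<Sum>k\<in>{1..2*n}. B k * pder k (Phi j)) - of_int (weyl_omega n i j) * of_nat (fact (p - 1)) \<in> Cp"
      if j: "j \<in> {1..2*n}" for j
    proof -
      let ?D = "\<Sum>k\<in>{1..2*n}. B k * pder k (Phi j)" and ?c = "weyl_omega n i j * int (fact (p - 1))"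
      have D: "?D \<in> wvars n" using B Phi(1)[OF j] by (intro mvars_sum mvars_mult pder_mvars)
      have "fact p = p * fact (p - 1)" using p0 by (simp add: fact_reduce)
      then have f: "of_int (weyl_omega n i j) * of_nat (fact p) = of_nat p * (of_int ?c :: (nat, int) mp endo)"
        by (simp add: of_nat_left_commute del: of_nat_fact)
      have "comm (P i ^ p) (P j ^ p) - of_nat p * mul (Frob p ?D) \<in> J2"
        using PA[OF j] Phi[OF j] by (intro B2) auto
      with comm_powers[OF P PA i j] have "(comm (P i ^ p) (P j ^ p) - of_nat p * of_int ?c) -
          (comm (P i ^ p) (P j ^ p) - of_nat p * mul (Frob p ?D)) \<in> J2"
        unfolding f by (rule M2.diff_J)
      then have "of_nat p * (mul (Frob p ?D) - of_int ?c) \<in> J2" by (simp add: right_diff_distrib)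
      moreover have cA: "mul (Frob p ?D) - of_int ?c \<in> A1"
      proof -
        have "(of_int ?c :: (nat, int) mp endo) \<in> A1"
          using scal_WA'[OF Ip_ideal, of "?c" n] by (metis Cst_of_int mul_of_int of_int_eq_id id_apply)
        then show ?thesis using mul_Frob_A1[OF D] by blast
      qed
      ultimately have "mul (Frob p ?D) - of_int ?c \<in> J1" by (simp only: p_J2)
      then have "app (mul (Frob p ?D) - of_int ?c) 1 \<in> Cp" using J1_iff cA by blast
      then have "Frob p ?D - of_int ?c \<in> Cp" by simp
      then have "Frob p (?D - of_int ?c) \<in> Cp"
        by (simp only: is_hom_diff[OF Frob_hom] is_hom_of_int[OF Frob_hom])
      then have "?D - of_int ?c \<in> Cp" by (simp only: Frob_Cp_iff)
      then show ?thesis by simp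
    qed
    then show ?thesis by blast
  qed
  then have "\<forall>i\<in>{1..2*n}. \<exists>B. \<forall>j\<in>{1..2*n}.
      (\<Sum>k\<in>{1..2*n}. B k * pder k (Phi j)) - of_int (weyl_omega n i j) * of_nat (fact (p - 1)) \<in> Cp"
    by blast
  from bchoice[OF this] obtain B where "\<forall>i\<in>{1..2*n}. \<forall>j\<in>{1..2*n}.
      (\<Sum>k\<in>{1..2*n}. B i k * pder k (Phi j)) - of_int (weyl_omega n i j) * of_nat (fact (p - 1)) \<in> Cp"
    by blast
  then show ?thesis using that[of B] by blast
qed

section \<open>Endomorphisms modulo p with an invertible map of the centre\<close>

context
  fixes P :: "nat \<Rightarrow> (nat, int) mp endo" and Phi Psi :: "nat \<Rightarrow> (nat, int) mp"
  assumes P: "weyl_rels n J1 P" and PA: "\<And>i. i \<in> {1..2*n} \<Longrightarrow> P i \<in> A1"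
    and Phi: "\<And>i. i \<in> {1..2*n} \<Longrightarrow> Phi i \<in> wvars n"
      "\<And>i. i \<in> {1..2*n} \<Longrightarrow> P i ^ p - mul (Frob p (Phi i)) \<in> J1"
    and Psi: "\<And>i. i \<in> {1..2*n} \<Longrightarrow> Psi i \<in> wvars n"
      "\<And>i. i \<in> {1..2*n} \<Longrightarrow> meval Cst Phi (Psi i) - Var i \<in> Cp"
      "\<And>i. i \<in> {1..2*n} \<Longrightarrow> meval Cst Psi (Phi i) - Var i \<in> Cp"
begin

abbreviation "HH \<equiv> osub scal P (2*n)"

lemma scal_facts: "is_hom (scal :: int \<Rightarrow> _)" "scal c \<in> A1" "T \<in> A1 \<Longrightarrow> comm T (scal c) = 0"
  using scal_WA'[OF Ip_ideal] by (auto intro: comm_scal[OF WA_lin])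

lemma HH_A1: "HH f \<in> A1"
  by (intro M1.osub_A scal_facts PA)

lemma HH_Cp: "f \<in> Cp \<Longrightarrow> HH f \<in> J1"
  by (rule M1.osub_coefs_in[OF scal_facts(1), where I = Ip]) (auto intro: PA scal_WJ[OF Ip_ideal])

lemma HH_cong: "f - g \<in> Cp \<Longrightarrow> HH f - HH g \<in> J1"
  using HH_Cp[of "f - g"] by (simp add: osub_diff scal_facts)

lemma HH_wop: "f \<in> wvars n \<Longrightarrow> HH (app (wop n g) f) - HH g * HH f \<in> J1"
  by (rule M1.osub_wop[OF scal_facts P PA])

lemma HH_Frob_mult:
  assumes "l \<in> wvars n" "h \<in> wvars n"
  shows "HH (Frob p l * h) - HH (Frob p l) * HH h \<in> J1"
proof -
  have "wop n (Frob p l) - mul (Frob p l) \<in> J1"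
    using assms wop_WA[OF Ip_ideal] mul_Frob_A1 by (subst J1_iff) (auto simp: wop_1[OF Frob_mvars[OF assms(1)]])
  then have "app (wop n (Frob p l) - mul (Frob p l)) h \<in> Cp" using assms unfolding WJ_def by blast
  then have "Frob p l * h - app (wop n (Frob p l)) h \<in> Cp" using Cp.cong_sym by simp
  then show ?thesis using HH_cong HH_wop[OF assms(2)] M1.cong_trans by blast
qed

lemma HH_Var_power: "i \<in> {1..2*n} \<Longrightarrow> HH (Var i ^ k) = P i ^ k"
  by (simp add: Var_power osub_single scal_facts omon_replicate)

lemma Phi_sub: "F \<in> wvars n \<Longrightarrow> meval Cst Phi F \<in> wvars n"
  using Phi by (auto intro: meval_mvars)

text \<open>A \<open>p\<close>-th power of a generator goes to \<open>P i ^ p\<close>, which is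
  \<open>Phi i\<close> in the \<open>p\<close>-th powers; so on the centre the endomorphism is the
  substitution of \<open>Phi\<close>.\<close>

lemma HH_Frob:
  assumes "F \<in> wvars n"
  shows "HH (Frob p F) - mul (Frob p (meval Cst Phi F)) \<in> J1"
  using assms
proof (induction rule: mp_induct)
  case (Cst c)
  then show ?case by (simp add: osub_Cst scal_facts meval_Cst)
next
  case (Var i F)
  have a: "HH (Frob p (Var i * F)) - HH (Frob p (Var i)) * HH (Frob p F) \<in> J1"
    unfolding Frob_mult using Var by (intro HH_Frob_mult) (auto intro: mvars_Var)
  have b: "HH (Frob p (Var i)) * HH (Frob p F) - mul (Frob p (Phi i)) * mul (Frob p (meval Cst Phi F)) \<in> J1"
    unfolding Frob_Var HH_Var_power[OF Var(1)] using Var Phi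
    by (intro M1.cong_mult HH_A1 mul_Frob_A1) auto
  from M1.cong_trans[OF a b] show ?case
    by (simp only: meval_mult meval_Var is_hom_Cst Frob_mult mul_mult)
next
  case (add F G)
  have "HH (Frob p (F + G)) - mul (Frob p (meval Cst Phi (F + G))) =
    (HH (Frob p F) - mul (Frob p (meval Cst Phi F))) + (HH (Frob p G) - mul (Frob p (meval Cst Phi G)))"
    by (simp add: Frob_add osub_add scal_facts meval_add mul_add)
  then show ?case using add by (metis M1.add_J)
qed

lemma sub_inverse:
  assumes "F \<in> wvars n"
  shows "meval Cst Psi (meval Cst Phi F) - F \<in> Cp" "meval Cst Phi (meval Cst Psi F) - F \<in> Cp"
proof -
  have 1: "meval Cst Psi (meval Cst Phi F) = meval Cst (\<lambda>i. meval Cst Psi (Phi i)) F"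
    by (simp add: meval_hom[OF is_hom_Cst is_hom_meval[OF is_hom_Cst]] meval_Cst)
  have 2: "meval Cst Phi (meval Cst Psi F) = meval Cst (\<lambda>i. meval Cst Phi (Psi i)) F"
    by (simp add: meval_hom[OF is_hom_Cst is_hom_meval[OF is_hom_Cst]] meval_Cst)
  have "meval Cst (\<lambda>i. meval Cst Psi (Phi i)) F - meval Cst Var F \<in> Cp"
    by (rule meval_cong_coefs[OF Ip_ideal assms]) (rule Psi(3))
  then show "meval Cst Psi (meval Cst Phi F) - F \<in> Cp" by (simp add: 1 meval_id)
  have "meval Cst (\<lambda>i. meval Cst Phi (Psi i)) F - meval Cst Var F \<in> Cp"
    by (rule meval_cong_coefs[OF Ip_ideal assms]) (rule Psi(2))
  then show "meval Cst Phi (meval Cst Psi F) - F \<in> Cp" by (simp add: 2 meval_id)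
qed

text \<open>The coordinates of \<open>f\<close> over the centre go to central elements, over which
  the ordered monomials in \<open>P\<close> with exponents below \<open>p\<close> are independent.
  Then \<open>Psi\<close> recovers the coordinates.\<close>

lemma HH_inj:
  assumes f: "f \<in> wvars n" and J: "HH f \<in> J1"
  shows "f \<in> Cp"
proof -
  let ?E = "box (2*n) p"
  define c where "c b = mul (Frob p (meval Cst Phi (pcomp p b f)))" for b
  have fb: "pcomp p b f \<in> wvars n" for b by (intro pcomp_mvars p0 f)
  have cA: "c b \<in> A1" for b unfolding c_def by (intro mul_Frob_A1 Phi_sub fb)
  have fS: "HH f = (\<Sum>b\<in>?E. HH (Frob p (pcomp p b f) * single b 1))"
    by (subst Frob_decomp[OF p0 f]) (simp add: osub_sum scal_facts)
  have dS: "(\<Sum>b\<in>?E. HH (Frob p (pcomp p b f) * single b 1)) - (\<Sum>b\<in>?E. c b * omon P (2*n) b) \<in> J1"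
    unfolding sum_subtractf[symmetric]
  proof (rule M1.sum_J)
    fix b assume b: "b \<in> ?E"
    then have bv: "single b 1 \<in> wvars n" by (auto simp: box_def intro: mvars_single)
    have "HH (Frob p (pcomp p b f) * single b 1) - HH (Frob p (pcomp p b f)) * HH (single b 1) \<in> J1"
      by (rule HH_Frob_mult[OF fb bv])
    moreover have "(HH (Frob p (pcomp p b f)) - c b) * HH (single b 1) \<in> J1"
      using HH_Frob[OF fb] HH_A1 unfolding c_def by (rule M1.mult_J)
    ultimately have "HH (Frob p (pcomp p b f) * single b 1) - c b * HH (single b 1) \<in> J1"
      unfolding left_diff_distrib by (rule M1.cong_trans)
    then show "HH (Frob p (pcomp p b f) * single b 1) - c b * omon P (2*n) b \<in> J1"
      by (simp add: osub_single scal_facts)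
  qed
  have s: "(\<Sum>b\<in>?E. c b * omon P (2*n) b) \<in> J1" using M1.cong_J[OF dS] J unfolding fS by blast
  have qA: "qgen n P j \<in> A1" if "j \<in> {1..2*n}" for j
    by (rule qgen_A[OF PA _ that]) unfold_locales
  have "\<forall>b\<in>?E. c b \<in> J1"
  proof (rule M1.omon_independent[where q = "qgen n P" and P = P and N = "2*n"])
    show "comm (qgen n P j) (c b) \<in> J1" if "b \<in> ?E" "j \<in> {1..2*n}" for b j
      unfolding c_def by (intro comm_Frob_J1 qA that Phi_sub fb)
    show "x \<in> J1" if "a \<in> ?E" "0 < m" "m \<le> count a j" "x \<in> A1" "of_nat m * x \<in> J1" for a j m x
    proof -
      have "m < p" using that by (auto simp: box_def intro: le_less_trans)
      then show ?thesis using that p_not_dvd tors_J1 by blast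
    qed
  qed (use finite_box cA PA qA M1.comm_qgen[OF P] s in \<open>auto simp: box_def\<close>)
  then have "meval Cst Phi (pcomp p b f) \<in> Cp" if "b \<in> ?E" for b
    using that mul_Frob_J1_iff[OF Phi_sub[OF fb]] unfolding c_def by blast
  then have "pcomp p b f \<in> Cp" if "b \<in> ?E" for b
    using that sub_inverse(1)[OF fb, of b] meval_coefs_in[OF Ip_ideal] Cp.cong_I by metis
  then show ?thesis by (intro coefs_in_pcomp[OF p0 f]) auto
qed

text \<open>By Taylor expansion only the centralizer of the \<open>P i\<close> has to be reached. It
  is the centre, which is reached because the substitution of \<open>Phi\<close> is
  invertible.\<close>

lemma HH_surj:
  assumes "x \<in> A1"
  shows "\<exists>g\<in>wvars n. x - HH g \<in> J1"
proof -
  define H where "H = {x \<in> A1. \<exists>g\<in>wvars n. x - HH g \<in> J1}"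
  have qA: "qgen n P j \<in> A1" if "j \<in> {1..2*n}" for j
    by (rule qgen_A[OF PA _ that]) unfold_locales
  have "x \<in> H"
  proof (rule M1.taylor_closed[where q = "qgen n P" and P = P and N = "2*n" and p = p])
    show "x + y \<in> H" if xy: "x \<in> H" "y \<in> H" for x y
    proof -
      obtain g h where "g \<in> wvars n" "x - HH g \<in> J1" "h \<in> wvars n" "y - HH h \<in> J1"
        using xy by (auto simp: H_def)
      moreover have "(x + y) - HH (g + h) = (x - HH g) + (y - HH h)" by (simp add: osub_add scal_facts)
      ultimately show ?thesis using xy unfolding H_def by (metis (mono_tags, lifting) M1.add_A M1.add_J mem_Collect_eq mvars_add)
    qed
    show "x * P j \<in> H" if x: "x \<in> H" and j: "j \<in> {1..2*n}" for x j
    proof -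
      obtain g where g: "g \<in> wvars n" "x - HH g \<in> J1" using x by (auto simp: H_def)
      have Vj: "Var j \<in> wvars n" using j by (rule mvars_Var)
      have "HH g * P j - HH (app (wop n g) (Var j)) \<in> J1"
        using HH_wop[OF Vj, of g] HH_Var_power[OF j, of 1] M1.cong_sym by simp
      moreover have "(x - HH g) * P j \<in> J1" using g PA[OF j] by blast
      ultimately have "x * P j - HH (app (wop n g) (Var j)) \<in> J1"
        unfolding left_diff_distrib using M1.cong_trans by blast
      moreover have "app (wop n g) (Var j) \<in> wvars n" using wop_WA0 Vj unfolding WA_def by blast
      ultimately show ?thesis using x PA[OF j] unfolding H_def by blast
    qed
    show "x \<in> H" if m: "\<not> p dvd m" and x: "x \<in> A1" "of_nat m * x \<in> H" for m x
    proof -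
      obtain g where g: "g \<in> wvars n" "of_nat m * x - HH g \<in> J1" using x by (auto simp: H_def)
      \<comment> \<open>Division by \<open>m\<close> is multiplication by its inverse
        \<open>m'\<close> modulo \<open>p\<close>.\<close>
      obtain m' k where "m * m' = Suc (p * k)" using bezout_prime[OF p m] by blast
      then have k: "m' * m = 1 + p * k" by (simp add: mult.commute)
      have "of_nat m' * (of_nat m * x - HH g) \<in> J1" using g by auto
      moreover have "of_nat m' * (of_nat m * x) = x + of_nat p * (of_nat k * x)"
        using arg_cong[OF k, of "\<lambda>c. of_nat c * x"] by (simp add: distrib_right mult.assoc)
      moreover have "of_nat m' * HH g = HH (Cst (int m') * g)"
        using osub_Cst_mult[OF scal_facts(1), of P "2*n" "int m'" g] by simp
      ultimately have "x + of_nat p * (of_nat k * x) - HH (Cst (int m') * g) \<in> J1"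
        by (simp add: right_diff_distrib)
      moreover have "of_nat p * (of_nat k * x) \<in> J1" using x by (intro p_J1) auto
      ultimately have "x + of_nat p * (of_nat k * x) - HH (Cst (int m') * g) - of_nat p * (of_nat k * x) \<in> J1"
        by (rule M1.diff_J)
      then have "x - HH (Cst (int m') * g) \<in> J1" by simp
      moreover have "Cst (int m') * g \<in> wvars n" using g by blast
      ultimately show ?thesis using x unfolding H_def by blast
    qed
    show "c \<in> H" if c: "c \<in> A1" "\<And>j. j \<in> {1..2*n} \<Longrightarrow> comm (qgen n P j) c \<in> J1" for c
    proof -
      have Pc: "comm (P i) c \<in> J1" if i: "i \<in> {1..2*n}" for i
      proof (cases "i \<le> n")
        case True
        then have "i + n \<in> {1..2*n}" "qgen n P (i + n) = - P i" using i by (auto simp: qgen_def)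
        then show ?thesis using c(2)[of "i + n"] M1.uminus_J by fastforce
      next
        case False
        then have "i - n \<in> {1..2*n}" "qgen n P (i - n) = P i" using i by (auto simp: qgen_def)
        then show ?thesis using c(2)[of "i - n"] by simp
      qed
      have "comm c T \<in> J1" if "T \<in> A1" for T
        by (rule centralizer_central[OF P PA c(1) Pc that])
      then have "comm c (Yop n i) \<in> J1" if "i \<in> {1..2*n}" for i
        using Yop_WA'[OF Ip_ideal that] by blast
      from central_Frob[OF c(1) this] obtain G where G: "G \<in> wvars n" "c - mul (Frob p G) \<in> J1" by blast
      define F where "F = meval Cst Psi G"
      have F: "F \<in> wvars n" unfolding F_def using G Psi by (auto intro: meval_mvars)
      have "Frob p (G - meval Cst Phi F) \<in> Cp"
        unfolding F_def using Cp.cong_sym[OF sub_inverse(2)[OF G(1)]] by (rule Frob_coefs_in[OF Ip_ideal])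
      then have "mul (Frob p G) - mul (Frob p (meval Cst Phi F)) \<in> J1"
        using mul_Frob_A1[OF G(1)] mul_Frob_A1[OF Phi_sub[OF F]]
        by (subst J1_iff) (auto simp: is_hom_diff[OF Frob_hom])
      then have "c - HH (Frob p F) \<in> J1"
        using G(2) M1.cong_sym[OF HH_Frob[OF F]] M1.cong_trans by blast
      then show ?thesis using c(1) F unfolding H_def by blast
    qed
    show "comm (comm (qgen n P i) (qgen n P j)) x \<in> J1" if "i \<in> {1..2*n}" "j \<in> {1..2*n}" "x \<in> A1" for i j x
      by (rule M1.comm_comm_qgen[OF P that PA])
  qed (use assms PA qA p M1.comm_qgen[OF P] adp_qgen[OF P PA] in auto)
  then show ?thesis by (simp add: H_def)
qed

text \<open>If \<open>HH g\<close> is a generator, then \<open>g\<close> has the degree of its \<open>p\<close>-th power divided by \<open>p\<close>, and this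
  power is \<open>Psi i\<close> in the variables \<open>y\<^sub>j\<^sup>p\<close>.\<close>

lemma generator_in_image:
  assumes D: "\<And>i. i \<in> {1..2*n} \<Longrightarrow> degle D (Psi i)" and i: "i \<in> {1..2*n}"
  shows "\<exists>g\<in>wvars n. degle D g \<and> Yop n i - HH g \<in> J1"
proof -
  obtain g0 where g0: "g0 \<in> wvars n" "Yop n i - HH g0 \<in> J1"
    using HH_surj[OF Yop_WA'[OF Ip_ideal i]] by blast
  \<comment> \<open>Dropping the coefficients divisible by \<open>p\<close> makes the leading
    component of \<open>g\<close> nonzero modulo \<open>p\<close>.\<close>
  define g where "g = pfilt (\<lambda>m. lookup g0 m \<notin> Ip) g0"
  have g: "g \<in> wvars n" using g0 by (auto simp: g_def)
  have "g0 - g \<in> Cp" by (auto simp: coefs_in_def g_def lookup_minus lookup_pfilt)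
  then have YH: "Yop n i - HH g \<in> J1" using g0(2) HH_cong M1.cong_trans by blast
  have kg: "lookup g m \<notin> Ip" if "m \<in> keys g" for m
    using that by (auto simp: g_def keys_pfilt lookup_pfilt)
  have pw: "app (wop n g ^ k) 1 \<in> wvars n" for k
    using wop_WA[OF Ip_ideal, of n g] by (intro WA_1[of _ n Ip]) auto
  have HHp: "HH (app (wop n g ^ k) 1) - HH g ^ k \<in> J1" for k
  proof (induction k)
    case 0
    show ?case using osub_Cst[OF scal_facts(1), of P "2*n" 1] by simp
  next
    case (Suc k)
    have a: "HH (app (wop n g) (app (wop n g ^ k) 1)) - HH g * HH (app (wop n g ^ k) 1) \<in> J1"
      by (rule HH_wop[OF pw])
    have "HH g * (HH (app (wop n g ^ k) 1) - HH g ^ k) \<in> J1" using HH_A1 Suc by (rule M1.mult_J')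
    then have "HH g * HH (app (wop n g ^ k) 1) - HH g * HH g ^ k \<in> J1" by (simp only: right_diff_distrib)
    from M1.cong_trans[OF a this] show ?case by simp
  qed
  have Vi: "Var i \<in> wvars n" using i by (rule mvars_Var)
  have cp: "x ^ k - y ^ k \<in> J1" if "x - y \<in> J1" "x \<in> A1" "y \<in> A1" for x y k
    using that by (induction k) (auto intro!: M1.cong_mult)
  have 1: "HH g ^ p - Yop n i ^ p \<in> J1"
    using M1.cong_sym[OF YH] HH_A1 Yop_WA'[OF Ip_ideal i] by (rule cp)
  have 2: "Yop n i ^ p - mul (Frob p (Var i)) \<in> J1"
    using Yop_WA'[OF Ip_ideal i] mul_Frob_A1[OF Vi] by (subst J1_iff) (auto simp: Yop_power_1[OF i] Frob_Var)
  have 3: "mul (Frob p (Var i)) - mul (Frob p (meval Cst Phi (Psi i))) \<in> J1"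
  proof -
    have "Frob p (Var i - meval Cst Phi (Psi i)) \<in> Cp"
      using Cp.cong_sym[OF Psi(2)[OF i]] by (rule Frob_coefs_in[OF Ip_ideal])
    then show ?thesis
      using mul_Frob_A1[OF Vi] mul_Frob_A1[OF Phi_sub[OF Psi(1)[OF i]]]
      by (subst J1_iff) (auto simp: is_hom_diff[OF Frob_hom])
  qed
  have 4: "mul (Frob p (meval Cst Phi (Psi i))) - HH (Frob p (Psi i)) \<in> J1"
    by (rule M1.cong_sym[OF HH_Frob[OF Psi(1)[OF i]]])
  have "HH (app (wop n g ^ p) 1) - HH (Frob p (Psi i)) \<in> J1"
    using HHp[of p] 1 2 3 4 by (meson M1.cong_trans)
  then have "HH (app (wop n g ^ p) 1 - Frob p (Psi i)) \<in> J1" by (simp add: osub_diff scal_facts)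
  then have eq: "app (wop n g ^ p) 1 - Frob p (Psi i) \<in> Cp"
    using pw Psi(1)[OF i] by (intro HH_inj) auto
  have dF: "degle (p * D) (Frob p (Psi i))"
  proof -
    have "degle (p * d) (Frob p (single m c))" if "size m \<le> d" for m :: "nat multiset" and c :: int and d
    proof -
      have "prod_mset (image_mset (\<lambda>i. Var i ^ p) m) = (single (repeat_mset p m) 1 :: (nat, int) mp)"
        by (induction m) (auto simp: Var_power mult_single)
      then have "Frob p (single m c) = single (repeat_mset p m) c"
        by (simp add: Frob_def meval_single) (simp add: Cst_def mult_single)
      then show ?thesis using that by (auto intro!: degle_single)
    qed
    then have "degle (p * D) (\<Sum>m\<in>keys (Psi i). Frob p (single m (lookup (Psi i) m)))"
      using D[OF i] by (intro degle_sum) (auto simp: degle_def)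
    also have "(\<Sum>m\<in>keys (Psi i). Frob p (single m (lookup (Psi i) m))) = Frob p (Psi i)"
      by (subst (3) pm_sum_single) (simp add: is_hom_sum[OF Frob_hom])
    finally show ?thesis .
  qed
  \<comment> \<open>If the degree \<open>e\<close> of \<open>g\<close> exceeded \<open>D\<close>,
    the component of degree \<open>p * e\<close> of its Weyl power, which is
    \<open>hc e g ^ p\<close>, would vanish modulo \<open>p\<close>; but polynomials modulo
    \<open>p\<close> form a domain.\<close>
  have "degle D g"
  proof (rule ccontr)
    assume nD: "\<not> degle D g"
    define e where "e = Max (size ` keys g)"
    have "keys g \<noteq> {}" using nD by (auto simp: degle_def)
    then have "e \<in> size ` keys g" unfolding e_def by (intro Max_in) auto
    then obtain m where m: "m \<in> keys g" "size m = e" by blast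
    have ge: "degle e g" unfolding e_def degle_def by simp
    have "D < e" using nD ge degle_mono not_less by blast
    then have "p * D < p * e" using p0 by simp
    then have "hc (p * e) (Frob p (Psi i)) = 0" using dF by (rule hc_eq_0[rotated])
    moreover have "hc (p * e) (app (wop n g ^ p) 1 - Frob p (Psi i)) \<in> Cp"
      using eq by (intro hc_coefs_in) auto
    ultimately have "hc e g ^ p \<in> Cp" using hc_wop_power(2)[OF g ge, of p] by (simp add: hc_diff)
    then have "hc e g \<in> Cp" using Cp.power_notin by blast
    then have "lookup (hc e g) m \<in> Ip" by (simp add: coefs_in_def)
    then show False using kg[OF m(1)] m(2) by (simp add: hc_def lookup_pfilt)
  qed
  then show ?thesis using g YH by blast
qed

end

end


section \<open>Specialization of finitely generated domains to integers modulo \<open>p\<^sup>2\<close>\<close>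

abbreviation "pcf \<equiv> Polynomial.coeff"
abbreviation "pdeg \<equiv> Polynomial.degree"

section \<open>Univariate polynomials with coefficients in a subring\<close>

definition subring_of :: "'r::comm_ring_1 set \<Rightarrow> bool"
  where "subring_of S \<longleftrightarrow> 0 \<in> S \<and> 1 \<in> S \<and> (\<forall>x\<in>S. \<forall>y\<in>S. x + y \<in> S \<and> x - y \<in> S \<and> x * y \<in> S)"

definition polys_over :: "'r::comm_ring_1 set \<Rightarrow> 'r poly set"
  where "polys_over S = {f. \<forall>i. pcf f i \<in> S}"

lemma subring_of_mvars [simp]: "subring_of (mvars V)"
  by (auto simp: subring_of_def)

lemma subring_of_UNIV [simp]: "subring_of UNIV"
  by (simp add: subring_of_def)

context
  fixes S :: "'r::comm_ring_1 set"
  assumes S: "subring_of S"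
begin

lemma subring_sum: "(\<And>i. i \<in> A \<Longrightarrow> f i \<in> S) \<Longrightarrow> sum f A \<in> S"
  using S by (induction A rule: infinite_finite_induct) (auto simp: subring_of_def)

lemma subring_power: "x \<in> S \<Longrightarrow> x ^ k \<in> S"
  using S by (induction k) (auto simp: subring_of_def)

lemma polys_over_add: "f \<in> polys_over S \<Longrightarrow> g \<in> polys_over S \<Longrightarrow> f + g \<in> polys_over S"
  and polys_over_diff: "f \<in> polys_over S \<Longrightarrow> g \<in> polys_over S \<Longrightarrow> f - g \<in> polys_over S"
  and polys_over_smult: "c \<in> S \<Longrightarrow> f \<in> polys_over S \<Longrightarrow> smult c f \<in> polys_over S"
  and polys_over_0: "0 \<in> polys_over S"
  and polys_over_pCons: "c \<in> S \<Longrightarrow> f \<in> polys_over S \<Longrightarrow> pCons c f \<in> polys_over S"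
  and polys_over_monom: "c \<in> S \<Longrightarrow> Polynomial.monom c k \<in> polys_over S"
  using S by (auto simp: polys_over_def subring_of_def coeff_pCons split: nat.split)

lemma polys_over_mult: "f \<in> polys_over S \<Longrightarrow> g \<in> polys_over S \<Longrightarrow> f * g \<in> polys_over S"
  using S by (auto simp: polys_over_def coeff_mult subring_of_def intro!: subring_sum)

lemma poly_in_subring: "f \<in> polys_over S \<Longrightarrow> x \<in> S \<Longrightarrow> poly f x \<in> S"
  using S by (auto simp: poly_altdef polys_over_def subring_of_def intro!: subring_sum subring_power)

text \<open>Division by a polynomial that need not be monic, at the price of a power of its leading
  coefficient. The last clause bounds the degree of the quotient, so that minimality of a degree can
  be applied to it.\<close>

lemma pseudo_division:
  assumes f: "f \<in> polys_over S" "\<forall>i>d. pcf f i = 0" and g: "g \<in> polys_over S" "\<forall>i\<ge>m. pcf g i = 0"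
  shows "\<exists>k q r. q \<in> polys_over S \<and> r \<in> polys_over S \<and> smult (pcf f d ^ k) g = f * q + r
     \<and> (\<forall>i\<ge>d. pcf r i = 0) \<and> (\<forall>i. m \<le> i + d \<longrightarrow> pcf q i = 0)"
  using g
proof (induction m arbitrary: g)
  case 0
  then have "g = 0" by (simp add: poly_eq_iff)
  then show ?case using polys_over_0 by (intro exI[of _ 0]) auto
next
  case (Suc m)
  show ?case
  proof (cases "Suc m \<le> d")
    case True
    then show ?thesis using Suc.prems polys_over_0
      by (intro exI[of _ 0] exI[of _ 0] exI[of _ g]) auto
  next
    case False
    define l where "l = pcf f d"
    define h where "h = Polynomial.monom (pcf g m) (m - d)"
    define g' where "g' = smult l g - h * f"
    have lS: "l \<in> S" using f by (simp add: l_def polys_over_def)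
    have hS: "h \<in> polys_over S"
      unfolding h_def by (rule polys_over_monom) (use Suc.prems in \<open>simp add: polys_over_def\<close>)
    have g'S: "g' \<in> polys_over S"
      unfolding g'_def by (intro polys_over_diff polys_over_smult polys_over_mult lS Suc.prems hS f)
    have "pcf g' i = 0" if "m \<le> i" for i
    proof (cases "i = m")
      case True
      then show ?thesis using False by (simp add: g'_def h_def coeff_monom_mult) (simp add: l_def mult.commute)
    next
      case neq: False
      then have "pcf g i = 0" "pcf f (i - (m - d)) = 0" using Suc.prems(2) f(2) that False by auto
      then show ?thesis by (simp add: g'_def h_def coeff_monom_mult)
    qed
    then obtain k q r where q: "q \<in> polys_over S" "r \<in> polys_over S" "smult (l ^ k) g' = f * q + r"
       "\<forall>i\<ge>d. pcf r i = 0" "\<forall>i. m \<le> i + d \<longrightarrow> pcf q i = 0"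
      using Suc.IH[OF g'S] unfolding l_def by blast
    have "smult (l ^ Suc k) g = f * (smult (l ^ k) h + q) + r"
      using q(3) by (simp add: g'_def smult_diff_right algebra_simps)
    moreover have "smult (l ^ k) h + q \<in> polys_over S"
      by (intro polys_over_add polys_over_smult hS q subring_power lS)
    moreover have "pcf (smult (l ^ k) h + q) i = 0" if "Suc m \<le> i + d" for i
      using q(5) that False by (simp add: h_def)
    ultimately show ?thesis using q(2,4) unfolding l_def by blast
  qed
qed

end

lemma map_poly_hom_poly:
  assumes "is_hom t"
  shows "t (poly f x) = poly (map_poly t f) (t x)"
  by (induction f) (auto simp: map_poly_pCons is_hom_0[OF assms] is_homD[OF assms])

lemma map_poly_hom_add: "is_hom t \<Longrightarrow> map_poly t (f + g) = map_poly t f + map_poly t g"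
  by (rule poly_eqI) (simp add: coeff_map_poly is_hom_0 is_homD)

lemma map_poly_hom_mult: "is_hom t \<Longrightarrow> map_poly t (f * g) = map_poly t f * map_poly t g"
  by (rule poly_eqI) (simp add: coeff_map_poly is_hom_0 is_homD coeff_mult is_hom_sum)

lemma map_poly_hom_smult: "is_hom t \<Longrightarrow> map_poly t (smult c f) = smult (t c) (map_poly t f)"
  by (rule poly_eqI) (simp add: coeff_map_poly is_hom_0 is_homD)

lemma mvars_insert_poly:
  assumes "F \<in> mvars (insert b V)"
  shows "\<exists>f\<in>polys_over (mvars V). F = poly f (Var b)"
  using assms
proof (induction rule: mp_induct)
  case (Cst c)
  then show ?case by (intro bexI[of _ "[:Cst c:]"]) (auto simp: polys_over_def coeff_pCons split: nat.split)
next
  case (Var i F)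
  then obtain f where f: "f \<in> polys_over (mvars V)" "F = poly f (Var b)" by blast
  show ?case
  proof (cases "i = b")
    case True
    then show ?thesis using f polys_over_pCons[OF subring_of_mvars _ f(1), of 0]
      by (intro bexI[of _ "pCons 0 f"]) auto
  next
    case False
    then have "Var i \<in> mvars V" using Var by (auto intro: mvars_Var)
    then show ?thesis using f polys_over_smult[OF subring_of_mvars _ f(1)]
      by (intro bexI[of _ "smult (Var i) f"]) auto
  qed
next
  case (add F G)
  then obtain f g where "f \<in> polys_over (mvars V)" "F = poly f (Var b)" "g \<in> polys_over (mvars V)" "G = poly g (Var b)" by blast
  then show ?case using polys_over_add[OF subring_of_mvars] by (intro bexI[of _ "f + g"]) auto
qed

lemma meval_poly:
  assumes s: "is_hom s" and f: "f \<in> polys_over (mvars V)" and "b \<notin> V"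
  shows "meval s (a(b := x)) (poly f (Var b)) = poly (map_poly (meval s a) f) x"
proof -
  have "meval s (a(b := x)) (poly f (Var b)) = poly (map_poly (meval s (a(b := x))) f) x"
    by (simp add: map_poly_hom_poly[OF is_hom_meval[OF s]] meval_Var[OF s])
  also have "map_poly (meval s (a(b := x))) f = map_poly (meval s a) f"
  proof (rule poly_eqI)
    fix i
    have "meval s (a(b := x)) (pcf f i) = meval s a (pcf f i)"
      by (rule meval_cong[OF s, of _ V]) (use f \<open>b \<notin> V\<close> in \<open>auto simp: polys_over_def\<close>)
    then show "pcf (map_poly (meval s (a(b := x))) f) i = pcf (map_poly (meval s a) f) i"
      by (simp add: coeff_map_poly is_hom_0[OF is_hom_meval[OF s]])
  qed
  finally show ?thesis .
qed

lemma Cst_int: "Cst (z :: int) = of_int z"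
  by (metis Cst_of_int of_int_eq_id id_apply)

text \<open>Extension of homomorphisms to an algebraically closed field, one generator at a time; the
  element \<open>s\<close> plays the role of the denominators.\<close>

lemma specialize_to_algebraic:
  fixes I :: "('a, int) mp set"
  assumes I: "cring_prime I" and char: "\<And>z. of_int z \<in> I \<Longrightarrow> z = 0"
    and "finite V" "s \<in> mvars V" "s \<notin> I"
  shows "\<exists>a :: 'a \<Rightarrow> rat alg_closure.
     (\<forall>E\<in>mvars V. E \<in> I \<longrightarrow> meval of_int a E = 0) \<and> meval of_int a s \<noteq> 0"
  using assms(3-5)
proof (induction V arbitrary: s rule: finite_induct)
  case empty
  have "\<exists>z. E = of_int z" if "E \<in> mvars {}" for E :: "('a, int) mp"
    using that by (induction rule: mp_induct) (auto simp: Cst_int intro: of_int_add[symmetric])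
  then obtain z where z: "s = of_int z" using empty by blast
  interpret cring_prime I by fact
  have "z \<noteq> 0" using z empty by auto
  have "meval of_int a E = 0" if "E \<in> mvars {}" "E \<in> I" for E and a :: "'a \<Rightarrow> rat alg_closure"
  proof -
    obtain w where "E = of_int w"
      using \<open>\<And>E. E \<in> mvars {} \<Longrightarrow> \<exists>z. E = of_int z\<close> \<open>E \<in> mvars {}\<close> by blast
    then have "E = 0" using char \<open>E \<in> I\<close> by auto
    then show ?thesis by (simp add: meval_def)
  qed
  moreover have "meval of_int a s = of_int z" for a :: "'a \<Rightarrow> rat alg_closure"
    using is_hom_of_int[OF is_hom_meval[OF is_hom_of_int']] z by metis
  ultimately show ?case using \<open>z \<noteq> 0\<close> by auto
next
  case (insert b V)
  interpret cring_prime I by fact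
  note [simp] = is_hom_meval[OF is_hom_of_int']
  let ?R = "mvars V :: ('a, int) mp set" and ?P = "polys_over (mvars V) :: ('a, int) mp poly set"
  let ?X = "Var b :: ('a, int) mp"
  have PR: "pcf f i \<in> ?R" if "f \<in> ?P" for f i using that by (simp add: polys_over_def)
  have polyI: "poly f x \<in> I" if "\<And>i. pcf f i \<in> I" for f x
    unfolding poly_altdef using that by auto
  have ev0: "meval of_int (a(b := x)) (poly f ?X) = 0"
    if "f \<in> ?P" "\<And>i. pcf f i \<in> I" "\<forall>E\<in>?R. E \<in> I \<longrightarrow> meval of_int a E = 0"
    for f x and a :: "'a \<Rightarrow> rat alg_closure"
  proof -
    have "map_poly (meval of_int a) f = 0"
      by (rule poly_eqI) (use that PR in \<open>auto simp: coeff_map_poly is_hom_0\<close>)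
    then show ?thesis using meval_poly[OF is_hom_of_int' that(1) insert(2), of a x] by simp
  qed
  obtain F where F: "F \<in> ?P" "s = poly F ?X" using mvars_insert_poly[OF insert.prems(1)] by blast
  show ?case
  proof (cases "\<exists>f\<in>?P. poly f ?X \<in> I \<and> (\<exists>i. pcf f i \<notin> I)")
    \<comment> \<open>The variable \<open>b\<close> is transcendental over the others modulo
      \<open>I\<close>: any value is allowed, and it only has to avoid the roots of the polynomial
      \<open>G\<close> obtained from \<open>s\<close>.\<close>
    case False
    then have tr: "pcf f i \<in> I" if "f \<in> ?P" "poly f ?X \<in> I" for f i using that by blast
    obtain j where j: "pcf F j \<notin> I" using polyI[of F] F insert.prems by blast
    obtain a :: "'a \<Rightarrow> rat alg_closure" where a: "\<forall>E\<in>?R. E \<in> I \<longrightarrow> meval of_int a E = 0" "meval of_int a (pcf F j) \<noteq> 0"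
      using insert.IH[OF PR[OF F(1)] j] by blast
    define G where "G = map_poly (meval of_int a) F"
    have "pcf G j \<noteq> 0" using a(2) by (simp add: G_def coeff_map_poly is_hom_0)
    then have "G \<noteq> 0" by auto
    then have "finite {x. poly G x = 0}" by (rule poly_roots_finite)
    then have "\<exists>x. x \<notin> {x. poly G x = 0}"
      by (rule ex_new_if_finite[rotated]) (rule infinite_UNIV_char_0)
    then obtain x where x: "poly G x \<noteq> 0" by blast
    have "meval of_int (a(b := x)) s \<noteq> 0"
      using x meval_poly[OF is_hom_of_int' F(1) insert(2), of a x] by (simp add: F(2) G_def)
    moreover have "meval of_int (a(b := x)) E = 0" if E: "E \<in> mvars (insert b V)" "E \<in> I" for E
    proof -
      obtain f where "f \<in> ?P" "E = poly f ?X" using mvars_insert_poly[OF E(1)] by blast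
      then show ?thesis using ev0[of f a x] tr[of f] E a(1) by blast
    qed
    ultimately show ?thesis by blast
  next
    case True
    \<comment> \<open>The variable \<open>b\<close> is algebraic over the others. A relation
      \<open>f\<close> of least degree \<open>d\<close> serves as its minimal polynomial, up to the
      leading coefficient \<open>l\<close>.\<close>
    define K where "K d f \<longleftrightarrow> f \<in> ?P \<and> poly f ?X \<in> I \<and> (\<exists>i. pcf f i \<notin> I) \<and> (\<forall>i>d. pcf f i = 0)" for d f
    have "\<exists>d f. K d f" using True unfolding K_def by (metis coeff_eq_0)
    then obtain d where d: "\<exists>f. K d f" "\<And>e. e < d \<Longrightarrow> \<not> (\<exists>f. K e f)"
      using exists_least_iff[of "\<lambda>d. \<exists>f. K d f"] by blast
    then obtain f where f: "f \<in> ?P" "poly f ?X \<in> I" "\<exists>i. pcf f i \<notin> I" "\<forall>i>d. pcf f i = 0" unfolding K_def by blast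
    have low: "pcf g i \<in> I" if g: "g \<in> ?P" "poly g ?X \<in> I" "\<forall>i\<ge>d. pcf g i = 0" for g i
    proof (cases d)
      case 0
      then show ?thesis using g by simp
    next
      case (Suc e)
      then show ?thesis using d(2)[of e] g unfolding K_def by (metis lessI Suc_leI)
    qed
    define l where "l = pcf f d"
    have lR: "l \<in> ?R" unfolding l_def by (rule PR[OF f(1)])
    have l: "l \<notin> I"
    proof
      assume "l \<in> I"
      define g where "g = f - Polynomial.monom l d"
      have "g \<in> ?P" unfolding g_def by (intro polys_over_diff polys_over_monom f lR subring_of_mvars)
      moreover have "poly g ?X \<in> I" using f(2) \<open>l \<in> I\<close> by (simp add: g_def poly_monom)
      moreover have "\<forall>i\<ge>d. pcf g i = 0" using f(4) by (auto simp: g_def l_def)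
      ultimately have "pcf g i \<in> I" for i using low by blast
      then have "pcf g i + (if i = d then l else 0) \<in> I" for i using \<open>l \<in> I\<close> by auto
      moreover have "pcf f i = pcf g i + (if i = d then l else 0)" for i by (simp add: g_def)
      ultimately show False using f(3) by metis
    qed
    have d0: "d > 0"
    proof (rule ccontr)
      assume "\<not> d > 0"
      then have "f = [:l:]" using f(4) by (intro poly_eqI) (auto simp: l_def coeff_pCons split: nat.split)
      then show False using f(2) l by simp
    qed
    \<comment> \<open>Candidates for a multiple of \<open>s\<close> that is free of
      \<open>b\<close>: polynomials of degree at most \<open>e\<close> that are congruent to
      multiples of \<open>s\<close> but not to zero. The least \<open>e\<close> will be zero, so
      that non-vanishing of \<open>s\<close> follows from that of an element \<open>g0\<close> in
      the other variables.\<close>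
    define M where "M e g \<longleftrightarrow> g \<in> ?P \<and> poly g ?X \<notin> I \<and> (\<forall>i>e. pcf g i = 0) \<and>
        (\<exists>v\<in>mvars (insert b V). poly g ?X - s * v \<in> I)" for e g
    have sub: "mvars V \<subseteq> mvars (insert b V)" for V :: "'a set" by (auto intro: mvars_mono)
    have Xv: "?X \<in> mvars (insert b V)" by (auto intro: mvars_Var)
    have Pv: "poly g ?X \<in> mvars (insert b V)" if "g \<in> ?P" for g
      using that sub by (intro poly_in_subring[OF subring_of_mvars _ Xv]) (auto simp: polys_over_def)
    have "M (pdeg F) F" unfolding M_def using F insert.prems by (auto simp: coeff_eq_0 intro!: bexI[of _ 1])
    then obtain e where e: "\<exists>g. M e g" "\<And>e'. e' < e \<Longrightarrow> \<not> (\<exists>g. M e' g)"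
      using exists_least_iff[of "\<lambda>e. \<exists>g. M e g"] by blast
    then obtain g v where g: "g \<in> ?P" "poly g ?X \<notin> I" "\<forall>i>e. pcf g i = 0" and v: "v \<in> mvars (insert b V)" "poly g ?X - s * v \<in> I"
      unfolding M_def by blast
    have lowM: "poly h ?X \<in> I" if h: "h \<in> ?P" "\<forall>i\<ge>k. pcf h i = 0" "k \<le> e" "w \<in> mvars (insert b V)" "poly h ?X - s * w \<in> I" for h k w
    proof (cases k)
      case 0
      then have "h = 0" using h(2) by (simp add: poly_eq_iff)
      then show ?thesis by simp
    next
      case (Suc k')
      then show ?thesis using e(2)[of k'] h unfolding M_def by (metis Suc_le_eq)
    qed
    \<comment> \<open>A \<open>g\<close> of degree at least \<open>d\<close> can be reduced modulo
      \<open>f\<close>. If its degree lies strictly between zero and \<open>d\<close>, dividing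
      \<open>f\<close> by \<open>g\<close> leaves a remainder that is a multiple of \<open>s\<close>
      of smaller degree, hence in \<open>I\<close>. By primality the quotient lies in
      \<open>I\<close> too, and minimality of \<open>d\<close> puts all coefficients of both into
      \<open>I\<close>, against the leading coefficient \<open>l\<close>.\<close>
    have "e = 0"
    proof (rule ccontr)
      assume "e \<noteq> 0"
      have lgR: "pcf g e \<in> ?R" by (rule PR[OF g(1)])
      have lg: "pcf g e \<notin> I"
      proof
        assume *: "pcf g e \<in> I"
        define h where "h = g - Polynomial.monom (pcf g e) e"
        have h: "h \<in> ?P" unfolding h_def by (intro polys_over_diff polys_over_monom g lgR subring_of_mvars)
        have gh: "poly g ?X - poly h ?X \<in> I" using * by (simp add: h_def poly_monom)
        have "poly h ?X - s * v \<in> I" using cong_trans[OF cong_sym[OF gh] v(2)] .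
        then have "poly h ?X \<in> I" using h g(3) v(1) by (intro lowM[of h e v]) (auto simp: h_def)
        then show False using gh g(2) cong_I by blast
      qed
      have ed: "e < d"
      proof (rule ccontr)
        assume "\<not> e < d"
        have "\<forall>i\<ge>Suc e. pcf g i = 0" using g(3) by auto
        from pseudo_division[OF subring_of_mvars f(1,4) g(1) this]
        obtain k q r where qr: "q \<in> ?P" "r \<in> ?P" "smult (l ^ k) g = f * q + r" "\<forall>i\<ge>d. pcf r i = 0"
          unfolding l_def by blast
        have eq: "l ^ k * poly g ?X = poly f ?X * poly q ?X + poly r ?X"
          using arg_cong[OF qr(3), of "\<lambda>f. poly f ?X"] by simp
        have lkv: "l ^ k * v \<in> mvars (insert b V)" using v(1) lR sub[of V] by blast
        have "l ^ k * (poly g ?X - s * v) - poly f ?X * poly q ?X \<in> I" using v(2) f(2) by auto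
        moreover have "l ^ k * (poly g ?X - s * v) - poly f ?X * poly q ?X = poly r ?X - s * (l ^ k * v)"
          using eq by (simp add: algebra_simps)
        ultimately have "poly r ?X - s * (l ^ k * v) \<in> I" by simp
        then have "poly r ?X \<in> I" using qr lkv \<open>\<not> e < d\<close> by (intro lowM[of r d]) auto
        then have "l ^ k * poly g ?X \<in> I" using f(2) by (auto simp: eq)
        then show False using prime_I power_notin[OF l] g(2) by blast
      qed
      have "\<forall>i\<ge>Suc d. pcf f i = 0" using f(4) by auto
      from pseudo_division[OF subring_of_mvars g(1,3) f(1) this]
      obtain k q r where qr: "q \<in> ?P" "r \<in> ?P" "smult (pcf g e ^ k) f = g * q + r" "\<forall>i\<ge>e. pcf r i = 0"
         "\<forall>i. Suc d \<le> i + e \<longrightarrow> pcf q i = 0" by blast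
      have eq: "pcf g e ^ k * poly f ?X = poly g ?X * poly q ?X + poly r ?X"
        using arg_cong[OF qr(3), of "\<lambda>f. poly f ?X"] by simp
      have vq: "- (v * poly q ?X) \<in> mvars (insert b V)" using v(1) Pv[OF qr(1)] by blast
      have "pcf g e ^ k * poly f ?X - (poly g ?X - s * v) * poly q ?X \<in> I" using v(2) f(2) by auto
      moreover have "pcf g e ^ k * poly f ?X - (poly g ?X - s * v) * poly q ?X = poly r ?X - s * (- (v * poly q ?X))"
        using eq by (simp add: algebra_simps)
      ultimately have "poly r ?X - s * (- (v * poly q ?X)) \<in> I" by simp
      then have rI: "poly r ?X \<in> I" using qr vq by (intro lowM[of r e]) auto
      then have "poly g ?X * poly q ?X \<in> I" using eq f(2) by (metis add_diff_cancel_right' diff_I mult_I)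
      then have "poly q ?X \<in> I" using prime_I g(2) by blast
      then have qI: "pcf q i \<in> I" for i using qr(1,5) \<open>e \<noteq> 0\<close> by (intro low) auto
      have rI': "pcf r i \<in> I" for i using qr(2,4) ed rI by (intro low) auto
      have "pcf g e ^ k * l = pcf (g * q) d + pcf r d"
        using arg_cong[OF qr(3), of "\<lambda>f. pcf f d"] by (simp add: l_def)
      also have "\<dots> \<in> I" using qI rI' by (auto simp: coeff_mult)
      finally show False using prime_I power_notin[OF lg] l by blast
    qed
    define g0 where "g0 = pcf g 0"
    have "g = [:g0:]" using g(3) \<open>e = 0\<close> by (intro poly_eqI) (auto simp: g0_def coeff_pCons split: nat.split)
    from arg_cong[OF this, of "\<lambda>f. poly f ?X"] have gX: "poly g ?X = g0" by simp
    have g0: "g0 \<notin> I" "g0 \<in> ?R" "g0 - s * v \<in> I"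
      using g(2) v(2) PR[OF g(1), of 0] unfolding gX by (simp_all only: g0_def not_False_eq_True)
    \<comment> \<open>Non-vanishing of \<open>l\<close> keeps the degree of the specialized
      \<open>f\<close>, so that it has a root; non-vanishing of \<open>g0\<close> keeps
      \<open>s\<close> from vanishing.\<close>
    have "l * g0 \<notin> I" using prime_I l g0 by blast
    moreover have "l * g0 \<in> ?R" using lR g0 by blast
    ultimately obtain a :: "'a \<Rightarrow> rat alg_closure" where a: "\<forall>E\<in>?R. E \<in> I \<longrightarrow> meval of_int a E = 0" "meval of_int a (l * g0) \<noteq> 0"
      using insert.IH by blast
    define G where "G = map_poly (meval of_int a) f"
    have la: "meval of_int a l \<noteq> 0" "meval of_int a g0 \<noteq> 0" using a(2) by (auto simp: meval_mult)
    have "pcf G d \<noteq> 0" using la by (simp add: G_def coeff_map_poly is_hom_0 l_def[symmetric])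
    then have "pdeg G > 0" using d0 le_degree[of G d] by linarith
    then obtain x where x: "poly G x = 0" using alg_closed_imp_poly_has_root by blast
    have fx: "meval of_int (a(b := x)) (poly f ?X) = 0"
      using x meval_poly[OF is_hom_of_int' f(1) insert(2), of a x] by (simp add: G_def)
    have same: "meval of_int (a(b := x)) E = meval of_int a E" if "E \<in> ?R" for E
      using that insert(2) by (intro meval_cong[OF is_hom_of_int', of _ V]) auto
    have kill: "meval of_int (a(b := x)) E = 0" if E: "E \<in> mvars (insert b V)" "E \<in> I" for E
    proof -
      obtain h where h: "h \<in> ?P" "E = poly h ?X" using mvars_insert_poly[OF E(1)] by blast
      have "\<forall>i\<ge>Suc (pdeg h). pcf h i = 0" by (simp add: coeff_eq_0)
      from pseudo_division[OF subring_of_mvars f(1,4) h(1) this]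
      obtain k q r where qr: "q \<in> ?P" "r \<in> ?P" "smult (l ^ k) h = f * q + r" "\<forall>i\<ge>d. pcf r i = 0"
        unfolding l_def by blast
      have eq: "l ^ k * poly h ?X = poly f ?X * poly q ?X + poly r ?X"
        using arg_cong[OF qr(3), of "\<lambda>f. poly f ?X"] by simp
      then have "poly r ?X \<in> I" using f(2) E(2) h(2) by (metis add_diff_cancel_left' diff_I mult_I mult_I')
      then have "\<And>i. pcf r i \<in> I" using qr low by blast
      then have r0: "meval of_int (a(b := x)) (poly r ?X) = 0" using ev0[OF qr(2) _ a(1)] by blast
      have "meval of_int (a(b := x)) (l ^ k * poly h ?X) = 0"
        unfolding eq by (simp add: meval_add meval_mult r0 fx)
      moreover have "meval of_int (a(b := x)) (l ^ k) \<noteq> 0"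
      proof -
        have "l ^ k \<in> ?R" using lR by blast
        moreover have "meval of_int a (l ^ k) = meval of_int a l ^ k"
          by (induction k) (auto simp: meval_mult is_homD)
        ultimately show ?thesis using la(1) same by simp
      qed
      ultimately show ?thesis by (simp add: meval_mult h(2))
    qed
    have "meval of_int (a(b := x)) (g0 - s * v) = 0"
      using g0 insert.prems v sub[of V] by (intro kill) auto
    then have "meval of_int (a(b := x)) s * meval of_int (a(b := x)) v = meval of_int a g0"
      using same[OF g0(2)] by (simp add: is_hom_diff meval_mult)
    then have "meval of_int (a(b := x)) s \<noteq> 0" using la(2) by auto
    then show ?thesis using kill by blast
  qed
qed


section \<open>Simple extensions of the rationals inside their algebraic closure\<close>

type_synonym qbar = "rat alg_closure"

definition evr :: "rat poly \<Rightarrow> qbar \<Rightarrow> qbar"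
  where "evr q t = poly (map_poly to_ac q) t"

definition evz :: "int poly \<Rightarrow> qbar \<Rightarrow> qbar"
  where "evz q t = poly (map_poly of_int q) t"

text \<open>The ring generated by \<open>t\<close> over the rationals. It is a field because
  \<open>t\<close> is algebraic, see \<open>inverse_Qext\<close>.\<close>

definition Qext :: "qbar \<Rightarrow> qbar set"
  where "Qext t = range (\<lambda>q. evr q t)"

lemma is_hom_to_ac [simp]: "is_hom to_ac"
  by (simp add: is_hom_def)

lemma evr_simps [simp]:
  "evr 0 t = 0" "evr 1 t = 1" "evr (f + g) t = evr f t + evr g t" "evr (f * g) t = evr f t * evr g t"
  "evr (smult c f) t = to_ac c * evr f t" "evr (pCons c f) t = to_ac c + t * evr f t"
  by (simp_all add: evr_def map_poly_hom_add map_poly_hom_mult map_poly_hom_smult map_poly_pCons)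

lemma evz_simps [simp]:
  "evz 0 t = 0" "evz 1 t = 1" "evz (f + g) t = evz f t + evz g t" "evz (f * g) t = evz f t * evz g t"
  "evz (smult c f) t = of_int c * evz f t" "evz (pCons c f) t = of_int c + t * evz f t"
  by (simp_all add: evz_def map_poly_hom_add map_poly_hom_mult map_poly_hom_smult map_poly_pCons)

lemma evz_minus [simp]: "evz (- f) t = - evz f t" "evz (f - g) t = evz f t - evz g t"
proof -
  show m: "evz (- f) t = - evz f t" for f using evz_simps(3)[of f "- f" t] by (simp add: eq_neg_iff_add_eq_0 add.commute)
  show "evz (f - g) t = evz f t - evz g t" using evz_simps(3)[of f "- g" t] m[of g] by simp
qed

lemma QextI: "evr q t \<in> Qext t"
  by (simp add: Qext_def)

lemma subring_Qext: "subring_of (Qext t)"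
  unfolding subring_of_def
proof (intro conjI ballI)
  show "0 \<in> Qext t" "1 \<in> Qext t" using QextI[of 0 t] QextI[of 1 t] by simp_all
  fix x y assume "x \<in> Qext t" "y \<in> Qext t"
  then obtain f g where fg: "x = evr f t" "y = evr g t" by (auto simp: Qext_def)
  show "x + y \<in> Qext t" using QextI[of "f + g" t] by (simp add: fg)
  show "x * y \<in> Qext t" using QextI[of "f * g" t] by (simp add: fg)
  have "evr (f - g) t = x - y" using evr_simps(3)[of "f - g" g t] by (simp add: fg)
  then show "x - y \<in> Qext t" using QextI[of "f - g" t] by simp
qed

lemma to_ac_Qext [intro]: "to_ac c \<in> Qext t"
  unfolding Qext_def by (rule range_eqI[of _ _ "[:c:]"]) simp

lemma self_Qext [intro]: "t \<in> Qext t"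
  unfolding Qext_def by (rule range_eqI[of _ _ "[:0,1:]"]) simp

lemma evr_Qext: "y \<in> Qext t \<Longrightarrow> evr q y \<in> Qext t"
proof (induction q)
  case (pCons c q)
  then show ?case using subring_Qext[of t] to_ac_Qext[of c t] by (simp add: subring_of_def)
qed (use subring_Qext in \<open>simp add: subring_of_def\<close>)

lemma Qext_mono: "t \<in> Qext t' \<Longrightarrow> Qext t \<subseteq> Qext t'"
  using evr_Qext[of t t'] by (auto simp: Qext_def[of t])

text \<open>Cancelling powers of the variable from an annihilating polynomial of \<open>y\<close>
  yields one with nonzero constant term, which can be solved for the inverse.\<close>

lemma inverse_poly:
  assumes "y \<noteq> (0 :: qbar)"
  shows "\<exists>v. y * evr v y = 1"
proof -
  obtain q :: "rat poly" where "q \<noteq> 0" "evr q y = 0"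
    using alg_closure_algebraic[of y] unfolding evr_def by blast
  then show ?thesis
  proof (induction q)
    case (pCons c q)
    show ?case
    proof (cases "c = 0")
      case True
      then have "q \<noteq> 0" "evr q y = 0" using pCons assms by auto
      then show ?thesis using pCons.IH by blast
    next
      case False
      have "y * evr (smult (- (1 / c)) q) y = - (to_ac (1 / c) * (y * evr q y))"
        by (simp only: evr_simps(5) to_ac_minus mult_minus_left mult_minus_right mult.left_commute)
      also have "y * evr q y = - to_ac c"
        using pCons.prems by (simp add: eq_neg_iff_add_eq_0 add.commute)
      also have "- (to_ac (1 / c) * - to_ac c) = 1"
        using False by (simp flip: to_ac_mult)
      finally show ?thesis by blast
    qed
  qed simp
qed

lemma inverse_Qext: "y \<in> Qext t \<Longrightarrow> inverse y \<in> Qext t"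
proof (cases "y = 0")
  case False
  assume y: "y \<in> Qext t"
  obtain v where "y * evr v y = 1" using inverse_poly[OF False] by blast
  then have "inverse y = evr v y" by (simp add: inverse_unique)
  then show ?thesis using evr_Qext[OF y] by simp
qed auto

lemma polys_over_pcompose:
  assumes S: "subring_of S" and "f \<in> polys_over S" "g \<in> polys_over S"
  shows "pcompose f g \<in> polys_over S"
  using assms(2)
proof (induction f)
  case (pCons a f)
  have "a \<in> S" using pCons.prems by (simp add: polys_over_def) (metis coeff_pCons_0)
  moreover have "f \<in> polys_over S" using pCons.prems by (simp add: polys_over_def) (metis coeff_pCons_Suc)
  ultimately show ?case using pCons.IH assms
    by (auto simp: pcompose_pCons intro!: polys_over_add polys_over_mult polys_over_pCons polys_over_0)
qed (use S in \<open>simp add: polys_over_def subring_of_def\<close>)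

text \<open>The polynomials \<open>G\<close> and \<open>F (\<theta> + c b - c X)\<close> have only the root \<open>b\<close> in common.\<close>

lemma primitive_element:
  fixes \<theta> b :: qbar
  shows "\<exists>t. \<theta> \<in> Qext t \<and> b \<in> Qext t"
proof -
  obtain f :: "rat poly" where f: "f \<noteq> 0" "evr f \<theta> = 0"
    using alg_closure_algebraic[of \<theta>] unfolding evr_def by blast
  have "\<exists>g. g \<noteq> 0 \<and> evr g b = 0"
    using alg_closure_algebraic[of b] unfolding evr_def by blast
  then obtain g where g: "g \<noteq> 0" "evr g b = 0" and gmin: "\<And>h. pdeg h < pdeg g \<Longrightarrow> h \<noteq> 0 \<Longrightarrow> evr h b \<noteq> 0"
    using exists_least_iff[of "\<lambda>d. \<exists>g. g \<noteq> 0 \<and> evr g b = 0 \<and> pdeg g = d"] by metis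
  have g0: "pdeg g \<noteq> 0"
  proof
    assume "pdeg g = 0"
    then obtain c where "g = [:c:]" by (rule degree_eq_zeroE)
    then show False using g by simp
  qed
  define F G where "F = map_poly to_ac f" and "G = map_poly to_ac g"
  have F: "F \<noteq> 0" "poly F \<theta> = 0" and G: "G \<noteq> 0" "poly G b = 0"
    using f g by (auto simp: F_def G_def evr_def map_poly_eq_0_iff)
  have "map_poly to_ac (pderiv g) = pderiv G"
    by (rule poly_eqI) (simp add: G_def coeff_map_poly coeff_pderiv)
  then have G': "poly (pderiv G) b \<noteq> 0"
    using gmin[of "pderiv g"] g0 by (simp add: evr_def degree_pderiv pderiv_eq_0_iff)
  \<comment> \<open>The values of \<open>c\<close> for which \<open>\<theta> + c b - c y\<close> is
    a root of \<open>F\<close>, for some root \<open>y\<close> of \<open>G\<close> other than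
    \<open>b\<close>, are among these finitely many quotients.\<close>
  have "finite ((\<lambda>(x, y). (x - \<theta>) / (b - y)) ` ({x. poly F x = 0} \<times> {y. poly G y = 0}))"
    using F G by (intro finite_imageI finite_cartesian_product poly_roots_finite)
  moreover have "infinite (range (to_ac :: rat \<Rightarrow> qbar))"
    using finite_imageD[OF _ inj_to_ac] infinite_UNIV_char_0 by blast
  ultimately obtain c where c: "to_ac c \<notin> (\<lambda>(x, y). (x - \<theta>) / (b - y)) ` ({x. poly F x = 0} \<times> {y. poly G y = 0})"
    by (metis (no_types, lifting) finite_subset image_subset_iff rangeE subsetI)
  define t where "t = \<theta> + to_ac c * b"
  let ?K = "Qext t"
  have S: "subring_of ?K" by (rule subring_Qext)
  define F2 where "F2 = pcompose F [:t, - to_ac c:]"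
  have F2b: "poly F2 b = 0" using F by (simp add: F2_def poly_pcompose t_def)
  have GK: "G \<in> polys_over ?K" and FK: "F \<in> polys_over ?K"
    by (auto simp: polys_over_def G_def F_def coeff_map_poly)
  have "- to_ac c \<in> ?K" using to_ac_Qext[of "- c" t] by simp
  then have F2K: "F2 \<in> polys_over ?K"
    unfolding F2_def using self_Qext[of t] S
    by (intro polys_over_pcompose FK polys_over_pCons polys_over_0) auto
  \<comment> \<open>A polynomial \<open>h\<close> of least degree over \<open>Qext t\<close> with
    root \<open>b\<close> divides \<open>G\<close> and \<open>F2\<close> up to constants, so
    \<open>b\<close> is its only root.\<close>
  define N where "N d h \<longleftrightarrow> h \<in> polys_over ?K \<and> h \<noteq> 0 \<and> poly h b = 0 \<and> pdeg h = d" for d h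
  have "N (pdeg G) G" using GK G by (simp add: N_def)
  then obtain h where h: "h \<in> polys_over ?K" "h \<noteq> 0" "poly h b = 0"
    and hmin: "\<And>k. k \<in> polys_over ?K \<Longrightarrow> pdeg k < pdeg h \<Longrightarrow> poly k b = 0 \<Longrightarrow> k = 0"
    using exists_least_iff[of "\<lambda>d. \<exists>h. N d h"] unfolding N_def by metis
  have h0: "pdeg h \<noteq> 0"
  proof
    assume "pdeg h = 0"
    then obtain c where "h = [:c:]" by (rule degree_eq_zeroE)
    then show False using h by simp
  qed
  have hdvd: "\<exists>l q. l \<noteq> 0 \<and> smult l k = h * q" if k: "k \<in> polys_over ?K" "poly k b = 0" for k
  proof -
    have "\<forall>i>pdeg h. pcf h i = 0" "\<forall>i\<ge>Suc (pdeg k). pcf k i = 0" by (auto simp: coeff_eq_0)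
    from pseudo_division[OF S h(1) this(1) k(1) this(2)] obtain m q r where
      r: "r \<in> polys_over ?K" "smult (pcf h (pdeg h) ^ m) k = h * q + r" "\<forall>i\<ge>pdeg h. pcf r i = 0" by blast
    have "poly r b = 0" using arg_cong[OF r(2), of "\<lambda>f. poly f b"] k(2) h(3) by simp
    moreover have "pdeg r < pdeg h" using r(3) h0 by (metis degree_0 gr0I leading_coeff_0_iff not_less)
    ultimately have "r = 0" using hmin r(1) by blast
    then show ?thesis using r(2) h(2) by (intro exI[of _ "pcf h (pdeg h) ^ m"] exI[of _ q]) simp
  qed
  obtain l q where lq: "l \<noteq> 0" "smult l G = h * q" using hdvd[OF GK G(2)] by blast
  obtain l2 q2 where lq2: "l2 \<noteq> 0" "smult l2 F2 = h * q2" using hdvd[OF F2K F2b] by blast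
  have root: "y = b" if y: "poly h y = 0" for y
  proof (rule ccontr)
    assume "y \<noteq> b"
    have "poly G y = 0" using arg_cong[OF lq(2), of "\<lambda>f. poly f y"] lq(1) y by simp
    moreover have "poly F (t - to_ac c * y) = 0"
      using arg_cong[OF lq2(2), of "\<lambda>f. poly f y"] lq2(1) y by (simp add: F2_def poly_pcompose mult.commute)
    moreover have "to_ac c = (t - to_ac c * y - \<theta>) / (b - y)"
      using \<open>y \<noteq> b\<close> by (simp add: t_def field_simps)
    ultimately show False using c by (metis (mono_tags, lifting) SigmaI case_prod_conv image_eqI mem_Collect_eq)
  qed
  obtain h2 where h2: "h = [:- b, 1:] * h2" using h(3) by (metis dvdE poly_eq_0_iff_dvd)
  have h2n: "h2 \<noteq> 0" using h(2) h2 by auto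
  \<comment> \<open>A second root of \<open>h\<close> would be \<open>b\<close> again, hence
    \<open>b\<close> would be a double root of \<open>G\<close>. This is excluded since
    \<open>g\<close> has least degree among the rational polynomials annihilating
    \<open>b\<close>.\<close>
  have "pdeg h2 = 0"
  proof (rule ccontr)
    assume "pdeg h2 \<noteq> 0"
    then obtain y where y: "poly h2 y = 0" using alg_closed_imp_poly_has_root by blast
    then have "y = b" using root h2 by simp
    then obtain h3 where h3: "h2 = [:- b, 1:] * h3" using y by (metis dvdE poly_eq_0_iff_dvd)
    have "smult l (pderiv G) = pderiv (h * q)" using lq(2) by (simp add: pderiv_smult flip: lq(2))
    then have "l * poly (pderiv G) b = poly (pderiv (h * q)) b" by (metis poly_smult)
    also have "\<dots> = 0" unfolding h2 h3 by (simp only: pderiv_mult poly_add poly_mult) simp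
    finally show False using lq(1) G' by simp
  qed
  then obtain e where e: "h2 = [:e:]" by (rule degree_eq_zeroE)
  then have "e \<noteq> 0" using h2n by auto
  have "pcf h 0 = - (b * e)" "pcf h 1 = e" by (simp_all add: h2 e)
  then have "- (b * e) \<in> ?K" "e \<in> ?K" using h(1) unfolding polys_over_def by (metis mem_Collect_eq)+
  moreover have "b = (0 - (- (b * e))) * inverse e" using \<open>e \<noteq> 0\<close> by simp
  ultimately have bK: "b \<in> ?K" using S inverse_Qext unfolding subring_of_def by metis
  moreover have "\<theta> = t - to_ac c * b" by (simp add: t_def)
  then have "\<theta> \<in> ?K" using bK S self_Qext to_ac_Qext unfolding subring_of_def by metis
  ultimately show ?thesis by blast
qed

lemma finite_primitive_element:
  fixes A :: "qbar set"
  assumes "finite A"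
  shows "\<exists>t. A \<subseteq> Qext t"
  using assms
proof (induction A)
  case (insert b A)
  then obtain t where "A \<subseteq> Qext t" by blast
  moreover obtain t' where "t \<in> Qext t'" "b \<in> Qext t'" using primitive_element by blast
  ultimately show ?case using Qext_mono by blast
qed simp

section \<open>Reduction of algebraic numbers modulo squares of primes\<close>

lemma clear_denominators: "\<exists>d q. d \<noteq> 0 \<and> smult (of_int d) f = map_poly of_int q" for f :: "rat poly"
proof (induction f)
  case 0
  show ?case by (intro exI[of _ 1] exI[of _ 0]) simp
next
  case (pCons c f)
  then obtain d q where d: "d \<noteq> 0" "smult (of_int d) f = map_poly of_int q" by blast
  obtain a m where c: "c = of_int a / of_int m" "m \<noteq> 0"
    by (metis Fract_of_int_quotient Rat_cases less_numeral_extra(3))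
  have "smult (of_int (d * m)) (pCons c f) = pCons (of_int (d * a)) (smult (of_int m) (smult (of_int d) f))"
    using c(2) by (simp add: c(1) mult.commute)
  also have "\<dots> = map_poly of_int (pCons (d * a) (smult m q))"
    unfolding d(2) by (simp add: map_poly_pCons map_poly_hom_smult)
  finally show ?case using d(1) c(2) by (metis mult_eq_0_iff)
qed

lemma evr_map_of_int: "evr (map_poly of_int q) t = evz q t"
  by (simp add: evr_def evz_def map_poly_map_poly o_def)

lemma Qext_evz:
  assumes "y \<in> Qext t"
  shows "\<exists>d q. d \<noteq> 0 \<and> of_int d * y = evz q t"
proof -
  obtain f where f: "y = evr f t" using assms by (auto simp: Qext_def)
  obtain d q where d: "d \<noteq> 0" "smult (of_int d) f = map_poly of_int q" using clear_denominators by blast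
  have "of_int d * y = evr (smult (of_int d) f) t" by (simp add: f)
  then show ?thesis using d by (metis evr_map_of_int)
qed

text \<open>Euclid's argument: if the constant term \<open>c\<close> is nonzero, the values at
  multiples of \<open>c * fact N\<close> have the form \<open>c * w\<close> with \<open>w\<close>
  congruent to 1 modulo \<open>fact N\<close>, so the prime factors of \<open>w\<close> exceed
  \<open>N\<close>.\<close>

lemma infinitely_many_prime_divisors:
  fixes f :: "int poly" and N :: nat
  assumes "pdeg f \<noteq> 0"
  shows "\<exists>p x. prime p \<and> N < p \<and> int p dvd poly f x"
proof (cases "poly f 0 = 0")
  case True
  obtain p where "prime p" "N < p" using bigger_prime by blast
  then show ?thesis using True by (intro exI[of _ p] exI[of _ 0]) simp
next
  case False
  define c where "c = poly f 0"
  obtain q where q: "f = pCons c q" by (metis c_def pCons_cases poly_0_coeff_0 coeff_pCons_0)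
  define u where "u = pcompose f [:0, c * fact N:]"
  have "pdeg u \<noteq> 0" using assms False by (simp add: u_def c_def degree_pcompose)
  then have "infinite (range (poly u))" 
  proof -
    have "finite (poly u -` {y})" for y
    proof -
      have "u - [:y:] \<noteq> 0" using \<open>pdeg u \<noteq> 0\<close> by auto
      then have "finite {x. poly (u - [:y:]) x = 0}" by (rule poly_roots_finite)
      then show ?thesis by (simp add: vimage_def)
    qed
    then show ?thesis using inf_img_fin_dom[of "poly u" UNIV] by (metis infinite_UNIV_int vimage_def finite_vimage_iff UNIV_I Int_UNIV_right)
  qed
  \<comment> \<open>Avoiding these three values makes \<open>w\<close> different from 1, -1 and 0,
    so it has a prime factor.\<close>
  moreover have "finite {c, - c, 0}" by simp
  ultimately obtain z where z: "poly u z \<notin> {c, - c, 0}"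
    by (metis (no_types, lifting) finite_subset image_subsetI)
  define w where "w = 1 + fact N * (z * poly q (c * fact N * z))"
  have uw: "poly u z = c * w" by (simp add: u_def poly_pcompose q w_def algebra_simps)
  have "w \<noteq> 1" "w \<noteq> -1" "w \<noteq> 0" using z uw by auto
  then have "nat \<bar>w\<bar> \<noteq> 1" by auto
  then obtain p where p: "prime p" "p dvd nat \<bar>w\<bar>" using prime_factor_nat by blast
  then have pw: "int p dvd w" by (metis abs_ge_zero dvd_abs_iff int_dvd_int_iff int_nat_eq nat_0_le)
  have "N < p"
  proof (rule ccontr)
    assume "\<not> N < p"
    then have "p dvd fact N" using p(1) prime_dvd_fact_iff by simp
    then have "int p dvd fact N" by (metis int_dvd_int_iff of_nat_fact)
    then have "int p dvd w - fact N * (z * poly q (c * fact N * z))" using pw by auto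
    then have "int p dvd 1" by (simp add: w_def)
    then show False using p(1) by (simp add: prime_nat_iff)
  qed
  moreover have "int p dvd poly f (c * fact N * z)"
    using pw uw by (simp add: u_def poly_pcompose mult.commute)
  ultimately show ?thesis using p(1) by blast
qed

lemma poly_taylor:
  fixes f :: "'a::idom poly"
  shows "\<exists>e. poly f (x + h) = poly f x + h * poly (pderiv f) x + h\<^sup>2 * e"
proof (induction f)
  case (pCons a f)
  then obtain e where "poly f (x + h) = poly f x + h * poly (pderiv f) x + h\<^sup>2 * e" by blast
  then have "poly (pCons a f) (x + h) = poly (pCons a f) x + h * poly (pderiv (pCons a f)) x
     + h\<^sup>2 * (poly (pderiv f) x + x * e + h * e)"
    by (simp add: pderiv_pCons power2_eq_square algebra_simps)
  then show ?case by blast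
qed auto

text \<open>All \<open>a i\<close> are fractions in one algebraic number \<open>t\<close> with
  minimal polynomial \<open>f\<close>. A root of \<open>f\<close> modulo a large prime is lifted to
  a root \<open>x\<close> modulo p^2, and \<open>t\<close> is sent to \<open>x\<close>.\<close>

lemma specialize_algebraic_to_int:
  fixes a :: "'a \<Rightarrow> qbar" and N :: nat
  assumes "finite V"
  shows "\<exists>p a'. prime p \<and> N < p \<and> (\<forall>E\<in>mvars V. meval of_int a E = 0 \<longrightarrow> int (p\<^sup>2) dvd meval (\<lambda>x. x) a' E)"
proof -
  obtain t where t: "a ` V \<subseteq> Qext t" using finite_primitive_element assms by blast
  have "\<exists>f. f \<noteq> 0 \<and> evz f t = 0"
  proof -
    obtain q :: "rat poly" where q: "q \<noteq> 0" "evr q t = 0"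
      using alg_closure_algebraic[of t] unfolding evr_def by blast
    obtain d f where d: "d \<noteq> 0" "smult (of_int d) q = map_poly of_int f" using clear_denominators by blast
    have "evz f t = 0" using q by (simp flip: evr_map_of_int d(2))
    moreover have "f \<noteq> 0" using d q by auto
    ultimately show ?thesis by blast
  qed
  then obtain f where f: "f \<noteq> 0" "evz f t = 0" and fmin: "\<And>h. pdeg h < pdeg f \<Longrightarrow> evz h t = 0 \<Longrightarrow> h = 0"
    using exists_least_iff[of "\<lambda>d. \<exists>f. f \<noteq> 0 \<and> evz f t = 0 \<and> pdeg f = d"] by metis
  have f0: "pdeg f \<noteq> 0"
  proof
    assume "pdeg f = 0"
    then obtain c where "f = [:c:]" by (rule degree_eq_zeroE)
    then show False using f by simp
  qed
  define l where "l = pcf f (pdeg f)"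
  have l0: "l \<noteq> 0" using f by (simp add: l_def)
  have fdvd: "\<exists>k q. smult (l ^ k) h = f * q" if h: "evz h t = 0" for h
  proof -
    have "\<forall>i>pdeg f. pcf f i = 0" "\<forall>i\<ge>Suc (pdeg h). pcf h i = 0" by (auto simp: coeff_eq_0)
    from pseudo_division[OF subring_of_UNIV _ this(1) _ this(2)] obtain k q r where
      r: "smult (l ^ k) h = f * q + r" "\<forall>i\<ge>pdeg f. pcf r i = 0"
      unfolding polys_over_def l_def by auto
    have "evz r t = 0" using arg_cong[OF r(1), of "\<lambda>f. evz f t"] h f(2) by simp
    moreover have "pdeg r < pdeg f" using r(2) f0 by (metis degree_0 gr0I leading_coeff_0_iff not_less)
    ultimately have "r = 0" using fmin by blast
    then show ?thesis using r(1) by auto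
  qed
  have "evz (pderiv f) t \<noteq> 0"
    using fmin[of "pderiv f"] f0 by (auto simp: degree_pderiv pderiv_eq_0_iff)
  moreover have "evz (pderiv f) t \<in> Qext t"
    unfolding Qext_def by (rule range_eqI[of _ _ "map_poly of_int (pderiv f)"]) (simp add: evr_map_of_int)
  ultimately have "inverse (evz (pderiv f) t) \<in> Qext t" by (intro inverse_Qext)
  \<comment> \<open>A Bezout relation between \<open>f\<close> and its derivative, read at
    \<open>t\<close>: modulo a prime that divides neither \<open>D\<close> nor \<open>l\<close>, the
    roots of \<open>f\<close> are simple.\<close>
  then obtain D v where D: "D \<noteq> 0" "of_int D * inverse (evz (pderiv f) t) = evz v t" using Qext_evz by blast
  then have vD: "evz (v * pderiv f - [:D:]) t = 0"
    using \<open>evz (pderiv f) t \<noteq> 0\<close> by (simp flip: D(2))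
  \<comment> \<open>A common denominator of the \<open>a i\<close> as integer polynomials in
    \<open>t\<close>.\<close>
  have "\<exists>g. g \<noteq> 0 \<and> (\<forall>i\<in>V. \<exists>U. of_int g * a i = evz U t)"
    using assms t
  proof (induction V)
    case empty
    show ?case by (intro exI[of _ 1]) simp
  next
    case (insert j V)
    then obtain g where g: "g \<noteq> 0" "\<forall>i\<in>V. \<exists>U. of_int g * a i = evz U t" by auto
    obtain d U where d: "d \<noteq> 0" "of_int d * a j = evz U t" using Qext_evz[of "a j" t] insert.prems by auto
    have "\<exists>U. of_int (g * d) * a i = evz U t" if i: "i \<in> insert j V" for i
    proof (cases "i = j")
      case True
      have "of_int (g * d) * a j = of_int g * (of_int d * a j)" by simp
      also have "\<dots> = evz (smult g U) t" by (simp only: d(2) evz_simps)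
      finally have "of_int (g * d) * a j = evz (smult g U) t" .
      then show ?thesis using True by blast
    next
      case False
      then have "i \<in> V" using i by simp
      then obtain U' where U': "of_int g * a i = evz U' t" using g(2) by blast
      have "of_int (g * d) * a i = of_int d * (of_int g * a i)" by simp
      also have "\<dots> = evz (smult d U') t" by (simp only: U' evz_simps)
      finally have "of_int (g * d) * a i = evz (smult d U') t" .
      then show ?thesis by blast
    qed
    then show ?case using g(1) d(1) by (intro exI[of _ "g * d"]) auto
  qed
  then obtain g U where g: "g \<noteq> 0" and U: "\<And>i. i \<in> V \<Longrightarrow> of_int g * a i = evz (U i) t" by metis
  obtain p x0 where p: "prime p" "N + nat \<bar>l\<bar> + nat \<bar>g\<bar> + nat \<bar>D\<bar> < p" "int p dvd poly f x0"
    using infinitely_many_prime_divisors[OF f0] by blast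
  have nd: "\<not> int p dvd z" if "z \<noteq> 0" "nat \<bar>z\<bar> < p" for z
  proof
    assume "int p dvd z"
    then have "int p \<le> \<bar>z\<bar>" using that(1) zdvd_imp_le[of "int p" "\<bar>z\<bar>"] by simp
    then show False using that(2) by linarith
  qed
  have pl: "\<not> int p dvd l" and pg: "\<not> int p dvd g" and pD: "\<not> int p dvd D"
    using nd[OF l0] nd[OF g] nd[OF D(1)] p(2) by linarith+
  have pp: "prime (int p)" using p(1) by simp
  have cp: "coprime (z ^ k) (int (p\<^sup>2))" if "\<not> int p dvd z" for z k
    using that prime_imp_coprime[OF pp that] by (simp add: coprime_commute)
  have "\<not> int p dvd poly (pderiv f) x0"
  proof
    assume *: "int p dvd poly (pderiv f) x0"
    obtain k q where "smult (l ^ k) (v * pderiv f - [:D:]) = f * q" using fdvd[OF vD] by blast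
    from arg_cong[OF this, of "\<lambda>f. poly f x0"]
    have "l ^ k * (poly v x0 * poly (pderiv f) x0 - D) = poly f x0 * poly q x0" by simp
    then have "int p dvd l ^ k * (poly v x0 * poly (pderiv f) x0 - D)" using p(3) by simp
    then have "int p dvd poly v x0 * poly (pderiv f) x0 - D"
      using pl pp by (simp add: prime_dvd_mult_iff prime_dvd_power_iff) (metis pp prime_dvd_power)
    then have "int p dvd D" using * by (metis dvd_diff_right_iff dvd_mult)
    then show False using pD by blast
  qed
  then have "coprime (poly (pderiv f) x0) (int p)"
    using prime_imp_coprime[OF pp] by (metis coprime_commute)
  then obtain u where u: "[poly (pderiv f) x0 * u = 1] (mod int p)" using cong_solve_coprime_int by blast
  obtain b where b: "poly f x0 = int p * b" using p(3) by blast
  \<comment> \<open>Newton's step from \<open>x0\<close>: the integer \<open>u\<close> inverts the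
    derivative of \<open>f\<close> at \<open>x0\<close> modulo \<open>p\<close>.\<close>
  define x where "x = x0 + int p * (- b * u)"
  have fx: "int (p\<^sup>2) dvd poly f x"
  proof -
    obtain e where e: "poly f x = poly f x0 + int p * (- b * u) * poly (pderiv f) x0 + (int p * (- b * u))\<^sup>2 * e"
      unfolding x_def using poly_taylor by blast
    have "int p dvd 1 - poly (pderiv f) x0 * u"
      using u by (metis cong_iff_dvd_diff cong_sym)
    then obtain c where c: "1 - poly (pderiv f) x0 * u = int p * c" by blast
    have "poly f x = int p * b * (1 - poly (pderiv f) x0 * u) + (int p * (- b * u))\<^sup>2 * e"
      by (simp add: e b algebra_simps)
    also have "\<dots> = int (p\<^sup>2) * (b * c + (b * u)\<^sup>2 * e)"
      unfolding c by (simp add: power2_eq_square algebra_simps)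
    finally show ?thesis by simp
  qed
  obtain g' where g': "[g * g' = 1] (mod int (p\<^sup>2))" using cong_solve_coprime_int[OF cp[OF pg, of 1]] unfolding power_one_right by blast
  define a' where "a' i = g' * poly (U i) x" for i
  define \<mu> where "\<mu> z c \<longleftrightarrow> (\<exists>e Q. of_int (g ^ e) * z = evz Q t \<and> [c = g' ^ e * poly Q x] (mod int (p\<^sup>2)))" for z c
  have gpow: "[(g * g') ^ e = 1] (mod int (p\<^sup>2))" for e using cong_pow[OF g', of e] by simp
  have \<mu>0: "int (p\<^sup>2) dvd c" if m: "\<mu> 0 c" for c
  proof -
    obtain e Q where Q: "evz Q t = 0" "[c = g' ^ e * poly Q x] (mod int (p\<^sup>2))" using m by (auto simp: \<mu>_def)
    obtain k q where "smult (l ^ k) Q = f * q" using fdvd[OF Q(1)] by blast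
    from arg_cong[OF this, of "\<lambda>f. poly f x"] have "int (p\<^sup>2) dvd l ^ k * poly Q x" using fx by simp
    then have "int (p\<^sup>2) dvd poly Q x" using cp[OF pl, of k] by (simp add: coprime_dvd_mult_right_iff coprime_commute)
    then show ?thesis using Q(2) by (metis cong_dvd_iff dvd_mult)
  qed
  have \<mu>add: "\<mu> (z1 + z2) (c1 + c2)" if m: "\<mu> z1 c1" "\<mu> z2 c2" for z1 z2 c1 c2
  proof -
    obtain e1 Q1 where 1: "of_int (g ^ e1) * z1 = evz Q1 t" "[c1 = g' ^ e1 * poly Q1 x] (mod int (p\<^sup>2))" using m by (auto simp: \<mu>_def)
    obtain e2 Q2 where 2: "of_int (g ^ e2) * z2 = evz Q2 t" "[c2 = g' ^ e2 * poly Q2 x] (mod int (p\<^sup>2))" using m by (auto simp: \<mu>_def)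
    have "of_int (g ^ (e1 + e2)) * (z1 + z2) = evz (smult (g ^ e2) Q1 + smult (g ^ e1) Q2) t"
      unfolding evz_simps 1(1)[symmetric] 2(1)[symmetric] by (simp add: power_add algebra_simps)
    moreover have "[c1 + c2 = g' ^ (e1 + e2) * poly (smult (g ^ e2) Q1 + smult (g ^ e1) Q2) x] (mod int (p\<^sup>2))"
    proof -
      have "[g' ^ e1 * poly Q1 x * 1 + g' ^ e2 * poly Q2 x * 1 =
         g' ^ e1 * poly Q1 x * (g * g') ^ e2 + g' ^ e2 * poly Q2 x * (g * g') ^ e1] (mod int (p\<^sup>2))"
        by (intro cong_add cong_mult cong_refl cong_sym[OF gpow])
      then have "[g' ^ e1 * poly Q1 x + g' ^ e2 * poly Q2 x =
         g' ^ (e1 + e2) * poly (smult (g ^ e2) Q1 + smult (g ^ e1) Q2) x] (mod int (p\<^sup>2))"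
        by (simp add: power_add power_mult_distrib algebra_simps)
      then show ?thesis using cong_add[OF 1(2) 2(2)] cong_trans by blast
    qed
    ultimately show ?thesis unfolding \<mu>_def by blast
  qed
  have \<mu>mult: "\<mu> (z1 * z2) (c1 * c2)" if m: "\<mu> z1 c1" "\<mu> z2 c2" for z1 z2 c1 c2
  proof -
    obtain e1 Q1 where 1: "of_int (g ^ e1) * z1 = evz Q1 t" "[c1 = g' ^ e1 * poly Q1 x] (mod int (p\<^sup>2))" using m by (auto simp: \<mu>_def)
    obtain e2 Q2 where 2: "of_int (g ^ e2) * z2 = evz Q2 t" "[c2 = g' ^ e2 * poly Q2 x] (mod int (p\<^sup>2))" using m by (auto simp: \<mu>_def)
    have "of_int (g ^ (e1 + e2)) * (z1 * z2) = evz (Q1 * Q2) t"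
      unfolding evz_simps 1(1)[symmetric] 2(1)[symmetric] by (simp add: power_add algebra_simps)
    moreover have "[c1 * c2 = g' ^ (e1 + e2) * poly (Q1 * Q2) x] (mod int (p\<^sup>2))"
      using cong_mult[OF 1(2) 2(2)] by (simp add: power_add algebra_simps)
    ultimately show ?thesis unfolding \<mu>_def by blast
  qed
  have \<mu>int: "\<mu> (of_int c) c" for c
    unfolding \<mu>_def by (intro exI[of _ 0] exI[of _ "[:c:]"]) simp
  have \<mu>a: "\<mu> (a i) (a' i)" if "i \<in> V" for i
    unfolding \<mu>_def a'_def by (intro exI[of _ 1] exI[of _ "U i"]) (simp add: U[OF that])
  have id: "is_hom (\<lambda>x::int. x)" by (simp add: is_hom_def)
  have "\<mu> (meval of_int a E) (meval (\<lambda>x. x) a' E)" if "E \<in> mvars V" for E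
    using that
  proof (induction rule: mp_induct)
    case (Cst c)
    then show ?case by (simp add: meval_Cst id \<mu>int)
  next
    case (Var i E)
    then show ?case by (simp add: meval_mult meval_Var id \<mu>mult \<mu>a)
  next
    case (add E F)
    then show ?case by (simp add: meval_add id \<mu>add)
  qed
  then have "\<forall>E\<in>mvars V. meval of_int a E = 0 \<longrightarrow> int (p\<^sup>2) dvd meval (\<lambda>x. x) a' E"
    using \<mu>0 by metis
  then show ?thesis using p by (intro exI[of _ p] exI[of _ a']) auto
qed

theorem specialize_mod_prime_square:
  fixes I :: "('a, int) mp set" and N :: nat
  assumes "cring_prime I" "\<And>z. of_int z \<in> I \<Longrightarrow> z = 0" "finite V"
  shows "\<exists>p a. prime p \<and> N < p \<and> (\<forall>E\<in>mvars V. E \<in> I \<longrightarrow> int (p\<^sup>2) dvd meval (\<lambda>x. x) a E)"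
proof -
  have "1 \<notin> I" using assms(1) by (rule cring_prime.one_notin)
  then obtain a :: "'a \<Rightarrow> qbar" where a: "\<forall>E\<in>mvars V. E \<in> I \<longrightarrow> meval of_int a E = 0"
    using specialize_to_algebraic[OF assms(1,2,3), of 1] by auto
  obtain p a' where "prime p" "N < p" "\<forall>E\<in>mvars V. meval of_int a E = 0 \<longrightarrow> int (p\<^sup>2) dvd meval (\<lambda>x. x) a' E"
    using specialize_algebraic_to_int[OF assms(3)] by blast
  then show ?thesis using a by blast
qed


section \<open>Determinants\<close>

definition tdet :: "nat \<Rightarrow> (nat \<Rightarrow> nat \<Rightarrow> 'r::comm_ring_1) \<Rightarrow> 'r"
  where "tdet N M = (\<Sum>q | q permutes {1..N}. of_int (sign q) * (\<Prod>i\<in>{1..N}. M i (q i)))"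

text \<open>Bordering by a unit row and column with index 0 avoids shifting the indices.\<close>

definition bord :: "nat \<Rightarrow> (nat \<Rightarrow> nat \<Rightarrow> 'r::comm_ring_1) \<Rightarrow> 'r mat"
  where "bord N M = mat (Suc N) (Suc N) (\<lambda>(i, j). if i = 0 \<or> j = 0 then of_bool (i = j) else M i j)"

lemma bord_carrier [simp]: "bord N M \<in> carrier_mat (Suc N) (Suc N)"
  by (simp add: bord_def)

lemma index_bord: "i \<le> N \<Longrightarrow> j \<le> N \<Longrightarrow> bord N M $$ (i, j) = (if i = 0 \<or> j = 0 then of_bool (i = j) else M i j)"
  by (simp add: bord_def)

lemma permutes_in: "q permutes {1..N} \<Longrightarrow> i \<in> {1..N} \<Longrightarrow> q i \<in> {1..N}" for N :: nat
  by (simp only: permutes_in_image)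

lemma det_bord: "Determinant.det (bord N M) = tdet N M"
proof -
  let ?t = "\<lambda>q. of_int (sign q) * (\<Prod>i = 0..<Suc N. bord N M $$ (i, q i))"
  have split: "{0..<Suc N} = insert 0 {1..N}" by auto
  have "Determinant.det (bord N M) = (\<Sum>q | q permutes {0..<Suc N}. ?t q)"
    by (rule det_def') simp
  also have "\<dots> = (\<Sum>q | q permutes {1..N}. ?t q)"
  proof (rule sum.mono_neutral_right)
    show "finite {q. q permutes {0..<Suc N}}" by (simp add: finite_permutations)
    show "{q. q permutes {1..N}} \<subseteq> {q. q permutes {0..<Suc N}}"
    proof
      fix q assume "q \<in> {q. q permutes {1..N}}"
      then have "q permutes {1..N}" by simp
      then have "q permutes {0..<Suc N}" by (rule permutes_subset) auto
      then show "q \<in> {q. q permutes {0..<Suc N}}" by simp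
    qed
    show "\<forall>q\<in>{q. q permutes {0..<Suc N}} - {q. q permutes {1..N}}. ?t q = 0"
    proof
      fix q assume q: "q \<in> {q. q permutes {0..<Suc N}} - {q. q permutes {1..N}}"
      have q0: "q 0 \<noteq> 0"
      proof
        assume "q 0 = 0"
        have qp: "q permutes {0..<Suc N}" using q by simp
        have "q permutes {1..N}"
        proof (rule permutes_superset[OF qp])
          fix x assume "x \<in> {0..<Suc N} - {1..N}"
          then have "x = 0" by auto
          then show "q x = x" using \<open>q 0 = 0\<close> by simp
        qed
        then show False using q by simp
      qed
      have "q 0 \<in> {0..<Suc N}" using q permutes_in_image[of q "{0..<Suc N}" 0] by simp
      then have "bord N M $$ (0, q 0) = 0" using q0 by (simp add: index_bord)
      then have "(\<Prod>i = 0..<Suc N. bord N M $$ (i, q i)) = 0"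
        by (intro prod_zero) (auto intro!: bexI[of _ 0])
      then show "?t q = 0" by simp
    qed
  qed
  also have "\<dots> = tdet N M"
    unfolding tdet_def
  proof (rule sum.cong[OF refl])
    fix q assume "q \<in> {q. q permutes {1..N}}"
    then have q: "q permutes {1..N}" by simp
    have "q 0 = 0" using q by (auto simp: permutes_def)
    then have "(\<Prod>i = 0..<Suc N. bord N M $$ (i, q i)) = (\<Prod>i\<in>{1..N}. bord N M $$ (i, q i))"
      unfolding split by (simp add: index_bord)
    also have "\<dots> = (\<Prod>i\<in>{1..N}. M i (q i))"
    proof (rule prod.cong[OF refl])
      fix i assume i: "i \<in> {1..N}"
      then have "q i \<in> {1..N}" using permutes_in_image[OF q] by simp
      then show "bord N M $$ (i, q i) = M i (q i)" using i by (simp add: index_bord)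
    qed
    finally show "?t q = of_int (sign q) * (\<Prod>i\<in>{1..N}. M i (q i))" by simp
  qed
  finally show ?thesis .
qed

lemma sum_bord: "(\<Sum>k = 0..<Suc N. f k) = f 0 + (\<Sum>k\<in>{1..N}. f k)" for f :: "nat \<Rightarrow> 'r::comm_monoid_add"
proof -
  have "{0..<Suc N} = insert 0 {1..N}" by auto
  then show ?thesis by simp
qed

lemma index_mult_mat_sum:
  fixes A B :: "'r::comm_ring_1 mat"
  assumes "A \<in> carrier_mat n n" "B \<in> carrier_mat n n" "i < n" "j < n"
  shows "(A * B) $$ (i, j) = (\<Sum>k = 0..<n. A $$ (i, k) * B $$ (k, j))"
  using assms by (simp add: scalar_prod_def)

lemma bord_mult: "bord N A * bord N B = bord N (\<lambda>i j. \<Sum>k\<in>{1..N}. A i k * B k j)"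
proof (rule eq_matI)
  fix i j assume "i < dim_row (bord N (\<lambda>i j. \<Sum>k\<in>{1..N}. A i k * B k j))"
    "j < dim_col (bord N (\<lambda>i j. \<Sum>k\<in>{1..N}. A i k * B k j))"
  then have ij: "i < Suc N" "j < Suc N" by (simp_all add: bord_def)
  have "(bord N A * bord N B) $$ (i, j) = (\<Sum>k = 0..<Suc N. bord N A $$ (i, k) * bord N B $$ (k, j))"
    by (rule index_mult_mat_sum[OF bord_carrier bord_carrier ij])
  also have "\<dots> = bord N (\<lambda>i j. \<Sum>k\<in>{1..N}. A i k * B k j) $$ (i, j)"
    unfolding sum_bord using ij by (auto simp: index_bord)
  finally show "(bord N A * bord N B) $$ (i, j) = bord N (\<lambda>i j. \<Sum>k\<in>{1..N}. A i k * B k j) $$ (i, j)" .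
qed (auto simp: bord_def)

lemma tdet_mult: "tdet N A * tdet N B = tdet N (\<lambda>i j. \<Sum>k\<in>{1..N}. A i k * B k j)"
  unfolding det_bord[symmetric] bord_mult[symmetric] by (rule det_mult[OF bord_carrier bord_carrier, symmetric])

lemma tdet_adjugate:
  "\<exists>C. \<forall>i\<in>{1..N}. \<forall>j\<in>{1..N}. (\<Sum>k\<in>{1..N}. C i k * M k j) = (if i = j then tdet N M else 0)"
proof (intro exI ballI)
  fix i j assume ij: "i \<in> {1..N}" "j \<in> {1..N}"
  let ?A = "bord N M"
  have c: "adj_mat ?A \<in> carrier_mat (Suc N) (Suc N)" by (rule adj_mat) simp
  have "(adj_mat ?A * ?A) $$ (i, j) = (\<Sum>k = 0..<Suc N. adj_mat ?A $$ (i, k) * ?A $$ (k, j))"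
    using ij by (intro index_mult_mat_sum[OF c bord_carrier]) auto
  also have "\<dots> = (\<Sum>k\<in>{1..N}. adj_mat ?A $$ (i, k) * M k j)"
    unfolding sum_bord using ij by (simp add: index_bord)
  finally show "(\<Sum>k\<in>{1..N}. adj_mat ?A $$ (i, k) * M k j) = (if i = j then tdet N M else 0)"
    using ij adj_mat(3)[of ?A "Suc N"] by (cases "i = j") (simp_all add: det_bord)
qed

lemma tdet_scalar: "tdet N (\<lambda>i j. if i = j then c else 0) = c ^ N"
proof -
  have "tdet N (\<lambda>i j. if i = j then c else 0)
      = (\<Sum>q | q permutes {1..N}. if q = id then c ^ N else 0)"
    unfolding tdet_def
  proof (rule sum.cong[OF refl])
    fix q assume "q \<in> {q. q permutes {1..N}}"
    then have q: "q permutes {1..N}" by simp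
    show "of_int (sign q) * (\<Prod>i\<in>{1..N}. if i = q i then c else 0) = (if q = id then c ^ N else 0)"
    proof (cases "q = id")
      case False
      then obtain i where i: "q i \<noteq> i" by (auto simp: fun_eq_iff)
      then have "i \<in> {1..N}" using q by (auto simp: permutes_def)
      then have "(\<Prod>i\<in>{1..N}. if i = q i then c else 0) = 0"
        using i by (intro prod_zero) (auto intro!: bexI[of _ i])
      then show ?thesis using False by simp
    qed simp
  qed
  also have "\<dots> = c ^ N" by (simp add: finite_permutations permutes_id)
  finally show ?thesis .
qed

lemma tdet_cong: "(\<And>i j. i \<in> {1..N} \<Longrightarrow> j \<in> {1..N} \<Longrightarrow> A i j = B i j) \<Longrightarrow> tdet N A = tdet N B"
  unfolding tdet_def using permutes_in
  by (intro sum.cong refl arg_cong2[of _ _ _ _ "(*)"] prod.cong) blast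

lemma (in cring_ideal) tdet_cong_I:
  assumes "\<And>i j. i \<in> {1..N} \<Longrightarrow> j \<in> {1..N} \<Longrightarrow> A i j - B i j \<in> I"
  shows "tdet N A - tdet N B \<in> I"
  unfolding tdet_def
proof (rule cong_sum)
  fix q assume "q \<in> {q. q permutes {1..N}}"
  then have "A i (q i) - B i (q i) \<in> I" if "i \<in> {1..N}" for i
    using that permutes_in_image[of q "{1..N}" i] assms by simp
  then have "(\<Prod>i\<in>{1..N}. A i (q i)) - (\<Prod>i\<in>{1..N}. B i (q i)) \<in> I" by (rule cong_prod)
  then show "of_int (sign q) * (\<Prod>i\<in>{1..N}. A i (q i)) - of_int (sign q) * (\<Prod>i\<in>{1..N}. B i (q i)) \<in> I"
    unfolding right_diff_distrib[symmetric] by (rule mult_I)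
qed

lemma tdet_scale_rows: "tdet N (\<lambda>i j. s i * M i j) = (\<Prod>i\<in>{1..N}. s i) * tdet N M"
  by (simp add: tdet_def prod.distrib sum_distrib_left mult.left_commute)

lemma tdet_hom: "is_hom t \<Longrightarrow> t (tdet N M) = tdet N (\<lambda>i j. t (M i j))" for t :: "'r::comm_ring_1 \<Rightarrow> 'c::comm_ring_1"
proof -
  assume t: "is_hom t"
  have "t (prod f A) = (\<Prod>i\<in>A. t (f i))" for f and A :: "nat set"
    by (induction A rule: infinite_finite_induct) (auto simp: is_homD[OF t])
  then show ?thesis
    by (simp add: tdet_def is_hom_sum[OF t] is_homD[OF t] is_hom_of_int[OF t])
qed

lemma tdet_mvars: "(\<And>i j. i \<in> {1..N} \<Longrightarrow> j \<in> {1..N} \<Longrightarrow> M i j \<in> mvars V) \<Longrightarrow> tdet N M \<in> mvars V"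
  unfolding tdet_def mem_Collect_eq using permutes_in
  by (intro mvars_sum mvars_mult mvars_of_int mvars_prod) blast


section \<open>Rings in the sense of records as quotients of type class rings\<close>

text \<open>The record ring \<open>R\<close> is the image of a subring \<open>D\<close> of a type
  class ring, not necessarily an isomorphic one. Computations in \<open>R\<close> are carried out in
  \<open>D\<close> and compared by means of the kernel of \<open>\<pi>\<close>.\<close>

locale rcover =
  fixes R :: "('b, 'z) ring_scheme" (structure) and \<pi> :: "'t::ring_1 \<Rightarrow> 'b" and D :: "'t set"
  assumes D_0 [simp, intro]: "0 \<in> D" and D_1 [simp, intro]: "1 \<in> D"
    and D_add [simp, intro]: "\<And>x y. x \<in> D \<Longrightarrow> y \<in> D \<Longrightarrow> x + y \<in> D"
    and D_uminus [simp, intro]: "\<And>x. x \<in> D \<Longrightarrow> - x \<in> D"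
    and D_mult [simp, intro]: "\<And>x y. x \<in> D \<Longrightarrow> y \<in> D \<Longrightarrow> x * y \<in> D"
    and carr: "carrier R = \<pi> ` D"
    and pi_0: "\<pi> 0 = \<zero>" and pi_1: "\<pi> 1 = \<one>"
    and pi_add: "\<And>x y. x \<in> D \<Longrightarrow> y \<in> D \<Longrightarrow> \<pi> (x + y) = \<pi> x \<oplus> \<pi> y"
    and pi_mult: "\<And>x y. x \<in> D \<Longrightarrow> y \<in> D \<Longrightarrow> \<pi> (x * y) = \<pi> x \<otimes> \<pi> y"
begin

lemma D_diff [simp, intro]: "x \<in> D \<Longrightarrow> y \<in> D \<Longrightarrow> x - y \<in> D"
  using D_add[of x "- y"] by simp

lemma pi_closed [simp, intro]: "x \<in> D \<Longrightarrow> \<pi> x \<in> carrier R"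
  by (simp add: carr)

lemma carrE: "z \<in> carrier R \<Longrightarrow> (\<And>x. x \<in> D \<Longrightarrow> z = \<pi> x \<Longrightarrow> thesis) \<Longrightarrow> thesis"
  by (auto simp: carr)

lemma is_ring: "ring R"
proof (rule ringI)
  show "abelian_group R"
  proof (rule abelian_groupI)
    show "\<exists>y\<in>carrier R. y \<oplus> x = \<zero>" if xR: "x \<in> carrier R" for x
    proof -
      obtain a where "a \<in> D" "x = \<pi> a" using xR by (rule carrE)
      then show ?thesis using pi_add[of "- a" a] by (intro bexI[of _ "\<pi> (- a)"]) (auto simp: pi_0)
    qed
  qed (auto simp: carr pi_0[symmetric] pi_add[symmetric] add.assoc add.commute add.left_commute)
  show "Group.monoid R"
    by (rule Group.monoidI) (auto simp: carr pi_1[symmetric] pi_mult[symmetric] mult.assoc)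
qed (auto simp: carr pi_add[symmetric] pi_mult[symmetric] distrib_left distrib_right)

sublocale R: ring R by (rule is_ring)

lemma pi_uminus: "x \<in> D \<Longrightarrow> \<pi> (- x) = \<ominus> \<pi> x"
  using pi_add[of "- x" x] by (intro R.minus_equality[symmetric]) (auto simp: pi_0)

lemma pi_diff: "x \<in> D \<Longrightarrow> y \<in> D \<Longrightarrow> \<pi> (x - y) = \<pi> x \<ominus> \<pi> y"
  using pi_add[of x "- y"] by (simp add: pi_uminus a_minus_def)

lemma pi_eq_iff: "x \<in> D \<Longrightarrow> y \<in> D \<Longrightarrow> \<pi> x = \<pi> y \<longleftrightarrow> \<pi> (x - y) = \<zero>"
  by (simp add: pi_diff R.r_right_minus_eq)

lemma pi_sum: "(\<And>i. i \<in> A \<Longrightarrow> f i \<in> D) \<Longrightarrow> \<pi> (sum f A) = (\<Oplus>i\<in>A. \<pi> (f i))"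
proof -
  assume f: "\<And>i. i \<in> A \<Longrightarrow> f i \<in> D"
  have s: "sum f B \<in> D" if "B \<subseteq> A" for B
    using that f by (induction B rule: infinite_finite_induct) auto
  show ?thesis using f s
  proof (induction A rule: infinite_finite_induct)
    case (insert x A)
    have "\<pi> (sum f A) = (\<Oplus>i\<in>A. \<pi> (f i))" using insert by (intro insert.IH) auto
    moreover have "sum f A \<in> D" using insert.prems(2)[of A] by blast
    ultimately show ?case using insert by (subst R.finsum_insert) (auto simp: pi_add)
  qed (auto simp: pi_0 R.finsum_infinite)
qed

lemma of_nat_D [simp, intro]: "of_nat k \<in> D"
  by (induction k) auto

lemma of_int_D [simp, intro]: "of_int k \<in> D"
  by (cases k rule: int_diff_cases) auto

lemma pi_of_nat: "x \<in> D \<Longrightarrow> [(k :: nat)] \<cdot> \<pi> x = \<pi> (of_nat k * x)"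
  by (induction k) (auto simp: pi_0 pi_add distrib_right R.add.m_comm R.add.nat_pow_Suc)

lemma pi_of_int: "x \<in> D \<Longrightarrow> [(k :: int)] \<cdot> \<pi> x = \<pi> (of_int k * x)"
  by (cases "k \<ge> 0") (simp_all add: add_pow_int_ge add_pow_int_lt pi_of_nat pi_uminus[symmetric])

text \<open>Multiplicativity is required only after applying \<open>\<pi>\<close>, since ordered
  substitution respects products only up to congruence.\<close>

lemma lift_endomorphism:
  assumes E: "\<And>x. x \<in> D \<Longrightarrow> E x \<in> D" and ker: "\<And>x. x \<in> D \<Longrightarrow> \<pi> x = \<zero> \<Longrightarrow> \<pi> (E x) = \<zero>"
    and add: "\<And>x y. x \<in> D \<Longrightarrow> y \<in> D \<Longrightarrow> E (x + y) = E x + E y"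
    and mult: "\<And>x y. x \<in> D \<Longrightarrow> y \<in> D \<Longrightarrow> \<pi> (E (x * y)) = \<pi> (E x * E y)"
    and one: "\<pi> (E 1) = \<one>"
  shows "\<exists>h\<in>Ring.ring_hom R R. \<forall>x\<in>D. h (\<pi> x) = \<pi> (E x)"
proof -
  define h where "h z = \<pi> (E (SOME x. x \<in> D \<and> \<pi> x = z))" for z
  have diff: "E (x - y) = E x - E y" if "x \<in> D" "y \<in> D" for x y
    using add[of "x - y" y] that by (simp add: eq_diff_eq)
  have h: "h (\<pi> x) = \<pi> (E x)" if x: "x \<in> D" for x
  proof -
    define y where "y = (SOME y. y \<in> D \<and> \<pi> y = \<pi> x)"
    have y: "y \<in> D \<and> \<pi> y = \<pi> x" unfolding y_def by (rule someI[of _ x]) (use x in simp)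
    then have "\<pi> (y - x) = \<zero>" using pi_eq_iff[of y x] x by simp
    then have "\<pi> (E y) = \<pi> (E x)"
      using ker[of "y - x"] x y E by (simp add: diff pi_eq_iff)
    then show ?thesis by (simp only: h_def y_def)
  qed
  have "h \<in> Ring.ring_hom R R"
  proof (rule ring_hom_memI)
    show "h z \<in> carrier R" if "z \<in> carrier R" for z
      using that by (auto simp: carr h E)
    fix z w assume "z \<in> carrier R" "w \<in> carrier R"
    then obtain x y where xy: "x \<in> D" "z = \<pi> x" "y \<in> D" "w = \<pi> y" by (auto simp: carr)
    show "h (z \<otimes> w) = h z \<otimes> h w"
      using xy h[of "x * y"] mult[of x y] by (simp add: pi_mult[symmetric] h E)
    show "h (z \<oplus> w) = h z \<oplus> h w"
      using xy h[of "x + y"] add[of x y] by (simp add: pi_add[symmetric] h E)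
  next
    show "h \<one> = \<one>" using h[of 1] one by (simp add: pi_1)
  qed
  then show ?thesis using h by blast
qed

end

lemma (in cring) pi_prod:
  fixes \<pi> :: "'t::comm_ring_1 \<Rightarrow> 'a"
  assumes "rcover R \<pi> D" "\<And>i. i \<in> A \<Longrightarrow> f i \<in> D"
  shows "\<pi> (prod f A) = (\<Otimes>i\<in>A. \<pi> (f i))"
proof -
  interpret rcover R \<pi> D by fact
  have s: "prod f B \<in> D" if "B \<subseteq> A" for B
    using that assms(2) by (induction B rule: infinite_finite_induct) auto
  show ?thesis using assms(2) s
  proof (induction A rule: infinite_finite_induct)
    case (insert x A)
    have "\<pi> (prod f A) = (\<Otimes>i\<in>A. \<pi> (f i))" using insert by (intro insert.IH) auto
    moreover have "prod f A \<in> D" using insert.prems(2)[of A] by blast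
    ultimately show ?case using insert by (subst finprod_insert) (auto simp: pi_mult)
  qed (auto simp: pi_1 finprod_infinite)
qed

text \<open>A commutative ring given as a record is the image of a polynomial ring over the integers, where
  type class arithmetic is available.\<close>

context cring
begin

text \<open>The variables range over the whole type; those outside the carrier are evaluated at
  zero.\<close>

definition mono_val :: "'a multiset \<Rightarrow> 'a"
  where "mono_val m = (\<Otimes>x\<in>set_mset m. (if x \<in> carrier R then x else \<zero>) [^] count m x)"

definition poly_val :: "('a, int) mp \<Rightarrow> 'a"
  where "poly_val f = (\<Oplus>m\<in>keys f. [lookup f m] \<cdot> mono_val m)"

lemma mono_val_closed [simp]: "mono_val m \<in> carrier R"
  unfolding mono_val_def by (intro finprod_closed) auto

lemma mono_val_superset:
  assumes "finite S" "set_mset m \<subseteq> S"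
  shows "mono_val m = (\<Otimes>x\<in>S. (if x \<in> carrier R then x else \<zero>) [^] count m x)"
  unfolding mono_val_def using assms
  by (intro finprod_mono_neutral_cong_left) (auto simp: not_in_iff)

lemma mono_val_add: "mono_val (m + m') = mono_val m \<otimes> mono_val m'"
proof -
  let ?S = "set_mset m \<union> set_mset m'"
  have "mono_val (m + m') = (\<Otimes>x\<in>?S. ((if x \<in> carrier R then x else \<zero>) [^] count m x) \<otimes>
      ((if x \<in> carrier R then x else \<zero>) [^] count m' x))"
    by (subst mono_val_superset[of ?S]) (auto simp: nat_pow_mult intro!: finprod_cong')
  also have "\<dots> = mono_val m \<otimes> mono_val m'"
    by (subst (1 2) mono_val_superset[of ?S]) (auto intro!: finprod_multf)
  finally show ?thesis .
qed

lemma poly_val_closed [simp]: "poly_val f \<in> carrier R"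
  unfolding poly_val_def by (intro finsum_closed) auto

lemma poly_val_superset:
  assumes "finite S" "keys f \<subseteq> S"
  shows "poly_val f = (\<Oplus>m\<in>S. [lookup f m] \<cdot> mono_val m)"
proof -
  have "[(0 :: int)] \<cdot> x = \<zero>" for x by (simp add: add_pow_def)
  then show ?thesis unfolding poly_val_def using assms
    by (intro add.finprod_mono_neutral_cong_left) (auto simp: in_keys_iff)
qed

lemma poly_val_add: "poly_val (f + g) = poly_val f \<oplus> poly_val g"
proof -
  let ?S = "keys f \<union> keys g"
  have "keys (f + g) \<subseteq> ?S" by (rule keys_add)
  then have "poly_val (f + g) = (\<Oplus>m\<in>?S. ([lookup f m] \<cdot> mono_val m) \<oplus> ([lookup g m] \<cdot> mono_val m))"
    by (subst poly_val_superset[of ?S]) (auto simp: lookup_add add.int_pow_mult intro!: finsum_cong')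
  also have "\<dots> = poly_val f \<oplus> poly_val g"
    by (subst (1 2) poly_val_superset[of ?S]) (auto intro!: finsum_addf)
  finally show ?thesis .
qed

lemma poly_val_single: "poly_val (single m c) = [c] \<cdot> mono_val m"
  by (subst poly_val_superset[of "{m}"]) auto

lemma poly_val_0: "poly_val 0 = \<zero>"
  by (simp add: poly_val_def)

lemma poly_val_mult: "poly_val (f * g) = poly_val f \<otimes> poly_val g"
proof (induction f rule: pm_induct)
  case (single m c)
  show ?case
  proof (induction g rule: pm_induct)
    case (single m' c')
    show ?case
      by (simp add: mult_single poly_val_single mono_val_add add_pow_ldistr_int add_pow_rdistr_int
          add.int_pow_pow)
  next
    case (add f g)
    then show ?case by (simp add: distrib_left poly_val_add r_distr)
  qed (simp add: poly_val_0)
next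
  case (add f h)
  then show ?case by (simp add: distrib_right poly_val_add l_distr)
qed (simp add: poly_val_0)

lemma mono_val_empty: "mono_val {#} = \<one>"
  by (simp add: mono_val_def)

lemma rcover_poly_val: "rcover R poly_val UNIV"
proof
  have "poly_val (Var x) = x" if "x \<in> carrier R" for x
    using that by (simp add: Var_def poly_val_single mono_val_superset[of "{x}"])
  then have "x \<in> poly_val ` UNIV" if "x \<in> carrier R" for x
    using that by (intro image_eqI[of _ _ "Var x"]) simp_all
  then show "carrier R = poly_val ` UNIV"
    by (intro equalityI subsetI) (auto simp: poly_val_closed)
  show "poly_val 1 = \<one>"
    using poly_val_single[of "{#}" 1] by (simp add: mono_val_empty)
qed (auto simp: poly_val_0 poly_val_add poly_val_mult)

end


section \<open>Monoid rings\<close>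

text \<open>With concatenation as addition, finitely supported functions on words multiply as in the
  free algebra.\<close>

instantiation list :: (type) monoid_add
begin
definition zero_list :: "'a list" where "zero_list = []"
definition plus_list :: "'a list \<Rightarrow> 'a list \<Rightarrow> 'a list" where "plus_list = (@)"
instance by standard (auto simp: zero_list_def plus_list_def)
end

text \<open>The field \<open>K\<close> is the quotient of a type class ring by the prime ideal
  \<open>kerI\<close>. Two such covers occur: integer polynomials with the elements of the type of
  \<open>K\<close> as variables, and for the limit field those with terms as variables.\<close>

locale kcover = K: field K for K :: "'k ring" +
  fixes ev :: "'r::comm_ring_1 \<Rightarrow> 'k"
  assumes cov: "rcover K ev UNIV"
begin

sublocale C: rcover K ev UNIV by (rule cov)

definition kerI :: "'r set" where "kerI = {x. ev x = \<zero>\<^bsub>K\<^esub>}"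

lemma kerI_prime: "cring_prime kerI"
proof
  show "1 \<notin> kerI" by (simp add: kerI_def C.pi_1)
  show "x \<in> kerI \<or> y \<in> kerI" if "x * y \<in> kerI" for x y
    using that K.integral[of "ev x" "ev y"] by (auto simp: kerI_def C.pi_mult)
qed (auto simp: kerI_def C.pi_0 C.pi_add C.pi_mult)

sublocale I: cring_prime kerI by (rule kerI_prime)

lemma kerI_ideal: "cring_ideal kerI" by unfold_locales

lemma ev_eq_iff: "ev x = ev y \<longleftrightarrow> x - y \<in> kerI"
  using C.pi_eq_iff[of x y] by (simp add: kerI_def)

lemma kerI_inverse: "x \<notin> kerI \<Longrightarrow> \<exists>y. x * y - 1 \<in> kerI"
proof -
  assume x: "x \<notin> kerI"
  then have "ev x \<in> Units K" using K.field_Units by (auto simp: kerI_def)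
  then obtain z where "z \<in> carrier K" "ev x \<otimes>\<^bsub>K\<^esub> z = \<one>\<^bsub>K\<^esub>" by (auto simp: Units_def)
  moreover from this obtain y where "z = ev y" using C.carrE by blast
  ultimately have "ev (x * y) = ev 1" by (simp add: C.pi_mult C.pi_1)
  then show ?thesis using ev_eq_iff by blast
qed

definition cmap :: "('m \<Rightarrow>\<^sub>0 'r) \<Rightarrow> 'm \<Rightarrow> 'k"
  where "cmap f = (\<lambda>m. ev (lookup f m))"

lemma supp_cmap: "monoid_ring_supp K (cmap f) \<subseteq> keys f"
  by (auto simp: monoid_ring_supp_def cmap_def in_keys_iff C.pi_0)

lemma lookup_mult_keys:
  fixes f g :: "'m::monoid_add \<Rightarrow>\<^sub>0 'c::ring_1"
  shows "lookup (f * g) m = (\<Sum>q\<in>{(a, b). a \<in> keys f \<and> b \<in> keys g \<and> a + b = m}. lookup f (fst q) * lookup g (snd q))"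
proof -
  have "f * g = (\<Sum>a\<in>keys f. \<Sum>b\<in>keys g. single (a + b) (lookup f a * lookup g b))"
    by (subst pm_sum_single[of f], subst pm_sum_single[of g]) (simp add: sum_product mult_single)
  then have "lookup (f * g) m = (\<Sum>q\<in>keys f \<times> keys g. if fst q + snd q = m then lookup f (fst q) * lookup g (snd q) else 0)"
    by (simp add: lookup_sum lookup_single when_def sum.cartesian_product case_prod_beta)
  also have "\<dots> = (\<Sum>q\<in>{q \<in> keys f \<times> keys g. fst q + snd q = m}. lookup f (fst q) * lookup g (snd q))"
    by (rule sum.inter_filter[symmetric]) simp
  also have "{q \<in> keys f \<times> keys g. fst q + snd q = m} = {(a, b). a \<in> keys f \<and> b \<in> keys g \<and> a + b = m}"
    by auto
  finally show ?thesis .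
qed

lemma rcover_monoid_ring:
  fixes Mo :: "('m::monoid_add, 'x) monoid_scheme"
  assumes M: "monoid.mult Mo = (+)" "one Mo = 0" "0 \<in> carrier Mo"
    "\<And>a b. a \<in> carrier Mo \<Longrightarrow> b \<in> carrier Mo \<Longrightarrow> a + b \<in> carrier Mo"
  shows "rcover (monoid_ring Mo K) cmap {f. keys f \<subseteq> carrier Mo}"
proof
  let ?D = "{f :: 'm \<Rightarrow>\<^sub>0 'r. keys f \<subseteq> carrier Mo}"
  show "0 \<in> ?D" by simp
  show "1 \<in> ?D" using M by simp
  show "x + y \<in> ?D" if "x \<in> ?D" "y \<in> ?D" for x y
    using that keys_add[of x y] by blast
  show "- x \<in> ?D" if "x \<in> ?D" for x
    using that by (auto simp: in_keys_iff)
  show "x * y \<in> ?D" if "x \<in> ?D" "y \<in> ?D" for x y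
    using that by (auto dest!: subsetD[OF keys_mult] intro!: M(4))
  show "carrier (monoid_ring Mo K) = cmap ` ?D"
  proof (intro equalityI subsetI)
    fix F assume F: "F \<in> carrier (monoid_ring Mo K)"
    define f where "f = (\<Sum>m\<in>monoid_ring_supp K F. single m (inv_into UNIV ev (F m)))"
    have fin: "finite (monoid_ring_supp K F)" "monoid_ring_supp K F \<subseteq> carrier Mo" "\<And>m. F m \<in> carrier K"
      using F by (auto simp: monoid_ring_def)
    have lf: "lookup f m = (if m \<in> monoid_ring_supp K F then inv_into UNIV ev (F m) else 0)" for m
      using fin(1) by (simp add: f_def lookup_sum lookup_single when_def)
    have "F m = cmap f m" for m
    proof (cases "m \<in> monoid_ring_supp K F")
      case True
      then show ?thesis using fin(3)[of m] by (simp add: cmap_def lf f_inv_into_f C.carr)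
    next
      case False
      then show ?thesis by (simp add: cmap_def lf C.pi_0) (simp add: monoid_ring_supp_def)
    qed
    moreover have "f \<in> ?D" using fin by (auto simp: in_keys_iff lf split: if_splits)
    ultimately show "F \<in> cmap ` ?D" by blast
  next
    fix F assume "F \<in> cmap ` ?D"
    then obtain f where f: "F = cmap f" "keys f \<subseteq> carrier Mo" by blast
    then have "finite (monoid_ring_supp K F)" "monoid_ring_supp K F \<subseteq> carrier Mo"
      using supp_cmap[of f] by (auto intro: finite_subset)
    then show "F \<in> carrier (monoid_ring Mo K)" by (auto simp: monoid_ring_def f cmap_def)
  qed
  show "cmap 0 = \<zero>\<^bsub>monoid_ring Mo K\<^esub>" by (simp add: cmap_def monoid_ring_def C.pi_0)
  show "cmap 1 = \<one>\<^bsub>monoid_ring Mo K\<^esub>"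
    by (auto simp: cmap_def monoid_ring_def C.pi_0 C.pi_1 lookup_one when_def M fun_eq_iff)
  show "cmap (x + y) = cmap x \<oplus>\<^bsub>monoid_ring Mo K\<^esub> cmap y" for x y
    by (simp add: cmap_def monoid_ring_def C.pi_add lookup_add)
  show "cmap (f * g) = cmap f \<otimes>\<^bsub>monoid_ring Mo K\<^esub> cmap g" for f g
  proof
    fix m
    let ?B = "{(a, b). a \<in> keys f \<and> b \<in> keys g \<and> a + b = m}"
    let ?A = "{(a, b). a \<in> monoid_ring_supp K (cmap f) \<and> b \<in> monoid_ring_supp K (cmap g) \<and> a + b = m}"
    have "?B \<subseteq> keys f \<times> keys g" by auto
    then have fB: "finite ?B" by (rule finite_subset) simp
    have "cmap (f * g) m = (\<Oplus>\<^bsub>K\<^esub>q\<in>?B. ev (lookup f (fst q) * lookup g (snd q)))"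
      by (simp only: cmap_def lookup_mult_keys) (rule C.pi_sum, simp)
    also have "\<dots> = (\<Oplus>\<^bsub>K\<^esub>q\<in>?A. cmap f (fst q) \<otimes>\<^bsub>K\<^esub> cmap g (snd q))"
    proof (rule K.add.finprod_mono_neutral_cong_left[symmetric])
      show "?A \<subseteq> ?B" using supp_cmap[of f] supp_cmap[of g] by auto
      show "ev (lookup f (fst i) * lookup g (snd i)) = \<zero>\<^bsub>K\<^esub>" if "i \<in> ?B - ?A" for i
        using that by (auto simp: monoid_ring_supp_def cmap_def C.pi_mult)
    qed (auto simp: fB cmap_def C.pi_mult)
    finally show "cmap (f * g) m = (cmap f \<otimes>\<^bsub>monoid_ring Mo K\<^esub> cmap g) m"
      by (simp add: monoid_ring_def M)
  qed
qed

lemma cmap_eq_iff: "cmap f = cmap g \<longleftrightarrow> (\<forall>m. lookup (f - g) m \<in> kerI)"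
  by (auto simp: cmap_def fun_eq_iff ev_eq_iff lookup_minus)

lemma cmap_eq_coefs: "cmap f = cmap g \<longleftrightarrow> f - g \<in> coefs_in kerI"
  by (simp add: cmap_eq_iff coefs_in_def)


section \<open>Endomorphisms of polynomial rings\<close>

abbreviation "PR N \<equiv> mpoly_ring K N"

lemma mvars_keys: "mvars V = {f. keys f \<subseteq> {m. set_mset m \<subseteq> V}}"
  by (auto simp: mvars_def)

lemma rcover_mpoly: "rcover (PR N) cmap (mvars {1..N})"
proof -
  have "rcover (monoid_ring (monomials N) K) cmap {f :: (nat, 'r) mp. keys f \<subseteq> carrier (monomials N)}"
    by (rule rcover_monoid_ring) (auto simp: monomials_def)
  then show ?thesis by (simp add: mpoly_ring_def mvars_keys monomials_def)
qed

lemma cring_mpoly: "cring (PR N)"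
proof -
  interpret P: rcover "PR N" cmap "mvars {1..N}" by (rule rcover_mpoly)
  show ?thesis
  proof (intro cring.intro P.is_ring comm_monoid.intro comm_monoid_axioms.intro)
    show "Group.monoid (PR N)" by (rule P.R.monoid_axioms)
    show "x \<otimes>\<^bsub>PR N\<^esub> y = y \<otimes>\<^bsub>PR N\<^esub> x" if "x \<in> carrier (PR N)" "y \<in> carrier (PR N)" for x y
      using that by (auto simp: P.carr P.pi_mult[symmetric] mult.commute)
  qed
qed

lemma cmap_Var: "cmap (Var i) = mpoly_var K i"
  by (auto simp: cmap_def Var_def mpoly_var_def monoid_ring_basis_def lookup_single when_def C.pi_0 C.pi_1)

lemma cmap_Cst: "cmap (Cst c) = mpoly_const K N (ev c)"
  by (auto simp: cmap_def lookup_Cst mpoly_const_def monoid_ring_const_def monomials_def C.pi_0)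

lemma cmap_pder: "mpoly_deriv K j (cmap f) = cmap (pder j f)"
  unfolding mpoly_deriv_def cmap_def lookup_pder by (rule ext) (rule C.pi_of_nat, simp)

lemma cmap_tdet:
  assumes "\<And>i j. i \<in> {1..N} \<Longrightarrow> j \<in> {1..N} \<Longrightarrow> M i j \<in> mvars {1..N}"
    "\<And>i j. i \<in> {1..N} \<Longrightarrow> j \<in> {1..N} \<Longrightarrow> M' i j = cmap (M i j)"
  shows "ring_det (PR N) N M' = cmap (tdet N M)"
proof -
  interpret P: rcover "PR N" cmap "mvars {1..N}" by (rule rcover_mpoly)
  interpret PC: cring "PR N" by (rule cring_mpoly)
  have q: "q i \<in> {1..N}" if "q permutes {1..N}" "i \<in> {1..N}" for q i
    using that permutes_in_image[of q "{1..N}" i] by simp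
  have pv: "(\<Prod>i\<in>{1..N}. M i (q i)) \<in> mvars {1..N}" if "q permutes {1..N}" for q
    using that assms(1) q by (intro mvars_prod) blast
  have "cmap (tdet N M) = (\<Oplus>\<^bsub>PR N\<^esub>q\<in>{q. q permutes {1..N}}. cmap (of_int (sign q) * (\<Prod>i\<in>{1..N}. M i (q i))))"
    unfolding tdet_def by (rule P.pi_sum) (use pv in auto)
  also have "\<dots> = ring_det (PR N) N M'"
    unfolding ring_det_def
  proof (rule P.R.finsum_cong')
    fix q assume "q \<in> {q. q permutes {1..N}}"
    then have qp: "q permutes {1..N}" by simp
    have "(\<Otimes>\<^bsub>PR N\<^esub>i\<in>{1..N}. M' i (q i)) = (\<Otimes>\<^bsub>PR N\<^esub>i\<in>{1..N}. cmap (M i (q i)))"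
      using assms q[OF qp] by (intro PC.finprod_cong') auto
    also have "\<dots> = cmap (\<Prod>i\<in>{1..N}. M i (q i))"
      using assms q[OF qp] by (intro PC.pi_prod[OF rcover_mpoly, symmetric]) auto
    finally show "cmap (of_int (sign q) * (\<Prod>i\<in>{1..N}. M i (q i))) = [sign q] \<cdot>\<^bsub>PR N\<^esub> (\<Otimes>\<^bsub>PR N\<^esub>i\<in>{1..N}. M' i (q i))"
      using P.pi_of_int[OF pv[OF qp]] by simp
  next
    show "(\<lambda>q. [sign q] \<cdot>\<^bsub>PR N\<^esub> (\<Otimes>\<^bsub>PR N\<^esub>i\<in>{1..N}. M' i (q i))) \<in> {q. q permutes {1..N}} \<rightarrow> carrier (PR N)"
    proof
      fix q assume "q \<in> {q. q permutes {1..N}}"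
      then have "(\<Otimes>\<^bsub>PR N\<^esub>i\<in>{1..N}. M' i (q i)) \<in> carrier (PR N)"
        using assms q by (intro PC.finprod_closed) auto
      then show "[sign q] \<cdot>\<^bsub>PR N\<^esub> (\<Otimes>\<^bsub>PR N\<^esub>i\<in>{1..N}. M' i (q i)) \<in> carrier (PR N)"
        by (rule P.R.add.int_pow_closed)
    qed
  qed simp
  finally show ?thesis by simp
qed

lemma mpoly_end_exists:
  assumes Phi: "\<And>i. i \<in> {1..N} \<Longrightarrow> Phi i \<in> mvars {1..N}"
  shows "\<exists>\<phi>\<in>alg_end K (mpoly_const K N) (PR N). \<forall>f\<in>mvars {1..N}. \<phi> (cmap f) = cmap (meval Cst Phi f)"
proof -
  interpret P: rcover "PR N" cmap "mvars {1..N}" by (rule rcover_mpoly)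
  have "\<exists>\<phi>\<in>Ring.ring_hom (PR N) (PR N). \<forall>f\<in>mvars {1..N}. \<phi> (cmap f) = cmap (meval Cst Phi f)"
  proof (rule P.lift_endomorphism)
    show "meval Cst Phi f \<in> mvars {1..N}" if "f \<in> mvars {1..N}" for f
      using that Phi by (auto intro: meval_mvars)
    show "cmap (meval Cst Phi f) = \<zero>\<^bsub>PR N\<^esub>" if "cmap f = \<zero>\<^bsub>PR N\<^esub>" for f
      using that meval_coefs_in[OF kerI_ideal, of f Phi] unfolding P.pi_0[symmetric] cmap_eq_coefs by simp
    show "cmap (meval Cst Phi 1) = \<one>\<^bsub>PR N\<^esub>"
      by (simp only: is_homD(1)[OF is_hom_meval[OF is_hom_Cst]] P.pi_1)
  qed (simp_all only: meval_add[OF is_hom_Cst] meval_mult[OF is_hom_Cst])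
  then obtain \<phi> where \<phi>: "\<phi> \<in> Ring.ring_hom (PR N) (PR N)"
    "\<And>f. f \<in> mvars {1..N} \<Longrightarrow> \<phi> (cmap f) = cmap (meval Cst Phi f)" by blast
  have "\<phi> (mpoly_const K N c) = mpoly_const K N c" if "c \<in> carrier K" for c
  proof -
    obtain x where "c = ev x" using \<open>c \<in> carrier K\<close> by (rule C.carrE)
    then show ?thesis using \<phi>(2)[of "Cst x"] by (simp add: cmap_Cst[of _ N, symmetric] meval_Cst)
  qed
  then show ?thesis using \<phi> unfolding alg_end_def by blast
qed

lemma mpoly_end_form:
  assumes \<phi>: "\<phi> \<in> alg_end K (mpoly_const K N) (PR N)"
  shows "\<exists>Phi. (\<forall>i\<in>{1..N}. Phi i \<in> mvars {1..N}) \<and> (\<forall>f\<in>mvars {1..N}. \<phi> (cmap f) = cmap (meval Cst Phi f))"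
proof -
  interpret P: rcover "PR N" cmap "mvars {1..N}" by (rule rcover_mpoly)
  have h: "\<phi> \<in> Ring.ring_hom (PR N) (PR N)" and hc: "\<And>c. c \<in> carrier K \<Longrightarrow> \<phi> (mpoly_const K N c) = mpoly_const K N c"
    using \<phi> by (auto simp: alg_end_def)
  have "\<exists>g\<in>mvars {1..N}. \<phi> (cmap (Var i)) = cmap g" if "i \<in> {1..N}" for i
  proof -
    have "cmap (Var i) \<in> carrier (PR N)" by (rule P.pi_closed[OF mvars_Var[OF that]])
    then have "\<phi> (cmap (Var i)) \<in> carrier (PR N)" using h by (rule ring_hom_closed[rotated])
    then show ?thesis by (auto simp: P.carr)
  qed
  then obtain Phi where Phi: "\<And>i. i \<in> {1..N} \<Longrightarrow> Phi i \<in> mvars {1..N}" "\<And>i. i \<in> {1..N} \<Longrightarrow> \<phi> (cmap (Var i)) = cmap (Phi i)"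
    by metis
  have mv: "meval Cst Phi f \<in> mvars {1..N}" if "f \<in> mvars {1..N}" for f
    using that Phi by (auto intro: meval_mvars)
  have "\<phi> (cmap f) = cmap (meval Cst Phi f)" if "f \<in> mvars {1..N}" for f
    using that
  proof (induction rule: mp_induct)
    case (Cst c)
    then show ?case using hc[of "ev c"] by (simp add: cmap_Cst[of _ N, symmetric] meval_Cst)
  next
    case (Var i f)
    have "\<phi> (cmap (Var i * f)) = \<phi> (cmap (Var i)) \<otimes>\<^bsub>PR N\<^esub> \<phi> (cmap f)"
      unfolding P.pi_mult[OF mvars_Var[OF Var(1)] Var(2)]
      by (rule ring_hom_mult[OF h P.pi_closed[OF mvars_Var[OF Var(1)]] P.pi_closed[OF Var(2)]])
    also have "\<dots> = cmap (Phi i * meval Cst Phi f)"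
      unfolding Var(3) Phi(2)[OF Var(1)] by (rule P.pi_mult[OF Phi(1)[OF Var(1)] mv[OF Var(2)], symmetric])
    finally show ?case by (simp add: meval_mult meval_Var)
  next
    case (add f g)
    have "\<phi> (cmap (f + g)) = \<phi> (cmap f) \<oplus>\<^bsub>PR N\<^esub> \<phi> (cmap g)"
      unfolding P.pi_add[OF add(1,2)]
      by (rule ring_hom_add[OF h P.pi_closed[OF add(1)] P.pi_closed[OF add(2)]])
    also have "\<dots> = cmap (meval Cst Phi f + meval Cst Phi g)"
      unfolding add(3,4) by (rule P.pi_add[OF mv[OF add(1)] mv[OF add(2)], symmetric])
    finally show ?case by (simp add: meval_add)
  qed
  then show ?thesis using Phi(1) by blast
qed

lemma jacobian_eq:
  assumes "\<And>i. i \<in> {1..N} \<Longrightarrow> Phi i \<in> mvars {1..N}" "\<And>f. f \<in> mvars {1..N} \<Longrightarrow> \<phi> (cmap f) = cmap (meval Cst Phi f)"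
  shows "jacobian K N \<phi> = cmap (tdet N (\<lambda>i j. pder j (Phi i)))"
  unfolding jacobian_def
proof (rule cmap_tdet)
  fix i j assume ij: "i \<in> {1..N}" "j \<in> {1..N}"
  show "pder j (Phi i) \<in> mvars {1..N}" using assms(1)[OF ij(1)] by blast
  have "\<phi> (mpoly_var K i) = cmap (Phi i)"
    using assms(2)[OF mvars_Var[OF ij(1)]] by (simp add: cmap_Var meval_Var)
  then show "mpoly_deriv K j (\<phi> (mpoly_var K i)) = cmap (pder j (Phi i))" by (simp add: cmap_pder)
qed

lemma one_mpoly: "\<one>\<^bsub>PR N\<^esub> = cmap 1"
  by (rule rcover.pi_1[OF rcover_mpoly, symmetric])

text \<open>Surjectivity of the automorphism yields a right inverse \<open>Psi\<close>, and its
  injectivity makes this inverse two-sided.\<close>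

lemma Jacobian_inverse:
  assumes JC: "Jacobian_Conjecture TYPE('k) N" and char: "char_zero_field K"
    and Phi: "\<And>i. i \<in> {1..N} \<Longrightarrow> Phi i \<in> mvars {1..N}"
    and det: "tdet N (\<lambda>i j. pder j (Phi i)) - 1 \<in> coefs_in kerI"
  shows "\<exists>Psi. \<forall>i\<in>{1..N}. Psi i \<in> mvars {1..N} \<and> meval Cst Phi (Psi i) - Var i \<in> coefs_in kerI
      \<and> meval Cst Psi (Phi i) - Var i \<in> coefs_in kerI"
proof -
  interpret P: rcover "PR N" cmap "mvars {1..N}" by (rule rcover_mpoly)
  obtain \<phi> where \<phi>: "\<phi> \<in> alg_end K (mpoly_const K N) (PR N)" "\<And>f. f \<in> mvars {1..N} \<Longrightarrow> \<phi> (cmap f) = cmap (meval Cst Phi f)"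
    using mpoly_end_exists[of N Phi] Phi by blast
  have "jacobian K N \<phi> = cmap (tdet N (\<lambda>i j. pder j (Phi i)))" by (rule jacobian_eq[OF Phi \<phi>(2)])
  also have "\<dots> = \<one>\<^bsub>PR N\<^esub>" unfolding one_mpoly cmap_eq_coefs by (rule det)
  finally have "\<phi> \<in> alg_aut K (mpoly_const K N) (PR N)"
    using JC char \<phi>(1) unfolding Jacobian_Conjecture_def by blast
  then have bij: "bij_betw \<phi> (carrier (PR N)) (carrier (PR N))" by (simp add: alg_aut_def ring_iso_def)
  have "\<exists>g\<in>mvars {1..N}. cmap (meval Cst Phi g) = cmap (Var i)" if "i \<in> {1..N}" for i
  proof -
    have "cmap (Var i) \<in> \<phi> ` carrier (PR N)"
      using bij P.pi_closed[OF mvars_Var[OF that]] by (simp add: bij_betw_def)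
    then show ?thesis by (auto simp: P.carr \<phi>)
  qed
  then obtain Psi where Psi: "\<And>i. i \<in> {1..N} \<Longrightarrow> Psi i \<in> mvars {1..N}"
    "\<And>i. i \<in> {1..N} \<Longrightarrow> cmap (meval Cst Phi (Psi i)) = cmap (Var i)" by metis
  have "cmap (meval Cst Psi (Phi i)) = cmap (Var i)" if i: "i \<in> {1..N}" for i
  proof -
    have v: "meval Cst Psi (Phi i) \<in> mvars {1..N}" using Phi[OF i] Psi by (auto intro: meval_mvars)
    have "meval Cst Phi (meval Cst Psi (Phi i)) = meval Cst (\<lambda>j. meval Cst Phi (Psi j)) (Phi i)"
      by (simp add: meval_hom[OF is_hom_Cst is_hom_meval[OF is_hom_Cst]] meval_Cst)
    moreover have "meval Cst (\<lambda>j. meval Cst Phi (Psi j)) (Phi i) - meval Cst Var (Phi i) \<in> coefs_in kerI"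
      using Psi(2) by (intro meval_cong_coefs[OF kerI_ideal Phi[OF i]]) (simp add: cmap_eq_coefs)
    ultimately have "cmap (meval Cst Phi (meval Cst Psi (Phi i))) = cmap (Phi i)"
      by (simp add: meval_id cmap_eq_coefs)
    then have "\<phi> (cmap (meval Cst Psi (Phi i))) = \<phi> (cmap (Var i))"
      by (simp only: \<phi>(2)[OF v] \<phi>(2)[OF mvars_Var[OF i]] meval_Var[OF is_hom_Cst])
    then show ?thesis
      using inj_onD[OF bij_betw_imp_inj_on[OF bij] _ P.pi_closed[OF v] P.pi_closed[OF mvars_Var[OF i]]] by blast
  qed
  then show ?thesis using Psi unfolding cmap_eq_coefs by (intro exI[of _ Psi]) blast
qed

end


section \<open>Ideals and quotients\<close>

context rcover
begin

lemma ideal_image: "ring_mod D J \<Longrightarrow> ideal (\<pi> ` J) R"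
proof -
  assume "ring_mod D J"
  interpret D: ring_mod D J by fact
  show ?thesis
  proof (rule idealI[OF is_ring])
    show "subgroup (\<pi> ` J) (add_monoid R)"
    proof (rule R.add.subgroupI)
      show "\<pi> ` J \<subseteq> carrier R" by auto
      show "\<pi> ` J \<noteq> {}" by auto
      show "\<ominus> a \<in> \<pi> ` J" if "a \<in> \<pi> ` J" for a
        using that by (auto simp: pi_uminus[symmetric] D.in_A_of_J)
      show "a \<oplus> b \<in> \<pi> ` J" if "a \<in> \<pi> ` J" "b \<in> \<pi> ` J" for a b
        using that by (auto simp: pi_add[symmetric] D.in_A_of_J)
    qed
  qed (auto simp: carr pi_mult[symmetric] D.in_A_of_J)
qed

lemma ring_mod_preimage: "ideal I R \<Longrightarrow> ring_mod D {x \<in> D. \<pi> x \<in> I}"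
proof -
  assume "ideal I R"
  interpret ideal I R by fact
  show ?thesis
    by unfold_locales (auto simp: pi_0 pi_add pi_mult I_l_closed I_r_closed)
qed

lemma
  assumes "ideal I R"
  shows rcover_quotient: "rcover (R Quot I) (\<lambda>x. I +> \<pi> x) D"
    and quotient_zero_iff: "x \<in> D \<Longrightarrow> I +> \<pi> x = \<zero>\<^bsub>R Quot I\<^esub> \<longleftrightarrow> \<pi> x \<in> I"
proof -
  interpret I: ideal I R by fact
  have h: "(+>) I \<in> Ring.ring_hom R (R Quot I)" by (rule I.rcos_ring_hom)
  show *: "I +> \<pi> x = \<zero>\<^bsub>R Quot I\<^esub> \<longleftrightarrow> \<pi> x \<in> I" if "x \<in> D" for x
    using that I.rcos_const_imp_mem[of "\<pi> x"] R.a_rcos_zero[OF assms, of "\<pi> x"] by (auto simp: FactRing_def)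
  show "rcover (R Quot I) (\<lambda>x. I +> \<pi> x) D"
  proof
    show "carrier (R Quot I) = (\<lambda>x. I +> \<pi> x) ` D"
      by (auto simp: FactRing_def A_RCOSETS_def' carr)
    show "I +> \<pi> 0 = \<zero>\<^bsub>R Quot I\<^esub>" by (simp add: *) (simp add: pi_0)
    show "I +> \<pi> 1 = \<one>\<^bsub>R Quot I\<^esub>" using ring_hom_one[OF h] by (simp add: pi_1)
  qed (auto simp: pi_add pi_mult ring_hom_add[OF h] ring_hom_mult[OF h])
qed

end


section \<open>The Weyl algebra\<close>

context kcover
begin

lemma ring_mod_WA: "ring_mod (WA n kerI) (WJ n kerI)"
  by (rule ring_mod_weyl[OF kerI_ideal])

definition fD :: "nat \<Rightarrow> (nat list \<Rightarrow>\<^sub>0 'r) set"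
  where "fD n = {w. keys w \<subseteq> lists {1..2*n}}"

lemma rcover_free: "rcover (free_alg K (2*n)) cmap (fD n)"
proof -
  have "rcover (monoid_ring (words (2*n)) K) cmap {f :: nat list \<Rightarrow>\<^sub>0 'r. keys f \<subseteq> carrier (words (2*n))}"
    by (rule rcover_monoid_ring) (auto simp: words_def zero_list_def plus_list_def)
  then show ?thesis by (simp add: free_alg_def fD_def words_def)
qed

abbreviation "fC c \<equiv> single (0 :: nat list) c"
abbreviation "fV i \<equiv> single [i :: nat] (1 :: 'r)"

lemma fC_fD: "fC c \<in> fD n" by (auto simp: fD_def zero_list_def)
lemma fV_fD: "i \<in> {1..2*n} \<Longrightarrow> fV i \<in> fD n" by (auto simp: fD_def)

lemma is_hom_fC: "is_hom (fC :: 'r \<Rightarrow> _)"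
  by (auto simp: is_hom_def single_add mult_single)

lemma comm_fC: "comm w (fC (c :: 'r)) = 0"
  by (induction w rule: pm_induct) (auto simp: comm_def mult_single mult.commute distrib_left distrib_right)

definition fJ :: "nat \<Rightarrow> (nat list \<Rightarrow>\<^sub>0 'r) set"
  where "fJ n = {w \<in> fD n. cmap w \<in> weyl_ideal K n}"

lemma weyl_rel_eq: "i \<in> {1..2*n} \<Longrightarrow> j \<in> {1..2*n} \<Longrightarrow>
    weyl_rel K n i j = cmap (comm (fV i) (fV j) - of_int (weyl_omega n i j))"
proof -
  assume i: "i \<in> {1..2*n}" and j: "j \<in> {1..2*n}"
  interpret F: rcover "free_alg K (2*n)" cmap "fD n" by (rule rcover_free)
  have v: "free_var K k = cmap (fV k)" for k
    by (auto simp: free_var_def monoid_ring_basis_def cmap_def lookup_single when_def C.pi_0 C.pi_1)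
  have "[weyl_omega n i j] \<cdot>\<^bsub>free_alg K (2*n)\<^esub> \<one>\<^bsub>free_alg K (2*n)\<^esub> = cmap (of_int (weyl_omega n i j) :: nat list \<Rightarrow>\<^sub>0 'r)"
    unfolding F.pi_1[symmetric] F.pi_of_int[OF F.D_1] by simp
  moreover note m = F.D_mult[OF fV_fD[OF i] fV_fD[OF j]] F.D_mult[OF fV_fD[OF j] fV_fD[OF i]]
  ultimately show ?thesis
    unfolding weyl_rel_def Let_def v comm_def F.pi_diff[OF F.D_diff[OF m] F.of_int_D] F.pi_diff[OF m]
      F.pi_mult[OF fV_fD[OF i] fV_fD[OF j]] F.pi_mult[OF fV_fD[OF j] fV_fD[OF i]] by (simp only:)
qed

lemma comm_fV_fD: "i \<in> {1..2*n} \<Longrightarrow> j \<in> {1..2*n} \<Longrightarrow> comm (fV i) (fV j) - of_int (weyl_omega n i j) \<in> fD n"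
proof -
  assume ij: "i \<in> {1..2*n}" "j \<in> {1..2*n}"
  interpret F: rcover "free_alg K (2*n)" cmap "fD n" by (rule rcover_free)
  show ?thesis unfolding comm_def using ij by (intro F.D_diff F.D_mult F.of_int_D fV_fD)
qed

lemma weyl_ideal: "ideal (weyl_ideal K n) (free_alg K (2*n))"
  and weyl_rel_mem: "i \<in> {1..2*n} \<Longrightarrow> j \<in> {1..2*n} \<Longrightarrow> weyl_rel K n i j \<in> weyl_ideal K n"
  and weyl_ideal_minimal: "ideal J (free_alg K (2*n)) \<Longrightarrow>
      (\<And>i j. i \<in> {1..2*n} \<Longrightarrow> j \<in> {1..2*n} \<Longrightarrow> weyl_rel K n i j \<in> J) \<Longrightarrow> weyl_ideal K n \<subseteq> J"
proof -
  interpret F: rcover "free_alg K (2*n)" cmap "fD n" by (rule rcover_free)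
  let ?S = "{weyl_rel K n i j |i j. i \<in> {1..2*n} \<and> j \<in> {1..2*n}}"
  have S: "?S \<subseteq> carrier (free_alg K (2*n))"
  proof
    fix z assume "z \<in> ?S"
    then obtain i j where ij: "i \<in> {1..2*n}" "j \<in> {1..2*n}" "z = weyl_rel K n i j" by blast
    show "z \<in> carrier (free_alg K (2*n))"
      unfolding ij(3) weyl_rel_eq[OF ij(1,2)] by (rule F.pi_closed[OF comm_fV_fD[OF ij(1,2)]])
  qed
  show "ideal (weyl_ideal K n) (free_alg K (2*n))"
    unfolding weyl_ideal_def by (rule F.R.genideal_ideal[OF S])
  show "weyl_rel K n i j \<in> weyl_ideal K n" if "i \<in> {1..2*n}" "j \<in> {1..2*n}"
    using F.R.genideal_self[OF S] that unfolding weyl_ideal_def by blast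
  show "weyl_ideal K n \<subseteq> J" if J: "ideal J (free_alg K (2*n))"
    and r: "\<And>i j. i \<in> {1..2*n} \<Longrightarrow> j \<in> {1..2*n} \<Longrightarrow> weyl_rel K n i j \<in> J"
    unfolding weyl_ideal_def by (rule F.R.genideal_minimal[OF J]) (use r in blast)
qed

lemma ring_mod_fJ: "ring_mod (fD n) (fJ n)"
  unfolding fJ_def by (rule rcover.ring_mod_preimage[OF rcover_free weyl_ideal])

lemma weyl_rels_fV: "weyl_rels n (fJ n) fV"
  unfolding weyl_rels_def fJ_def
proof (intro ballI CollectI conjI)
  fix i j assume ij: "i \<in> {1..2*n}" "j \<in> {1..2*n}"
  show "comm (fV i) (fV j) - of_int (weyl_omega n i j) \<in> fD n" by (rule comm_fV_fD[OF ij])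
  show "cmap (comm (fV i) (fV j) - of_int (weyl_omega n i j)) \<in> weyl_ideal K n"
    using weyl_rel_mem[OF ij] unfolding weyl_rel_eq[OF ij] .
qed

lemma fC_fJ: "c \<in> kerI \<Longrightarrow> fC c \<in> fJ n"
proof -
  assume c: "c \<in> kerI"
  interpret F: rcover "free_alg K (2*n)" cmap "fD n" by (rule rcover_free)
  have "cmap (fC c) = \<zero>\<^bsub>free_alg K (2*n)\<^esub>"
    unfolding F.pi_0[symmetric] using c by (auto simp: cmap_def lookup_single when_def kerI_def C.pi_0)
  moreover have "\<zero>\<^bsub>free_alg K (2*n)\<^esub> \<in> weyl_ideal K n"
    using weyl_ideal[of n] by (simp add: additive_subgroup.zero_closed ideal.axioms(1))
  ultimately show ?thesis by (simp add: fJ_def fC_fD)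
qed

lemma cons_fV: "single (i # l) c = fV i * single l c"
  by (simp add: mult_single plus_list_def)

abbreviation "fsub n f \<equiv> osub fC fV (2*n) f"

lemma fsub_fD: "fsub n f \<in> fD n"
proof -
  interpret F: ring_mod "fD n" "fJ n" by (rule ring_mod_fJ)
  show ?thesis by (rule F.osub_A[OF is_hom_fC fC_fD fV_fD])
qed

text \<open>Normal ordering of words: putting a letter in front of a normally ordered polynomial
  amounts to \<open>Yop n i\<close>, up to the Weyl relations.\<close>

lemma fsub_onto:
  assumes "w \<in> fD n"
  shows "\<exists>f\<in>wvars n. w - fsub n f \<in> fJ n"
proof -
  interpret F: ring_mod "fD n" "fJ n" by (rule ring_mod_fJ)
  note [simp] = is_hom_fC
  have word: "\<exists>f\<in>wvars n. single l c - fsub n f \<in> fJ n" if "l \<in> lists {1..2*n}" for l c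
    using that
  proof (induction l)
    case Nil
    show ?case unfolding zero_list_def[symmetric] by (intro bexI[of _ "Cst c"]) (auto simp: osub_Cst)
  next
    case (Cons i l)
    then obtain f where f: "f \<in> wvars n" "single l c - fsub n f \<in> fJ n" by auto
    have i: "i \<in> {1..2*n}" using Cons by auto
    have "fV i * (single l c - fsub n f) \<in> fJ n" using fV_fD[OF i] f by blast
    moreover have "fsub n (app (Yop n i) f) - fV i * fsub n f \<in> fJ n"
      by (rule F.osub_Yop[OF is_hom_fC fC_fD comm_fC weyl_rels_fV fV_fD i f(1)])
    ultimately have "fV i * (single l c - fsub n f) - (fsub n (app (Yop n i) f) - fV i * fsub n f) \<in> fJ n"
      by (rule F.diff_J)
    then have "single (i # l) c - fsub n (app (Yop n i) f) \<in> fJ n"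
      by (simp add: cons_fV[of i l c] algebra_simps)
    then show ?case using Yop_wvars[OF i f(1)] by blast
  qed
  from assms have "keys w \<subseteq> lists {1..2*n}" by (simp add: fD_def)
  then show ?thesis
  proof (induction rule: pm_induct_keys)
    case zero
    then show ?case by (intro bexI[of _ 0]) auto
  next
    case (add v w)
    then obtain f g where "f \<in> wvars n" "v - fsub n f \<in> fJ n" "g \<in> wvars n" "w - fsub n g \<in> fJ n" by blast
    then show ?case
      using F.add_J[of "v - fsub n f" "w - fsub n g"]
      by (intro bexI[of _ "f + g"]) (auto simp: osub_add algebra_simps)
  qed (use word in auto)
qed

section \<open>Evaluation of the free algebra at operators\<close>

definition wsub :: "(nat \<Rightarrow> (nat, 'r) mp endo) \<Rightarrow> (nat list \<Rightarrow>\<^sub>0 'r) \<Rightarrow> (nat, 'r) mp endo"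
  where "wsub Q w = lext (\<lambda>l c. scal c * prod_list (map Q l)) w"

lemma wsub_single: "wsub Q (single l c) = scal c * prod_list (map Q l)"
  unfolding wsub_def by (rule lext_single) (simp add: is_hom_0)

lemma wsub_add: "wsub Q (v + w) = wsub Q v + wsub Q w"
  unfolding wsub_def by (rule lext_add) (simp_all add: is_hom_0 is_homD algebra_simps)

lemma wsub_0 [simp]: "wsub Q 0 = 0" by (simp add: wsub_def)

lemma wsub_diff: "wsub Q (v - w) = wsub Q v - wsub Q w"
  using wsub_add[of Q "v - w" w] by (simp add: eq_diff_eq)

context
  fixes n :: nat and Q :: "nat \<Rightarrow> (nat, 'r) mp endo"
  assumes QA: "\<And>i. i \<in> {1..2*n} \<Longrightarrow> Q i \<in> WA n kerI"
begin

interpretation W: ring_mod "WA n kerI" "WJ n kerI" by (rule ring_mod_WA)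

lemma prod_list_WA: "l \<in> lists {1..2*n} \<Longrightarrow> prod_list (map Q l) \<in> WA n kerI"
  by (induction l) (use QA in auto)

lemma scal_commutes: "T \<in> WA n kerI \<Longrightarrow> T * (scal c * S) = scal c * (T * S)"
  using comm_scal[OF WA_lin, of T n kerI c] by (simp add: comm_def mult.assoc[symmetric])

lemma wsub_WA: "w \<in> fD n \<Longrightarrow> wsub Q w \<in> WA n kerI"
  unfolding wsub_def lext_def fD_def
  by (intro W.sum_A W.mult_A scal_WA'[OF kerI_ideal] prod_list_WA) auto

lemma wsub_mult:
  assumes "v \<in> fD n" "w \<in> fD n"
  shows "wsub Q (v * w) = wsub Q v * wsub Q w"
proof -
  have "keys v \<subseteq> lists {1..2*n}" "keys w \<subseteq> lists {1..2*n}" using assms by (simp_all add: fD_def)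
  then show ?thesis
  proof (induction rule: pm_induct_keys)
    case (single l c)
    note l = \<open>l \<in> lists {1..2*n}\<close>
    show ?case using \<open>keys w \<subseteq> lists {1..2*n}\<close>
    proof (induction rule: pm_induct_keys)
      case (single m d)
      have "scal (c * d) = scal c * scal d" by (rule is_homD(3)[OF is_hom_scal])
      then show ?case
        using scal_commutes[OF prod_list_WA[OF l], of d "prod_list (map Q m)"]
        by (simp add: mult_single wsub_single plus_list_def mult.assoc)
    next
      case (add f g)
      then show ?case by (simp add: distrib_left wsub_add)
    qed auto
  next
    case (add f g)
    then show ?case by (simp add: distrib_right wsub_add)
  qed auto
qed

lemma wsub_fV: "wsub Q (fV i) = Q i"
  by (simp add: wsub_single is_homD(1)[OF is_hom_scal, unfolded])

lemma wsub_fC: "wsub Q (fC c) = scal c"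
  by (simp add: wsub_single zero_list_def)

lemma wsub_of_int: "wsub Q (of_int k) = of_int k"
proof -
  have "(of_int k :: nat list \<Rightarrow>\<^sub>0 'r) = fC (of_int k)" by (rule is_hom_of_int[OF is_hom_fC, symmetric])
  then show ?thesis by (simp only: wsub_fC is_hom_of_int[OF is_hom_scal])
qed

lemma wsub_fsub: "wsub Q (fsub n f) = osub scal Q (2*n) f"
proof -
  interpret F: ring_mod "fD n" "fJ n" by (rule ring_mod_fJ)
  have one: "wsub Q 1 = 1" using wsub_of_int[of 1] by simp
  have pow: "wsub Q (fV i ^ k) = Q i ^ k" if i: "i \<in> {1..2*n}" for i k
  proof (induction k)
    case (Suc k)
    then show ?case
      unfolding power_Suc using wsub_mult[OF fV_fD[OF i] F.power_A[OF fV_fD[OF i]], of k] by (simp only: wsub_fV)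
  qed (simp add: one)
  have mon: "wsub Q (omon fV N m) = omon Q N m" if "N \<le> 2*n" for N m
    using that
  proof (induction N)
    case (Suc N)
    have "Suc N \<in> {1..2*n}" "omon fV N m \<in> fD n" using Suc.prems by (auto intro!: F.omon_A fV_fD)
    then show ?case
      using wsub_mult[OF \<open>omon fV N m \<in> fD n\<close> F.power_A[OF fV_fD], of "Suc N" "count m (Suc N)"] pow[of "Suc N"] Suc by simp
  qed (simp add: one)
  have mD: "omon fV (2*n) m \<in> fD n" for m by (rule F.omon_A[OF fV_fD])
  show ?thesis
  proof (induction f rule: pm_induct)
    case (single m c)
    have "wsub Q (fC c * omon fV (2*n) m) = scal c * omon Q (2*n) m"
      by (simp only: wsub_mult[OF fC_fD mD] wsub_fC mon[OF order_refl])
    then show ?case by (simp only: osub_single[OF is_hom_fC] osub_single[OF is_hom_scal])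
  next
    case (add f g)
    then show ?case by (simp only: osub_add[OF is_hom_fC] osub_add[OF is_hom_scal] wsub_add)
  qed simp
qed

text \<open>The elements of the free algebra that evaluate into \<open>WJ n kerI\<close> form an
  ideal containing the defining relations.\<close>

lemma wsub_fJ:
  assumes rels: "weyl_rels n (WJ n kerI) Q" and w: "w \<in> fJ n"
  shows "wsub Q w \<in> WJ n kerI"
proof -
  interpret F: rcover "free_alg K (2*n)" cmap "fD n" by (rule rcover_free)
  define J where "J = {w \<in> fD n. wsub Q w \<in> WJ n kerI}"
  have J: "ring_mod (fD n) J"
  proof
    show "J \<subseteq> fD n" "0 \<in> J" by (auto simp: J_def)
    show "x + y \<in> J" if "x \<in> J" "y \<in> J" for x y
      using that by (simp add: J_def wsub_add)
    show "x * y \<in> J" if "x \<in> J" "y \<in> fD n" for x y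
    proof -
      from that have x: "x \<in> fD n" "wsub Q x \<in> WJ n kerI" and y: "y \<in> fD n" by (auto simp: J_def)
      show ?thesis unfolding J_def mem_Collect_eq wsub_mult[OF x(1) y]
        using F.D_mult[OF x(1) y] W.mult_J[OF x(2) wsub_WA[OF y]] by blast
    qed
    show "x * y \<in> J" if "x \<in> fD n" "y \<in> J" for x y
    proof -
      from that have y: "y \<in> fD n" "wsub Q y \<in> WJ n kerI" and x: "x \<in> fD n" by (auto simp: J_def)
      show ?thesis unfolding J_def mem_Collect_eq wsub_mult[OF x y(1)]
        using F.D_mult[OF x y(1)] W.mult_J'[OF wsub_WA[OF x] y(2)] by blast
    qed
  qed (fact F.D_1 F.D_add F.D_uminus F.D_mult)+
  have "weyl_ideal K n \<subseteq> cmap ` J"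
  proof (rule weyl_ideal_minimal[OF F.ideal_image[OF J]])
    fix i j assume ij: "i \<in> {1..2*n}" "j \<in> {1..2*n}"
    have "wsub Q (comm (fV i) (fV j) - of_int (weyl_omega n i j)) = comm (Q i) (Q j) - of_int (weyl_omega n i j)"
      using ij by (simp add: comm_def wsub_diff wsub_mult fV_fD wsub_fV wsub_of_int)
    then have "wsub Q (comm (fV i) (fV j) - of_int (weyl_omega n i j)) \<in> WJ n kerI"
      using rels ij unfolding weyl_rels_def by simp
    then have "comm (fV i) (fV j) - of_int (weyl_omega n i j) \<in> J"
      unfolding J_def using comm_fV_fD[OF ij] by blast
    then show "weyl_rel K n i j \<in> cmap ` J" unfolding weyl_rel_eq[OF ij] by (rule imageI)
  qed
  then obtain v where v: "v \<in> fD n" "wsub Q v \<in> WJ n kerI" "cmap w = cmap v"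
    using w by (auto simp: fJ_def J_def)
  have "wsub Q (w - v) \<in> WJ n kerI"
    unfolding wsub_def lext_def
  proof (rule W.sum_J)
    fix l assume l: "l \<in> keys (w - v)"
    have "w \<in> fD n" using w by (simp add: fJ_def)
    then have "w - v \<in> fD n" using v(1) by (rule F.D_diff)
    then have "l \<in> lists {1..2*n}" using l unfolding fD_def by blast
    moreover have "lookup (w - v) l \<in> kerI" using v(3) unfolding cmap_eq_iff by blast
    ultimately show "scal (lookup (w - v) l) * prod_list (map Q l) \<in> WJ n kerI"
      by (intro W.mult_J prod_list_WA scal_WJ[OF kerI_ideal])
  qed
  then show ?thesis using W.add_J[OF _ v(2), of "wsub Q (w - v)"] by (simp add: wsub_diff)
qed

end

lemma fsub_coefs_in: "f \<in> coefs_in kerI \<Longrightarrow> fsub n f \<in> fJ n"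
  by (rule ring_mod.osub_coefs_in[OF ring_mod_fJ is_hom_fC fC_fJ _ fV_fD])

text \<open>Uniqueness of the normal form: evaluation at the operators \<open>Yop n\<close> turns it
  into \<open>wop n f\<close>, from which \<open>f\<close> is recovered by application to
  \<open>1\<close>.\<close>

lemma fsub_fJ_iff: "f \<in> wvars n \<Longrightarrow> fsub n f \<in> fJ n \<longleftrightarrow> f \<in> coefs_in kerI"
proof -
  assume f: "f \<in> wvars n"
  have Y: "Yop n i \<in> WA n kerI" if "i \<in> {1..2*n}" for i by (rule Yop_WA'[OF kerI_ideal that])
  have "wop n f \<in> WJ n kerI" if "fsub n f \<in> fJ n"
  proof -
    have "wsub (Yop n) (fsub n f) \<in> WJ n kerI" by (rule wsub_fJ[OF Y weyl_rels_Yop[OF kerI_ideal] that])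
    moreover have "wsub (Yop n) (fsub n f) = wop n f" unfolding wop_def by (rule wsub_fsub[OF Y])
    ultimately show ?thesis by simp
  qed
  then show ?thesis using WJ_wop_iff[OF kerI_ideal f] fsub_coefs_in by blast
qed

section \<open>The Weyl algebra as a quotient of a ring of operators\<close>

abbreviation "fcl n w \<equiv> weyl_ideal K n +>\<^bsub>free_alg K (2*n)\<^esub> cmap w"

lemma rcover_fcl: "rcover (weyl_alg K n) (fcl n) (fD n)"
  unfolding weyl_alg_def by (rule rcover.rcover_quotient[OF rcover_free weyl_ideal])

lemma fcl_zero_iff: "w \<in> fD n \<Longrightarrow> fcl n w = \<zero>\<^bsub>weyl_alg K n\<^esub> \<longleftrightarrow> w \<in> fJ n"
  using rcover.quotient_zero_iff[OF rcover_free weyl_ideal] by (simp add: weyl_alg_def fJ_def)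

lemma fcl_eq_iff: "v \<in> fD n \<Longrightarrow> w \<in> fD n \<Longrightarrow> fcl n v = fcl n w \<longleftrightarrow> v - w \<in> fJ n"
proof -
  assume vw: "v \<in> fD n" "w \<in> fD n"
  interpret Q: rcover "weyl_alg K n" "fcl n" "fD n" by (rule rcover_fcl)
  show ?thesis by (simp only: Q.pi_eq_iff[OF vw] fcl_zero_iff[OF Q.D_diff[OF vw]])
qed

text \<open>The Weyl algebra acts on polynomials by left multiplication, so \<open>WA n kerI\<close> covers it.\<close>

definition wrep :: "nat \<Rightarrow> (nat, 'r) mp endo \<Rightarrow> (nat list \<Rightarrow> 'k) set"
  where "wrep n T = fcl n (fsub n (app T 1))"

lemma rcover_weyl: "rcover (weyl_alg K n) (wrep n) (WA n kerI)"
proof -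
  interpret W: ring_mod "WA n kerI" "WJ n kerI" by (rule ring_mod_WA)
  interpret F: ring_mod "fD n" "fJ n" by (rule ring_mod_fJ)
  interpret Q: rcover "weyl_alg K n" "fcl n" "fD n" by (rule rcover_fcl)
  show ?thesis
  proof (rule rcover.intro)
    show "carrier (weyl_alg K n) = wrep n ` WA n kerI"
    proof (intro equalityI subsetI)
      fix z assume "z \<in> carrier (weyl_alg K n)"
      then obtain w where w: "w \<in> fD n" "z = fcl n w" by (rule Q.carrE)
      obtain f where f: "f \<in> wvars n" "w - fsub n f \<in> fJ n" using fsub_onto[OF w(1)] by blast
      then have "z = wrep n (wop n f)"
        unfolding w(2) wrep_def wop_1[OF f(1)] fcl_eq_iff[OF w(1) fsub_fD] by blast
      then show "z \<in> wrep n ` WA n kerI" using wop_WA[OF kerI_ideal] by blast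
    next
      fix z assume "z \<in> wrep n ` WA n kerI"
      then show "z \<in> carrier (weyl_alg K n)" using Q.pi_closed[OF fsub_fD] by (auto simp: wrep_def)
    qed
    show "wrep n 0 = \<zero>\<^bsub>weyl_alg K n\<^esub>" by (simp only: wrep_def app_simps osub_0 Q.pi_0)
    show "wrep n 1 = \<one>\<^bsub>weyl_alg K n\<^esub>"
      using osub_Cst[OF is_hom_fC, of fV "2*n" 1] by (simp add: wrep_def Q.pi_1)
    show "wrep n (T + S) = wrep n T \<oplus>\<^bsub>weyl_alg K n\<^esub> wrep n S" for T S
      by (simp only: wrep_def app_simps osub_add[OF is_hom_fC] Q.pi_add[OF fsub_fD fsub_fD])
    show "wrep n (T * S) = wrep n T \<otimes>\<^bsub>weyl_alg K n\<^esub> wrep n S" if T: "T \<in> WA n kerI" and S: "S \<in> WA n kerI" for T S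
    proof -
      define f g where "f = app T 1" and "g = app S 1"
      have fg: "f \<in> wvars n" "g \<in> wvars n" unfolding f_def g_def by (rule WA_1[OF T], rule WA_1[OF S])
      have "T - wop n f \<in> WJ n kerI" unfolding f_def by (rule WJ_wop[OF kerI_ideal T])
      then have "app (T - wop n f) g \<in> coefs_in kerI" using fg unfolding WJ_def by blast
      then have "fsub n (app (T - wop n f) g) \<in> fJ n"
        by (rule fsub_coefs_in)
      moreover have "fsub n (app (wop n f) g) - fsub n f * fsub n g \<in> fJ n"
        by (rule F.osub_wop[OF is_hom_fC fC_fD comm_fC weyl_rels_fV fV_fD fg(2)])
      ultimately have "fsub n (app (T - wop n f) g) + (fsub n (app (wop n f) g) - fsub n f * fsub n g) \<in> fJ n"
        by (rule F.add_J)
      then have "fsub n (app T g) - fsub n f * fsub n g \<in> fJ n"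
        by (simp add: osub_diff[OF is_hom_fC])
      then show ?thesis
        unfolding wrep_def f_def[symmetric] g_def[symmetric] Q.pi_mult[OF fsub_fD fsub_fD, symmetric]
          fcl_eq_iff[OF fsub_fD Q.D_mult[OF fsub_fD fsub_fD]] by (simp add: g_def)
    qed
  qed (fact W.zero_A W.one_A W.add_A W.uminus_A W.mult_A)+
qed

lemma wrep_zero_iff: "T \<in> WA n kerI \<Longrightarrow> wrep n T = \<zero>\<^bsub>weyl_alg K n\<^esub> \<longleftrightarrow> T \<in> WJ n kerI"
  unfolding wrep_def fcl_zero_iff[OF fsub_fD] by (simp only: fsub_fJ_iff[OF WA_1] WJ_iff[OF kerI_ideal])

lemma wrep_eq_iff: "T \<in> WA n kerI \<Longrightarrow> S \<in> WA n kerI \<Longrightarrow> wrep n T = wrep n S \<longleftrightarrow> T - S \<in> WJ n kerI"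
proof -
  assume TS: "T \<in> WA n kerI" "S \<in> WA n kerI"
  interpret Q: rcover "weyl_alg K n" "wrep n" "WA n kerI" by (rule rcover_weyl)
  show ?thesis by (simp only: Q.pi_eq_iff[OF TS] wrep_zero_iff[OF Q.D_diff[OF TS]])
qed

lemma weyl_const_wrep: "weyl_const K n (ev c) = wrep n (scal c)"
proof -
  have "cmap (fC c) = monoid_ring_const (words (2*n)) K (ev c)"
    by (auto simp: cmap_def monoid_ring_const_def words_def lookup_single when_def C.pi_0 zero_list_def)
  then show ?thesis by (simp add: weyl_const_def wrep_def osub_Cst[OF is_hom_fC])
qed


section \<open>Endomorphisms of the Weyl algebra\<close>

text \<open>The endomorphism sending the generators to the \<open>Q i\<close>, evaluated on the
  normal form \<open>app T 1\<close> of \<open>T\<close>.\<close>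

definition dsub :: "nat \<Rightarrow> (nat \<Rightarrow> (nat, 'r) mp endo) \<Rightarrow> (nat, 'r) mp endo \<Rightarrow> (nat, 'r) mp endo"
  where "dsub n Q T = osub scal Q (2*n) (app T 1)"

lemma dsub_add: "dsub n Q (T + S) = dsub n Q T + dsub n Q S"
  by (simp add: dsub_def osub_add)

context
  fixes n :: nat and Q :: "nat \<Rightarrow> (nat, 'r) mp endo"
  assumes QA: "\<And>i. i \<in> {1..2*n} \<Longrightarrow> Q i \<in> WA n kerI"
    and rels: "weyl_rels n (WJ n kerI) Q"
begin

interpretation W: ring_mod "WA n kerI" "WJ n kerI" by (rule ring_mod_WA)

lemma comm_scal_WA: "T \<in> WA n kerI \<Longrightarrow> comm T (scal c) = 0"
  by (rule comm_scal[OF WA_lin])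

lemma osub_WA: "osub scal Q (2*n) f \<in> WA n kerI"
  by (rule W.osub_A[OF is_hom_scal scal_WA'[OF kerI_ideal] QA])

lemma dsub_WA: "dsub n Q T \<in> WA n kerI"
  unfolding dsub_def by (rule osub_WA)

lemma osub_WJ: "f \<in> coefs_in kerI \<Longrightarrow> osub scal Q (2*n) f \<in> WJ n kerI"
  by (rule W.osub_coefs_in[OF is_hom_scal scal_WJ[OF kerI_ideal] _ QA])

lemma dsub_mult:
  assumes T: "T \<in> WA n kerI" and S: "S \<in> WA n kerI"
  shows "dsub n Q (T * S) - dsub n Q T * dsub n Q S \<in> WJ n kerI"
proof -
  define f g where "f = app T 1" and "g = app S 1"
  have fg: "f \<in> wvars n" "g \<in> wvars n" unfolding f_def g_def by (rule WA_1[OF T], rule WA_1[OF S])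
  have "T - wop n f \<in> WJ n kerI" unfolding f_def by (rule WJ_wop[OF kerI_ideal T])
  then have "app (T - wop n f) g \<in> coefs_in kerI" using fg unfolding WJ_def by blast
  then have "osub scal Q (2*n) (app (T - wop n f) g) \<in> WJ n kerI" by (rule osub_WJ)
  moreover have "osub scal Q (2*n) (app (wop n f) g) - osub scal Q (2*n) f * osub scal Q (2*n) g \<in> WJ n kerI"
    by (rule W.osub_wop[OF is_hom_scal scal_WA'[OF kerI_ideal] comm_scal_WA rels QA fg(2)])
  ultimately have "osub scal Q (2*n) (app (T - wop n f) g) +
      (osub scal Q (2*n) (app (wop n f) g) - osub scal Q (2*n) f * osub scal Q (2*n) g) \<in> WJ n kerI"
    by (rule W.add_J)
  then show ?thesis
    by (simp add: osub_diff dsub_def f_def g_def)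
qed

lemma dsub_WJ: "T \<in> WJ n kerI \<Longrightarrow> dsub n Q T \<in> WJ n kerI"
  unfolding dsub_def by (rule osub_WJ) (simp add: WJ_def)

lemma dsub_scal: "dsub n Q (scal c) = scal c"
  by (simp add: dsub_def osub_Cst)

lemma weyl_end_exists:
  "\<exists>h\<in>alg_end K (weyl_const K n) (weyl_alg K n). \<forall>T\<in>WA n kerI. h (wrep n T) = wrep n (dsub n Q T)"
proof -
  interpret R: rcover "weyl_alg K n" "wrep n" "WA n kerI" by (rule rcover_weyl)
  have "\<exists>h\<in>Ring.ring_hom (weyl_alg K n) (weyl_alg K n). \<forall>T\<in>WA n kerI. h (wrep n T) = wrep n (dsub n Q T)"
  proof (rule R.lift_endomorphism)
    show "wrep n (dsub n Q T) = \<zero>\<^bsub>weyl_alg K n\<^esub>" if "T \<in> WA n kerI" "wrep n T = \<zero>\<^bsub>weyl_alg K n\<^esub>" for T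
      using that dsub_WJ wrep_zero_iff dsub_WA by blast
    show "wrep n (dsub n Q (T * S)) = wrep n (dsub n Q T * dsub n Q S)" if "T \<in> WA n kerI" "S \<in> WA n kerI" for T S
      unfolding wrep_eq_iff[OF dsub_WA R.D_mult[OF dsub_WA dsub_WA]] using that by (rule dsub_mult)
    show "wrep n (dsub n Q 1) = \<one>\<^bsub>weyl_alg K n\<^esub>"
      using dsub_scal[of 1] by (simp add: R.pi_1 is_homD(1)[OF is_hom_mul])
  qed (simp_all only: dsub_WA dsub_add)
  then obtain h where h: "h \<in> Ring.ring_hom (weyl_alg K n) (weyl_alg K n)" "\<forall>T\<in>WA n kerI. h (wrep n T) = wrep n (dsub n Q T)"
    by blast
  have "h (weyl_const K n c) = weyl_const K n c" if cK: "c \<in> carrier K" for c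
  proof -
    obtain x where "c = ev x" using cK by (rule C.carrE)
    then show ?thesis using h(2) scal_WA'[OF kerI_ideal] by (simp add: weyl_const_wrep dsub_scal)
  qed
  then show ?thesis using h unfolding alg_end_def by blast
qed

end

lemma weyl_end_form:
  assumes h: "h \<in> alg_end K (weyl_const K n) (weyl_alg K n)"
  shows "\<exists>Q. (\<forall>i\<in>{1..2*n}. Q i \<in> WA n kerI) \<and> weyl_rels n (WJ n kerI) Q \<and>
      (\<forall>T\<in>WA n kerI. h (wrep n T) = wrep n (dsub n Q T))"
proof -
  interpret W: ring_mod "WA n kerI" "WJ n kerI" by (rule ring_mod_WA)
  interpret R: rcover "weyl_alg K n" "wrep n" "WA n kerI" by (rule rcover_weyl)
  have hh: "h \<in> Ring.ring_hom (weyl_alg K n) (weyl_alg K n)"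
    and hc: "\<And>c. c \<in> carrier K \<Longrightarrow> h (weyl_const K n c) = weyl_const K n c"
    using h by (auto simp: alg_end_def)
  \<comment> \<open>Here \<open>E\<close> represents the image of \<open>T\<close> under
    \<open>h\<close>. The relation is closed under the ring operations, so that its validity for the
    generators determines \<open>h\<close> on normal forms.\<close>
  define rel where "rel T E \<longleftrightarrow> T \<in> WA n kerI \<and> E \<in> WA n kerI \<and> h (wrep n T) = wrep n E" for T E
  have rel_mult: "rel (T * S) (E * F)" if "rel T E" "rel S F" for T S E F
    using that ring_hom_mult[OF hh R.pi_closed R.pi_closed, of T S]
    by (simp only: rel_def R.pi_mult R.D_mult simp_thms)
  have rel_add: "rel (T + S) (E + F)" if "rel T E" "rel S F" for T S E F
    using that ring_hom_add[OF hh R.pi_closed R.pi_closed, of T S]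
    by (simp only: rel_def R.pi_add R.D_add simp_thms)
  have rel_scal: "rel (scal c) (scal c)" for c
    using hc[OF C.pi_closed, of c] scal_WA'[OF kerI_ideal, of c n] by (simp add: rel_def weyl_const_wrep)
  have rel_1: "rel 1 1" using rel_scal[of 1] by (simp add: is_homD(1)[OF is_hom_mul])
  have rel_neg: "rel (- T) (- E)" if "rel T E" for T E
    using rel_mult[OF rel_scal[of "- 1"] that] by (simp add: Cst_minus is_hom_minus[OF is_hom_mul] is_homD(1)[OF is_hom_mul])
  have rel_of_int: "rel (of_int k) (of_int k)" for k
    using rel_scal[of "of_int k"] by (simp add: is_hom_of_int[OF is_hom_mul])
  have "\<exists>E. rel (Yop n i) E" if i: "i \<in> {1..2*n}" for i
  proof -
    note Y = Yop_WA'[OF kerI_ideal i]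
    have "h (wrep n (Yop n i)) \<in> carrier (weyl_alg K n)" by (rule ring_hom_closed[OF hh R.pi_closed[OF Y]])
    then obtain E where "E \<in> WA n kerI" "h (wrep n (Yop n i)) = wrep n E" by (rule R.carrE)
    then show ?thesis using Y by (auto simp: rel_def)
  qed
  then obtain Q where Q: "\<And>i. i \<in> {1..2*n} \<Longrightarrow> rel (Yop n i) (Q i)" by metis
  have QA: "Q i \<in> WA n kerI" if "i \<in> {1..2*n}" for i using Q[OF that] by (simp add: rel_def)
  have "weyl_rels n (WJ n kerI) Q"
    unfolding weyl_rels_def
  proof (intro ballI)
    fix i j assume i: "i \<in> {1..2*n}" and j: "j \<in> {1..2*n}"
    let ?T = "comm (Yop n i) (Yop n j) - of_int (weyl_omega n i j)"
    let ?E = "comm (Q i) (Q j) - of_int (weyl_omega n i j)"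
    have "rel ((Yop n i * Yop n j + - (Yop n j * Yop n i)) + - of_int (weyl_omega n i j))
      ((Q i * Q j + - (Q j * Q i)) + - of_int (weyl_omega n i j))"
      by (intro rel_add rel_mult rel_neg rel_of_int Q i j)
    then have r: "rel ?T ?E" by (simp add: comm_def)
    moreover have "?T = 0" using comm_Yop[OF i j] by simp
    ultimately have "wrep n ?E = h (wrep n 0)" unfolding rel_def by (metis (no_types))
    also have "\<dots> = \<zero>\<^bsub>weyl_alg K n\<^esub>" unfolding R.pi_0 by (rule ring_hom_zero[OF hh R.is_ring R.is_ring])
    finally show "?E \<in> WJ n kerI" using wrep_zero_iff r by (simp add: rel_def)
  qed
  moreover have "h (wrep n T) = wrep n (dsub n Q T)" if T: "T \<in> WA n kerI" for T
  proof -
    have rel_power: "rel (T ^ k) (E ^ k)" if "rel T E" for T E k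
      using that by (induction k) (simp_all only: power_0 power_Suc rel_1 rel_mult)
    have rel_omon: "rel (omon (Yop n) N m) (omon Q N m)" if "N \<le> 2*n" for N m
      using that
    proof (induction N)
      case (Suc N)
      then show ?case using Q[of "Suc N"] by (auto intro!: rel_mult rel_power)
    qed (simp add: rel_1)
    have "rel (wop n f) (osub scal Q (2*n) f)" for f
      unfolding wop_def
    proof (induction f rule: pm_induct)
      case zero
      show ?case using rel_scal[of 0] by (simp add: is_hom_0[OF is_hom_mul])
    next
      case (single m c)
      show ?case unfolding osub_single[OF is_hom_scal] by (intro rel_mult rel_scal rel_omon order_refl)
    next
      case (add f g)
      then show ?case unfolding osub_add[OF is_hom_scal] by (rule rel_add)
    qed
    then have "h (wrep n (wop n (app T 1))) = wrep n (dsub n Q T)" by (simp add: rel_def dsub_def)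
    moreover have "wrep n (wop n (app T 1)) = wrep n T"
      by (simp add: wrep_def wop_1[OF WA_1[OF T]])
    ultimately show ?thesis by simp
  qed
  ultimately show ?thesis using QA by blast
qed

end


section \<open>The Dixmier conjecture for one endomorphism\<close>

text \<open>Makes the closure rules of \<open>ring_mod\<close> available for a subring without an
  ideal; used for the image of an endomorphism.\<close>

lemma ring_mod_zero:
  assumes one: "1 \<in> A" and add: "\<And>x y. x \<in> A \<Longrightarrow> y \<in> A \<Longrightarrow> x + y \<in> A"
    and neg: "\<And>x. x \<in> A \<Longrightarrow> - x \<in> A" and mult: "\<And>x y. x \<in> A \<Longrightarrow> y \<in> A \<Longrightarrow> x * y \<in> A"
  shows "ring_mod A {0}"
proof
  show "{0} \<subseteq> A" using add[OF one neg[OF one]] by simp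
qed (simp_all add: one add neg mult)

context kcover
begin

lemma of_nat_notin_kerI: "char_zero_field K \<Longrightarrow> 0 < m \<Longrightarrow> of_nat m \<notin> kerI"
  using C.pi_of_nat[of 1 m] by (auto simp: char_zero_field_def kerI_def C.pi_1)

lemma coefs_in_pder:
  assumes char: "char_zero_field K" and g: "pder j g \<in> coefs_in kerI" and j: "j \<in># m"
  shows "lookup g m \<in> kerI"
proof -
  obtain m' where m: "m = add_mset j m'" using j by (meson multi_member_split)
  have "of_nat (Suc (count m' j)) * lookup g m \<in> kerI"
    using g unfolding m coefs_in_def lookup_pder[symmetric] by blast
  then show ?thesis using I.prime_I of_nat_notin_kerI[OF char, of "Suc (count m' j)"] by blast
qed

context
  fixes n :: nat and Q :: "nat \<Rightarrow> (nat, 'r) mp endo"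
  assumes char: "char_zero_field K"
    and QA: "\<And>i. i \<in> {1..2*n} \<Longrightarrow> Q i \<in> WA n kerI"
    and rels: "weyl_rels n (WJ n kerI) Q"
begin

interpretation W: ring_mod "WA n kerI" "WJ n kerI" by (rule ring_mod_WA)

lemma osub_WA': "osub scal Q (2*n) f \<in> WA n kerI" by (rule osub_WA[OF QA rels])

lemma dsub_WA': "dsub n Q T \<in> WA n kerI" by (rule dsub_WA[OF QA rels])

text \<open>Endomorphisms are injective in characteristic zero, because the inner derivations by the
  partners of the \<open>Q j\<close> differentiate any relation between ordered monomials.\<close>

lemma osub_inj:
  assumes f: "f \<in> wvars n" and o: "osub scal Q (2*n) f \<in> WJ n kerI"
  shows "f \<in> coefs_in kerI"
proof -
  have "\<forall>a\<in>keys f. scal (lookup f a) \<in> WJ n kerI"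
  proof (rule W.omon_independent[where N = "2*n" and q = "qgen n Q" and P = Q])
    show "set_mset a \<subseteq> {1..2*n}" if "a \<in> keys f" for a using f that unfolding mvars_def by blast
    show "x \<in> WJ n kerI" if m: "0 < m" and x: "x \<in> WA n kerI" and mx: "of_nat m * x \<in> WJ n kerI"
      for m :: nat and x
    proof -
      have "app (of_nat m * x) 1 = of_nat m * app x 1"
        using is_hom_of_nat[OF is_hom_mul, of m, symmetric] by simp
      moreover have "app (of_nat m * x) 1 \<in> coefs_in kerI" using mx WJ_iff[OF kerI_ideal] by (auto simp: WJ_def)
      ultimately have "of_nat m * lookup (app x 1) a \<in> kerI" for a by (simp add: coefs_in_def)
      then have "app x 1 \<in> coefs_in kerI"
        using I.prime_I of_nat_notin_kerI[OF char m] unfolding coefs_in_def by blast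
      then show ?thesis using WJ_iff[OF kerI_ideal x] by blast
    qed
    show "comm (qgen n Q j) (scal (lookup f a)) \<in> WJ n kerI" if "j \<in> {1..2*n}" for a j
      using comm_scal[OF WA_lin[OF qgen_A[OF QA ring_mod_WA that]]] by simp
    show "comm (qgen n Q j) (Q i) - of_bool (i = j) \<in> WJ n kerI" if "i \<in> {1..2*n}" "j \<in> {1..2*n}" for i j
      by (rule W.comm_qgen[OF rels that])
    show "Q i \<in> WA n kerI" if "i \<in> {1..2*n}" for i by (rule QA[OF that])
    show "qgen n Q i \<in> WA n kerI" if "i \<in> {1..2*n}" for i by (rule qgen_A[OF QA ring_mod_WA that])
    show "scal (lookup f a) \<in> WA n kerI" for a by (rule scal_WA'[OF kerI_ideal])
    show "(\<Sum>a\<in>keys f. scal (lookup f a) * omon Q (2*n) a) \<in> WJ n kerI"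
      using o unfolding osub_def lext_def .
  qed simp
  then have "lookup f a \<in> kerI" if "a \<in> keys f" for a
    using that WJ_iff[OF kerI_ideal scal_WA'[OF kerI_ideal]] by (simp add: I.zero_I)
  then have "lookup f a \<in> kerI" for a by (cases "a \<in> keys f") (simp_all add: in_keys_iff)
  then show ?thesis by (simp add: coefs_in_def)
qed

lemma osub_surj:
  assumes gen: "\<And>i. i \<in> {1..2*n} \<Longrightarrow> \<exists>g\<in>wvars n. Yop n i - osub scal Q (2*n) g \<in> WJ n kerI"
    and T: "T \<in> WA n kerI"
  shows "\<exists>g\<in>wvars n. T - osub scal Q (2*n) g \<in> WJ n kerI"
proof -
  define S where "S = {T \<in> WA n kerI. \<exists>g\<in>wvars n. T - osub scal Q (2*n) g \<in> WJ n kerI}"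
  have SI: "T \<in> S" if "T \<in> WA n kerI" "g \<in> wvars n" "T - osub scal Q (2*n) g \<in> WJ n kerI" for T g
    using that unfolding S_def by blast
  have scal: "scal c \<in> S" for c
    by (rule SI[of _ "Cst c"]) (auto simp: osub_Cst scal_WA'[OF kerI_ideal])
  have one: "1 \<in> S" using scal[of 1] by (simp add: is_homD(1)[OF is_hom_mul])
  have add: "T + U \<in> S" if TS: "T \<in> S" and US: "U \<in> S" for T U
  proof -
    obtain f g where f: "T \<in> WA n kerI" "f \<in> wvars n" "T - osub scal Q (2*n) f \<in> WJ n kerI"
      and g: "U \<in> WA n kerI" "g \<in> wvars n" "U - osub scal Q (2*n) g \<in> WJ n kerI"
      using TS US unfolding S_def by blast
    show ?thesis
      using W.add_J[OF f(3) g(3)]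
      by (intro SI[OF W.add_A[OF f(1) g(1)] mvars_add[OF f(2) g(2)]]) (simp add: osub_add algebra_simps)
  qed
  have mult: "T * U \<in> S" if TS: "T \<in> S" and US: "U \<in> S" for T U
  proof -
    obtain f g where f: "T \<in> WA n kerI" "f \<in> wvars n" "T - osub scal Q (2*n) f \<in> WJ n kerI"
      and g: "U \<in> WA n kerI" "g \<in> wvars n" "U - osub scal Q (2*n) g \<in> WJ n kerI"
      using TS US unfolding S_def by blast
    have v: "app (wop n f) g \<in> wvars n" using wop_WA[OF kerI_ideal, of n f] g(2) unfolding WA_def by blast
    have "T * U - osub scal Q (2*n) f * osub scal Q (2*n) g \<in> WJ n kerI"
      by (rule W.cong_mult[OF f(3) g(3) osub_WA' g(1)])
    moreover have "osub scal Q (2*n) (app (wop n f) g) - osub scal Q (2*n) f * osub scal Q (2*n) g \<in> WJ n kerI"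
      by (rule W.osub_wop[OF is_hom_scal scal_WA'[OF kerI_ideal] comm_scal[OF WA_lin] rels QA g(2)])
    ultimately show ?thesis
      using W.cong_trans W.cong_sym by (intro SI[OF W.mult_A[OF f(1) g(1)] v]) blast
  qed
  have neg: "- T \<in> S" if "T \<in> S" for T
    using mult[OF scal[of "- 1"] that] by (simp add: Cst_minus is_hom_minus[OF is_hom_mul] is_homD(1)[OF is_hom_mul])
  have S: "ring_mod S {0}" by (rule ring_mod_zero[OF one add neg mult])
  have Y: "Yop n i \<in> S" if "i \<in> {1..2*n}" for i
    using gen[OF that] Yop_WA'[OF kerI_ideal that] unfolding S_def by blast
  have "wop n (app T 1) \<in> S"
    unfolding wop_def by (rule ring_mod.osub_A[OF S is_hom_scal scal Y])
  then obtain g where g: "g \<in> wvars n" "wop n (app T 1) - osub scal Q (2*n) g \<in> WJ n kerI"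
    unfolding S_def by blast
  then show ?thesis using W.cong_trans[OF WJ_wop[OF kerI_ideal T]] by blast
qed

context
  fixes h assumes h: "h \<in> alg_end K (weyl_const K n) (weyl_alg K n)"
    and hQ: "\<And>T. T \<in> WA n kerI \<Longrightarrow> h (wrep n T) = wrep n (dsub n Q T)"
begin

interpretation R: rcover "weyl_alg K n" "wrep n" "WA n kerI" by (rule rcover_weyl)

lemma weyl_aut_surj:
  assumes "h \<in> alg_aut K (weyl_const K n) (weyl_alg K n)" and T: "T \<in> WA n kerI"
  shows "\<exists>g\<in>wvars n. T - osub scal Q (2*n) g \<in> WJ n kerI"
proof -
  have "bij_betw h (carrier (weyl_alg K n)) (carrier (weyl_alg K n))"
    using assms(1) by (simp add: alg_aut_def ring_iso_def)
  then have "wrep n T \<in> h ` carrier (weyl_alg K n)" using R.pi_closed[OF T] by (simp add: bij_betw_def)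
  then obtain S where S: "S \<in> WA n kerI" "wrep n T = h (wrep n S)" by (auto simp: R.carr)
  then have "wrep n T = wrep n (dsub n Q S)" using hQ by simp
  then have "T - dsub n Q S \<in> WJ n kerI" using wrep_eq_iff[OF T dsub_WA'] by blast
  then show ?thesis using WA_1[OF S(1)] unfolding dsub_def by blast
qed

text \<open>Injectivity is automatic and the image is a subring, so only the generators have to be
  reached.\<close>

lemma weyl_autI:
  assumes gen: "\<And>i. i \<in> {1..2*n} \<Longrightarrow> \<exists>g\<in>wvars n. Yop n i - osub scal Q (2*n) g \<in> WJ n kerI"
  shows "h \<in> alg_aut K (weyl_const K n) (weyl_alg K n)"
proof -
  have hh: "h \<in> Ring.ring_hom (weyl_alg K n) (weyl_alg K n)" using h by (simp add: alg_end_def)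
  have "inj_on h (carrier (weyl_alg K n))"
  proof (rule inj_onI)
    fix z w assume "z \<in> carrier (weyl_alg K n)" "w \<in> carrier (weyl_alg K n)" and eq: "h z = h w"
    then obtain T S where T: "T \<in> WA n kerI" "z = wrep n T" and S: "S \<in> WA n kerI" "w = wrep n S"
      by (auto simp: R.carr)
    have "wrep n (dsub n Q T) = wrep n (dsub n Q S)" using eq hQ T S by simp
    then have "dsub n Q T - dsub n Q S \<in> WJ n kerI"
      using wrep_eq_iff[OF dsub_WA' dsub_WA'] by blast
    then have "osub scal Q (2*n) (app (T - S) 1) \<in> WJ n kerI" by (simp add: dsub_def osub_diff)
    then have "app (T - S) 1 \<in> coefs_in kerI" by (rule osub_inj[OF WA_1[OF R.D_diff[OF T(1) S(1)]]])
    then have "T - S \<in> WJ n kerI" using WJ_iff[OF kerI_ideal R.D_diff[OF T(1) S(1)]] by blast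
    then show "z = w" using wrep_eq_iff[OF T(1) S(1)] T S by blast
  qed
  moreover have "h ` carrier (weyl_alg K n) = carrier (weyl_alg K n)"
  proof (intro equalityI subsetI)
    fix z assume "z \<in> carrier (weyl_alg K n)"
    then obtain T where T: "T \<in> WA n kerI" "z = wrep n T" by (rule R.carrE)
    obtain g where g: "g \<in> wvars n" "T - osub scal Q (2*n) g \<in> WJ n kerI" using osub_surj[OF gen T(1)] by blast
    have "wrep n T = wrep n (osub scal Q (2*n) g)" using g wrep_eq_iff[OF T(1) osub_WA'] by blast
    also have "\<dots> = h (wrep n (wop n g))"
      using hQ[OF wop_WA[OF kerI_ideal], of g] by (simp only: dsub_def wop_1[OF g(1)])
    finally show "z \<in> h ` carrier (weyl_alg K n)"
      unfolding T(2) using R.pi_closed[OF wop_WA[OF kerI_ideal]] by blast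
  next
    fix z assume "z \<in> h ` carrier (weyl_alg K n)"
    then show "z \<in> carrier (weyl_alg K n)" using ring_hom_closed[OF hh] by blast
  qed
  ultimately show ?thesis
    using h hh by (simp add: alg_aut_def ring_iso_def bij_betw_def)
qed

end

end

end


section \<open>The Dixmier conjecture implies the Jacobian conjecture\<close>

lemma tdet_transpose: "tdet N (\<lambda>i j. M j i) = tdet N M"
proof -
  have "bord N (\<lambda>i j. M j i) = transpose_mat (bord N M)"
    by (rule eq_matI) (auto simp: bord_def)
  then show ?thesis unfolding det_bord[symmetric] by (simp add: det_transpose[OF bord_carrier])
qed

text \<open>Setting the variables outside \<open>V\<close> to zero fixes the entries of
  \<open>M\<close> and moves the adjugate matrix into \<open>mvars V\<close>.\<close>

lemma tdet_adjugate_mvars: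
  fixes M :: "nat \<Rightarrow> nat \<Rightarrow> ('v, 'r::comm_ring_1) mp"
  assumes M: "\<And>i j. i \<in> {1..N} \<Longrightarrow> j \<in> {1..N} \<Longrightarrow> M i j \<in> mvars V"
  shows "\<exists>C. (\<forall>i j. C i j \<in> mvars V) \<and>
    (\<forall>i\<in>{1..N}. \<forall>j\<in>{1..N}. (\<Sum>k\<in>{1..N}. C i k * M k j) = (if i = j then tdet N M else 0))"
proof -
  obtain C :: "nat \<Rightarrow> nat \<Rightarrow> ('v, 'r) mp" where C: "\<And>i j. i \<in> {1..N} \<Longrightarrow> j \<in> {1..N} \<Longrightarrow>
      (\<Sum>k\<in>{1..N}. C i k * M k j) = (if i = j then tdet N M else 0)"
    using tdet_adjugate[of N M] by blast
  define \<pi> :: "('v, 'r) mp \<Rightarrow> ('v, 'r) mp" where "\<pi> = meval Cst (\<lambda>v. if v \<in> V then Var v else 0)"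
  have h: "is_hom \<pi>" unfolding \<pi>_def by (rule is_hom_meval) simp
  have id: "\<pi> f = f" if "f \<in> mvars V" for f
    using meval_cong[OF is_hom_Cst that, of "\<lambda>v. if v \<in> V then Var v else 0" Var] by (simp add: \<pi>_def meval_id)
  have "\<pi> f \<in> mvars V" for f
    unfolding \<pi>_def by (rule meval_mvars[OF mvars_UNIV]) auto
  moreover have "(\<Sum>k\<in>{1..N}. \<pi> (C i k) * M k j) = (if i = j then tdet N M else 0)"
    if i: "i \<in> {1..N}" and j: "j \<in> {1..N}" for i j
  proof -
    have "(\<Sum>k\<in>{1..N}. \<pi> (C i k) * M k j) = \<pi> (\<Sum>k\<in>{1..N}. C i k * M k j)"
      unfolding is_hom_sum[OF h] is_homD(3)[OF h] using id[OF M[OF _ j]] by (intro sum.cong) auto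
    then show ?thesis using C[OF i j] id[OF tdet_mvars[OF M]] by (simp add: is_hom_0[OF h] id)
  qed
  ultimately show ?thesis by (intro exI[of _ "\<lambda>i j. \<pi> (C i j)"]) blast
qed

lemma mul_WA:
  assumes f: "f \<in> mvars {1..n}"
  shows "mul f \<in> WA n {0}"
proof -
  have "f \<in> wvars n" by (rule mvars_mono[OF f]) auto
  moreover have "pder (i + n) f = 0" if "i \<in> {1..2*n}" for i
    by (rule pder_notin[OF f]) (use that in auto)
  ultimately show ?thesis by (auto simp: WA_def Rop_def pder_mult algebra_simps)
qed

lemma comm_Yop_mul: "1 \<le> j \<Longrightarrow> comm (Yop n (j + n)) (mul g) = mul (pder j g)"
  by (rule endo_eqI) (simp add: comm_def Yop_def pder_mult algebra_simps)

lemma comm_mul_mul: "comm (mul f) (mul g) = 0" for f g :: "('v, 'r::comm_ring_1) mp"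
  by (rule endo_eqI) (simp add: comm_def mult.left_commute)


lemma comm_mul_left: "comm (mul a * T) (mul g) = mul a * comm T (mul g)" for a g :: "('v, 'r::comm_ring_1) mp"
  by (rule endo_eqI) (simp add: comm_def mult.left_commute right_diff_distrib)

context kcover
begin

lemma osub_mul:
  assumes f: "f \<in> mvars {1..n}" and Q: "\<And>i. i \<in> {1..n} \<Longrightarrow> Q i = mul (Phi i)"
  shows "osub scal Q (2*n) f = mul (meval Cst Phi f)"
proof -
  have mon: "omon Q (2*n) m = mul (prod_mset (image_mset Phi m))" if m: "set_mset m \<subseteq> {1..n}" for m
  proof -
    have h: "mul (omon Phi N m) = omon (\<lambda>i. mul (Phi i)) N m" for N
    proof (induction N)
      case (Suc N)
      have "mul (Phi (Suc N) ^ k) = mul (Phi (Suc N)) ^ k" for k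
        by (induction k) (simp_all add: is_homD[OF is_hom_mul])
      then show ?case by (simp add: is_homD[OF is_hom_mul] Suc)
    qed (simp add: is_homD[OF is_hom_mul])
    have "omon Q N m = omon (\<lambda>i. mul (Phi i)) N m" for N
    proof (induction N)
      case (Suc N)
      show ?case
      proof (cases "Suc N \<in># m")
        case True
        then have "Suc N \<in> {1..n}" using m by blast
        then show ?thesis using Suc Q by simp
      next
        case False
        then show ?thesis using Suc by (simp add: not_in_iff)
      qed
    qed simp
    moreover have "set_mset m \<subseteq> {1..2*n}" using m by (rule subset_trans) auto
    ultimately show ?thesis by (simp add: h[symmetric] omon_prod_mset)
  qed
  have "keys f \<subseteq> {m. set_mset m \<subseteq> {1..n}}" using f by (auto simp: mvars_def)
  then show ?thesis
  proof (induction rule: pm_induct_keys)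
    case zero
    then show ?case by (simp add: is_hom_0[OF is_hom_mul] is_hom_0[OF is_hom_meval[OF is_hom_Cst]])
  next
    case (single m c)
    then show ?case by (simp add: osub_single meval_single mon is_homD[OF is_hom_mul])
  next
    case (add f g)
    then show ?case by (simp add: osub_add meval_add is_homD[OF is_hom_mul])
  qed
qed

text \<open>A polynomial map with Jacobian determinant one extends to an endomorphism of the Weyl algebra
  by the vector fields dual to the differentials of its components.\<close>

context
  fixes n :: nat and Phi :: "nat \<Rightarrow> (nat, 'r) mp"
  assumes Phi: "\<And>i. i \<in> {1..n} \<Longrightarrow> Phi i \<in> mvars {1..n}"
    and det: "tdet n (\<lambda>i j. pder j (Phi i)) - 1 \<in> coefs_in kerI"
begin

interpretation W: ring_mod "WA n kerI" "WJ n kerI" by (rule ring_mod_WA)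
interpretation CI: cring_ideal "coefs_in kerI :: (nat, 'r) mp set" by (rule cring_ideal_coefs_in[OF kerI_ideal])

lemma symplectic_lift:
  "\<exists>Q. (\<forall>i\<in>{1..2*n}. Q i \<in> WA n kerI) \<and> weyl_rels n (WJ n kerI) Q \<and> (\<forall>i\<in>{1..n}. Q i = mul (Phi i))"
proof -
  define d where "d = tdet n (\<lambda>i j. pder j (Phi i))"
  have d1: "d - 1 \<in> coefs_in kerI" using det by (simp add: d_def)
  have JP: "pder j (Phi i) \<in> mvars {1..n}" if "i \<in> {1..n}" for i j using Phi[OF that] by blast
  \<comment> \<open>The adjugate of the transposed Jacobian matrix: row \<open>i\<close> holds the
    coefficients of the vector field dual to the differential of \<open>Phi i\<close>, up to the
    factor \<open>d\<close>, which is 1 modulo \<open>kerI\<close>.\<close>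
  obtain A where Av: "\<And>i j. A i j \<in> mvars {1..n}" and
    A: "\<And>i k. i \<in> {1..n} \<Longrightarrow> k \<in> {1..n} \<Longrightarrow> (\<Sum>j\<in>{1..n}. A i j * pder j (Phi k)) = (if i = k then d else 0)"
  proof -
    have "\<exists>A. (\<forall>i j. A i j \<in> mvars {1..n}) \<and> (\<forall>i\<in>{1..n}. \<forall>k\<in>{1..n}.
        (\<Sum>j\<in>{1..n}. A i j * pder j (Phi k)) = (if i = k then tdet n (\<lambda>j k. pder j (Phi k)) else 0))"
      by (rule tdet_adjugate_mvars) (rule JP)
    then have "\<exists>A. (\<forall>i j. A i j \<in> mvars {1..n}) \<and> (\<forall>i\<in>{1..n}. \<forall>k\<in>{1..n}.
        (\<Sum>j\<in>{1..n}. A i j * pder j (Phi k)) = (if i = k then d else 0))"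
      unfolding d_def tdet_transpose[of n "\<lambda>i j. pder j (Phi i)"] .
    then show ?thesis using that by blast
  qed
  \<comment> \<open>An adjugate for the other side: it cancels the Jacobian matrix, to show that a
    vector field killing all \<open>Phi k\<close> vanishes.\<close>
  obtain B where B: "\<And>i l. i \<in> {1..n} \<Longrightarrow> l \<in> {1..n} \<Longrightarrow> (\<Sum>k\<in>{1..n}. B i k * pder l (Phi k)) = (if i = l then d else 0)"
    using tdet_adjugate[of n "\<lambda>k l. pder l (Phi k)"] unfolding d_def by blast
  define E where "E i = (\<Sum>j\<in>{1..n}. mul (A i j) * Yop n (j + n))" for i
  define \<delta> where "\<delta> i f = (\<Sum>j\<in>{1..n}. A i j * pder j f)" for i f
  have E_mul: "comm (E i) (mul g) = mul (\<delta> i g)" for i g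
  proof -
    have "comm (E i) (mul g) = (\<Sum>j\<in>{1..n}. comm (mul (A i j) * Yop n (j + n)) (mul g))"
      by (simp add: comm_swap[of _ "mul g"] E_def comm_sum sum_negf)
    also have "\<dots> = (\<Sum>j\<in>{1..n}. mul (A i j * pder j g))"
      by (rule sum.cong) (auto simp: comm_mul_left comm_Yop_mul is_homD[OF is_hom_mul])
    finally show ?thesis by (simp add: \<delta>_def mul_sum)
  qed
  have \<delta>_add: "\<delta> i (f + g) = \<delta> i f + \<delta> i g" for i f g by (simp add: \<delta>_def distrib_left sum.distrib)
  have \<delta>_0: "\<delta> i 0 = 0" for i by (simp add: \<delta>_def)
  have \<delta>_sum: "\<delta> i (sum f S) = (\<Sum>l\<in>S. \<delta> i (f l))" for i f and S :: "nat set"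
    by (induction S rule: infinite_finite_induct) (auto simp: \<delta>_add \<delta>_0)
  have \<delta>_mult: "\<delta> i (f * g) = \<delta> i f * g + f * \<delta> i g" for i f g
    by (simp add: \<delta>_def pder_mult distrib_left sum.distrib sum_distrib_left sum_distrib_right mult_ac)
  have \<delta>_d: "\<delta> i (if i' = k then d else 0) \<in> coefs_in kerI" for i i' k :: nat
  proof -
    have "pder j d \<in> coefs_in kerI" for j
      using pder_coefs_in[OF kerI_ideal d1, of j] by simp
    then have "\<delta> i d \<in> coefs_in kerI" unfolding \<delta>_def by (intro CI.sum_I CI.mult_I)
    then show ?thesis by (simp add: \<delta>_0)
  qed
  \<comment> \<open>The coefficients of the commutator of the vector fields
    \<open>\<delta> i\<close> and \<open>\<delta> k\<close>; its second-order part cancels since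
    partial derivatives commute.\<close>
  define g where "g i k l = \<delta> i (A k l) - \<delta> k (A i l)" for i k l
  have gP: "(\<Sum>l\<in>{1..n}. g i k l * pder l (Phi m)) \<in> coefs_in kerI"
    if i: "i \<in> {1..n}" and k: "k \<in> {1..n}" and m: "m \<in> {1..n}" for i k m
  proof -
    have *: "\<delta> i (\<delta> k f) = (\<Sum>l\<in>{1..n}. \<delta> i (A k l) * pder l f) +
        (\<Sum>l\<in>{1..n}. \<Sum>j\<in>{1..n}. A k l * A i j * pder j (pder l f))" for i k f
      unfolding \<delta>_def[of k f] \<delta>_sum \<delta>_mult by (simp add: sum.distrib \<delta>_def[of i "pder _ _"] sum_distrib_left mult.assoc)
    have "(\<Sum>l\<in>{1..n}. \<Sum>j\<in>{1..n}. A k l * A i j * pder j (pder l f)) =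
        (\<Sum>l\<in>{1..n}. \<Sum>j\<in>{1..n}. A i l * A k j * pder j (pder l f))" for f
      by (subst sum.swap) (simp add: pder_commute mult.commute)
    then have "\<delta> i (\<delta> k (Phi m)) - \<delta> k (\<delta> i (Phi m)) = (\<Sum>l\<in>{1..n}. g i k l * pder l (Phi m))"
      unfolding *[of i k] *[of k i] by (simp add: g_def left_diff_distrib sum_subtractf)
    moreover have "\<delta> k (Phi m) = (if k = m then d else 0)" "\<delta> i (Phi m) = (if i = m then d else 0)"
      unfolding \<delta>_def by (rule A[OF k m], rule A[OF i m])
    ultimately show ?thesis using CI.diff_I[OF \<delta>_d[of i k m] \<delta>_d[of k i m]] by simp
  qed
  have g: "g i k l \<in> coefs_in kerI" if "i \<in> {1..n}" "k \<in> {1..n}" "l \<in> {1..n}" for i k l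
  proof -
    have "(\<Sum>m\<in>{1..n}. B l m * (\<Sum>l\<in>{1..n}. g i k l * pder l (Phi m))) \<in> coefs_in kerI"
      by (rule CI.sum_I, rule CI.mult_I, rule gP[OF that(1,2)])
    also have "(\<Sum>m\<in>{1..n}. B l m * (\<Sum>l\<in>{1..n}. g i k l * pder l (Phi m))) =
        (\<Sum>m\<in>{1..n}. \<Sum>l'\<in>{1..n}. g i k l' * (B l m * pder l' (Phi m)))"
      by (simp add: sum_distrib_left mult.left_commute)
    also have "\<dots> = (\<Sum>l'\<in>{1..n}. g i k l' * (\<Sum>m\<in>{1..n}. B l m * pder l' (Phi m)))"
      by (subst sum.swap) (simp add: sum_distrib_left)
    also have "\<dots> = (\<Sum>l'\<in>{1..n}. if l = l' then g i k l' * d else 0)"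
      using B[OF that(3)] by (intro sum.cong) auto
    also have "\<dots> = g i k l * d" using that(3) by simp
    finally have "g i k l * d \<in> coefs_in kerI" .
    moreover have "g i k l * (d - 1) \<in> coefs_in kerI" using d1 by blast
    ultimately have "g i k l * d - g i k l * (d - 1) \<in> coefs_in kerI" by (rule CI.diff_I)
    then show ?thesis by (simp add: algebra_simps)
  qed
  have EA: "E i \<in> WA n kerI" for i
    unfolding E_def
  proof (intro W.sum_A W.mult_A)
    fix j assume "j \<in> {1..n}"
    then show "Yop n (j + n) \<in> WA n kerI" by (intro Yop_WA'[OF kerI_ideal]) auto
    show "mul (A i j) \<in> WA n kerI" by (rule WA_0[OF kerI_ideal mul_WA[OF Av]])
  qed
  have E1: "app (E i) 1 = (\<Sum>l\<in>{1..n}. A i l * Var (l + n))" for i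
    unfolding E_def app_sum_left by (rule sum.cong) (auto simp: Yop_def)
  have EE: "comm (E i) (E k) \<in> WJ n kerI" if ik: "i \<in> {1..n}" "k \<in> {1..n}" for i k
  proof -
    have *: "app (E i) (app (E k) 1) = (\<Sum>j\<in>{1..n}. \<Sum>l\<in>{1..n}. A i j * A k l * (Var (j + n) * Var (l + n))) +
        (\<Sum>l\<in>{1..n}. \<delta> i (A k l) * Var (l + n))" for i k
    proof -
      have "app (E i) f = (\<Sum>j\<in>{1..n}. A i j * (Var (j + n) * f)) + \<delta> i f" for f
        unfolding E_def app_sum_left \<delta>_def sum.distrib[symmetric]
        by (rule sum.cong) (auto simp: Yop_def distrib_left)
      moreover have V: "\<delta> i (Var (l + n)) = 0" if "l \<in> {1..n}" for l
        unfolding \<delta>_def by (rule sum.neutral) (use that in \<open>auto simp: pder_Var\<close>)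
      have "\<delta> i (\<Sum>l\<in>{1..n}. A k l * Var (l + n)) = (\<Sum>l\<in>{1..n}. \<delta> i (A k l) * Var (l + n))"
        unfolding \<delta>_sum \<delta>_mult by (rule sum.cong[OF refl]) (simp only: V mult_zero_right add_0_right)
      ultimately show ?thesis
        unfolding E1 by (simp add: sum_distrib_left mult_ac)
    qed
    have "(\<Sum>j\<in>{1..n}. \<Sum>l\<in>{1..n}. A i j * A k l * (Var (j + n) * Var (l + n))) =
      (\<Sum>j\<in>{1..n}. \<Sum>l\<in>{1..n}. A k j * A i l * (Var (j + n) * Var (l + n)))"
      by (subst sum.swap) (simp add: mult.commute)
    then have "app (comm (E i) (E k)) 1 = (\<Sum>l\<in>{1..n}. g i k l * Var (l + n))"
      by (simp add: comm_def *[of i k] *[of k i] g_def left_diff_distrib sum_subtractf)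
    also have "\<dots> \<in> coefs_in kerI" using g[OF ik] by (intro CI.sum_I CI.mult_I')
    finally show ?thesis using WJ_iff[OF kerI_ideal W.comm_A[OF EA EA]] by blast
  qed
  have EP: "comm (E i) (mul (Phi k)) - of_bool (i = k) \<in> WJ n kerI" if "i \<in> {1..n}" "k \<in> {1..n}" for i k
  proof -
    have m: "\<delta> i (Phi k) = (if i = k then d else 0)" unfolding \<delta>_def by (rule A[OF that])
    have wa: "comm (E i) (mul (Phi k)) - of_bool (i = k) \<in> WA n kerI"
      using WA_0[OF kerI_ideal mul_WA[OF Phi[OF that(2)]]] EA by (cases "i = k") auto
    have "app (comm (E i) (mul (Phi k)) - of_bool (i = k)) 1 \<in> coefs_in kerI"
      unfolding E_mul m using d1 by (cases "i = k") auto
    then show ?thesis using WJ_iff[OF kerI_ideal wa] by blast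
  qed
  define Q where "Q i = (if i \<le> n then mul (Phi i) else E (i - n))" for i
  have "Q i \<in> WA n kerI" if "i \<in> {1..2*n}" for i
    using that EA WA_0[OF kerI_ideal mul_WA[OF Phi], of i] by (auto simp: Q_def)
  moreover have "weyl_rels n (WJ n kerI) Q"
    unfolding weyl_rels_def
  proof (intro ballI)
    fix i j assume i: "i \<in> {1..2*n}" and j: "j \<in> {1..2*n}"
    show "comm (Q i) (Q j) - of_int (weyl_omega n i j) \<in> WJ n kerI"
    proof (cases "i \<le> n")
      case True
      show ?thesis
      proof (cases "j \<le> n")
        case True
        then have "weyl_omega n i j = 0" using \<open>i \<le> n\<close> i j by (auto simp: weyl_omega_def)
        then show ?thesis using True \<open>i \<le> n\<close> by (simp add: Q_def comm_mul_mul)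
      next
        case False
        then have "- (comm (E (j - n)) (mul (Phi i)) - of_bool (j - n = i)) \<in> WJ n kerI"
          using i j True by (intro W.uminus_J EP) auto
        moreover have "weyl_omega n i j = - of_bool (j - n = i)"
          using True False i j by (auto simp: weyl_omega_def)
        ultimately show ?thesis using True False by (auto simp: Q_def comm_swap[of "E _"] add.commute)
      qed
    next
      case False
      show ?thesis
      proof (cases "j \<le> n")
        case True
        have "comm (E (i - n)) (mul (Phi j)) - of_bool (i - n = j) \<in> WJ n kerI"
          using i j True False by (intro EP) auto
        moreover have "weyl_omega n i j = of_bool (i - n = j)"
          using True False i j by (auto simp: weyl_omega_def)
        ultimately show ?thesis using True False by (simp add: Q_def)
      next
        case jn: False
        have "comm (E (i - n)) (E (j - n)) \<in> WJ n kerI" using i j False jn by (intro EE) auto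
        moreover have "weyl_omega n i j = 0" using False jn i j by (auto simp: weyl_omega_def)
        ultimately show ?thesis using False jn by (simp add: Q_def)
      qed
    qed
  qed
  ultimately show ?thesis by (intro exI[of _ Q]) (auto simp: Q_def)
qed

end

theorem Dixmier_imp_Jacobian_map:
  assumes DC: "Dixmier_Conjecture TYPE('k) n" and char: "char_zero_field K"
    and \<phi>: "\<phi> \<in> alg_end K (mpoly_const K n) (PR n)" and jac: "jacobian K n \<phi> = \<one>\<^bsub>PR n\<^esub>"
  shows "\<phi> \<in> alg_aut K (mpoly_const K n) (PR n)"
proof -
  interpret W: ring_mod "WA n kerI" "WJ n kerI" by (rule ring_mod_WA)
  interpret P: rcover "PR n" cmap "mvars {1..n}" by (rule rcover_mpoly)
  have hh: "\<phi> \<in> Ring.ring_hom (PR n) (PR n)" using \<phi> by (simp add: alg_end_def)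
  obtain Phi where Phi: "\<And>i. i \<in> {1..n} \<Longrightarrow> Phi i \<in> mvars {1..n}"
    and \<phi>f: "\<And>f. f \<in> mvars {1..n} \<Longrightarrow> \<phi> (cmap f) = cmap (meval Cst Phi f)"
    using mpoly_end_form[OF \<phi>] by blast
  have "cmap (tdet n (\<lambda>i j. pder j (Phi i))) = jacobian K n \<phi>"
    by (rule jacobian_eq[OF Phi \<phi>f, symmetric])
  also have "\<dots> = cmap 1" unfolding jac by (rule one_mpoly)
  finally have det: "tdet n (\<lambda>i j. pder j (Phi i)) - 1 \<in> coefs_in kerI" unfolding cmap_eq_coefs .
  obtain Q where QA: "\<And>i. i \<in> {1..2*n} \<Longrightarrow> Q i \<in> WA n kerI" and rels: "weyl_rels n (WJ n kerI) Q"
    and Q: "\<And>i. i \<in> {1..n} \<Longrightarrow> Q i = mul (Phi i)"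
    using symplectic_lift[OF Phi det] by blast
  have oQ: "osub scal Q (2*n) f = mul (meval Cst Phi f)" if "f \<in> mvars {1..n}" for f
    using that Q by (rule osub_mul)
  obtain h where h: "h \<in> alg_end K (weyl_const K n) (weyl_alg K n)"
    and hQ: "\<And>T. T \<in> WA n kerI \<Longrightarrow> h (wrep n T) = wrep n (dsub n Q T)"
    using weyl_end_exists[OF QA rels] by blast
  have aut: "h \<in> alg_aut K (weyl_const K n) (weyl_alg K n)"
    using DC char h unfolding Dixmier_Conjecture_def by blast
  have mv: "meval Cst Phi f \<in> mvars {1..n}" if "f \<in> mvars {1..n}" for f
    using that Phi by (auto intro: meval_mvars)
  have "\<exists>g\<in>mvars {1..n}. f - meval Cst Phi g \<in> coefs_in kerI" if f: "f \<in> mvars {1..n}" for f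
  proof -
    have fA: "mul f \<in> WA n kerI" by (rule WA_0[OF kerI_ideal mul_WA[OF f]])
    obtain g where g: "g \<in> wvars n" "mul f - osub scal Q (2*n) g \<in> WJ n kerI"
      using weyl_aut_surj[OF char QA rels h hQ aut fA] by blast
    \<comment> \<open>The operator \<open>mul f\<close> commutes with the image
      \<open>mul (Phi j)\<close> of \<open>x\<^sub>j\<close>, and up to sign that commutator is the
      derivative of \<open>g\<close> in the variable \<open>j + n\<close>.\<close>
    have pd: "pder (j + n) g \<in> coefs_in kerI" if j: "j \<in> {1..n}" for j
    proof -
      have jn: "j + n \<in> {1..2*n}" using j by auto
      have q: "qgen n Q (j + n) = - mul (Phi j)" using j Q by (simp add: qgen_def)
      have qA: "qgen n Q (j + n) \<in> WA n kerI" by (rule qgen_A[OF QA ring_mod_WA jn])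
      have "comm (qgen n Q (j + n)) (mul f - osub scal Q (2*n) g) \<in> WJ n kerI"
        using qA g(2) by (rule W.comm_J')
      moreover have "comm (qgen n Q (j + n)) (mul f) = 0"
        using comm_mul_mul[of "Phi j" f] unfolding q by (simp add: comm_def)
      ultimately have c: "comm (qgen n Q (j + n)) (osub scal Q (2*n) g) \<in> WJ n kerI"
        using W.uminus_J by (fastforce simp: comm_def algebra_simps)
      have "comm (qgen n Q (j + n)) (osub scal Q (2*n) g) - osub scal Q (2*n) (pder (j + n) g) \<in> WJ n kerI"
        by (rule W.comm_osub[OF is_hom_scal scal_WA'[OF kerI_ideal] comm_scal[OF WA_lin[OF qA]]
              W.comm_qgen[OF rels _ jn] QA jn qA])
      then have "osub scal Q (2*n) (pder (j + n) g) \<in> WJ n kerI" using c W.cong_J by blast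
      then show ?thesis by (intro osub_inj[OF char QA rels pder_mvars[OF g(1)]])
    qed
    define g0 where "g0 = pfilt (\<lambda>m. set_mset m \<subseteq> {1..n}) g"
    have g0: "g0 \<in> mvars {1..n}" by (auto simp: mvars_def g0_def keys_pfilt)
    have "g - g0 \<in> coefs_in kerI"
      unfolding coefs_in_def
    proof (intro CollectI allI)
      fix m
      show "lookup (g - g0) m \<in> kerI"
      proof (cases "set_mset m \<subseteq> {1..n} \<or> m \<notin> keys g")
        case True
        then show ?thesis by (auto simp: g0_def lookup_minus lookup_pfilt in_keys_iff)
      next
        case False
        then have "set_mset m \<subseteq> {1..2*n}" using g(1) unfolding mvars_def by blast
        then obtain i where i: "i \<in># m" "i \<in> {1..2*n}" "i \<notin> {1..n}" using False by blast
        then have "i - n \<in> {1..n}" "i - n + n = i" by auto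
        then have "lookup g m \<in> kerI" using coefs_in_pder[OF char _ i(1)] pd[of "i - n"] by simp
        then show ?thesis using False by (simp add: g0_def lookup_minus lookup_pfilt)
      qed
    qed
    then have "osub scal Q (2*n) (g - g0) \<in> WJ n kerI" by (intro osub_WJ[OF QA rels])
    then have "osub scal Q (2*n) g - mul (meval Cst Phi g0) \<in> WJ n kerI"
      unfolding osub_diff[OF is_hom_scal] oQ[OF g0] .
    with g(2) have "mul f - mul (meval Cst Phi g0) \<in> WJ n kerI" by (rule W.cong_trans)
    then have "app (mul f - mul (meval Cst Phi g0)) 1 \<in> coefs_in kerI" unfolding WJ_def by blast
    then show ?thesis using g0 by auto
  qed
  then have "cmap f \<in> \<phi> ` carrier (PR n)" if "f \<in> mvars {1..n}" for f
    using that unfolding cmap_eq_coefs[symmetric] by (metis P.pi_closed \<phi>f imageI)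
  then have "\<phi> ` carrier (PR n) = carrier (PR n)"
    using ring_hom_closed[OF hh] by (auto simp: P.carr)
  moreover have "inj_on \<phi> (carrier (PR n))"
  proof (rule inj_onI)
    fix z w assume "z \<in> carrier (PR n)" "w \<in> carrier (PR n)" and eq: "\<phi> z = \<phi> w"
    then obtain f g where f: "f \<in> mvars {1..n}" "z = cmap f" and g: "g \<in> mvars {1..n}" "w = cmap g"
      by (auto simp: P.carr)
    have fg: "f - g \<in> mvars {1..n}" using f g by blast
    have "meval Cst Phi (f - g) \<in> coefs_in kerI"
      using eq unfolding f(2) g(2) \<phi>f[OF f(1)] \<phi>f[OF g(1)] cmap_eq_coefs
      by (simp add: is_hom_diff[OF is_hom_meval[OF is_hom_Cst]])
    then have "mul (meval Cst Phi (f - g)) \<in> WJ n kerI"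
      using WJ_iff[OF kerI_ideal WA_0[OF kerI_ideal mul_WA[OF mv[OF fg]]]] by simp
    then have "osub scal Q (2*n) (f - g) \<in> WJ n kerI" by (simp only: oQ[OF fg])
    moreover have "f - g \<in> wvars n" by (rule mvars_mono[OF fg]) auto
    ultimately have "f - g \<in> coefs_in kerI" by (intro osub_inj[OF char QA rels])
    then show "z = w" using f g by (simp add: cmap_eq_coefs)
  qed
  ultimately show ?thesis using \<phi> hh by (simp add: alg_aut_def ring_iso_def bij_betw_def)
qed

end

lemma char_zero_field_cover: "char_zero_field K \<Longrightarrow> kcover K (cring.poly_val K)"
  by (simp add: char_zero_field_def kcover_def kcover_axioms_def cring.rcover_poly_val fieldE(1))

theorem Dixmier_imp_Jacobian: "Dixmier_Conjecture TYPE('k) n \<Longrightarrow> Jacobian_Conjecture TYPE('k) n"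
  unfolding Jacobian_Conjecture_def using kcover.Dixmier_imp_Jacobian_map[OF char_zero_field_cover] by blast


section \<open>A linear alternative\<close>

text \<open>A polynomial \<open>w\<close> is read as a linear functional on polynomials through its
  coefficients, so that \<open>mmap\<close> specializes functionals as well.\<close>

definition pairing :: "('v, 'r::comm_ring_1) mp \<Rightarrow> ('v, 'r) mp \<Rightarrow> 'r"
  where "pairing w f = lext (\<lambda>m c. c * lookup f m) w"

lemma pairing_single_left: "pairing (single m c) f = c * lookup f m"
  unfolding pairing_def by (rule lext_single) simp

lemma pairing_add_left: "pairing (v + w) f = pairing v f + pairing w f"
  unfolding pairing_def by (rule lext_add) (simp_all add: distrib_right)

lemma pairing_0_left [simp]: "pairing 0 f = 0"
  by (simp add: pairing_def)

lemma pairing_Cst_mult_left: "pairing (Cst c * w) f = c * pairing w f"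
  by (induction w rule: pm_induct)
    (simp_all add: Cst_def mult_single pairing_single_left pairing_add_left distrib_left mult.assoc)

lemma pairing_diff_left: "pairing (v - w) f = pairing v f - pairing w f"
  using pairing_add_left[of "v - w" w f] by (simp add: eq_diff_eq)

lemma pairing_add: "pairing w (f + g) = pairing w f + pairing w g"
  by (simp add: pairing_def lext_def lookup_add distrib_left sum.distrib)

lemma pairing_0 [simp]: "pairing w 0 = 0"
  by (simp add: pairing_def lext_def)

lemma pairing_diff: "pairing w (f - g) = pairing w f - pairing w g"
  using pairing_add[of w "f - g" g] by (simp add: eq_diff_eq)

lemma pairing_sum: "pairing w (sum f A) = (\<Sum>a\<in>A. pairing w (f a))"
  by (induction A rule: infinite_finite_induct) (auto simp: pairing_add)

lemma pairing_Cst_mult: "pairing w (Cst c * f) = c * pairing w f"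
  by (simp add: pairing_def lext_def sum_distrib_left mult.left_commute)

lemma pairing_mmap:
  fixes s :: "'r::comm_ring_1 \<Rightarrow> 'c::comm_ring_1" and w f :: "('v, 'r) mp"
  assumes s: "is_hom s"
  shows "pairing (mmap s w) (mmap s f) = s (pairing w f)"
proof (induction w rule: pm_induct)
  case zero
  have "mmap s 0 = (0 :: ('v, 'c) mp)" by (rule is_hom_0[OF is_hom_meval[OF is_hom_comp[OF s is_hom_Cst]]])
  then show ?case by (simp add: is_hom_0[OF s])
next
  case (single m c)
  have "mmap s (single m c) = single m (s c)"
    by (rule poly_mapping_eqI) (simp add: lookup_mmap[OF s] lookup_single when_def is_hom_0[OF s])
  then show ?case by (simp add: pairing_single_left lookup_mmap[OF s] is_homD[OF s])
next
  case (add f g)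
  then show ?case by (simp add: meval_add[OF is_hom_comp[OF s is_hom_Cst]] pairing_add_left is_homD[OF s])
qed

lemma (in cring_ideal) pairing_coefs_in: "f \<in> coefs_in I \<Longrightarrow> pairing w f \<in> I"
  unfolding pairing_def lext_def by (auto simp: coefs_in_def)

text \<open>Unsolvability of a linear system could be lost under specialization; a separating
  functional \<open>w\<close> expresses it by finitely many congruences, which are preserved. The
  hypothesis \<open>inv\<close> makes the residues modulo \<open>I\<close> a field or
  trivial.\<close>

lemma linear_alternative:
  fixes v :: "('v, 'r::comm_ring_1) mp"
  assumes "cring_ideal I" and inv: "\<And>x. x \<notin> I \<Longrightarrow> \<exists>y. x * y - 1 \<in> I" and "finite B"
  shows "(\<exists>c. v - (\<Sum>b\<in>B. Cst (c b) * u b) \<in> coefs_in I) \<or>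
    (\<exists>w. (\<forall>b\<in>B. pairing w (u b) \<in> I) \<and> pairing w v - 1 \<in> I)"
proof -
  interpret cring_ideal I by fact
  show ?thesis using \<open>finite B\<close>
proof (induction B arbitrary: v rule: finite_induct)
  case empty
  show ?case
  proof (cases "v \<in> coefs_in I")
    case False
    then obtain m y where "lookup v m * y - 1 \<in> I" using inv unfolding coefs_in_def by blast
    then show ?thesis by (intro disjI2 exI[of _ "single m y"]) (simp add: pairing_single_left mult.commute)
  qed simp
next
  case (insert a B)
  interpret C: cring_ideal "coefs_in I :: ('v, 'r) mp set" by (rule cring_ideal_coefs_in) unfold_locales
  have span: "\<exists>c. v - (\<Sum>b\<in>insert a B. Cst (c b) * u b) \<in> coefs_in I"
    if "v - Cst y * u a - (\<Sum>b\<in>B. Cst (c b) * u b) \<in> coefs_in I" for y c v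
  proof
    have "(\<Sum>b\<in>B. Cst ((c(a := y)) b) * u b) = (\<Sum>b\<in>B. Cst (c b) * u b)"
      using insert.hyps by (intro sum.cong) auto
    then show "v - (\<Sum>b\<in>insert a B. Cst ((c(a := y)) b) * u b) \<in> coefs_in I"
      using that insert.hyps by (simp add: diff_diff_eq)
  qed
  show ?case using insert.IH[of v]
  proof
    assume "\<exists>c. v - (\<Sum>b\<in>B. Cst (c b) * u b) \<in> coefs_in I"
    then show ?thesis using span[where y = 0] by auto
  next
    assume "\<exists>w. (\<forall>b\<in>B. pairing w (u b) \<in> I) \<and> pairing w v - 1 \<in> I"
    then obtain w where w: "\<And>b. b \<in> B \<Longrightarrow> pairing w (u b) \<in> I" "pairing w v - 1 \<in> I" by blast
    show ?thesis
    proof (cases "pairing w (u a) \<in> I")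
      case True
      then show ?thesis using w by blast
    next
      case False
      then obtain y where y: "pairing w (u a) * y - 1 \<in> I" using inv by blast
      \<comment> \<open>By the choice of \<open>y\<close>, the functional \<open>w\<close> vanishes
        on \<open>v - Cst y * u a\<close> modulo \<open>I\<close>. A functional \<open>t\<close> for
        this vector can thus be corrected by a multiple of \<open>w\<close> so as to vanish on
        \<open>u a\<close>.\<close>
      show ?thesis using insert.IH[of "v - Cst y * u a"]
      proof
        assume "\<exists>c. v - Cst y * u a - (\<Sum>b\<in>B. Cst (c b) * u b) \<in> coefs_in I"
        then show ?thesis using span by blast
      next
        assume "\<exists>w. (\<forall>b\<in>B. pairing w (u b) \<in> I) \<and> pairing w (v - Cst y * u a) - 1 \<in> I"
        then obtain t where t: "\<And>b. b \<in> B \<Longrightarrow> pairing t (u b) \<in> I" "pairing t (v - Cst y * u a) - 1 \<in> I" by blast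
        define s where "s = t - Cst (pairing t (u a) * y) * w"
        have s: "pairing s f = pairing t f - pairing t (u a) * y * pairing w f" for f
          by (simp add: s_def pairing_diff_left pairing_Cst_mult_left)
        have "pairing s (u a) = - (pairing t (u a) * (pairing w (u a) * y - 1))"
          by (simp add: s algebra_simps)
        then have "pairing s (u a) \<in> I" using y by simp
        moreover have "pairing s (u b) \<in> I" if "b \<in> B" for b
          unfolding s using t(1)[OF that] w(1)[OF that] by auto
        moreover have "pairing s v - 1 = (pairing t (v - Cst y * u a) - 1) - pairing t (u a) * y * (pairing w v - 1)"
          by (simp add: s pairing_diff pairing_Cst_mult algebra_simps)
        then have "pairing s v - 1 \<in> I" using t(2) w(2) by (simp only: diff_I mult_I)
        ultimately show ?thesis by blast
      qed
    qed
  qed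
qed
qed


section \<open>Specialization of Weyl algebra endomorphisms\<close>

text \<open>Here \<open>T'\<close> is a specialization of \<open>T\<close> along \<open>s\<close>.
  An arbitrary operator has no such partner in sight, but those built from generators and scalars
  do.\<close>

definition intertwined :: "('r::comm_ring_1 \<Rightarrow> 'c::comm_ring_1) \<Rightarrow> (nat, 'r) mp endo \<Rightarrow> (nat, 'c) mp endo \<Rightarrow> bool"
  where "intertwined s T T' \<longleftrightarrow> (\<forall>g. mmap s (app T g) = app T' (mmap s g))"

context
  fixes s :: "'r::comm_ring_1 \<Rightarrow> 'c::comm_ring_1"
  assumes s: "is_hom s"
begin

lemma mmap_hom: "is_hom (mmap s)"
  by (rule is_hom_meval[OF is_hom_comp[OF s is_hom_Cst]])

lemma mmap_Cst: "mmap s (Cst c) = Cst (s c)"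
  by (rule meval_Cst[OF is_hom_comp[OF s is_hom_Cst]])

lemma mmap_Var: "mmap s (Var i) = Var i"
  by (rule meval_Var[OF is_hom_comp[OF s is_hom_Cst]])

lemma intertwined_mult: "intertwined s T T' \<Longrightarrow> intertwined s S S' \<Longrightarrow> intertwined s (T * S) (T' * S')"
  by (simp add: intertwined_def)

lemma intertwined_add: "intertwined s T T' \<Longrightarrow> intertwined s S S' \<Longrightarrow> intertwined s (T + S) (T' + S')"
  by (simp add: intertwined_def is_homD[OF mmap_hom])

lemma intertwined_diff: "intertwined s T T' \<Longrightarrow> intertwined s S S' \<Longrightarrow> intertwined s (T - S) (T' - S')"
  by (simp add: intertwined_def is_hom_diff[OF mmap_hom])

lemma intertwined_comm: "intertwined s T T' \<Longrightarrow> intertwined s S S' \<Longrightarrow> intertwined s (comm T S) (comm T' S')"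
  unfolding comm_def by (intro intertwined_diff intertwined_mult)

lemma intertwined_scal: "intertwined s (scal c) (scal (s c))"
  by (simp add: intertwined_def is_homD[OF mmap_hom] mmap_Cst)

lemma intertwined_1: "intertwined s 1 1"
  by (simp add: intertwined_def)

lemma intertwined_of_int: "intertwined s (of_int k) (of_int k)"
  using intertwined_scal[of "of_int k"] by (simp add: is_hom_of_int[OF is_hom_mul] is_hom_of_int[OF s])

lemma intertwined_omon:
  "(\<And>i. i \<in> {1..N} \<Longrightarrow> intertwined s (P i) (P' i)) \<Longrightarrow> intertwined s (omon P N m) (omon P' N m)"
proof (induction N)
  case (Suc N)
  have "intertwined s (T ^ k) (T' ^ k)" if "intertwined s T T'" for T T' k
    using that by (induction k) (simp_all add: intertwined_1 intertwined_mult)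
  then show ?case using Suc by (simp add: intertwined_mult)
qed (simp add: intertwined_1)

lemma intertwined_osub:
  assumes "\<And>i. i \<in> {1..N} \<Longrightarrow> intertwined s (P i) (P' i)"
  shows "intertwined s (osub scal P N f) (osub scal P' N (mmap s f))"
proof (induction f rule: pm_induct)
  case zero
  show ?case by (simp add: intertwined_def is_hom_0[OF mmap_hom])
next
  case (single m c)
  have "mmap s (single m c) = single m (s c)"
    by (rule poly_mapping_eqI) (simp add: lookup_mmap[OF s] lookup_single when_def is_hom_0[OF s])
  moreover have "intertwined s (scal c * omon P N m) (scal (s c) * omon P' N m)"
    using assms by (intro intertwined_mult intertwined_scal intertwined_omon)
  ultimately show ?case by (simp add: osub_single)
next
  case (add f g)
  then show ?case by (simp add: is_homD[OF mmap_hom] osub_add intertwined_add)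
qed

lemma intertwined_Yop: "intertwined s (Yop n i) (Yop n i)"
  by (simp add: intertwined_def Yop_def is_homD[OF mmap_hom] is_hom_0[OF mmap_hom] mmap_Var mmap_pder[OF s])

lemma intertwined_wop: "intertwined s (wop n f) (wop n (mmap s f))"
  unfolding wop_def by (rule intertwined_osub[OF intertwined_Yop])

end

lemma finite_monomials: "finite V \<Longrightarrow> finite {m. set_mset m \<subseteq> V \<and> size m \<le> d}"
proof (rule finite_subset)
  assume "finite V"
  then show "finite (mset ` {xs. set xs \<subseteq> V \<and> length xs \<le> d})"
    by (intro finite_imageI finite_lists_length_le)
  show "{m. set_mset m \<subseteq> V \<and> size m \<le> d} \<subseteq> mset ` {xs. set xs \<subseteq> V \<and> length xs \<le> d}"
  proof
    fix m assume m: "m \<in> {m. set_mset m \<subseteq> V \<and> size m \<le> d}"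
    obtain xs where "m = mset xs" using ex_mset by metis
    then show "m \<in> mset ` {xs. set xs \<subseteq> V \<and> length xs \<le> d}" using m by auto
  qed
qed

lemma common_degle: "finite A \<Longrightarrow> \<exists>d. \<forall>a\<in>A. degle d (f a)"
proof (induction A rule: finite_induct)
  case (insert a A)
  then obtain d e where "\<forall>a\<in>A. degle d (f a)" "degle e (f a)" using degle_exists by blast
  then show ?case by (intro exI[of _ "max d e"]) (auto intro: degle_mono[OF _ max.cobounded1] degle_mono[OF _ max.cobounded2])
qed simp

section \<open>Primes at which a missed generator remains missed\<close>

lemma specialize_finite:
  fixes I :: "('v, int) mp set"
  assumes "cring_prime I" "\<And>z. of_int z \<in> I \<Longrightarrow> z = 0" and S: "finite S" "S \<subseteq> I"
  shows "\<exists>p s. prime (p :: nat) \<and> N < p \<and> is_hom (s :: _ \<Rightarrow> int) \<and> (\<forall>E\<in>S. int (p\<^sup>2) dvd s E)"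
proof -
  define V where "V = (\<Union>E\<in>S. \<Union>m\<in>keys E. set_mset m)"
  have "finite V" unfolding V_def using S by auto
  then obtain p a where pa: "prime p" "N < p" "\<forall>E\<in>mvars V. E \<in> I \<longrightarrow> int (p\<^sup>2) dvd meval (\<lambda>x. x) a E"
    using specialize_mod_prime_square[OF assms(1,2)] by blast
  have "E \<in> mvars V" if "E \<in> S" for E using that unfolding mvars_def V_def by blast
  moreover have "is_hom (meval (\<lambda>x. x) a :: _ \<Rightarrow> int)" by (rule is_hom_meval) (simp add: is_hom_def)
  ultimately show ?thesis using pa S(2) by (intro exI[of _ p] exI[of _ "meval (\<lambda>x. x) a"]) blast
qed

text \<open>A functional certifies that the generator is no combination of low degree, and it survives
  specialization. The relations are kept modulo \<open>p\<^sup>2\<close> because commutators of \<open>p\<close>-th powers will be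
  divided by \<open>p\<close>.\<close>

lemma bad_prime:
  fixes I :: "('v, int) mp set" and f :: "nat \<Rightarrow> (nat, ('v, int) mp) mp"
  assumes I: "cring_prime I" and char: "\<And>z. of_int z \<in> I \<Longrightarrow> z = 0"
    and inv: "\<And>x. x \<notin> I \<Longrightarrow> \<exists>y. x * y - 1 \<in> I"
    and f: "\<And>i. i \<in> {1..2*n} \<Longrightarrow> f i \<in> wvars n" and rels: "weyl_rels n (WJ n I) (\<lambda>i. wop n (f i))"
    and i0: "i0 \<in> {1..2*n}"
    and out: "\<And>g. g \<in> wvars n \<Longrightarrow> Yop n i0 - osub scal (\<lambda>i. wop n (f i)) (2*n) g \<notin> WJ n I"
  shows "\<exists>p F. prime (p :: nat) \<and> k < p \<and>
    (\<forall>i\<in>{1..2*n}. F i \<in> wvars n \<and> (\<forall>d. degle d (f i) \<longrightarrow> degle d (F i))) \<and>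
    weyl_rels n (WJ n {x. int (p\<^sup>2) dvd x}) (\<lambda>i. wop n (F i)) \<and>
    (\<forall>g\<in>wvars n. degle k g \<longrightarrow> Yop n i0 - osub scal (\<lambda>i. wop n (F i)) (2*n) g \<notin> WJ n {x. int p dvd x})"
proof -
  interpret I: cring_prime I by fact
  have II: "cring_ideal I" by unfold_locales
  interpret W: ring_mod "WA n I" "WJ n I" by (rule ring_mod_weyl[OF II])
  define P where "P = (\<lambda>i. wop n (f i))"
  define B where "B = {m. set_mset m \<subseteq> {1..2*n} \<and> size m \<le> k}"
  have B: "finite B" unfolding B_def by (rule finite_monomials) simp
  define u where "u m = app (omon P (2*n) m) 1" for m
  have PA: "P i \<in> WA n I" for i unfolding P_def by (rule wop_WA[OF II])
  have Y1: "app (Yop n i0) 1 = Var i0" by (simp add: Yop_def)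
  have osubA: "osub scal P (2*n) g \<in> WA n I" for g
    by (rule W.osub_A[OF is_hom_scal scal_WA'[OF II] PA])
  have osub_1: "app (osub scal P (2*n) g) 1 = (\<Sum>m\<in>keys g. Cst (lookup g m) * u m)" for g
    by (simp add: osub_def lext_def app_sum_left u_def)
  have "\<not> (\<exists>c. Var i0 - (\<Sum>m\<in>B. Cst (c m) * u m) \<in> coefs_in I)"
  proof
    assume "\<exists>c. Var i0 - (\<Sum>m\<in>B. Cst (c m) * u m) \<in> coefs_in I"
    then obtain c where c: "Var i0 - (\<Sum>m\<in>B. Cst (c m) * u m) \<in> coefs_in I" by blast
    define g where "g = (\<Sum>m\<in>B. single m (c m))"
    have g: "g \<in> wvars n" unfolding g_def by (intro mvars_sum mvars_single) (simp add: B_def)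
    have "osub scal P (2*n) g = (\<Sum>m\<in>B. scal (c m) * omon P (2*n) m)"
      by (simp add: g_def osub_sum osub_single)
    then have "app (Yop n i0 - osub scal P (2*n) g) 1 \<in> coefs_in I"
      using c by (simp add: Y1 app_sum_left u_def)
    then have "Yop n i0 - osub scal P (2*n) g \<in> WJ n I"
      using WJ_iff[OF II W.diff_A[OF Yop_WA'[OF II i0] osubA]] by blast
    then show False using out[OF g] by (simp add: P_def)
  qed
  then obtain w where w: "\<And>m. m \<in> B \<Longrightarrow> pairing w (u m) \<in> I" "pairing w (Var i0) - 1 \<in> I"
    using linear_alternative[OF II inv B, of "Var i0" u] by blast
  define E where "E i j = app (comm (P i) (P j) - of_int (weyl_omega n i j)) 1" for i j
  have E: "E i j \<in> coefs_in I" if "i \<in> {1..2*n}" "j \<in> {1..2*n}" for i j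
    using rels that unfolding weyl_rels_def E_def P_def WJ_def by blast
  \<comment> \<open>The finitely many elements of \<open>I\<close> that have to vanish at the prime:
    the conditions on the functional for all monomials of degree at most \<open>k\<close>, and the
    coefficients of the defects of the Weyl relations.\<close>
  define S where "S = insert (pairing w (Var i0) - 1) ((\<lambda>m. pairing w (u m)) ` B) \<union>
    (\<Union>i\<in>{1..2*n}. \<Union>j\<in>{1..2*n}. lookup (E i j) ` keys (E i j))"
  have "finite S" using B by (simp add: S_def)
  moreover have "S \<subseteq> I"
  proof
    fix x assume "x \<in> S"
    then consider "x = pairing w (Var i0) - 1" | m where "m \<in> B" "x = pairing w (u m)"
      | i j m where "i \<in> {1..2*n}" "j \<in> {1..2*n}" "x = lookup (E i j) m"
      unfolding S_def by blast
    then show "x \<in> I" using w E by cases (auto simp: coefs_in_def)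
  qed
  ultimately obtain p :: nat and s :: "('v, int) mp \<Rightarrow> int" where pk: "prime p" "k < p" and s: "is_hom s"
    and sS: "\<And>x. x \<in> S \<Longrightarrow> int (p\<^sup>2) dvd s x"
    using specialize_finite[OF I char, of S k] by blast
  interpret weyl_p n p by unfold_locales (rule pk)
  define F where "F i = mmap s (f i)" for i
  define P' where "P' = (\<lambda>i. wop n (F i))"
  have PP: "intertwined s (P i) (P' i)" for i unfolding P_def P'_def F_def by (rule intertwined_wop[OF s])
  have mm1: "mmap s 1 = 1" by (rule is_homD(1)[OF mmap_hom[OF s]])
  have PA2: "P' i \<in> A2" for i unfolding P'_def by (rule wop_WA[OF Iq_ideal])
  have PA1: "P' i \<in> A1" for i unfolding P'_def by (rule wop_WA[OF Ip_ideal])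
  have Fw: "F i \<in> wvars n" "degle d (f i) \<Longrightarrow> degle d (F i)" if "i \<in> {1..2*n}" for i d
  proof -
    show "F i \<in> wvars n" unfolding F_def by (rule mmap_mvars[OF s f[OF that]])
    have "keys (F i) \<subseteq> keys (f i)" by (auto simp: F_def in_keys_iff lookup_mmap[OF s] is_hom_0[OF s])
    then show "degle d (f i) \<Longrightarrow> degle d (F i)" unfolding degle_def by blast
  qed
  have rels': "weyl_rels n J2 P'"
    unfolding weyl_rels_def
  proof (intro ballI)
    fix i j assume ij: "i \<in> {1..2*n}" "j \<in> {1..2*n}"
    let ?T = "comm (P' i) (P' j) - of_int (weyl_omega n i j)"
    have "intertwined s (comm (P i) (P j) - of_int (weyl_omega n i j)) ?T"
      by (intro intertwined_diff[OF s] intertwined_comm[OF s] intertwined_of_int[OF s] PP)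
    then have T1: "app ?T 1 = mmap s (E i j)" unfolding intertwined_def E_def by (metis mm1)
    have "lookup (app ?T 1) m \<in> Iq" for m
    proof (cases "m \<in> keys (E i j)")
      case True
      then have "lookup (E i j) m \<in> S" using ij unfolding S_def by blast
      then show ?thesis using sS unfolding T1 lookup_mmap[OF s] Iq_def by blast
    next
      case False
      then show ?thesis unfolding T1 lookup_mmap[OF s] Iq_def by (simp add: in_keys_iff is_hom_0[OF s])
    qed
    then have "app ?T 1 \<in> Cq" unfolding coefs_in_def by blast
    moreover have "?T \<in> A2"
    proof (intro M2.diff_A M2.comm_A PA2)
      show "of_int (weyl_omega n i j) \<in> A2"
        using scal_WA'[OF Iq_ideal, of "of_int (weyl_omega n i j)" n]
        by (simp only: Cst_of_int is_hom_of_int[OF is_hom_mul])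
    qed
    ultimately show "?T \<in> J2" using WJ_iff[OF Iq_ideal] by blast
  qed
  \<comment> \<open>Modulo \<open>p\<close> the specialized functional takes the value 1 on the
    generator and 0 on every ordered polynomial of degree at most \<open>k\<close>.\<close>
  have "Yop n i0 - osub scal P' (2*n) g \<notin> J1" if g: "g \<in> wvars n" "degle k g" for g
  proof
    assume "Yop n i0 - osub scal P' (2*n) g \<in> J1"
    then have "app (Yop n i0 - osub scal P' (2*n) g) 1 \<in> Cp" unfolding WJ_def by blast
    then have c: "Var i0 - app (osub scal P' (2*n) g) 1 \<in> Cp" by (auto simp: Yop_def split: if_splits)
    define w' where "w' = mmap s w"
    have pq: "int p dvd s x" if "x \<in> S" for x
      using sS[OF that] by (metis dvd_mult_left of_nat_mult power2_eq_square)
    have "app (osub scal P' (2*n) g) 1 = (\<Sum>m\<in>keys g. Cst (lookup g m) * app (omon P' (2*n) m) 1)"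
      by (simp add: osub_def lext_def app_sum_left)
    then have "pairing w' (app (osub scal P' (2*n) g) 1) =
        (\<Sum>m\<in>keys g. lookup g m * pairing w' (app (omon P' (2*n) m) 1))"
      by (simp add: pairing_sum pairing_Cst_mult)
    also have "\<dots> \<in> Ip"
    proof (intro Ip.sum_I Ip.mult_I)
      fix m assume "m \<in> keys g"
      then have "m \<in> B" using g by (auto simp: B_def mvars_def degle_def)
      have "app (omon P' (2*n) m) 1 = mmap s (u m)"
        using intertwined_omon[OF s, of "2*n" P P' m] PP mm1 unfolding intertwined_def u_def by metis
      then have "pairing w' (app (omon P' (2*n) m) 1) = s (pairing w (u m))"
        by (simp add: w'_def pairing_mmap[OF s])
      then show "pairing w' (app (omon P' (2*n) m) 1) \<in> Ip"
        using pq[of "pairing w (u m)"] \<open>m \<in> B\<close> by (simp add: Ip_def S_def)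
    qed
    finally have 1: "pairing w' (app (osub scal P' (2*n) g) 1) \<in> Ip" .
    have 2: "pairing w' (Var i0) - pairing w' (app (osub scal P' (2*n) g) 1) \<in> Ip"
      using Ip.pairing_coefs_in[OF c, of w'] by (simp only: pairing_diff)
    have "pairing w' (Var i0) = s (pairing w (Var i0))"
      using pairing_mmap[OF s, of w "Var i0"] by (simp add: w'_def mmap_Var[OF s])
    then have "pairing w' (Var i0) - 1 = s (pairing w (Var i0) - 1)"
      by (simp add: is_hom_diff[OF s] is_homD[OF s])
    then have 3: "pairing w' (Var i0) - 1 \<in> Ip"
      using pq[of "pairing w (Var i0) - 1"] by (simp add: Ip_def S_def)
    have "pairing w' (Var i0) \<in> Ip" using Ip.cong_I[OF 2] 1 by blast
    then have "1 \<in> Ip" using Ip.cong_I[OF 3] by blast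
    then show False by simp
  qed
  then have "\<forall>g\<in>wvars n. degle k g \<longrightarrow>
      Yop n i0 - osub scal (\<lambda>i. wop n (F i)) (2*n) g \<notin> WJ n {x. int p dvd x}"
    unfolding P'_def Ip_def by (intro ballI impI)
  moreover have "weyl_rels n (WJ n {x. int (p\<^sup>2) dvd x}) (\<lambda>i. wop n (F i))"
    using rels' unfolding P'_def Iq_def .
  moreover have "\<forall>i\<in>{1..2*n}. F i \<in> wvars n \<and> (\<forall>d. degle d (f i) \<longrightarrow> degle d (F i))"
    by (intro ballI conjI allI impI Fw)
  ultimately show ?thesis using pk by (intro exI[of _ p] exI[of _ F] conjI)
qed


section \<open>Reduction modulo a prime\<close>

lemma hc_mult:
  assumes f: "degle d f" and g: "degle e g"
  shows "hc (d + e) (f * g) = hc d f * hc e g"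
proof -
  have "f * g = (\<Sum>m\<in>keys f. single m (lookup f m) * g)"
    by (subst pm_sum_single[of f]) (rule sum_distrib_right)
  then have "hc (d + e) (f * g) = (\<Sum>m\<in>keys f. hc (d + e) (single m (lookup f m) * g))"
    by (simp add: hc_sum)
  also have "\<dots> = (\<Sum>m\<in>keys f. if size m = d then single m (lookup f m) * hc e g else 0)"
  proof (rule sum.cong[OF refl])
    fix m assume m: "m \<in> keys f"
    show "hc (d + e) (single m (lookup f m) * g) = (if size m = d then single m (lookup f m) * hc e g else 0)"
    proof (cases "size m = d")
      case True
      then show ?thesis using hc_single_mult[of m e] by simp
    next
      case False
      then have "size m < d" using f m by (auto simp: degle_def)
      moreover have "degle (size m + e) (single m (lookup f m) * g)"
        by (intro degle_mult degle_single g order_refl)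
      ultimately show ?thesis using hc_eq_0[of "size m + e" _ "d + e"] by simp
    qed
  qed
  also have "\<dots> = hc d f * hc e g"
    unfolding hc_def pfilt_def by (simp add: sum.inter_filter sum_distrib_right if_distrib[of "\<lambda>x. x * _"] cong: if_cong)
  finally show ?thesis .
qed

context weyl_p
begin

text \<open>Modulo \<open>p\<close> the polynomials form a domain in which degrees add.\<close>

lemma factor_of_const:
  assumes fg: "f * g - Cst e \<in> Cp" and e: "e \<notin> Ip"
  shows "\<exists>c. f - Cst c \<in> Cp"
proof -
  define t where "t f = pfilt (\<lambda>m. lookup f m \<notin> Ip) f" for f :: "(nat, int) mp"
  have t: "f - t f \<in> Cp" for f
    by (auto simp: t_def coefs_in_def lookup_minus lookup_pfilt)
  have top: "\<exists>d. degle d (t f) \<and> hc d (t f) \<notin> Cp" if "f \<notin> Cp" for f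
  proof -
    have "t f \<noteq> 0" using t[of f] that by auto
    then have k: "finite (size ` keys (t f))" "size ` keys (t f) \<noteq> {}" by simp_all
    define d where "d = Max (size ` keys (t f))"
    obtain m where m: "m \<in> keys (t f)" "size m = d" using Max_in[OF k] unfolding d_def by auto
    have "degle d (t f)" unfolding degle_def d_def using Max_ge[OF k(1)] by simp
    moreover have "lookup (hc d (t f)) m \<notin> Ip"
      using m by (auto simp: hc_def t_def keys_pfilt lookup_pfilt)
    ultimately show ?thesis unfolding coefs_in_def by blast
  qed
  have fg': "t f * t g - Cst e \<in> Cp"
    using Cp.cong_trans[OF Cp.cong_sym[OF Cp.cong_mult[OF t t]] fg] .
  have eC: "Cst e \<notin> Cp" using e by simp
  have "f \<notin> Cp" "g \<notin> Cp"
    using fg eC Cp.cong_I[OF fg] by auto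
  then obtain d d' where d: "degle d (t f)" "hc d (t f) \<notin> Cp" and d': "degle d' (t g)" "hc d' (t g) \<notin> Cp"
    using top by blast
  have "hc (d + d') (t f * t g) \<notin> Cp"
    unfolding hc_mult[OF d(1) d'(1)] using d(2) d'(2) Cp.prime_I by blast
  moreover have "hc (d + d') (t f * t g) - hc (d + d') (Cst e) \<in> Cp"
    using hc_coefs_in[OF Ip.zero_I fg'] by (simp only: hc_diff)
  ultimately have "hc (d + d') (Cst e) \<notin> Cp" using Cp.cong_I by blast
  then have "hc (d + d') (Cst e :: (nat, int) mp) \<noteq> 0" using Cp.zero_I by metis
  then have "d = 0" using hc_eq_0[OF degle_Cst, of 0 "d + d'" e] by (metis add_gr_0 gr0I)
  then have "t f = Cst (lookup (t f) {#})"
    using d(1) by (intro poly_mapping_eqI) (auto simp: degle_def lookup_Cst in_keys_iff)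
  then show ?thesis using t[of f] by metis
qed

context
  fixes F :: "nat \<Rightarrow> (nat, int) mp" and P d
  assumes F: "\<And>i. i \<in> {1..2*n} \<Longrightarrow> F i \<in> wvars n" "\<And>i. i \<in> {1..2*n} \<Longrightarrow> degle d (F i)"
    and P: "P = (\<lambda>i. wop n (F i))" and rels: "weyl_rels n J2 P"
begin

lemma P_A2: "P i \<in> A2" and P_A1: "P i \<in> A1"
  unfolding P by (rule wop_WA[OF Iq_ideal], rule wop_WA[OF Ip_ideal])

text \<open>The power \<open>P i ^ p\<close> has degree at most \<open>p * d\<close>, and passing to
  polynomials in the \<open>p\<close>-th powers divides degrees by \<open>p\<close>. This makes the
  bound \<open>d\<close> independent of \<open>p\<close>.\<close>

lemma power_polynomials:
  "\<exists>Phi. \<forall>i\<in>{1..2*n}. Phi i \<in> wvars n \<and> degle d (Phi i) \<and> P i ^ p - mul (Frob p (Phi i)) \<in> J1"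
proof (intro exI ballI conjI)
  fix i assume i: "i \<in> {1..2*n}"
  let ?G = "pcomp p {#} (app (P i ^ p) 1)"
  have PpA: "P i ^ p \<in> A1" using P_A1 by blast
  have c: "comm (P i ^ p) (Yop n j) \<in> J1" if "j \<in> {1..2*n}" for j
    by (rule power_central[OF weyl_rels_mono[OF rels subsetI[OF J2_J1]] P_A1 i Yop_WA'[OF Ip_ideal that]])
  show "?G \<in> wvars n" "P i ^ p - mul (Frob p ?G) \<in> J1"
    using central_Frob[OF PpA c] by blast+
  have "degle (p * d) (app (P i ^ p) 1)" unfolding P by (rule hc_wop_power(1)[OF F[OF i]])
  then have "size (repeat_mset p m) \<le> p * d" if "m \<in> keys ?G" for m
  proof -
    have "repeat_mset p m \<in> keys (app (P i ^ p) 1)"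
      using that by (simp add: in_keys_iff lookup_pcomp[OF p0])
    then show ?thesis using \<open>degle (p * d) (app (P i ^ p) 1)\<close> unfolding degle_def by blast
  qed
  then show "degle d ?G" using p0 by (auto simp: degle_def)
qed

text \<open>The Jacobian determinant divides the determinant of \<open>W\<close> modulo
  \<open>p\<close>, hence is constant. The latter is a unit: \<open>W\<close> times its transpose is
  the scalar matrix with entry \<open>u^2\<close>, and \<open>u = fact (p - 1)\<close> is prime to
  \<open>p\<close>.\<close>

lemma jacobian_unit:
  assumes Phi: "\<And>i. i \<in> {1..2*n} \<Longrightarrow> Phi i \<in> wvars n"
    "\<And>i. i \<in> {1..2*n} \<Longrightarrow> P i ^ p - mul (Frob p (Phi i)) \<in> J1"
  shows "\<exists>c. c \<notin> Ip \<and> tdet (2*n) (\<lambda>i j. pder j (Phi i)) - Cst c \<in> Cp"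
proof -
  obtain B where B: "\<And>i j. i \<in> {1..2*n} \<Longrightarrow> j \<in> {1..2*n} \<Longrightarrow>
      (\<Sum>k\<in>{1..2*n}. B i k * pder k (Phi j)) - of_int (weyl_omega n i j) * of_nat (fact (p - 1)) \<in> Cp"
    using jacobian_invertible[OF rels P_A2 Phi] by blast
  define u where "u = int (fact (p - 1))"
  define W where "W i j = weyl_omega n i j * u" for i j
  have u: "u \<notin> Ip" unfolding u_def Ip_def mem_Collect_eq of_nat_dvd_iff
    using prime_dvd_fact_iff[OF p, of "p - 1"] p0 by simp
  have "(\<Sum>k\<in>{1..2*n}. W i k * W j k) = (if i = j then u\<^sup>2 else 0)"
    if i: "i \<in> {1..2*n}" and j: "j \<in> {1..2*n}" for i j
  proof -
    define i' where "i' = (if i \<le> n then i + n else i - n)"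
    have i': "i' \<in> {1..2*n}" using i by (auto simp: i'_def)
    have "weyl_omega n i k = 0" if "k \<noteq> i'" "k \<in> {1..2*n}" for k
      using i that by (auto simp: weyl_omega_def i'_def split: if_splits)
    then have "(\<Sum>k\<in>{1..2*n}. W i k * W j k) = (\<Sum>k\<in>{1..2*n}. if k = i' then W i i' * W j i' else 0)"
      by (intro sum.cong) (auto simp: W_def)
    also have "\<dots> = W i i' * W j i'" using i' by simp
    also have "\<dots> = (if i = j then u\<^sup>2 else 0)"
      using i j by (auto simp: W_def i'_def weyl_omega_def power2_eq_square split: if_splits)
    finally show ?thesis .
  qed
  then have "tdet (2*n) W * tdet (2*n) (\<lambda>i j. W j i) = tdet (2*n) (\<lambda>i j. if i = j then u\<^sup>2 else 0)"
    unfolding tdet_mult by (intro tdet_cong) auto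
  also have "\<dots> = (u\<^sup>2) ^ (2*n)" by (rule tdet_scalar)
  finally have W2: "tdet (2*n) W * tdet (2*n) (\<lambda>i j. W j i) = (u\<^sup>2) ^ (2*n)" .
  have Wu: "tdet (2*n) W \<notin> Ip"
  proof
    assume "tdet (2*n) W \<in> Ip"
    then have "(u\<^sup>2) ^ (2*n) \<in> Ip" unfolding W2[symmetric] by (rule Ip.mult_I')
    then show False using u Ip.power_notin by blast
  qed
  let ?J = "\<lambda>i j. pder j (Phi i)"
  have "tdet (2*n) B * tdet (2*n) (\<lambda>i j. ?J j i) - tdet (2*n) (\<lambda>i j. Cst (W i j)) \<in> Cp"
  proof -
    have Cst_int: "(Cst x :: (nat, int) mp) = of_int x" for x by (metis Cst_of_int of_int_eq_id id_apply)
    have "(Cst (W i j) :: (nat, int) mp) = of_int (weyl_omega n i j) * of_nat (fact (p - 1))" for i j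
      by (simp only: Cst_int W_def u_def of_int_mult of_int_of_nat_eq)
    then show ?thesis unfolding tdet_mult using B by (intro Cp.tdet_cong_I) simp
  qed
  then have "tdet (2*n) ?J * tdet (2*n) B - Cst (tdet (2*n) W) \<in> Cp"
    by (simp only: tdet_transpose[of _ ?J] tdet_hom[OF is_hom_Cst] mult.commute)
  then obtain c where c: "tdet (2*n) ?J - Cst c \<in> Cp" using factor_of_const Wu by blast
  have "c \<notin> Ip"
  proof
    assume "c \<in> Ip"
    then have "Cst c \<in> Cp" by simp
    then have "tdet (2*n) ?J \<in> Cp" using c Cp.cong_I by blast
    then have "tdet (2*n) ?J * tdet (2*n) B \<in> Cp" by (rule Cp.mult_I')
    then have "Cst (tdet (2*n) W) \<in> Cp"
      using \<open>tdet (2*n) ?J * tdet (2*n) B - Cst (tdet (2*n) W) \<in> Cp\<close> Cp.cong_I by blast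
    then show False using Wu by simp
  qed
  then show ?thesis using c by blast
qed

end

end

lemma degle_meval_linear:
  assumes a: "\<And>i. degle 1 (a i)" and f: "degle d f"
  shows "degle d (meval Cst a f)"
proof -
  have "degle (size m) (prod_mset (image_mset a m))" for m
  proof (induction m)
    case (add i m)
    then show ?case using degle_mult[OF a[of i] add.IH] by simp
  qed simp
  then have "degle d (Cst c * prod_mset (image_mset a m))" if "size m \<le> d" for m c
    using degle_mult[OF degle_Cst[of 0 c], of "size m"] that by (auto intro: degle_mono)
  then show ?thesis using f unfolding meval_def lext_def by (intro degle_sum) (auto simp: degle_def)
qed

context weyl_p
begin

text \<open>A map whose Jacobian determinant is a nonzero constant \<open>c\<close> is normalized by dividing its first
  component by \<open>c\<close>.\<close>

lemma normalize_jacobian: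
  fixes Phi :: "nat \<Rightarrow> (nat, int) mp" and N :: nat
  assumes N: "1 \<le> N" and Phi: "\<And>i. i \<in> {1..N} \<Longrightarrow> Phi i \<in> mvars {1..N}" "\<And>i. i \<in> {1..N} \<Longrightarrow> degle d (Phi i)"
    and c: "c \<notin> Ip" "tdet N (\<lambda>i j. pder j (Phi i)) - Cst c \<in> Cp"
  shows "\<exists>Phi'. (\<forall>i\<in>{1..N}. Phi' i \<in> mvars {1..N} \<and> degle d (Phi' i)) \<and>
    tdet N (\<lambda>i j. pder j (Phi' i)) - 1 \<in> Cp \<and>
    (\<forall>D Psi'. (\<forall>i\<in>{1..N}. Psi' i \<in> mvars {1..N} \<and> degle D (Psi' i) \<and>
        meval Cst Phi' (Psi' i) - Var i \<in> Cp \<and> meval Cst Psi' (Phi' i) - Var i \<in> Cp) \<longrightarrow>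
      (\<exists>Psi. \<forall>i\<in>{1..N}. Psi i \<in> mvars {1..N} \<and> degle D (Psi i) \<and>
        meval Cst Phi (Psi i) - Var i \<in> Cp \<and> meval Cst Psi (Phi i) - Var i \<in> Cp))"
proof -
  have "coprime c (int p)"
    using c(1) p prime_imp_coprime[of "int p" c] by (simp add: Ip_def coprime_commute)
  then obtain c' where "[c * c' = 1] (mod int p)" using cong_solve_coprime_int by blast
  then have c': "c * c' - 1 \<in> Ip" by (simp add: Ip_def cong_iff_dvd_diff)
  define s where "s i = (if i = 1 then c' else 1)" for i :: nat
  define s' where "s' i = (if i = 1 then c else 1)" for i :: nat
  have ss: "s' i * s i - 1 \<in> Ip" for i using c' by (simp add: s_def s'_def)
  define Phi' where "Phi' i = Cst (s i) * Phi i" for i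
  have "\<forall>i\<in>{1..N}. Phi' i \<in> mvars {1..N} \<and> degle d (Phi' i)"
  proof
    fix i assume i: "i \<in> {1..N}"
    show "Phi' i \<in> mvars {1..N} \<and> degle d (Phi' i)"
      using Phi[OF i] degle_mult[OF degle_Cst[of 0 "s i"], of d "Phi i"] by (simp add: Phi'_def)
  qed
  moreover have "tdet N (\<lambda>i j. pder j (Phi' i)) - 1 \<in> Cp"
  proof -
    have "(\<Prod>i\<in>{1..N}. Cst (s i)) = (Cst c' :: (nat, int) mp)"
    proof -
      have "{1..N} = insert 1 {2..N}" using N by auto
      then show ?thesis by (simp add: s_def)
    qed
    then have "tdet N (\<lambda>i j. pder j (Phi' i)) = Cst c' * tdet N (\<lambda>i j. pder j (Phi i))"
      by (simp add: Phi'_def tdet_scale_rows)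
    moreover have "Cst c' * (tdet N (\<lambda>i j. pder j (Phi i)) - Cst c) \<in> Cp" using c(2) by blast
    moreover have "Cst (c * c' - 1) \<in> Cp" using c' by simp
    ultimately have "(tdet N (\<lambda>i j. pder j (Phi' i)) - Cst (c * c')) + (Cst (c * c') - 1) \<in> Cp"
      by (intro Cp.add_I) (simp_all add: Cst_mult Cst_diff algebra_simps)
    then show ?thesis by simp
  qed
  moreover have "\<exists>Psi. \<forall>i\<in>{1..N}. Psi i \<in> mvars {1..N} \<and> degle D (Psi i) \<and>
        meval Cst Phi (Psi i) - Var i \<in> Cp \<and> meval Cst Psi (Phi i) - Var i \<in> Cp"
    if Psi': "\<forall>i\<in>{1..N}. Psi' i \<in> mvars {1..N} \<and> degle D (Psi' i) \<and>
        meval Cst Phi' (Psi' i) - Var i \<in> Cp \<and> meval Cst Psi' (Phi' i) - Var i \<in> Cp" for D Psi'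
  proof (intro exI ballI conjI)
    \<comment> \<open>Scaling the first variable by \<open>c'\<close> turns an inverse of
      \<open>Phi'\<close> into one of \<open>Phi\<close>, without changing its degree bound.\<close>
    define \<sigma> where "\<sigma> = (\<lambda>i. Cst (s i) * Var i :: (nat, int) mp)"
    fix i assume i: "i \<in> {1..N}"
    show "meval Cst \<sigma> (Psi' i) \<in> mvars {1..N}"
    proof (rule meval_mvars)
      show "Psi' i \<in> mvars {1..N}" using Psi' i by blast
      show "\<sigma> j \<in> mvars {1..N}" if "j \<in> {1..N}" for j
        unfolding \<sigma>_def by (intro mvars_mult mvars_Cst mvars_Var that)
    qed
    show "degle D (meval Cst \<sigma> (Psi' i))"
      using Psi' i degle_mult[OF degle_Cst[of 0] degle_Var[of 1]] by (intro degle_meval_linear) (auto simp: \<sigma>_def)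
    have "meval Cst Phi (meval Cst \<sigma> (Psi' i)) = meval Cst (\<lambda>j. meval Cst Phi (\<sigma> j)) (Psi' i)"
      by (simp add: meval_hom[OF is_hom_Cst is_hom_meval[OF is_hom_Cst]] meval_Cst)
    also have "(\<lambda>j. meval Cst Phi (\<sigma> j)) = Phi'"
      by (simp add: \<sigma>_def Phi'_def fun_eq_iff meval_mult meval_Cst meval_Var)
    finally show "meval Cst Phi (meval Cst \<sigma> (Psi' i)) - Var i \<in> Cp" using Psi' i by simp
    have "meval Cst (\<lambda>j. meval Cst \<sigma> (Psi' j)) (Phi i) = meval Cst \<sigma> (meval Cst Psi' (Phi i))"
      by (simp add: meval_hom[OF is_hom_Cst is_hom_meval[OF is_hom_Cst]] meval_Cst)
    moreover have "meval Cst Psi' (Phi i) - Cst (s' i) * Var i \<in> Cp"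
    proof -
      have "Cst (s' i) * (meval Cst Psi' (Phi' i) - Var i) \<in> Cp" using Psi' i by blast
      moreover have "meval Cst Psi' (Phi' i) = Cst (s i) * meval Cst Psi' (Phi i)"
        by (simp add: Phi'_def meval_mult meval_Cst)
      moreover have "Cst (s' i * s i - 1) * meval Cst Psi' (Phi i) \<in> Cp" using ss by (intro Cp.mult_I') simp
      ultimately have "Cst (s' i) * (meval Cst Psi' (Phi' i) - Var i) - Cst (s' i * s i - 1) * meval Cst Psi' (Phi i) \<in> Cp"
        by (intro Cp.diff_I)
      then show ?thesis
        using \<open>meval Cst Psi' (Phi' i) = Cst (s i) * meval Cst Psi' (Phi i)\<close>
        by (simp add: Cst_mult Cst_diff algebra_simps)
    qed
    then have "meval Cst \<sigma> (meval Cst Psi' (Phi i) - Cst (s' i) * Var i) \<in> Cp"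
      by (rule meval_coefs_in[OF Ip_ideal])
    moreover have "meval Cst \<sigma> (Cst (s' i) * Var i) = Cst (s' i * s i) * Var i"
      by (simp add: \<sigma>_def meval_mult meval_Cst meval_Var Cst_mult)
    moreover have "Cst (s' i * s i - 1) * Var i \<in> Cp" using ss by (intro Cp.mult_I') simp
    ultimately have "(meval Cst (\<lambda>j. meval Cst \<sigma> (Psi' j)) (Phi i) - Cst (s' i * s i) * Var i) +
        Cst (s' i * s i - 1) * Var i \<in> Cp"
      by (intro Cp.add_I) (simp_all add: is_hom_diff[OF is_hom_meval[OF is_hom_Cst]])
    then show "meval Cst (\<lambda>j. meval Cst \<sigma> (Psi' j)) (Phi i) - Var i \<in> Cp"
      by (simp add: Cst_diff algebra_simps)
  qed
  ultimately show ?thesis by blast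
qed

end


section \<open>A limit of prime fields\<close>

text \<open>Only a map \<open>ev\<close> that separates the classes modulo \<open>I\<close> is
  needed; the field is carried by its range, inside an arbitrary type \<open>'k\<close>.\<close>

lemma quotient_field:
  fixes I :: "'r::comm_ring_1 set" and ev :: "'r \<Rightarrow> 'k"
  assumes I: "cring_prime I" and inv: "\<And>x. x \<notin> I \<Longrightarrow> \<exists>y. x * y - 1 \<in> I"
    and ev: "\<And>x y. ev x = ev y \<longleftrightarrow> x - y \<in> I"
  shows "\<exists>K :: 'k ring. kcover K ev \<and> kcover.kerI K ev = I"
proof -
  interpret cring_prime I by fact
  define r where "r = inv_into UNIV ev"
  have r: "r (ev x) - x \<in> I" for x
    using ev[of "r (ev x)" x] f_inv_into_f[of "ev x" ev UNIV] by (simp add: r_def)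
  define K where "K = \<lparr>carrier = range ev, monoid.mult = (\<lambda>a b. ev (r a * r b)), one = ev 1,
    zero = ev 0, add = (\<lambda>a b. ev (r a + r b))\<rparr>"
  have cov: "rcover K ev UNIV"
  proof
    show "ev (x + y) = ev x \<oplus>\<^bsub>K\<^esub> ev y" for x y
      by (simp add: K_def ev cong_sym[OF cong_add[OF r r]])
    show "ev (x * y) = ev x \<otimes>\<^bsub>K\<^esub> ev y" for x y
      by (simp add: K_def ev cong_sym[OF cong_mult[OF r r]])
  qed (simp_all add: K_def)
  interpret C: rcover K ev UNIV by (rule cov)
  have "cring K"
  proof (intro cring.intro C.is_ring comm_monoid.intro comm_monoid_axioms.intro)
    show "Group.monoid K" by (rule C.R.monoid_axioms)
    show "x \<otimes>\<^bsub>K\<^esub> y = y \<otimes>\<^bsub>K\<^esub> x" for x y by (simp add: K_def mult.commute)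
  qed
  then have "field K"
  proof (rule cring.cring_fieldI2)
    show "\<zero>\<^bsub>K\<^esub> \<noteq> \<one>\<^bsub>K\<^esub>" using uminus_I[of "- 1"] by (auto simp: K_def ev)
    show "\<exists>b\<in>carrier K. a \<otimes>\<^bsub>K\<^esub> b = \<one>\<^bsub>K\<^esub>" if aK: "a \<in> carrier K" "a \<noteq> \<zero>\<^bsub>K\<^esub>" for a
    proof -
      obtain x where x: "a = ev x" using aK(1) by (rule C.carrE)
      then have "x \<notin> I" using aK(2) by (auto simp: K_def ev)
      then obtain y where "x * y - 1 \<in> I" using inv by blast
      then have "a \<otimes>\<^bsub>K\<^esub> ev y = ev 1" by (simp add: x C.pi_mult[symmetric] ev)
      then show ?thesis by (auto simp: C.pi_1)
    qed
  qed
  then have kc: "kcover K ev" using cov by (simp add: kcover_def kcover_axioms_def)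
  moreover have "kcover.kerI K ev = I"
    unfolding kcover.kerI_def[OF kc] using ev[of _ 0] by (auto simp: K_def)
  ultimately show ?thesis by blast
qed

text \<open>Names for sequences of integers indexed by the primes: \<open>Gen i l\<close> is the
  coefficient of the \<open>i\<close>-th component at the monomial with letters \<open>l\<close>,
  and \<open>Inv\<close> is an inverse modulo the prime, arbitrary where none exists. Unlike all
  such sequences, the names are countable.\<close>

datatype tm = Gen nat "nat list" | Con int | Add tm tm | Mul tm tm | Inv tm

instance tm :: countable by countable_datatype

primrec tval :: "nat \<Rightarrow> (nat \<Rightarrow> nat list \<Rightarrow> int) \<Rightarrow> tm \<Rightarrow> int"
  where "tval p G (Gen i l) = G i l"
  | "tval p G (Con c) = c"
  | "tval p G (Add t u) = tval p G t + tval p G u"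
  | "tval p G (Mul t u) = tval p G t * tval p G u"
  | "tval p G (Inv t) = (SOME y. int p dvd tval p G t * y - 1)"

text \<open>For countably many predicates a diagonal subsequence does the work of an
  ultrafilter.\<close>

lemma decisive_subsequence:
  fixes A :: "'t::countable \<Rightarrow> nat \<Rightarrow> bool"
  shows "\<exists>r. strict_mono r \<and>
    (\<forall>t. (\<forall>\<^sub>F k in sequentially. A t (r k)) \<or> (\<forall>\<^sub>F k in sequentially. \<not> A t (r k)))"
proof -
  define P where "P j r \<longleftrightarrow> (\<forall>k. A (from_nat j) (r k)) \<or> (\<forall>k. \<not> A (from_nat j) (r k))"
    for j and r :: "nat \<Rightarrow> nat"
  interpret subseqs P
  proof
    fix j and s :: "nat \<Rightarrow> nat" assume "strict_mono s"
    show "\<exists>r'. strict_mono r' \<and> P j (s \<circ> r')"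
    proof (cases "infinite {k. A (from_nat j) (s k)}")
      case True
      then show ?thesis using infinite_enumerate[OF True] by (auto simp: P_def)
    next
      case False
      then have "infinite {k. \<not> A (from_nat j) (s k)}"
        using finite_compl[of "{k. \<not> A (from_nat j) (s k)}"] infinite_UNIV_nat by (auto simp: Collect_neg_eq[symmetric])
      from infinite_enumerate[OF this] show ?thesis by (auto simp: P_def)
    qed
  qed
  have P: "P j (diagseq \<circ> ((+) (Suc j)))" for j
    by (rule diagseq_holds) (auto simp: P_def)
  have shift: "\<forall>\<^sub>F k in sequentially. Q (diagseq k)" if "\<And>k. Q (diagseq (Suc j + k))" for Q j
    using that[of "k - Suc j" for k] by (intro eventually_sequentiallyI[of "Suc j"]) (metis le_add_diff_inverse)
  have "(\<forall>\<^sub>F k in sequentially. A t (diagseq k)) \<or> (\<forall>\<^sub>F k in sequentially. \<not> A t (diagseq k))" for t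
    using P[of "to_nat t"] shift[where Q = "A t" and j = "to_nat t"] shift[where Q = "\<lambda>k. \<not> A t k" and j = "to_nat t"]
    by (auto simp: P_def)
  then show ?thesis using subseq_diagseq by blast
qed

text \<open>The limit field consists of sequences of residues, evaluated from terms that are closed under the
  ring operations and inversion, modulo eventual agreement along a decisive subsequence.\<close>

theorem limit_inverse:
  fixes Phi :: "nat \<Rightarrow> nat \<Rightarrow> (nat, int) mp" and p :: "nat \<Rightarrow> nat"
  assumes JC: "Jacobian_Conjecture TYPE('a) N" and inf: "infinite (UNIV :: 'a set)"
    and p: "\<And>k. prime (p k)" "\<And>k. k < p k"
    and Phi: "\<And>k i. i \<in> {1..N} \<Longrightarrow> Phi k i \<in> mvars {1..N}" "\<And>k i. i \<in> {1..N} \<Longrightarrow> degle d (Phi k i)"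
    and det: "\<And>k. tdet N (\<lambda>i j. pder j (Phi k i)) - 1 \<in> coefs_in {x. int (p k) dvd x}"
  shows "\<exists>k D Psi. D \<le> k \<and> (\<forall>i\<in>{1..N}. Psi i \<in> mvars {1..N} \<and> degle D (Psi i) \<and>
    meval Cst (Phi k) (Psi i) - Var i \<in> coefs_in {x. int (p k) dvd x} \<and>
    meval Cst Psi (Phi k i) - Var i \<in> coefs_in {x. int (p k) dvd x})"
proof -
  define e where "e k = tval (p k) (\<lambda>i l. lookup (Phi k i) (mset l))" for k
  define E where "E k = (meval (\<lambda>x. x) (e k) :: (tm, int) mp \<Rightarrow> int)" for k
  have id: "is_hom (\<lambda>x::int. x)" by (simp add: is_hom_def)
  have E: "is_hom (E k)" for k unfolding E_def by (rule is_hom_meval[OF id])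
  have E_Var: "E k (Var t) = e k t" for k t by (simp add: E_def meval_Var[OF id])
  \<comment> \<open>Terms are closed under the ring operations, so a subsequence that is decisive
    for divisibility of terms is decisive for all polynomials in terms.\<close>
  have tmE: "\<exists>t. \<forall>k. E k z = e k t" for z
  proof (induction z rule: mp_induct[OF mvars_UNIV])
    case (1 c)
    then show ?case by (intro exI[of _ "Con c"]) (simp add: E_def e_def meval_Cst[OF id])
  next
    case (2 t f)
    then obtain u where "\<forall>k. E k f = e k u" by blast
    then show ?case by (intro exI[of _ "Mul t u"]) (simp add: is_homD[OF E] E_Var, simp add: e_def)
  next
    case (3 f g)
    then obtain t u where "\<forall>k. E k f = e k t" "\<forall>k. E k g = e k u" by blast
    then show ?case by (intro exI[of _ "Add t u"]) (simp add: is_homD[OF E], simp add: e_def)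
  qed
  obtain r where r: "strict_mono r" and dec: "\<And>t. (\<forall>\<^sub>F k in sequentially. int (p (r k)) dvd e (r k) t) \<or>
      (\<forall>\<^sub>F k in sequentially. \<not> int (p (r k)) dvd e (r k) t)"
    using decisive_subsequence[of "\<lambda>t k. int (p k) dvd e k t"] by blast
  define I where "I = {z. \<forall>\<^sub>F k in sequentially. int (p (r k)) dvd E (r k) z}"
  have notI: "\<forall>\<^sub>F k in sequentially. \<not> int (p (r k)) dvd E (r k) z" if zI: "z \<notin> I" for z
  proof -
    obtain t where t: "\<And>k. E k z = e k t" using tmE[of z] by blast
    show ?thesis using dec[of t] zI by (auto simp: I_def t)
  qed
  have I: "cring_prime I"
  proof
    show "0 \<in> I" by (simp add: I_def is_hom_0[OF E])
    show "x + y \<in> I" if "x \<in> I" "y \<in> I" for x y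
      using that unfolding I_def mem_Collect_eq by eventually_elim (simp add: is_homD[OF E])
    show "x * y \<in> I" if "y \<in> I" for x y
      using that unfolding I_def mem_Collect_eq by eventually_elim (simp add: is_homD[OF E])
    show "1 \<notin> I"
    proof
      assume "1 \<in> I"
      then have "\<forall>\<^sub>F k in sequentially. int (p (r k)) dvd 1" by (simp add: I_def is_homD[OF E])
      then obtain k where "int (p (r k)) dvd 1" by (auto simp: eventually_sequentially)
      then show False using p(1)[of "r k"] by simp
    qed
    show "x \<in> I \<or> y \<in> I" if xy: "x * y \<in> I" for x y
    proof (rule ccontr)
      assume "\<not> (x \<in> I \<or> y \<in> I)"
      then have "\<forall>\<^sub>F k in sequentially. \<not> int (p (r k)) dvd E (r k) x" "\<forall>\<^sub>F k in sequentially. \<not> int (p (r k)) dvd E (r k) y"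
        using notI by blast+
      moreover have "\<forall>\<^sub>F k in sequentially. int (p (r k)) dvd E (r k) (x * y)" using xy by (simp add: I_def)
      ultimately have "\<forall>\<^sub>F k in sequentially. False"
      proof eventually_elim
        case (elim k)
        then show ?case
          using p(1)[of "r k"] prime_dvd_mult_iff[of "int (p (r k))" "E (r k) x" "E (r k) y"]
          by (simp add: is_homD[OF E])
      qed
      then show False by simp
    qed
  qed
  interpret I: cring_prime I by (rule I)
  have inverse: "\<exists>y. x * y - 1 \<in> I" if x: "x \<notin> I" for x
  proof -
    obtain t where t: "\<And>k. E k x = e k t" using tmE[of x] by blast
    have "\<forall>\<^sub>F k in sequentially. int (p (r k)) dvd E (r k) (x * Var (Inv t) - 1)"
      using notI[OF x]
    proof eventually_elim
      case (elim k)
      let ?q = "p (r k)"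
      have "coprime (e (r k) t) (int ?q)"
        using elim p(1)[of "r k"] prime_imp_coprime[of "int ?q" "e (r k) t"] by (simp add: t coprime_commute)
      then obtain y where "[e (r k) t * y = 1] (mod int ?q)" using cong_solve_coprime_int by blast
      then have "int ?q dvd e (r k) t * y - 1" by (simp add: cong_iff_dvd_diff)
      then have "int ?q dvd e (r k) t * e (r k) (Inv t) - 1"
        unfolding e_def tval.simps by (rule someI)
      then show ?case by (simp add: is_hom_diff[OF E] is_homD[OF E] E_Var t)
    qed
    then show ?thesis by (auto simp: I_def)
  qed
  \<comment> \<open>Characteristic zero: \<open>p (r k)\<close> exceeds \<open>r k\<close>, and thus
    eventually every given integer.\<close>
  have of_nat: "of_nat m \<notin> I" if m: "0 < m" for m
  proof
    assume "of_nat m \<in> I"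
    then have "\<forall>\<^sub>F k in sequentially. p (r k) dvd m" by (simp add: I_def is_hom_of_nat[OF E])
    then obtain k0 where "\<And>k. k \<ge> k0 \<Longrightarrow> p (r k) dvd m" by (auto simp: eventually_sequentially)
    then have "p (r (max k0 m)) dvd m" by simp
    then have "p (r (max k0 m)) \<le> m" using m by (rule dvd_imp_le)
    moreover have "m \<le> r (max k0 m)" using seq_suble[OF r, of "max k0 m"] by simp
    ultimately show False using p(2)[of "r (max k0 m)"] by linarith
  qed
  obtain \<iota> :: "nat \<Rightarrow> 'a" where \<iota>: "inj \<iota>" using inf infinite_countable_subset by blast
  \<comment> \<open>Each class is represented by the term of least index, and the indices are
    embedded into \<open>'a\<close>.\<close>
  define ev where "ev z = \<iota> (LEAST j. z - Var (from_nat j) \<in> I)" for z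
  have ev: "ev x = ev y \<longleftrightarrow> x - y \<in> I" for x y
  proof -
    have L: "z - Var (from_nat (LEAST j. z - Var (from_nat j) \<in> I)) \<in> I" for z
    proof (rule LeastI_ex)
      obtain t where "\<And>k. E k z = e k t" using tmE[of z] by blast
      then show "\<exists>j. z - Var (from_nat j) \<in> I"
        by (intro exI[of _ "to_nat t"]) (simp add: I_def is_hom_diff[OF E] E_Var)
    qed
    show ?thesis
    proof
      assume "ev x = ev y"
      then have eq: "(LEAST j. x - Var (from_nat j) \<in> I) = (LEAST j. y - Var (from_nat j) \<in> I)"
        unfolding ev_def by (rule injD[OF \<iota>])
      show "x - y \<in> I" by (rule I.cong_trans[OF L[of x, unfolded eq] I.cong_sym[OF L[of y]]])
    next
      assume "x - y \<in> I"
      then have "x - v \<in> I \<longleftrightarrow> y - v \<in> I" for v using I.cong_I[of "x - v" "y - v"] by simp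
      then show "ev x = ev y" by (simp add: ev_def)
    qed
  qed
  obtain K :: "'a ring" where K: "kcover K ev" "kcover.kerI K ev = I"
    using quotient_field[OF I inverse ev] by blast
  interpret kcover K ev by (rule K(1))
  have char: "char_zero_field K"
    unfolding char_zero_field_def
  proof (intro conjI allI impI)
    show "field K" by unfold_locales
    show "[m] \<cdot>\<^bsub>K\<^esub> \<one>\<^bsub>K\<^esub> \<noteq> \<zero>\<^bsub>K\<^esub>" if "0 < m" for m :: nat
      using of_nat[OF that] C.pi_of_nat[of 1 m] K(2) by (auto simp: kerI_def C.pi_1)
  qed
  define M where "M = {m. set_mset m \<subseteq> {1..N} \<and> size m \<le> d}"
  have finM: "finite M" unfolding M_def by (rule finite_monomials) simp
  \<comment> \<open>The generic map: its coefficients are variables named after the coefficients of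
    the \<open>Phi k\<close>, so that evaluation at \<open>k\<close> gives back
    \<open>Phi k\<close>. The uniform bound \<open>d\<close> leaves only finitely many
    monomials.\<close>
  define G where "G i = (\<Sum>m\<in>M. single m (Var (Gen i (SOME l. mset l = m))) :: (nat, (tm, int) mp) mp)" for i
  have Gv: "G i \<in> mvars {1..N}" for i
    unfolding G_def by (intro mvars_sum mvars_single) (simp add: M_def)
  have ml: "mset (SOME l. mset l = m) = m" for m :: "nat multiset" using ex_mset[of m] by (rule someI_ex)
  have GPhi: "mmap (E k) (G i) = Phi k i" if i: "i \<in> {1..N}" for i k
  proof (rule poly_mapping_eqI)
    fix m
    have "lookup (G i) m = (if m \<in> M then Var (Gen i (SOME l. mset l = m)) else 0)"
      using finM by (simp add: G_def lookup_sum lookup_single when_def)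
    then have "lookup (mmap (E k) (G i)) m = (if m \<in> M then lookup (Phi k i) m else 0)"
      by (simp add: lookup_mmap[OF E] E_Var is_hom_0[OF E]) (simp add: e_def ml)
    moreover have "m \<in> M" if "lookup (Phi k i) m \<noteq> 0"
      using Phi[OF i, of k] that unfolding M_def mvars_def degle_def by (simp add: in_keys_iff)
    ultimately show "lookup (mmap (E k) (G i)) m = lookup (Phi k i) m" by auto
  qed
  have coefs: "\<forall>\<^sub>F k in sequentially. mmap (E (r k)) f \<in> coefs_in {x. int (p (r k)) dvd x}" if "f \<in> coefs_in I"
    for f :: "(nat, (tm, int) mp) mp"
  proof -
    have "\<forall>\<^sub>F k in sequentially. \<forall>m\<in>keys f. int (p (r k)) dvd E (r k) (lookup f m)"
      using that by (intro eventually_ball_finite) (auto simp: coefs_in_def I_def)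
    then show ?thesis
    proof eventually_elim
      case (elim k)
      have "int (p (r k)) dvd E (r k) (lookup f m)" for m
        using elim by (cases "m \<in> keys f") (simp_all add: in_keys_iff is_hom_0[OF E])
      then show ?case by (simp add: coefs_in_def lookup_mmap[OF E])
    qed
  qed
  have "tdet N (\<lambda>i j. pder j (G i)) - 1 \<in> coefs_in kerI"
    unfolding K(2) coefs_in_def
  proof (intro CollectI allI)
    fix m
    have "int (p k) dvd E k (lookup (tdet N (\<lambda>i j. pder j (G i)) - 1) m)" for k
    proof -
      have "mmap (E k) (tdet N (\<lambda>i j. pder j (G i)) - 1) = tdet N (\<lambda>i j. mmap (E k) (pder j (G i))) - 1"
        by (simp only: is_hom_diff[OF mmap_hom[OF E]] is_homD(1)[OF mmap_hom[OF E]] tdet_hom[OF mmap_hom[OF E]])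
      also have "tdet N (\<lambda>i j. mmap (E k) (pder j (G i))) = tdet N (\<lambda>i j. pder j (Phi k i))"
        by (intro tdet_cong) (simp only: mmap_pder[OF E] GPhi)
      finally have "lookup (mmap (E k) (tdet N (\<lambda>i j. pder j (G i)) - 1)) m \<in> {x. int (p k) dvd x}"
        using det[of k] unfolding coefs_in_def by simp
      then show ?thesis by (simp only: lookup_mmap[OF E] mem_Collect_eq)
    qed
    then show "lookup (tdet N (\<lambda>i j. pder j (G i)) - 1) m \<in> I" by (simp add: I_def)
  qed
  from Jacobian_inverse[OF JC char Gv this] obtain H where H: "\<And>i. i \<in> {1..N} \<Longrightarrow> H i \<in> mvars {1..N}"
    "\<And>i. i \<in> {1..N} \<Longrightarrow> meval Cst G (H i) - Var i \<in> coefs_in I"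
    "\<And>i. i \<in> {1..N} \<Longrightarrow> meval Cst H (G i) - Var i \<in> coefs_in I"
    unfolding K(2) by blast
  obtain D where D: "\<And>i. i \<in> {1..N} \<Longrightarrow> degle D (H i)" using common_degle[of "{1..N}" H] by blast
  have "\<forall>\<^sub>F k in sequentially. \<forall>i\<in>{1..N}.
      mmap (E (r k)) (meval Cst G (H i) - Var i) \<in> coefs_in {x. int (p (r k)) dvd x} \<and>
      mmap (E (r k)) (meval Cst H (G i) - Var i) \<in> coefs_in {x. int (p (r k)) dvd x}"
    using H by (intro eventually_ball_finite eventually_conj ballI coefs) auto
  then obtain k0 where k0: "\<And>k. k \<ge> k0 \<Longrightarrow> \<forall>i\<in>{1..N}.
      mmap (E (r k)) (meval Cst G (H i) - Var i) \<in> coefs_in {x. int (p (r k)) dvd x} \<and>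
      mmap (E (r k)) (meval Cst H (G i) - Var i) \<in> coefs_in {x. int (p (r k)) dvd x}"
    unfolding eventually_sequentially by blast
  \<comment> \<open>Late enough for the congruences to hold and for \<open>k\<close> to be at least
    the degree bound \<open>D\<close> of the inverse over the limit field.\<close>
  define k where "k = r (max k0 D)"
  have kk: "\<forall>i\<in>{1..N}. mmap (E k) (meval Cst G (H i) - Var i) \<in> coefs_in {x. int (p k) dvd x} \<and>
      mmap (E k) (meval Cst H (G i) - Var i) \<in> coefs_in {x. int (p k) dvd x}"
    unfolding k_def by (rule k0[OF max.cobounded1])
  have Dk: "D \<le> k" using seq_suble[OF r, of "max k0 D"] by (simp add: k_def)
  define Psi where "Psi i = mmap (E k) (H i)" for i
  have mm: "mmap (E k) (meval Cst a f) = meval Cst (\<lambda>j. mmap (E k) (a j)) (mmap (E k) f)"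
    for a :: "nat \<Rightarrow> (nat, (tm, int) mp) mp" and f
    by (induction f rule: mp_induct[OF mvars_UNIV])
      (simp_all add: meval_Cst meval_Var meval_mult meval_add mmap_Cst[OF E] mmap_Var[OF E] is_homD[OF mmap_hom[OF E]])
  have "Psi i \<in> mvars {1..N} \<and> degle D (Psi i) \<and> meval Cst (Phi k) (Psi i) - Var i \<in> coefs_in {x. int (p k) dvd x} \<and>
      meval Cst Psi (Phi k i) - Var i \<in> coefs_in {x. int (p k) dvd x}" if i: "i \<in> {1..N}" for i
  proof (intro conjI)
    show "Psi i \<in> mvars {1..N}" unfolding Psi_def by (rule mmap_mvars[OF E H(1)[OF i]])
    have "keys (Psi i) \<subseteq> keys (H i)" by (auto simp: Psi_def in_keys_iff lookup_mmap[OF E] is_hom_0[OF E])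
    then show "degle D (Psi i)" using D[OF i] by (auto simp: degle_def)
    have "meval Cst (\<lambda>j. mmap (E k) (G j)) (Psi i) = meval Cst (Phi k) (Psi i)"
      by (rule meval_cong[OF is_hom_Cst \<open>Psi i \<in> mvars {1..N}\<close>]) (rule GPhi)
    then have eq: "mmap (E k) (meval Cst G (H i) - Var i) = meval Cst (Phi k) (Psi i) - Var i"
      by (simp add: is_hom_diff[OF mmap_hom[OF E]] mm mmap_Var[OF E] Psi_def[symmetric])
    show "meval Cst (Phi k) (Psi i) - Var i \<in> coefs_in {x. int (p k) dvd x}"
      using kk i unfolding eq[symmetric] by blast
    have eq': "mmap (E k) (meval Cst H (G i) - Var i) = meval Cst Psi (Phi k i) - Var i"
      by (simp add: is_hom_diff[OF mmap_hom[OF E]] mm mmap_Var[OF E] GPhi[OF i] Psi_def[abs_def])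
    show "meval Cst Psi (Phi k i) - Var i \<in> coefs_in {x. int (p k) dvd x}"
      using kk i unfolding eq'[symmetric] by blast
  qed
  then show ?thesis using Dk by blast
qed


section \<open>The Jacobian conjecture implies the Dixmier conjecture\<close>

text \<open>Collects the work at a single prime, in the form needed for the passage to the limit:
  the determinant is normalized to one, and an inverse of degree at most \<open>D\<close> becomes
  expressions of degree at most \<open>D\<close> for the generators.\<close>

lemma (in weyl_p) normalized_center_map:
  assumes n: "1 \<le> n" and F: "\<And>i. i \<in> {1..2*n} \<Longrightarrow> F i \<in> wvars n" "\<And>i. i \<in> {1..2*n} \<Longrightarrow> degle d (F i)"
    and rels: "weyl_rels n J2 (\<lambda>i. wop n (F i))"
  shows "\<exists>Phi. (\<forall>i\<in>{1..2*n}. Phi i \<in> wvars n \<and> degle d (Phi i)) \<and>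
    tdet (2*n) (\<lambda>i j. pder j (Phi i)) - 1 \<in> Cp \<and>
    (\<forall>D Psi. (\<forall>i\<in>{1..2*n}. Psi i \<in> wvars n \<and> degle D (Psi i) \<and>
        meval Cst Phi (Psi i) - Var i \<in> Cp \<and> meval Cst Psi (Phi i) - Var i \<in> Cp) \<longrightarrow>
      (\<forall>i\<in>{1..2*n}. \<exists>g\<in>wvars n. degle D g \<and> Yop n i - osub scal (\<lambda>i. wop n (F i)) (2*n) g \<in> J1))"
proof -
  let ?P = "\<lambda>i. wop n (F i)"
  obtain Phi0 where Phi0: "\<And>i. i \<in> {1..2*n} \<Longrightarrow> Phi0 i \<in> wvars n" "\<And>i. i \<in> {1..2*n} \<Longrightarrow> degle d (Phi0 i)"
      "\<And>i. i \<in> {1..2*n} \<Longrightarrow> ?P i ^ p - mul (Frob p (Phi0 i)) \<in> J1"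
    using power_polynomials[OF F refl rels] by blast
  obtain c where c: "c \<notin> Ip" "tdet (2*n) (\<lambda>i j. pder j (Phi0 i)) - Cst c \<in> Cp"
    using jacobian_unit[OF F refl rels Phi0(1,3)] by blast
  have n2: "1 \<le> 2 * n" using n by simp
  obtain Phi where Phi: "\<forall>i\<in>{1..2*n}. Phi i \<in> wvars n \<and> degle d (Phi i)"
      "tdet (2*n) (\<lambda>i j. pder j (Phi i)) - 1 \<in> Cp"
    and inv: "\<And>D Psi'. \<forall>i\<in>{1..2*n}. Psi' i \<in> wvars n \<and> degle D (Psi' i) \<and>
        meval Cst Phi (Psi' i) - Var i \<in> Cp \<and> meval Cst Psi' (Phi i) - Var i \<in> Cp \<Longrightarrow>
      \<exists>Psi. \<forall>i\<in>{1..2*n}. Psi i \<in> wvars n \<and> degle D (Psi i) \<and>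
        meval Cst Phi0 (Psi i) - Var i \<in> Cp \<and> meval Cst Psi (Phi0 i) - Var i \<in> Cp"
    using normalize_jacobian[OF n2 Phi0(1,2) c] by blast
  have "\<exists>g\<in>wvars n. degle D g \<and> Yop n i - osub scal ?P (2*n) g \<in> J1"
    if Psi': "\<forall>i\<in>{1..2*n}. Psi' i \<in> wvars n \<and> degle D (Psi' i) \<and>
        meval Cst Phi (Psi' i) - Var i \<in> Cp \<and> meval Cst Psi' (Phi i) - Var i \<in> Cp" and i: "i \<in> {1..2*n}" for D Psi' i
  proof -
    obtain Psi where Psi: "\<And>i. i \<in> {1..2*n} \<Longrightarrow> Psi i \<in> wvars n" "\<And>i. i \<in> {1..2*n} \<Longrightarrow> meval Cst Phi0 (Psi i) - Var i \<in> Cp"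
        "\<And>i. i \<in> {1..2*n} \<Longrightarrow> meval Cst Psi (Phi0 i) - Var i \<in> Cp" "\<And>i. i \<in> {1..2*n} \<Longrightarrow> degle D (Psi i)"
      using inv[OF Psi'] by blast
    show ?thesis
      by (rule generator_in_image[OF weyl_rels_mono[OF rels subsetI[OF J2_J1]] wop_WA[OF Ip_ideal] Phi0(1,3) Psi i])
  qed
  then show ?thesis using Phi by blast
qed

lemma (in ring_mod) weyl_rels_cong:
  assumes rels: "weyl_rels n J Q" and QA: "\<And>i. i \<in> {1..2*n} \<Longrightarrow> Q i \<in> A" and PA: "\<And>i. i \<in> {1..2*n} \<Longrightarrow> P i \<in> A"
    and PQ: "\<And>i. i \<in> {1..2*n} \<Longrightarrow> P i - Q i \<in> J"
  shows "weyl_rels n J P"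
  unfolding weyl_rels_def
proof (intro ballI)
  fix i j assume i: "i \<in> {1..2*n}" and j: "j \<in> {1..2*n}"
  have "(P i * P j - Q i * Q j) - (P j * P i - Q j * Q i) \<in> J"
    by (intro diff_J cong_mult PQ QA PA i j)
  then have "comm (P i) (P j) - comm (Q i) (Q j) \<in> J" by (simp add: comm_def algebra_simps)
  moreover have "comm (Q i) (Q j) - of_int (weyl_omega n i j) \<in> J" using rels i j unfolding weyl_rels_def by blast
  ultimately show "comm (P i) (P j) - of_int (weyl_omega n i j) \<in> J" by (rule cong_trans)
qed

text \<open>Guarantees room for the countable limit field in the type of the given field.\<close>

lemma infinite_char_zero:
  assumes "char_zero_field (K :: 'a ring)"
  shows "infinite (UNIV :: 'a set)"
proof -
  interpret kcover K "cring.poly_val K" by (rule char_zero_field_cover[OF assms])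
  have le: "i = j" if eq: "cring.poly_val K (of_nat i) = cring.poly_val K (of_nat j)" "i \<le> j" for i j
  proof (rule ccontr)
    assume "i \<noteq> j"
    then have "of_nat (j - i) \<notin> kerI" using of_nat_notin_kerI[OF assms, of "j - i"] eq(2) by simp
    then show False using eq ev_eq_iff[of "of_nat j" "of_nat i"] by (simp add: of_nat_diff)
  qed
  have "inj (\<lambda>m :: nat. cring.poly_val K (of_nat m))"
  proof (rule injI)
    fix i j :: nat assume "cring.poly_val K (of_nat i) = cring.poly_val K (of_nat j)"
    then show "i = j" using le[of i j] le[of j i] by (cases "i \<le> j") auto
  qed
  from range_inj_infinite[OF this] show ?thesis by (rule infinite_super[OF subset_UNIV])
qed

text \<open>The images of the generators are replaced by operators \<open>wop n (f i)\<close>, since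
  polynomials can be specialized coefficientwise.\<close>

lemma (in kcover) Jacobian_imp_Dixmier_map:
  assumes h: "h \<in> alg_end K (weyl_const K n) (weyl_alg K n)" and char: "char_zero_field K"
    and naut: "h \<notin> alg_aut K (weyl_const K n) (weyl_alg K n)"
  shows "\<exists>f i0. (\<forall>i\<in>{1..2*n}. f i \<in> wvars n) \<and> weyl_rels n (WJ n kerI) (\<lambda>i. wop n (f i)) \<and> i0 \<in> {1..2*n} \<and>
    (\<forall>g\<in>wvars n. Yop n i0 - osub scal (\<lambda>i. wop n (f i)) (2*n) g \<notin> WJ n kerI)"
proof -
  interpret W: ring_mod "WA n kerI" "WJ n kerI" by (rule ring_mod_WA)
  obtain Q where QA: "\<And>i. i \<in> {1..2*n} \<Longrightarrow> Q i \<in> WA n kerI" and rels: "weyl_rels n (WJ n kerI) Q"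
    and hQ: "\<And>T. T \<in> WA n kerI \<Longrightarrow> h (wrep n T) = wrep n (dsub n Q T)"
    using weyl_end_form[OF h] by blast
  obtain i0 where i0: "i0 \<in> {1..2*n}" "\<And>g. g \<in> wvars n \<Longrightarrow> Yop n i0 - osub scal Q (2*n) g \<notin> WJ n kerI"
    using weyl_autI[OF char QA rels h hQ] naut by blast
  define f where "f i = app (Q i) 1" for i
  have PQ: "wop n (f i) - Q i \<in> WJ n kerI" if "i \<in> {1..2*n}" for i
    unfolding f_def by (rule W.cong_sym[OF WJ_wop[OF kerI_ideal QA[OF that]]])
  have "f i \<in> wvars n" if "i \<in> {1..2*n}" for i unfolding f_def by (rule WA_1[OF QA[OF that]])
  moreover have "weyl_rels n (WJ n kerI) (\<lambda>i. wop n (f i))"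
    by (rule W.weyl_rels_cong[OF rels QA wop_WA[OF kerI_ideal] PQ])
  moreover have "Yop n i0 - osub scal (\<lambda>i. wop n (f i)) (2*n) g \<notin> WJ n kerI" if g: "g \<in> wvars n" for g
  proof
    assume "Yop n i0 - osub scal (\<lambda>i. wop n (f i)) (2*n) g \<in> WJ n kerI"
    moreover have "osub scal (\<lambda>i. wop n (f i)) (2*n) g - osub scal Q (2*n) g \<in> WJ n kerI"
      by (rule W.osub_cong_J[OF is_hom_scal scal_WA'[OF kerI_ideal] PQ wop_WA[OF kerI_ideal] QA])
    ultimately have "Yop n i0 - osub scal Q (2*n) g \<in> WJ n kerI" by (rule W.cong_trans)
    then show False using i0(2)[OF g] by blast
  qed
  ultimately show ?thesis using i0(1) by blast
qed

text \<open>The dimension doubles because the centre modulo a prime is a polynomial ring in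
  \<open>2 * n\<close> variables; this is why the equivalence is one of the stable
  conjectures.\<close>

theorem Jacobian_imp_Dixmier:
  assumes n: "1 \<le> n" and JC: "Jacobian_Conjecture TYPE('a) (2 * n)"
  shows "Dixmier_Conjecture TYPE('a) n"
  unfolding Dixmier_Conjecture_def
proof (intro allI impI ballI)
  fix K :: "'a ring" and h
  assume char: "char_zero_field K" and h: "h \<in> alg_end K (weyl_const K n) (weyl_alg K n)"
  interpret kcover K "cring.poly_val K" by (rule char_zero_field_cover[OF char])
  show "h \<in> alg_aut K (weyl_const K n) (weyl_alg K n)"
  proof (rule ccontr)
    assume "h \<notin> alg_aut K (weyl_const K n) (weyl_alg K n)"
    then obtain f i0 where f: "\<And>i. i \<in> {1..2*n} \<Longrightarrow> f i \<in> wvars n" and rels: "weyl_rels n (WJ n kerI) (\<lambda>i. wop n (f i))"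
      and i0: "i0 \<in> {1..2*n}" and out: "\<And>g. g \<in> wvars n \<Longrightarrow> Yop n i0 - osub scal (\<lambda>i. wop n (f i)) (2*n) g \<notin> WJ n kerI"
      using Jacobian_imp_Dixmier_map[OF h char] by blast
    have char0: "z = 0" if z: "of_int z \<in> kerI" for z
    proof (rule ccontr)
      assume "z \<noteq> 0"
      moreover have "of_nat (nat \<bar>z\<bar>) \<in> kerI" using z I.uminus_I[OF z] by (cases "z \<ge> 0") simp_all
      ultimately show False using of_nat_notin_kerI[OF char, of "nat \<bar>z\<bar>"] by simp
    qed
    \<comment> \<open>At the \<open>k\<close>-th prime no ordered polynomial of degree at most
      \<open>k\<close> expresses the generator \<open>i0\<close>. The final \<open>g\<close> has
      degree at most \<open>D\<close>, which contradicts this once \<open>D\<close> is at most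
      \<open>k\<close>.\<close>
    define R where "R k p F \<longleftrightarrow> prime (p :: nat) \<and> k < p \<and>
      (\<forall>i\<in>{1..2*n}. F i \<in> wvars n \<and> (\<forall>d. degle d (f i) \<longrightarrow> degle d (F i))) \<and>
      weyl_rels n (WJ n {x. int (p\<^sup>2) dvd x}) (\<lambda>i. wop n (F i)) \<and>
      (\<forall>g\<in>wvars n. degle k g \<longrightarrow> Yop n i0 - osub scal (\<lambda>i. wop n (F i)) (2*n) g \<notin> WJ n {x. int p dvd x})"
      for k p F
    have "\<exists>p F. R k p F" for k
      unfolding R_def by (rule bad_prime[OF kerI_prime char0 kerI_inverse f rels i0 out])
    then obtain p F where R: "\<And>k. R k (p k) (F k)" by metis
    have p: "prime (p k)" "k < p k" for k using R[of k] by (auto simp: R_def)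
    obtain d where d: "\<And>i. i \<in> {1..2*n} \<Longrightarrow> degle d (f i)" using common_degle[of "{1..2*n}" f] by blast
    define S where "S k Phi \<longleftrightarrow> (\<forall>i\<in>{1..2*n}. Phi i \<in> wvars n \<and> degle d (Phi i)) \<and>
      tdet (2*n) (\<lambda>i j. pder j (Phi i)) - 1 \<in> coefs_in {x. int (p k) dvd x} \<and>
      (\<forall>D Psi. (\<forall>i\<in>{1..2*n}. Psi i \<in> wvars n \<and> degle D (Psi i) \<and>
          meval Cst Phi (Psi i) - Var i \<in> coefs_in {x. int (p k) dvd x} \<and>
          meval Cst Psi (Phi i) - Var i \<in> coefs_in {x. int (p k) dvd x}) \<longrightarrow>
        (\<forall>i\<in>{1..2*n}. \<exists>g\<in>wvars n. degle D g \<and>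
          Yop n i - osub scal (\<lambda>i. wop n (F k i)) (2*n) g \<in> WJ n {x. int (p k) dvd x}))" for k Phi
    have "\<exists>Phi. S k Phi" for k
    proof -
      interpret weyl_p n "p k" by unfold_locales (rule p)
      have "weyl_rels n J2 (\<lambda>i. wop n (F k i))" using R[of k] unfolding R_def Iq_def by blast
      moreover have "F k i \<in> wvars n" "degle d (F k i)" if "i \<in> {1..2*n}" for i
        using R[of k] d[OF that] that unfolding R_def by blast+
      ultimately show ?thesis unfolding S_def Ip_def[symmetric] by (intro normalized_center_map[OF n])
    qed
    then obtain Phi where S: "\<And>k. S k (Phi k)" by metis
    have Phi: "Phi k i \<in> wvars n" "degle d (Phi k i)" if "i \<in> {1..2*n}" for k i
      using S[of k] that unfolding S_def by blast+
    have det: "tdet (2*n) (\<lambda>i j. pder j (Phi k i)) - 1 \<in> coefs_in {x. int (p k) dvd x}" for k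
      using S[of k] unfolding S_def by blast
    obtain k D Psi where k: "D \<le> k" and Psi: "\<forall>i\<in>{1..2*n}. Psi i \<in> wvars n \<and> degle D (Psi i) \<and>
        meval Cst (Phi k) (Psi i) - Var i \<in> coefs_in {x. int (p k) dvd x} \<and>
        meval Cst Psi (Phi k i) - Var i \<in> coefs_in {x. int (p k) dvd x}"
      using limit_inverse[OF JC infinite_char_zero[OF char] p Phi det] by blast
    obtain g where g: "g \<in> wvars n" "degle D g"
        "Yop n i0 - osub scal (\<lambda>i. wop n (F k i)) (2*n) g \<in> WJ n {x. int (p k) dvd x}"
      using S[of k] Psi i0 unfolding S_def by blast
    then show False using R[of k] degle_mono[OF g(2) k] unfolding R_def by blast
  qed
qed

theorem mainTheorem2:
  shows "(\<forall>n\<ge>1. Jacobian_Conjecture TYPE('a) n) \<longleftrightarrow> (\<forall>n\<ge>1. Dixmier_Conjecture TYPE('a) n)"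
proof (intro iffI allI impI)
  fix n :: nat
  assume "\<forall>n\<ge>1. Jacobian_Conjecture TYPE('a) n" and n: "1 \<le> n"
  then show "Dixmier_Conjecture TYPE('a) n" by (intro Jacobian_imp_Dixmier) simp_all
next
  fix n :: nat
  assume "\<forall>n\<ge>1. Dixmier_Conjecture TYPE('a) n" and "1 \<le> n"
  then show "Jacobian_Conjecture TYPE('a) n" by (intro Dixmier_imp_Jacobian) simp
qed

end
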